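(* Let $\lambda$ be a cardinal with $\lambda\ge\omega_3$, and assume that there is an $\omega_1$-strongly unbounded function on $\lambda$. Then there is a cardinal-preserving forcing notion such that in its generic extension, for each ordinal $\eta$ with $\omega_1\le\eta<\omega_2$ and $\operatorname{cf}(\eta)=\omega_1$, there is an $(\omega,\eta,\lambda)$-Boolean algebra.
   Context: A function $F:[\lambda]^2\to\omega_1$ is an $\omega_1$-strongly unbounded function on $\lambda$ if for every $\delta<\omega_1$, every $n<\omega$ and every family $A\subseteq[\lambda]^n$ of pairwise disjoint sets with $|A|=\omega_1$, there are distinct $a,b\in A$ with $F\{\alpha,\beta\}>\delta$ for all $\alpha\in a,\beta\in b$. A Boolean algebra is superatomic if every homomorphic image is atomic; with Cantor–Bendixson ideals $\mathcal J_0=\{0\}$, $\mathcal J_{\alpha+1}$ = preimage of the ideal generated by atoms of $\mathbb B/\mathcal J_\alpha$, unions at limits, the cardinal sequence of superatomic $\mathbb B$ is $\langle|\mathcal J_{\alpha+1}(\mathbb B)\setminus\mathcal J_\alpha(\mathbb B)|:\alpha<ht^-(\mathbb B)\rangle$, with $ht^-(\mathbb B)$ the least $\delta$ with $\mathbb B=\mathcal J_{\delta+1}(\mathbb B)$. An $(\omega,\eta,\lambda)$-Boolean algebra is a superatomic Boolean algebra with cardinal sequence $\langle\omega\rangle_\eta{}^\frown\langle\lambda\rangle$.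
   Formalization: The cardinal sequence counts the elements of J_{α+1}∖J_α modulo J_α (their images in B/J_α); counted literally, |J_{α+1}∖J_α| ≥ |J_α| ≥ ω_1 at α=ω_1, so the value ω would be impossible there whenever η>ω_1. *)

theory Defs
  imports Main
begin

section \<open>The universe of sets\<close>

text \<open>
  The set-theoretic universe is a type with a membership relation satisfying the axioms of ZFC.
  Separation and replacement are second-order (they hold for all HOL predicates and functions), so
  that choice is inherited from the choice operator of HOL.
\<close>

locale zfc_universe =
  fixes E :: "'v \<Rightarrow> 'v \<Rightarrow> bool"
  assumes extensionality: "(\<forall>z. E z x \<longleftrightarrow> E z y) \<Longrightarrow> x = y"
    and foundation: "wfp E"
    and pairing: "\<exists>u. \<forall>z. E z u \<longleftrightarrow> z = x \<or> z = y"
    and union: "\<exists>u. \<forall>z. E z u \<longleftrightarrow> (\<exists>y. E y x \<and> E z y)"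
    and power_set: "\<exists>u. \<forall>z. E z u \<longleftrightarrow> (\<forall>y. E y z \<longrightarrow> E y x)"
    and infinity: "\<exists>u. (\<exists>e. E e u \<and> (\<forall>z. \<not> E z e)) \<and>
                       (\<forall>y. E y u \<longrightarrow> (\<exists>s. E s u \<and> (\<forall>z. E z s \<longleftrightarrow> E z y \<or> z = y)))"
    and separation: "\<exists>u. \<forall>z. E z u \<longleftrightarrow> E z x \<and> Q z"
    and replacement: "\<exists>u. \<forall>z. E z u \<longleftrightarrow> (\<exists>y. E y x \<and> z = f y)"

definition vset :: "('v \<Rightarrow> 'v \<Rightarrow> bool) \<Rightarrow> 'v set \<Rightarrow> 'v" where
  "vset E S = (THE x. \<forall>z. E z x \<longleftrightarrow> z \<in> S)"

definition vpair :: "('v \<Rightarrow> 'v \<Rightarrow> bool) \<Rightarrow> 'v \<Rightarrow> 'v \<Rightarrow> 'v" where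
  "vpair E x y = vset E {vset E {x}, vset E {x, y}}"


section \<open>Formulas of the language of set theory\<close>

text \<open>
  Formulas with parameters from the type \<open>'c\<close>.  A quantified formula is given by its instances, so
  that HOL variables serve as object variables.  The same formula (polymorphic in \<open>'c\<close>) is
  evaluated in the ground universe by \<open>sat\<close> and in the generic extension by \<open>forces\<close>.
\<close>

datatype 'c fm =
    Mem 'c 'c   (infix "\<^bold>\<in>" 50)
  | Equ 'c 'c   (infix "\<^bold>=" 50)
  | Neg "'c fm"   ("\<^bold>\<not> _" [40] 40)
  | Conj "'c fm" "'c fm"   (infixr "\<^bold>\<and>" 35)
  | Forall "'c \<Rightarrow> 'c fm"   (binder "\<^bold>\<forall>" 10)

definition Disj :: "'c fm \<Rightarrow> 'c fm \<Rightarrow> 'c fm"  (infixr "\<^bold>\<or>" 30) where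
  "(\<phi> \<^bold>\<or> \<psi>) = (\<^bold>\<not> (\<^bold>\<not> \<phi> \<^bold>\<and> \<^bold>\<not> \<psi>))"

definition Imp :: "'c fm \<Rightarrow> 'c fm \<Rightarrow> 'c fm"  (infixr "\<^bold>\<longrightarrow>" 25) where
  "(\<phi> \<^bold>\<longrightarrow> \<psi>) = (\<^bold>\<not> (\<phi> \<^bold>\<and> \<^bold>\<not> \<psi>))"

definition Iff :: "'c fm \<Rightarrow> 'c fm \<Rightarrow> 'c fm"  (infixr "\<^bold>\<longleftrightarrow>" 25) where
  "(\<phi> \<^bold>\<longleftrightarrow> \<psi>) = ((\<phi> \<^bold>\<longrightarrow> \<psi>) \<^bold>\<and> (\<psi> \<^bold>\<longrightarrow> \<phi>))"

definition Exists :: "('c \<Rightarrow> 'c fm) \<Rightarrow> 'c fm"  (binder "\<^bold>\<exists>" 10) where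
  "(\<^bold>\<exists>x. \<phi> x) = (\<^bold>\<not> (\<^bold>\<forall>x. \<^bold>\<not> \<phi> x))"

primrec sat :: "('v \<Rightarrow> 'v \<Rightarrow> bool) \<Rightarrow> 'v fm \<Rightarrow> bool" where
  "sat E (x \<^bold>\<in> y) \<longleftrightarrow> E x y"
| "sat E (x \<^bold>= y) \<longleftrightarrow> x = y"
| "sat E (\<^bold>\<not> \<phi>) \<longleftrightarrow> \<not> sat E \<phi>"
| "sat E (\<phi> \<^bold>\<and> \<psi>) \<longleftrightarrow> sat E \<phi> \<and> sat E \<psi>"
| "sat E (Forall \<Phi>) \<longleftrightarrow> (\<forall>x. sat E (\<Phi> x))"


section \<open>Forcing\<close>

text \<open>
  The conditions form a set of the universe; by separation the order, restricted to the conditions,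
  is a set of the universe as well.
\<close>

record 'v forcing_notion =
  conds :: 'v
  leq :: "'v \<Rightarrow> 'v \<Rightarrow> bool"
  maxc :: 'v

definition forcing_notion :: "('v \<Rightarrow> 'v \<Rightarrow> bool) \<Rightarrow> 'v forcing_notion \<Rightarrow> bool" where
  "forcing_notion E P \<longleftrightarrow>
     E (maxc P) (conds P) \<and>
     (\<forall>p. E p (conds P) \<longrightarrow> leq P p p \<and> leq P p (maxc P)) \<and>
     (\<forall>p q r. E p (conds P) \<longrightarrow> E q (conds P) \<longrightarrow> E r (conds P) \<longrightarrow>
        leq P p q \<longrightarrow> leq P q r \<longrightarrow> leq P p r)"

definition extends :: "('v \<Rightarrow> 'v \<Rightarrow> bool) \<Rightarrow> 'v forcing_notion \<Rightarrow> 'v \<Rightarrow> 'v \<Rightarrow> bool" where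
  "extends E P q p \<longleftrightarrow> E q (conds P) \<and> leq P q p"

inductive is_name :: "('v \<Rightarrow> 'v \<Rightarrow> bool) \<Rightarrow> 'v forcing_notion \<Rightarrow> 'v \<Rightarrow> bool" for E P where
  "(\<forall>z. E z x \<longrightarrow> (\<exists>y p. is_name E P y \<and> E p (conds P) \<and> z = vpair E y p)) \<Longrightarrow> is_name E P x"

definition check :: "('v \<Rightarrow> 'v \<Rightarrow> bool) \<Rightarrow> 'v forcing_notion \<Rightarrow> 'v \<Rightarrow> 'v" where
  "check E P = wfrec {(y, x). E y x} (\<lambda>c x. vset E {vpair E (c y) (maxc P) | y. E y x})"

text \<open>
  The usual recursive definition of \<open>p \<tturnstile> x = y\<close>: below \<open>p\<close>, the conditions that put an element of
  \<open>x\<close> equal to some element of \<open>y\<close> are dense, and vice versa.  As membership is well-founded, the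
  recursive equation has only one solution, the least fixed point.
\<close>

inductive forces_eq ::
    "('v \<Rightarrow> 'v \<Rightarrow> bool) \<Rightarrow> 'v forcing_notion \<Rightarrow> 'v \<Rightarrow> 'v \<Rightarrow> 'v \<Rightarrow> bool" for E P where
  "(\<forall>u s q. E (vpair E u s) x \<longrightarrow> extends E P q p \<longrightarrow> extends E P q s \<longrightarrow>
      (\<exists>r w t. extends E P r q \<and> E (vpair E w t) y \<and> extends E P r t \<and> forces_eq E P r u w)) \<Longrightarrow>
   (\<forall>w t q. E (vpair E w t) y \<longrightarrow> extends E P q p \<longrightarrow> extends E P q t \<longrightarrow>
      (\<exists>r u s. extends E P r q \<and> E (vpair E u s) x \<and> extends E P r s \<and> forces_eq E P r u w)) \<Longrightarrow>
   forces_eq E P p x y"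

definition forces_mem ::
    "('v \<Rightarrow> 'v \<Rightarrow> bool) \<Rightarrow> 'v forcing_notion \<Rightarrow> 'v \<Rightarrow> 'v \<Rightarrow> 'v \<Rightarrow> bool" where
  "forces_mem E P p x y \<longleftrightarrow>
     (\<forall>q. extends E P q p \<longrightarrow>
        (\<exists>r w t. extends E P r q \<and> E (vpair E w t) y \<and> extends E P r t \<and> forces_eq E P r x w))"

primrec forces ::
    "('v \<Rightarrow> 'v \<Rightarrow> bool) \<Rightarrow> 'v forcing_notion \<Rightarrow> 'v fm \<Rightarrow> 'v \<Rightarrow> bool" where
  "forces E P (x \<^bold>\<in> y) = (\<lambda>p. forces_mem E P p x y)"
| "forces E P (x \<^bold>= y) = (\<lambda>p. forces_eq E P p x y)"
| "forces E P (\<^bold>\<not> \<phi>) = (\<lambda>p. \<forall>q. extends E P q p \<longrightarrow> \<not> forces E P \<phi> q)"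
| "forces E P (\<phi> \<^bold>\<and> \<psi>) = (\<lambda>p. forces E P \<phi> p \<and> forces E P \<psi> p)"
| "forces E P (Forall \<Phi>) = (\<lambda>p. \<forall>x. is_name E P x \<longrightarrow> forces E P (\<Phi> x) p)"

definition holds_in_extension :: "('v \<Rightarrow> 'v \<Rightarrow> bool) \<Rightarrow> 'v forcing_notion \<Rightarrow> 'v fm \<Rightarrow> bool" where
  "holds_in_extension E P \<phi> \<longleftrightarrow> forces E P \<phi> (maxc P)"


section \<open>Basic set-theoretic notions as formulas\<close>

definition is_empty :: "'c \<Rightarrow> 'c fm" where
  "is_empty x = (\<^bold>\<forall>y. \<^bold>\<not> y \<^bold>\<in> x)"

definition is_subset :: "'c \<Rightarrow> 'c \<Rightarrow> 'c fm" where
  "is_subset x y = (\<^bold>\<forall>z. z \<^bold>\<in> x \<^bold>\<longrightarrow> z \<^bold>\<in> y)"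

definition is_upair :: "'c \<Rightarrow> 'c \<Rightarrow> 'c \<Rightarrow> 'c fm" where
  "is_upair u x y = (\<^bold>\<forall>z. z \<^bold>\<in> u \<^bold>\<longleftrightarrow> z \<^bold>= x \<^bold>\<or> z \<^bold>= y)"

definition is_pair :: "'c \<Rightarrow> 'c \<Rightarrow> 'c \<Rightarrow> 'c fm" where
  "is_pair p x y = (\<^bold>\<exists>u. \<^bold>\<exists>v. is_upair u x x \<^bold>\<and> is_upair v x y \<^bold>\<and> is_upair p u v)"

definition is_product :: "'c \<Rightarrow> 'c \<Rightarrow> 'c \<Rightarrow> 'c fm" where
  "is_product D X Y = (\<^bold>\<forall>p. p \<^bold>\<in> D \<^bold>\<longleftrightarrow> (\<^bold>\<exists>x. \<^bold>\<exists>y. x \<^bold>\<in> X \<^bold>\<and> y \<^bold>\<in> Y \<^bold>\<and> is_pair p x y))"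

text \<open>\<open>maps f x y\<close> says \<open>f x = y\<close>, for a function \<open>f\<close> given by its graph.\<close>

definition maps :: "'c \<Rightarrow> 'c \<Rightarrow> 'c \<Rightarrow> 'c fm" where
  "maps f x y = (\<^bold>\<exists>p. is_pair p x y \<^bold>\<and> p \<^bold>\<in> f)"

definition is_fun :: "'c \<Rightarrow> 'c \<Rightarrow> 'c \<Rightarrow> 'c fm" where
  "is_fun f X Y =
     ((\<^bold>\<forall>p. p \<^bold>\<in> f \<^bold>\<longrightarrow> (\<^bold>\<exists>x. \<^bold>\<exists>y. x \<^bold>\<in> X \<^bold>\<and> y \<^bold>\<in> Y \<^bold>\<and> is_pair p x y)) \<^bold>\<and>
      (\<^bold>\<forall>x. x \<^bold>\<in> X \<^bold>\<longrightarrow> (\<^bold>\<exists>y. maps f x y)) \<^bold>\<and>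
      (\<^bold>\<forall>x. \<^bold>\<forall>y. \<^bold>\<forall>z. maps f x y \<^bold>\<and> maps f x z \<^bold>\<longrightarrow> y \<^bold>= z))"

definition is_fun_on :: "'c \<Rightarrow> 'c \<Rightarrow> 'c fm" where
  "is_fun_on f X = (\<^bold>\<exists>Y. is_fun f X Y)"

definition is_surj :: "'c \<Rightarrow> 'c \<Rightarrow> 'c \<Rightarrow> 'c fm" where
  "is_surj f X Y = (is_fun f X Y \<^bold>\<and> (\<^bold>\<forall>y. y \<^bold>\<in> Y \<^bold>\<longrightarrow> (\<^bold>\<exists>x. maps f x y)))"

definition is_bij :: "'c \<Rightarrow> 'c \<Rightarrow> 'c \<Rightarrow> 'c fm" where
  "is_bij f X Y =
     (is_surj f X Y \<^bold>\<and> (\<^bold>\<forall>x. \<^bold>\<forall>x'. \<^bold>\<forall>y. maps f x y \<^bold>\<and> maps f x' y \<^bold>\<longrightarrow> x \<^bold>= x'))"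

definition equipotent :: "'c \<Rightarrow> 'c \<Rightarrow> 'c fm" where
  "equipotent X Y = (\<^bold>\<exists>f. is_bij f X Y)"


section \<open>Ordinals and cardinals\<close>

definition is_transitive :: "'c \<Rightarrow> 'c fm" where
  "is_transitive x = (\<^bold>\<forall>y. y \<^bold>\<in> x \<^bold>\<longrightarrow> is_subset y x)"

definition is_ord :: "'c \<Rightarrow> 'c fm" where
  "is_ord x = (is_transitive x \<^bold>\<and> (\<^bold>\<forall>y. y \<^bold>\<in> x \<^bold>\<longrightarrow> is_transitive y))"

definition ord_le :: "'c \<Rightarrow> 'c \<Rightarrow> 'c fm" where
  "ord_le \<alpha> \<beta> = (\<alpha> \<^bold>\<in> \<beta> \<^bold>\<or> \<alpha> \<^bold>= \<beta>)"

definition is_succ :: "'c \<Rightarrow> 'c \<Rightarrow> 'c fm" where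
  "is_succ \<beta> \<alpha> = (\<^bold>\<forall>z. z \<^bold>\<in> \<beta> \<^bold>\<longleftrightarrow> z \<^bold>\<in> \<alpha> \<^bold>\<or> z \<^bold>= \<alpha>)"

definition is_limit :: "'c \<Rightarrow> 'c fm" where
  "is_limit \<alpha> = (is_ord \<alpha> \<^bold>\<and> \<^bold>\<not> is_empty \<alpha> \<^bold>\<and> \<^bold>\<not> (\<^bold>\<exists>\<beta>. is_succ \<alpha> \<beta>))"

definition is_two :: "'c \<Rightarrow> 'c fm" where
  "is_two x = (\<^bold>\<exists>z. \<^bold>\<exists>u. is_empty z \<^bold>\<and> is_succ u z \<^bold>\<and> is_succ x u)"

definition is_omega :: "'c \<Rightarrow> 'c fm" where
  "is_omega x = (is_limit x \<^bold>\<and> (\<^bold>\<forall>y. y \<^bold>\<in> x \<^bold>\<longrightarrow> \<^bold>\<not> is_limit y))"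

definition is_card :: "'c \<Rightarrow> 'c fm" where
  "is_card \<kappa> = (is_ord \<kappa> \<^bold>\<and> (\<^bold>\<forall>\<alpha>. \<alpha> \<^bold>\<in> \<kappa> \<^bold>\<longrightarrow> \<^bold>\<not> equipotent \<alpha> \<kappa>))"

definition is_card_of :: "'c \<Rightarrow> 'c \<Rightarrow> 'c fm" where
  "is_card_of \<kappa> X = (is_card \<kappa> \<^bold>\<and> equipotent X \<kappa>)"

definition is_succ_card :: "'c \<Rightarrow> 'c \<Rightarrow> 'c fm" where
  "is_succ_card \<mu> \<kappa> =
     (is_card \<mu> \<^bold>\<and> \<kappa> \<^bold>\<in> \<mu> \<^bold>\<and> (\<^bold>\<forall>\<nu>. is_card \<nu> \<^bold>\<and> \<kappa> \<^bold>\<in> \<nu> \<^bold>\<longrightarrow> ord_le \<mu> \<nu>))"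

primrec is_omega_n :: "nat \<Rightarrow> 'c \<Rightarrow> 'c fm" where
  "is_omega_n 0 x = is_omega x"
| "is_omega_n (Suc n) x = (\<^bold>\<exists>y. is_omega_n n y \<^bold>\<and> is_succ_card x y)"

definition cofinal_map :: "'c \<Rightarrow> 'c \<Rightarrow> 'c \<Rightarrow> 'c fm" where
  "cofinal_map f \<kappa> \<eta> =
     (is_fun f \<kappa> \<eta> \<^bold>\<and> (\<^bold>\<forall>\<xi>. \<xi> \<^bold>\<in> \<eta> \<^bold>\<longrightarrow> (\<^bold>\<exists>\<nu>. \<^bold>\<exists>\<zeta>. maps f \<nu> \<zeta> \<^bold>\<and> ord_le \<xi> \<zeta>)))"

definition is_cof :: "'c \<Rightarrow> 'c \<Rightarrow> 'c fm" where
  "is_cof \<kappa> \<eta> =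
     (is_ord \<kappa> \<^bold>\<and> (\<^bold>\<exists>f. cofinal_map f \<kappa> \<eta>) \<^bold>\<and>
      (\<^bold>\<forall>\<alpha>. \<alpha> \<^bold>\<in> \<kappa> \<^bold>\<longrightarrow> \<^bold>\<not> (\<^bold>\<exists>f. cofinal_map f \<alpha> \<eta>)))"

definition cardinal_preserving :: "('v \<Rightarrow> 'v \<Rightarrow> bool) \<Rightarrow> 'v forcing_notion \<Rightarrow> bool" where
  "cardinal_preserving E P \<longleftrightarrow>
     (\<forall>\<kappa>. sat E (is_card \<kappa>) \<longrightarrow> holds_in_extension E P (is_card (check E P \<kappa>)))"


section \<open>Strongly unbounded functions\<close>

definition subset_of_size :: "'c \<Rightarrow> 'c \<Rightarrow> 'c \<Rightarrow> 'c fm" where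
  "subset_of_size a X n = (is_subset a X \<^bold>\<and> equipotent a n)"

definition pairwise_disjoint :: "'c \<Rightarrow> 'c fm" where
  "pairwise_disjoint A =
     (\<^bold>\<forall>a. \<^bold>\<forall>b. a \<^bold>\<in> A \<^bold>\<and> b \<^bold>\<in> A \<^bold>\<and> \<^bold>\<not> a \<^bold>= b \<^bold>\<longrightarrow> \<^bold>\<not> (\<^bold>\<exists>x. x \<^bold>\<in> a \<^bold>\<and> x \<^bold>\<in> b))"

definition strongly_unbounded :: "'c \<Rightarrow> 'c \<Rightarrow> 'c fm" where
  "strongly_unbounded F lam =
     (\<^bold>\<exists>w w1 two pairs.
        is_omega w \<^bold>\<and> is_omega_n 1 w1 \<^bold>\<and> is_two two \<^bold>\<and>
        (\<^bold>\<forall>u. u \<^bold>\<in> pairs \<^bold>\<longleftrightarrow> subset_of_size u lam two) \<^bold>\<and> is_fun F pairs w1 \<^bold>\<and>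
        (\<^bold>\<forall>\<delta> n A.
           \<delta> \<^bold>\<in> w1 \<^bold>\<and> n \<^bold>\<in> w \<^bold>\<and> (\<^bold>\<forall>a. a \<^bold>\<in> A \<^bold>\<longrightarrow> subset_of_size a lam n) \<^bold>\<and>
           pairwise_disjoint A \<^bold>\<and> is_card_of w1 A \<^bold>\<longrightarrow>
           (\<^bold>\<exists>a b. a \<^bold>\<in> A \<^bold>\<and> b \<^bold>\<in> A \<^bold>\<and> \<^bold>\<not> a \<^bold>= b \<^bold>\<and>
              (\<^bold>\<forall>\<alpha> \<beta>. \<alpha> \<^bold>\<in> a \<^bold>\<and> \<beta> \<^bold>\<in> b \<^bold>\<longrightarrow>
                 (\<^bold>\<exists>u v. is_upair u \<alpha> \<beta> \<^bold>\<and> maps F u v \<^bold>\<and> \<delta> \<^bold>\<in> v)))))"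


section \<open>Boolean algebras\<close>

record 'c balg =
  car :: 'c
  meet :: 'c
  join :: 'c
  cmpl :: 'c
  bzero :: 'c
  bone :: 'c

definition ForallBA :: "('c balg \<Rightarrow> 'c fm) \<Rightarrow> 'c fm"  (binder "\<^bold>\<forall>\<^sub>B" 10) where
  "ForallBA \<Phi> = (\<^bold>\<forall>B m j c z u. \<Phi> \<lparr>car = B, meet = m, join = j, cmpl = c, bzero = z, bone = u\<rparr>)"

definition ExistsBA :: "('c balg \<Rightarrow> 'c fm) \<Rightarrow> 'c fm"  (binder "\<^bold>\<exists>\<^sub>B" 10) where
  "ExistsBA \<Phi> = (\<^bold>\<exists>B m j c z u. \<Phi> \<lparr>car = B, meet = m, join = j, cmpl = c, bzero = z, bone = u\<rparr>)"

text \<open>\<open>app f x \<phi>\<close> and \<open>app2 f x y \<phi>\<close> say \<open>\<phi> (f x)\<close> and \<open>\<phi> (f (x, y))\<close>.\<close>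

definition app :: "'c \<Rightarrow> 'c \<Rightarrow> ('c \<Rightarrow> 'c fm) \<Rightarrow> 'c fm" where
  "app f x \<phi> = (\<^bold>\<exists>y. maps f x y \<^bold>\<and> \<phi> y)"

definition app2 :: "'c \<Rightarrow> 'c \<Rightarrow> 'c \<Rightarrow> ('c \<Rightarrow> 'c fm) \<Rightarrow> 'c fm" where
  "app2 f x y \<phi> = (\<^bold>\<exists>p. is_pair p x y \<^bold>\<and> app f p \<phi>)"

definition is_binop :: "'c \<Rightarrow> 'c \<Rightarrow> 'c fm" where
  "is_binop m B = (\<^bold>\<exists>D. is_product D B B \<^bold>\<and> is_fun m D B)"

definition comm_assoc :: "'c \<Rightarrow> 'c \<Rightarrow> 'c fm" where
  "comm_assoc B m =
     ((\<^bold>\<forall>x y. x \<^bold>\<in> B \<^bold>\<and> y \<^bold>\<in> B \<^bold>\<longrightarrow> app2 m x y (\<lambda>s. app2 m y x (\<lambda>t. s \<^bold>= t))) \<^bold>\<and>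
      (\<^bold>\<forall>x y z. x \<^bold>\<in> B \<^bold>\<and> y \<^bold>\<in> B \<^bold>\<and> z \<^bold>\<in> B \<^bold>\<longrightarrow>
         app2 m x y (\<lambda>xy. app2 m xy z (\<lambda>s. app2 m y z (\<lambda>yz. app2 m x yz (\<lambda>t. s \<^bold>= t))))))"

definition distributes :: "'c \<Rightarrow> 'c \<Rightarrow> 'c \<Rightarrow> 'c fm" where
  "distributes B m j =
     (\<^bold>\<forall>x y z. x \<^bold>\<in> B \<^bold>\<and> y \<^bold>\<in> B \<^bold>\<and> z \<^bold>\<in> B \<^bold>\<longrightarrow>
        app2 j y z (\<lambda>yz. app2 m x yz (\<lambda>s.
          app2 m x y (\<lambda>xy. app2 m x z (\<lambda>xz. app2 j xy xz (\<lambda>t. s \<^bold>= t))))))"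

definition is_BA :: "'c balg \<Rightarrow> 'c fm" where
  "is_BA A =
     (bzero A \<^bold>\<in> car A \<^bold>\<and> bone A \<^bold>\<in> car A \<^bold>\<and> is_binop (meet A) (car A) \<^bold>\<and> is_binop (join A) (car A) \<^bold>\<and>
      is_fun (cmpl A) (car A) (car A) \<^bold>\<and>
      comm_assoc (car A) (meet A) \<^bold>\<and> comm_assoc (car A) (join A) \<^bold>\<and>
      distributes (car A) (meet A) (join A) \<^bold>\<and> distributes (car A) (join A) (meet A) \<^bold>\<and>
      (\<^bold>\<forall>x. x \<^bold>\<in> car A \<^bold>\<longrightarrow>
         app2 (meet A) x (bone A) (\<lambda>s. s \<^bold>= x) \<^bold>\<and> app2 (join A) x (bzero A) (\<lambda>s. s \<^bold>= x) \<^bold>\<and>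
         app (cmpl A) x (\<lambda>x'. app2 (meet A) x x' (\<lambda>s. s \<^bold>= bzero A) \<^bold>\<and>
                              app2 (join A) x x' (\<lambda>s. s \<^bold>= bone A))))"

definition ba_le :: "'c balg \<Rightarrow> 'c \<Rightarrow> 'c \<Rightarrow> 'c fm" where
  "ba_le A x y = app2 (meet A) x y (\<lambda>s. s \<^bold>= x)"

definition is_atom :: "'c balg \<Rightarrow> 'c \<Rightarrow> 'c fm" where
  "is_atom A a =
     (a \<^bold>\<in> car A \<^bold>\<and> \<^bold>\<not> a \<^bold>= bzero A \<^bold>\<and>
      (\<^bold>\<forall>x. x \<^bold>\<in> car A \<^bold>\<and> ba_le A x a \<^bold>\<longrightarrow> x \<^bold>= bzero A \<^bold>\<or> x \<^bold>= a))"

definition atomic :: "'c balg \<Rightarrow> 'c fm" where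
  "atomic A =
     (\<^bold>\<forall>x. x \<^bold>\<in> car A \<^bold>\<and> \<^bold>\<not> x \<^bold>= bzero A \<^bold>\<longrightarrow> (\<^bold>\<exists>a. is_atom A a \<^bold>\<and> ba_le A a x))"

definition is_surj_hom :: "'c \<Rightarrow> 'c balg \<Rightarrow> 'c balg \<Rightarrow> 'c fm" where
  "is_surj_hom h A C =
     (is_surj h (car A) (car C) \<^bold>\<and>
      maps h (bzero A) (bzero C) \<^bold>\<and> maps h (bone A) (bone C) \<^bold>\<and>
      (\<^bold>\<forall>x. x \<^bold>\<in> car A \<^bold>\<longrightarrow>
         app (cmpl A) x (\<lambda>s. app h x (\<lambda>x'. app (cmpl C) x' (\<lambda>t. maps h s t)))) \<^bold>\<and>
      (\<^bold>\<forall>x y. x \<^bold>\<in> car A \<^bold>\<and> y \<^bold>\<in> car A \<^bold>\<longrightarrow>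
         app h x (\<lambda>x'. app h y (\<lambda>y'.
           app2 (meet A) x y (\<lambda>s. app2 (meet C) x' y' (\<lambda>t. maps h s t)) \<^bold>\<and>
           app2 (join A) x y (\<lambda>s. app2 (join C) x' y' (\<lambda>t. maps h s t))))))"

definition superatomic :: "'c balg \<Rightarrow> 'c fm" where
  "superatomic A =
     (is_BA A \<^bold>\<and> (\<^bold>\<forall>\<^sub>B C. \<^bold>\<forall>h. is_BA C \<^bold>\<and> is_surj_hom h A C \<^bold>\<longrightarrow> atomic C))"

definition is_ideal :: "'c balg \<Rightarrow> 'c \<Rightarrow> 'c fm" where
  "is_ideal A I =
     (is_subset I (car A) \<^bold>\<and> bzero A \<^bold>\<in> I \<^bold>\<and>
      (\<^bold>\<forall>x y. x \<^bold>\<in> car A \<^bold>\<and> y \<^bold>\<in> I \<^bold>\<and> ba_le A x y \<^bold>\<longrightarrow> x \<^bold>\<in> I) \<^bold>\<and>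
      (\<^bold>\<forall>x y. x \<^bold>\<in> I \<^bold>\<and> y \<^bold>\<in> I \<^bold>\<longrightarrow> app2 (join A) x y (\<lambda>s. s \<^bold>\<in> I)))"

definition is_atom_ideal :: "'c balg \<Rightarrow> 'c \<Rightarrow> 'c fm" where
  "is_atom_ideal A I =
     (is_ideal A I \<^bold>\<and> (\<^bold>\<forall>a. is_atom A a \<^bold>\<longrightarrow> a \<^bold>\<in> I) \<^bold>\<and>
      (\<^bold>\<forall>K. is_ideal A K \<^bold>\<and> (\<^bold>\<forall>a. is_atom A a \<^bold>\<longrightarrow> a \<^bold>\<in> K) \<^bold>\<longrightarrow> is_subset I K))"

definition sym_diff :: "'c balg \<Rightarrow> 'c \<Rightarrow> 'c \<Rightarrow> ('c \<Rightarrow> 'c fm) \<Rightarrow> 'c fm" where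
  "sym_diff A x y \<phi> =
     app (cmpl A) x (\<lambda>x'. app (cmpl A) y (\<lambda>y'.
       app2 (meet A) x y' (\<lambda>s. app2 (meet A) x' y (\<lambda>t. app2 (join A) s t \<phi>))))"

text \<open>
  \<open>C\<close> is the quotient of \<open>A\<close> by the ideal \<open>I\<close> and \<open>h\<close> the canonical map: the elements of \<open>C\<close> are the
  cosets of \<open>I\<close>, and the operations of \<open>C\<close> are the ones that make \<open>h\<close> a homomorphism.
\<close>

definition is_quotient :: "'c balg \<Rightarrow> 'c \<Rightarrow> 'c balg \<Rightarrow> 'c \<Rightarrow> 'c fm" where
  "is_quotient A I C h =
     (is_ideal A I \<^bold>\<and> is_BA C \<^bold>\<and> is_surj_hom h A C \<^bold>\<and>
      (\<^bold>\<forall>x. x \<^bold>\<in> car A \<^bold>\<longrightarrow>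
         app h x (\<lambda>c. \<^bold>\<forall>y. y \<^bold>\<in> c \<^bold>\<longleftrightarrow> y \<^bold>\<in> car A \<^bold>\<and> sym_diff A x y (\<lambda>d. d \<^bold>\<in> I))))"


section \<open>Cantor-Bendixson ideals and cardinal sequences\<close>

definition cb_step :: "'c balg \<Rightarrow> 'c \<Rightarrow> 'c \<Rightarrow> 'c fm" where
  "cb_step A I I' =
     (\<^bold>\<exists>\<^sub>B C. \<^bold>\<exists>h K. is_quotient A I C h \<^bold>\<and> is_atom_ideal C K \<^bold>\<and>
        (\<^bold>\<forall>x. x \<^bold>\<in> I' \<^bold>\<longleftrightarrow> x \<^bold>\<in> car A \<^bold>\<and> app h x (\<lambda>c. c \<^bold>\<in> K)))"

text \<open>\<open>J\<close> is the sequence of the Cantor-Bendixson ideals with indices below the ordinal \<open>\<theta>\<close>.\<close>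

definition is_cb_sequence :: "'c balg \<Rightarrow> 'c \<Rightarrow> 'c \<Rightarrow> 'c fm" where
  "is_cb_sequence A J \<theta> =
     (is_ord \<theta> \<^bold>\<and> is_fun_on J \<theta> \<^bold>\<and>
      (\<^bold>\<forall>\<alpha> I. maps J \<alpha> I \<^bold>\<longrightarrow>
         (is_empty \<alpha> \<^bold>\<longrightarrow> (\<^bold>\<forall>x. x \<^bold>\<in> I \<^bold>\<longleftrightarrow> x \<^bold>= bzero A)) \<^bold>\<and>
         (\<^bold>\<forall>\<beta>. is_succ \<alpha> \<beta> \<^bold>\<longrightarrow> app J \<beta> (\<lambda>I0. cb_step A I0 I)) \<^bold>\<and>
         (is_limit \<alpha> \<^bold>\<longrightarrow> (\<^bold>\<forall>x. x \<^bold>\<in> I \<^bold>\<longleftrightarrow> (\<^bold>\<exists>\<beta>. \<beta> \<^bold>\<in> \<alpha> \<^bold>\<and> app J \<beta> (\<lambda>I0. x \<^bold>\<in> I0))))))"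

text \<open>\<open>app_succ J \<alpha> \<phi>\<close> says \<open>\<phi> (J (\<alpha> + 1))\<close>.\<close>

definition app_succ :: "'c \<Rightarrow> 'c \<Rightarrow> ('c \<Rightarrow> 'c fm) \<Rightarrow> 'c fm" where
  "app_succ J \<alpha> \<phi> = (\<^bold>\<exists>\<beta>. is_succ \<beta> \<alpha> \<^bold>\<and> app J \<beta> \<phi>)"

text \<open>
  \<open>\<delta>\<close> is the reduced height of \<open>A\<close>, the least \<open>\<delta>\<close> such that \<open>A\<close> is the ideal with index \<open>\<delta> + 1\<close>,
  and \<open>J\<close> is the sequence of the ideals with indices up to \<open>\<delta> + 1\<close>.
\<close>

definition is_reduced_height :: "'c balg \<Rightarrow> 'c \<Rightarrow> 'c \<Rightarrow> 'c fm" where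
  "is_reduced_height A J \<delta> =
     (is_ord \<delta> \<^bold>\<and>
      (\<^bold>\<exists>\<delta>' \<theta>. is_succ \<delta>' \<delta> \<^bold>\<and> is_succ \<theta> \<delta>' \<^bold>\<and> is_cb_sequence A J \<theta>) \<^bold>\<and>
      app_succ J \<delta> (\<lambda>I. I \<^bold>= car A) \<^bold>\<and>
      (\<^bold>\<forall>\<gamma>. \<gamma> \<^bold>\<in> \<delta> \<^bold>\<longrightarrow> \<^bold>\<not> app_succ J \<gamma> (\<lambda>I. I \<^bold>= car A)))"

text \<open>
  The level between consecutive ideals \<open>I\<close> and \<open>I'\<close> consists of the elements of \<open>I' - I\<close>,
  identified modulo \<open>I\<close>.  Below the reduced height it has the same cardinality as the set of atoms
  of the quotient by \<open>I\<close>.  Without the identification, \<open>I' - I\<close> would have at least as many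
  elements as \<open>I\<close> (take symmetric differences of one of its elements with the elements of \<open>I\<close>), so
  that no cardinal sequence could take the value \<open>\<omega>\<close> from index \<open>\<omega>\<^sub>1\<close> on.
\<close>

definition is_level :: "'c balg \<Rightarrow> 'c \<Rightarrow> 'c \<Rightarrow> 'c \<Rightarrow> 'c fm" where
  "is_level A I I' W =
     (\<^bold>\<exists>\<^sub>B C. \<^bold>\<exists>h. is_quotient A I C h \<^bold>\<and>
        (\<^bold>\<forall>c. c \<^bold>\<in> W \<^bold>\<longleftrightarrow> (\<^bold>\<exists>x. x \<^bold>\<in> I' \<^bold>\<and> \<^bold>\<not> x \<^bold>\<in> I \<^bold>\<and> maps h x c)))"

definition is_cardinal_sequence :: "'c balg \<Rightarrow> 'c \<Rightarrow> 'c fm" where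
  "is_cardinal_sequence A s =
     (\<^bold>\<exists>J \<delta>. is_reduced_height A J \<delta> \<^bold>\<and> is_fun_on s \<delta> \<^bold>\<and>
        (\<^bold>\<forall>\<alpha>. \<alpha> \<^bold>\<in> \<delta> \<^bold>\<longrightarrow>
           app J \<alpha> (\<lambda>I. app_succ J \<alpha> (\<lambda>I'. app s \<alpha> (\<lambda>\<kappa>.
             \<^bold>\<exists>W. is_level A I I' W \<^bold>\<and> is_card_of \<kappa> W)))))"

text \<open>\<open>s\<close> has length \<open>\<eta> + 1\<close>, the value \<open>\<omega>\<close> below \<open>\<eta>\<close>, and the value \<open>lam\<close> at \<open>\<eta>\<close>.\<close>

definition is_omega_then :: "'c \<Rightarrow> 'c \<Rightarrow> 'c \<Rightarrow> 'c fm" where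
  "is_omega_then s \<eta> lam =
     ((\<^bold>\<exists>\<eta>'. is_succ \<eta>' \<eta> \<^bold>\<and> is_fun_on s \<eta>') \<^bold>\<and>
      (\<^bold>\<forall>\<alpha>. \<alpha> \<^bold>\<in> \<eta> \<^bold>\<longrightarrow> app s \<alpha> is_omega) \<^bold>\<and> maps s \<eta> lam)"

definition is_omega_eta_lambda_BA :: "'c balg \<Rightarrow> 'c \<Rightarrow> 'c \<Rightarrow> 'c fm" where
  "is_omega_eta_lambda_BA A \<eta> lam =
     (superatomic A \<^bold>\<and> (\<^bold>\<exists>s. is_cardinal_sequence A s \<^bold>\<and> is_omega_then s \<eta> lam))"

end

(*
  Points are arranged in levels: omega points on every level below eta, lam points on level eta, and
  one point on top.  A condition is a finite partial order of points in which any common lower bound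
  of two incomparable points x, y lies below a common lower bound v of x and y that is admissible for
  the pair.  The generic order makes the finite sets of points into a Boolean algebra, a finite set
  standing for the symmetric difference of the cones below its points.  By genericity every element
  with a point above level a lies above a new point of level a, so the a-th Cantor-Bendixson ideal
  consists of the elements all of whose points have level below a.

  The points below level eta are coded by countable ordinals.  An admissible bound for two points of
  level eta is coded below the value of the strongly unbounded function at these points, hence comes
  from a countable set; for a pair with a point below level eta it is coded below the code of such a
  point.  Given uncountably many conditions, a delta-system argument makes them agree on a common
  root, and the strongly unbounded function provides two of them in which the points of level eta
  outside the root take values above the codes of the root.  The bounds in the root are then
  admissible bounds across the two conditions, so they amalgamate: the forcing is c.c.c. and preserves
  cardinals.  One forcing treats all eta below omega_2 at once; its conditions are finite disjoint
  unions of conditions for single eta.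
*)

theory Submission
  imports Defs "HOL-Library.Countable_Set_Type"
begin

text \<open>Meets must be generic, yet everything else should stay computable in the ground model. A
  refinement may therefore add a common lower bound of two old points only below an old one. Then a
  new point looks, from the old points, like one of them or lies below none, and the product of two
  finite sets of points is settled by any condition containing them. So carrier, complement, ideals
  and projections are check names; only meet and join are genuine names. Separation and replacement
  hold for all HOL predicates and functions, so every HOL map between sets of the universe is coded
  in it. Cardinality there is HOL cardinality, and the chain condition is ordinary combinatorics.
  Quantified formulas contain arbitrary HOL functions, so forced equality is not automatically a
  congruence; \<open>congr\<close> supplies this. The point on top gives the algebra its unit. It
  sits on level \<eta>+1, which is the reduced height and so contributes no term to the cardinal
  sequence. Homomorphic images are atomic by descent: an element with nonzero image that minimises
  its highest level, and then the number of points there, is mapped to an atom.\<close>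

unbundle cardinal_syntax

section \<open>Coded sets, ordinals and cardinals of the universe\<close>

section \<open>Sets of the universe as HOL sets\<close>

definition ext :: "('v \<Rightarrow> 'v \<Rightarrow> bool) \<Rightarrow> 'v \<Rightarrow> 'v set" where
  "ext E x = {z. E z x}"

definition small :: "('v \<Rightarrow> 'v \<Rightarrow> bool) \<Rightarrow> 'v set \<Rightarrow> bool" where
  "small E S \<longleftrightarrow> (\<exists>x. ext E x = S)"

definition vgraph :: "('v \<Rightarrow> 'v \<Rightarrow> bool) \<Rightarrow> ('v \<Rightarrow> 'v) \<Rightarrow> 'v set \<Rightarrow> 'v" where
  "vgraph E f X = vset E ((\<lambda>x. vpair E x (f x)) ` X)"

definition vsucc :: "('v \<Rightarrow> 'v \<Rightarrow> bool) \<Rightarrow> 'v \<Rightarrow> 'v" where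
  "vsucc E x = vset E (insert x (ext E x))"

definition Ord :: "('v \<Rightarrow> 'v \<Rightarrow> bool) \<Rightarrow> 'v \<Rightarrow> bool" where
  "Ord E x \<longleftrightarrow> (\<forall>y. E y x \<longrightarrow> (\<forall>z. E z y \<longrightarrow> E z x)) \<and>
     (\<forall>y. E y x \<longrightarrow> (\<forall>z. E z y \<longrightarrow> (\<forall>u. E u z \<longrightarrow> E u y)))"

primrec natV :: "('v \<Rightarrow> 'v \<Rightarrow> bool) \<Rightarrow> nat \<Rightarrow> 'v" where
  "natV E 0 = vset E {}"
| "natV E (Suc n) = vsucc E (natV E n)"

lemma sat_derived [simp]:
  "sat E (\<phi> \<^bold>\<or> \<psi>) \<longleftrightarrow> sat E \<phi> \<or> sat E \<psi>"
  "sat E (\<phi> \<^bold>\<longrightarrow> \<psi>) \<longleftrightarrow> (sat E \<phi> \<longrightarrow> sat E \<psi>)"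
  "sat E (\<phi> \<^bold>\<longleftrightarrow> \<psi>) \<longleftrightarrow> (sat E \<phi> \<longleftrightarrow> sat E \<psi>)"
  "sat E (Exists \<Phi>) \<longleftrightarrow> (\<exists>x. sat E (\<Phi> x))"
  by (auto simp: Disj_def Imp_def Iff_def Exists_def)

context zfc_universe
begin

lemma mem_ext [simp]: "z \<in> ext E x \<longleftrightarrow> E z x"
  by (simp add: ext_def)

lemma ext_inject [simp]: "ext E x = ext E y \<longleftrightarrow> x = y"
  using extensionality unfolding ext_def by blast

lemma small_ext [simp, intro]: "small E (ext E x)"
  unfolding small_def by blast

lemma vset_ext [simp]: "vset E (ext E x) = x"
  unfolding vset_def by (rule the_equality) (auto intro: extensionality)

lemma ext_vset [simp]: "small E S \<Longrightarrow> ext E (vset E S) = S"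
  unfolding small_def by auto

lemma mem_vset [simp]: "small E S \<Longrightarrow> E x (vset E S) \<longleftrightarrow> x \<in> S"
  using ext_vset[of S] mem_ext by blast

lemma vset_inject: "small E S \<Longrightarrow> small E T \<Longrightarrow> vset E S = vset E T \<longleftrightarrow> S = T"
  by (metis ext_vset)

text \<open>\<open>T\<close> may be an arbitrary HOL set, because separation holds for every HOL
  predicate; definability is never an issue.\<close>

lemma small_subset: "small E S \<Longrightarrow> T \<subseteq> S \<Longrightarrow> small E T"
proof -
  assume "small E S" "T \<subseteq> S"
  then obtain x where x: "ext E x = S" unfolding small_def by blast
  obtain u where "\<forall>z. E z u \<longleftrightarrow> E z x \<and> z \<in> T" using separation[of x "\<lambda>z. z \<in> T"] by blast
  then have "ext E u = T" using x \<open>T \<subseteq> S\<close> unfolding ext_def by auto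
  then show ?thesis unfolding small_def by blast
qed

lemma small_image [intro]: "small E S \<Longrightarrow> small E (f ` S)"
proof -
  assume "small E S"
  then obtain x where x: "ext E x = S" unfolding small_def by blast
  obtain u where "\<forall>z. E z u \<longleftrightarrow> (\<exists>y. E y x \<and> z = f y)" using replacement[of x f] by blast
  then have "ext E u = f ` S" using x unfolding ext_def by auto
  then show ?thesis unfolding small_def by blast
qed

lemma small_pair: "small E {x, y}"
proof -
  obtain u where "\<forall>z. E z u \<longleftrightarrow> z = x \<or> z = y" using pairing[of x y] by blast
  then have "ext E u = {x, y}" unfolding ext_def by auto
  then show ?thesis unfolding small_def by blast
qed

lemma small_sing [simp]: "small E {x}"
  using small_pair[of x x] by simp

lemma small_empty [simp]: "small E {}"
  using small_subset[OF small_sing] by blast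

lemma small_UN: "small E S \<Longrightarrow> (\<And>x. x \<in> S \<Longrightarrow> small E (B x)) \<Longrightarrow> small E (\<Union>x\<in>S. B x)"
proof -
  assume S: "small E S" and B: "\<And>x. x \<in> S \<Longrightarrow> small E (B x)"
  let ?W = "vset E ((\<lambda>x. vset E (B x)) ` S)"
  obtain u where u: "\<forall>z. E z u \<longleftrightarrow> (\<exists>y. E y ?W \<and> E z y)" using union[of ?W] by blast
  have "ext E u = (\<Union>x\<in>S. B x)"
    using S B small_image[OF S, of "\<lambda>x. vset E (B x)"] by (auto simp: u)
  then show ?thesis unfolding small_def by blast
qed

lemma small_Un: "small E S \<Longrightarrow> small E T \<Longrightarrow> small E (S \<union> T)"
proof -
  assume S: "small E S" and T: "small E T"
  \<comment> \<open>The indexed union yields the binary one as soon as two different indices are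
    available.\<close>
  have ne: "vset E {} \<noteq> vset E {vset E {}}"
    using vset_inject[of "{}" "{vset E {}}"] by simp
  have "small E (\<Union>x\<in>{vset E {}, vset E {vset E {}}}. if x = vset E {} then S else T)"
    by (rule small_UN) (auto intro: small_pair S T)
  then show ?thesis using ne by (simp add: Un_commute)
qed

lemma small_insert [simp]: "small E S \<Longrightarrow> small E (insert x S)"
  using small_Un[of "{x}" S] by simp

lemma small_finite [intro]: "finite S \<Longrightarrow> small E S"
  by (induction rule: finite_induct) auto

lemma small_Pow: "small E S \<Longrightarrow> small E (vset E ` Pow S)"
proof -
  assume "small E S"
  then obtain x where x: "ext E x = S" unfolding small_def by blast
  obtain u where u: "\<forall>z. E z u \<longleftrightarrow> (\<forall>y. E y z \<longrightarrow> E y x)" using power_set[of x] by blast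
  have "vset E ` Pow S \<subseteq> ext E u"
  proof
    fix z assume "z \<in> vset E ` Pow S"
    then obtain T where T: "T \<subseteq> S" "z = vset E T" by blast
    then have "small E T" using small_subset[of S T] x small_ext by metis
    then show "z \<in> ext E u" using T x[symmetric] by (auto simp: u)
  qed
  then show ?thesis using small_subset small_ext by blast
qed

lemma small_vset_image: "small E S \<Longrightarrow> (\<And>T. T \<in> A \<Longrightarrow> T \<subseteq> S) \<Longrightarrow> small E (vset E ` A)"
  by (rule small_subset[OF small_Pow]) auto

lemma vpair_inject [simp]: "vpair E x y = vpair E x' y' \<longleftrightarrow> x = x' \<and> y = y'"
  unfolding vpair_def by (auto simp: vset_inject small_pair doubleton_eq_iff)

lemma small_pairs: "small E S \<Longrightarrow> (\<And>x. x \<in> S \<Longrightarrow> small E (T x)) \<Longrightarrow>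
    small E {vpair E x y | x y. x \<in> S \<and> y \<in> T x}"
proof -
  assume S: "small E S" and T: "\<And>x. x \<in> S \<Longrightarrow> small E (T x)"
  have "small E (\<Union>x\<in>S. vpair E x ` T x)" using S T by (intro small_UN) auto
  moreover have "(\<Union>x\<in>S. vpair E x ` T x) = {vpair E x y | x y. x \<in> S \<and> y \<in> T x}" by auto
  ultimately show ?thesis by simp
qed

lemma mem_vgraph: "small E X \<Longrightarrow> E z (vgraph E f X) \<longleftrightarrow> (\<exists>x\<in>X. z = vpair E x (f x))"
  unfolding vgraph_def by (subst mem_vset) auto

lemma vpair_mem_vgraph [simp]: "small E X \<Longrightarrow> E (vpair E x y) (vgraph E f X) \<longleftrightarrow> x \<in> X \<and> y = f x"
  by (auto simp: mem_vgraph)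

lemma E_induct: "(\<And>x. (\<And>y. E y x \<Longrightarrow> Q y) \<Longrightarrow> Q x) \<Longrightarrow> Q x"
  using foundation by (metis wfp_induct_rule)

lemma E_irrefl [simp]: "\<not> E x x"
  by (induction x rule: E_induct) blast

lemma E_asym: "E x y \<Longrightarrow> \<not> E y x"
proof (induction x arbitrary: y rule: E_induct)
  case (1 x) then show ?case by blast
qed

lemma E_minimal: "Q x \<Longrightarrow> \<exists>z. Q z \<and> (\<forall>y. E y z \<longrightarrow> \<not> Q y)"
proof (induction x rule: E_induct)
  case (1 x) then show ?case by blast
qed

subsection \<open>Ordinals and cardinals\<close>

lemma sat_is_ord [simp]: "sat E (is_ord x) \<longleftrightarrow> Ord E x"
  by (simp add: is_ord_def is_transitive_def is_subset_def Ord_def)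

lemma Ord_mem: "Ord E x \<Longrightarrow> E y x \<Longrightarrow> Ord E y"
  unfolding Ord_def by blast

lemma Ord_trans: "Ord E x \<Longrightarrow> E y x \<Longrightarrow> E z y \<Longrightarrow> E z x"
  unfolding Ord_def by blast

text \<open>Induction on both arguments. If \<open>x\<close> and \<open>y\<close> are incomparable,
  each element of \<open>x\<close> is comparable with \<open>y\<close> by the outer hypothesis, and
  the wrong alternatives would put \<open>y\<close> into \<open>x\<close> by transitivity; so it
  lies in \<open>y\<close>. The inner hypothesis gives the converse inclusion, and extensionality
  ends the argument.\<close>

lemma Ord_linear: "Ord E x \<Longrightarrow> Ord E y \<Longrightarrow> E x y \<or> x = y \<or> E y x"
proof (induction x arbitrary: y rule: E_induct)
  case (1 x)
  note IHx = 1
  show ?case using \<open>Ord E y\<close>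
  proof (induction y rule: E_induct)
    case (1 y)
    show ?case
    proof (rule ccontr)
      assume n: "\<not> ?thesis"
      have "E z y" if "E z x" for z
        using IHx(1)[OF that Ord_mem[OF IHx(2) that] 1(2)] n Ord_trans[OF IHx(2)] that by blast
      moreover have "E z x" if "E z y" for z
        using 1(1)[OF that Ord_mem[OF 1(2) that]] n Ord_trans[OF 1(2)] that by blast
      ultimately have "x = y" using extensionality by blast
      then show False using n by blast
    qed
  qed
qed

lemma mem_vsucc [simp]: "E z (vsucc E x) \<longleftrightarrow> z = x \<or> E z x"
  unfolding vsucc_def by (subst mem_vset) auto

lemma ext_vsucc: "ext E (vsucc E x) = insert x (ext E x)"
  by auto

lemma Ord_vsucc [simp]: "Ord E x \<Longrightarrow> Ord E (vsucc E x)"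
  unfolding Ord_def mem_vsucc by blast

lemma Ord_natV [simp]: "Ord E (natV E n)"
proof (induction n)
  case 0 then show ?case by (simp add: Ord_def)
qed simp

lemma sat_is_empty [simp]: "sat E (is_empty x) \<longleftrightarrow> x = vset E {}"
  by (auto simp: is_empty_def intro: extensionality)

lemma sat_is_succ [simp]: "sat E (is_succ y x) \<longleftrightarrow> y = vsucc E x"
  by (auto simp: is_succ_def intro: extensionality)

lemma sat_is_limit: "sat E (is_limit x) \<longleftrightarrow> Ord E x \<and> x \<noteq> vset E {} \<and> (\<forall>y. x \<noteq> vsucc E y)"
  by (auto simp: is_limit_def)

text \<open>A limit contains 0 and is closed under successors, by comparability of ordinals.
  Conversely, a member is an ordinal that is not a limit, hence 0 or the successor of a smaller
  member, so membership induction reaches a numeral.\<close>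

lemma sat_is_omega:
  assumes "sat E (is_omega w)"
  shows "ext E w = range (natV E)"
proof -
  have w: "Ord E w" "w \<noteq> vset E {}" "\<And>y. w \<noteq> vsucc E y"
    and nl: "\<And>y. E y w \<Longrightarrow> \<not> sat E (is_limit y)"
    using assms by (auto simp: is_omega_def sat_is_limit)
  have 1: "E (natV E n) w" for n
  proof (induction n)
    case 0
    then show ?case using Ord_linear[OF w(1) Ord_natV[of 0]] w(2) by auto
  next
    case (Suc n)
    then show ?case using Ord_linear[OF w(1) Ord_natV[of "Suc n"]] w(3) E_asym by auto
  qed
  have 2: "y \<in> range (natV E)" if "E y w" for y using that
  proof (induction y rule: E_induct)
    case (1 y)
    then have "Ord E y" using w Ord_mem by blast
    show ?case
    proof (cases "y = vset E {}")
      case True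
      then show ?thesis by (metis natV.simps(1) rangeI)
    next
      case False
      then obtain z where z: "y = vsucc E z" using nl[OF 1(2)] \<open>Ord E y\<close> by (auto simp: sat_is_limit)
      then have "E z w" using w(1) 1(2) Ord_trans by simp
      then obtain n where "z = natV E n" using 1(1)[of z] z by auto
      then have "y = natV E (Suc n)" using z by simp
      then show ?thesis by blast
    qed
  qed
  show ?thesis using 1 2 by auto
qed

lemma natV_less: "m < n \<Longrightarrow> E (natV E m) (natV E n)"
  by (induction n) (auto simp: less_Suc_eq)

lemma inj_natV: "inj (natV E)"
  by (rule injI) (metis natV_less E_irrefl linorder_neqE_nat)

lemma natV_eq [simp]: "natV E m = natV E n \<longleftrightarrow> m = n"
  using inj_natV by (auto dest: injD)

lemma ext_natV: "ext E (natV E n) = natV E ` {..<n}"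
proof (induction n)
  case (Suc n)
  then show ?case by (simp add: ext_vsucc lessThan_Suc)
qed auto

lemma sat_is_upair [simp]: "sat E (is_upair u x y) \<longleftrightarrow> u = vset E {x, y}"
  using small_pair[of x y] by (auto simp: is_upair_def intro: extensionality)

lemma sat_is_pair [simp]: "sat E (is_pair p x y) \<longleftrightarrow> p = vpair E x y"
  by (auto simp: is_pair_def vpair_def)

lemma sat_maps [simp]: "sat E (maps f x y) \<longleftrightarrow> E (vpair E x y) f"
  by (simp add: maps_def)

text \<open>The choice operator extracts \<open>g\<close> from an internal function, and replacement
  codes the graph of every HOL map into \<open>Y\<close>. Internal functions are thus the graphs of
  HOL functions, and all later counting can use HOL cardinals.\<close>

lemma sat_is_fun: "sat E (is_fun f X Y) \<longleftrightarrow> (\<exists>g. g ` ext E X \<subseteq> ext E Y \<and> f = vgraph E g (ext E X))"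
proof
  assume a: "sat E (is_fun f X Y)"
  then have c: "(\<forall>p. E p f \<longrightarrow> (\<exists>x y. E x X \<and> E y Y \<and> p = vpair E x y)) \<and>
      (\<forall>x. E x X \<longrightarrow> (\<exists>y. E (vpair E x y) f)) \<and>
      (\<forall>x y z. E (vpair E x y) f \<and> E (vpair E x z) f \<longrightarrow> y = z)"
    unfolding is_fun_def by simp
  have sub: "\<And>p. E p f \<Longrightarrow> \<exists>x y. E x X \<and> E y Y \<and> p = vpair E x y"
    and tot: "\<And>x. E x X \<Longrightarrow> \<exists>y. E (vpair E x y) f"
    and fnl: "\<And>x y z. E (vpair E x y) f \<Longrightarrow> E (vpair E x z) f \<Longrightarrow> y = z"
    using c by blast+
  define g where "g x = (SOME y. E (vpair E x y) f)" for x
  have g: "E (vpair E x (g x)) f" if "E x X" for x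
    unfolding g_def using tot[OF that] by (rule someI_ex)
  have Y: "E y Y" if "E (vpair E x y) f" for x y
    using sub[OF that] by auto
  have eq: "E z f \<longleftrightarrow> E z (vgraph E g (ext E X))" for z
  proof
    assume z: "E z f"
    then obtain x y where xy: "E x X" "z = vpair E x y" using sub by blast
    moreover from this have "y = g x" using fnl[OF _ g] z by blast
    ultimately show "E z (vgraph E g (ext E X))" by (auto simp: mem_vgraph)
  next
    assume "E z (vgraph E g (ext E X))"
    then show "E z f" by (auto simp: mem_vgraph g)
  qed
  then have "f = vgraph E g (ext E X)" using extensionality by blast
  then show "\<exists>g. g ` ext E X \<subseteq> ext E Y \<and> f = vgraph E g (ext E X)"
    using g Y by (intro exI[of _ g]) auto
next
  assume "\<exists>g. g ` ext E X \<subseteq> ext E Y \<and> f = vgraph E g (ext E X)"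
  then obtain g where g: "g ` ext E X \<subseteq> ext E Y" "f = vgraph E g (ext E X)" by blast
  have Y: "E (g x) Y" if "E x X" for x using g(1) that by (auto simp: image_subset_iff)
  show "sat E (is_fun f X Y)" unfolding g(2) by (auto simp: is_fun_def mem_vgraph Y)
qed

lemma sat_equipotent: "sat E (equipotent X Y) \<longleftrightarrow> (\<exists>g. bij_betw g (ext E X) (ext E Y))"
proof
  assume "sat E (equipotent X Y)"
  then obtain f where f: "sat E (is_fun f X Y)" "\<And>y. E y Y \<Longrightarrow> \<exists>x. E (vpair E x y) f"
      "\<And>x x' y. E (vpair E x y) f \<Longrightarrow> E (vpair E x' y) f \<Longrightarrow> x = x'"
    unfolding equipotent_def is_bij_def is_surj_def sat_derived sat.simps sat_maps by blast
  then obtain g where g: "g ` ext E X \<subseteq> ext E Y" "f = vgraph E g (ext E X)"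
    by (auto simp: sat_is_fun)
  then have "bij_betw g (ext E X) (ext E Y)"
    using f(2,3) unfolding bij_betw_def inj_on_def by (fastforce simp: image_iff)
  then show "\<exists>g. bij_betw g (ext E X) (ext E Y)" by blast
next
  assume "\<exists>g. bij_betw g (ext E X) (ext E Y)"
  then obtain g where g: "bij_betw g (ext E X) (ext E Y)" by blast
  then have im: "g ` ext E X = ext E Y" and inj: "\<And>x x'. E x X \<Longrightarrow> E x' X \<Longrightarrow> g x = g x' \<Longrightarrow> x = x'"
    by (auto simp: bij_betw_def inj_on_def)
  have "sat E (is_fun (vgraph E g (ext E X)) X Y)" unfolding sat_is_fun using im by blast
  moreover have "\<exists>x. E x X \<and> y = g x" if "E y Y" for y
  proof -
    have "y \<in> g ` ext E X" using im that by simp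
    then show ?thesis by auto
  qed
  ultimately have "sat E (is_bij (vgraph E g (ext E X)) X Y)"
    unfolding is_bij_def is_surj_def using inj by auto
  then show "sat E (equipotent X Y)" unfolding equipotent_def by auto
qed

lemma sat_is_card: "sat E (is_card k) \<longleftrightarrow> Ord E k \<and> (\<forall>a. E a k \<longrightarrow> (\<nexists>g. bij_betw g (ext E a) (ext E k)))"
  by (auto simp: is_card_def sat_equipotent)

text \<open>The least ordinal equipotent with \<open>a\<close> is a cardinal, because bijections
  compose, and linearity places it at or below \<open>a\<close>.\<close>

lemma card_of_Ord:
  assumes "Ord E a"
  shows "\<exists>k g. sat E (is_card k) \<and> (E k a \<or> k = a) \<and> bij_betw g (ext E k) (ext E a)"
proof -
  obtain k where k: "Ord E k \<and> (\<exists>g. bij_betw g (ext E k) (ext E a))"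
    and min: "\<And>y. E y k \<Longrightarrow> \<not> (Ord E y \<and> (\<exists>g. bij_betw g (ext E y) (ext E a)))"
    using E_minimal[of "\<lambda>k. Ord E k \<and> (\<exists>g. bij_betw g (ext E k) (ext E a))" a] assms
      bij_betw_id[of "ext E a"] by blast
  have "sat E (is_card k)" unfolding sat_is_card
    using k min Ord_mem bij_betw_trans by meson
  moreover have "\<not> E a k" using min[of a] assms bij_betw_id[of "ext E a"] by blast
  ultimately show ?thesis using k Ord_linear[of k a] assms by blast
qed

lemma Ord_subset: "Ord E b \<Longrightarrow> E a b \<or> a = b \<Longrightarrow> ext E a \<subseteq> ext E b"
  using Ord_trans by auto

text \<open>The cardinal \<open>n\<close> of \<open>d\<close> lies in \<open>m\<close>. It cannot
  exceed \<open>k\<close>, since \<open>m\<close> is the least cardinal above \<open>k\<close>; so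
  \<open>n\<close> is at most \<open>k\<close>, and its elements form a subset of
  \<open>k\<close>.\<close>

lemma succ_card_le:
  assumes "sat E (is_succ_card m k)" "E d m"
  shows "|ext E d| \<le>o |ext E k|"
proof -
  have m: "sat E (is_card m)" "E k m" "\<And>n. sat E (is_card n) \<Longrightarrow> E k n \<Longrightarrow> E m n \<or> m = n"
    using assms(1) by (auto simp: is_succ_card_def ord_le_def)
  have Om: "Ord E m" using m(1) by (simp add: sat_is_card)
  then obtain n g where n: "sat E (is_card n)" "E n d \<or> n = d" "bij_betw g (ext E n) (ext E d)"
    using card_of_Ord assms(2) Ord_mem by meson
  have "E n m" using n(2) assms(2) Om Ord_trans by blast
  then have "\<not> E k n" using m(3)[OF n(1)] E_asym by auto
  then have "E n k \<or> n = k" using Ord_linear Ord_mem Om \<open>E n m\<close> m(2) by blast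
  then have "ext E n \<subseteq> ext E k" using Ord_subset Ord_mem Om m(2) by blast
  then have "|ext E n| \<le>o |ext E k|" by (rule card_of_mono1)
  then show ?thesis using n(3) card_of_ordIsoI ordIso_symmetric ordIso_ordLeq_trans by blast
qed

lemma is_omega_unique: "sat E (is_omega w) \<Longrightarrow> sat E (is_omega w') \<Longrightarrow> w = w'"
  using sat_is_omega ext_inject by metis

lemma is_omega_n_unique: "sat E (is_omega_n n w) \<Longrightarrow> sat E (is_omega_n n w') \<Longrightarrow> w = w'"
proof (induction n arbitrary: w w')
  case 0
  then show ?case using is_omega_unique by simp
next
  case (Suc n)
  then obtain y y' where "sat E (is_omega_n n y)" "sat E (is_succ_card w y)"
     "sat E (is_omega_n n y')" "sat E (is_succ_card w' y')" by auto
  moreover from this have "y = y'" using Suc.IH by blast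
  ultimately have "E w w' \<or> w = w'" "E w' w \<or> w' = w" by (auto simp: is_succ_card_def ord_le_def)
  then show ?case using E_asym by blast
qed

end

section \<open>Rules for forcing, absoluteness, and cardinals under the countable chain
  condition\<close>

section \<open>The forcing relation\<close>

text \<open>Stronger than \<open>forcing_notion\<close>: the order relates conditions only. Hence
  nothing extends a non-condition, which lets many rules drop the hypothesis that \<open>p\<close>
  is a condition.\<close>

locale forcing = zfc_universe E for E :: "'v \<Rightarrow> 'v \<Rightarrow> bool" +
  fixes P :: "'v forcing_notion"
  assumes leq_conds: "leq P q p \<Longrightarrow> E q (conds P) \<and> E p (conds P)"
    and leq_refl: "E p (conds P) \<Longrightarrow> leq P p p"
    and leq_trans: "leq P r q \<Longrightarrow> leq P q p \<Longrightarrow> leq P r p"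
    and leq_max: "E p (conds P) \<Longrightarrow> leq P p (maxc P)"
    and max_cond [simp]: "E (maxc P) (conds P)"
begin

abbreviation le (infix "\<preceq>" 50) where "q \<preceq> p \<equiv> extends E P q p"
abbreviation cond where "cond p \<equiv> E p (conds P)"
abbreviation frc (infix "\<tturnstile>" 50) where "p \<tturnstile> \<phi> \<equiv> forces E P \<phi> p"
abbreviation name where "name x \<equiv> is_name E P x"
abbreviation ck where "ck x \<equiv> check E P x"

lemma is_forcing_notion: "forcing_notion E P"
  unfolding forcing_notion_def using leq_refl leq_trans leq_max by auto

lemma le_cond: "q \<preceq> p \<Longrightarrow> cond q" "q \<preceq> p \<Longrightarrow> cond p"
  using leq_conds by (auto simp: extends_def)

lemma le_refl [simp]: "cond p \<Longrightarrow> p \<preceq> p"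
  using leq_refl by (auto simp: extends_def)

lemma le_trans [trans]: "r \<preceq> q \<Longrightarrow> q \<preceq> p \<Longrightarrow> r \<preceq> p"
  using leq_trans by (auto simp: extends_def)

lemma le_max [simp]: "cond p \<Longrightarrow> p \<preceq> maxc P"
  using leq_max by (auto simp: extends_def)

text \<open>With a single introduction rule, the least fixed point satisfies its clause as an
  equivalence. All reasoning about forced equality goes through this unfolding.\<close>

lemma forces_eq_iff: "forces_eq E P p x y \<longleftrightarrow>
  (\<forall>u s q. E (vpair E u s) x \<longrightarrow> q \<preceq> p \<longrightarrow> q \<preceq> s \<longrightarrow>
      (\<exists>r w t. r \<preceq> q \<and> E (vpair E w t) y \<and> r \<preceq> t \<and> forces_eq E P r u w)) \<and>
  (\<forall>w t q. E (vpair E w t) y \<longrightarrow> q \<preceq> p \<longrightarrow> q \<preceq> t \<longrightarrow>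
      (\<exists>r u s. r \<preceq> q \<and> E (vpair E u s) x \<and> r \<preceq> s \<and> forces_eq E P r u w))"
  by (subst forces_eq.simps) (rule iffI, blast+)

lemma forces_eqD1:
  assumes "forces_eq E P p x y" "E (vpair E u s) x" "q \<preceq> p" "q \<preceq> s"
  shows "\<exists>r w t. r \<preceq> q \<and> E (vpair E w t) y \<and> r \<preceq> t \<and> forces_eq E P r u w"
  using iffD1[OF forces_eq_iff assms(1)] assms(2-) by blast

lemma forces_eqD2:
  assumes "forces_eq E P p x y" "E (vpair E w t) y" "q \<preceq> p" "q \<preceq> t"
  shows "\<exists>r u s. r \<preceq> q \<and> E (vpair E u s) x \<and> r \<preceq> s \<and> forces_eq E P r u w"
  using iffD1[OF forces_eq_iff assms(1)] assms(2-) by blast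

lemma forces_eqI:
  assumes "\<And>u s q. E (vpair E u s) x \<Longrightarrow> q \<preceq> p \<Longrightarrow> q \<preceq> s \<Longrightarrow>
      \<exists>r w t. r \<preceq> q \<and> E (vpair E w t) y \<and> r \<preceq> t \<and> forces_eq E P r u w"
    "\<And>w t q. E (vpair E w t) y \<Longrightarrow> q \<preceq> p \<Longrightarrow> q \<preceq> t \<Longrightarrow>
      \<exists>r u s. r \<preceq> q \<and> E (vpair E u s) x \<and> r \<preceq> s \<and> forces_eq E P r u w"
  shows "forces_eq E P p x y"
  by (rule iffD2[OF forces_eq_iff]) (intro conjI allI impI assms)

lemma forces_eq_mono:
  assumes "forces_eq E P p x y" "q \<preceq> p"
  shows "forces_eq E P q x y"
proof (rule forces_eqI)
  fix u s r assume "E (vpair E u s) x" "r \<preceq> q" "r \<preceq> s"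
  then show "\<exists>r' w t. r' \<preceq> r \<and> E (vpair E w t) y \<and> r' \<preceq> t \<and> forces_eq E P r' u w"
    using forces_eqD1[OF assms(1)] le_trans[OF _ assms(2)] by blast
next
  fix w t r assume "E (vpair E w t) y" "r \<preceq> q" "r \<preceq> t"
  then show "\<exists>r' u s. r' \<preceq> r \<and> E (vpair E u s) x \<and> r' \<preceq> s \<and> forces_eq E P r' u w"
    using forces_eqD2[OF assms(1)] le_trans[OF _ assms(2)] by blast
qed

lemma forces_eq_dense:
  assumes "\<And>q. q \<preceq> p \<Longrightarrow> \<exists>r. r \<preceq> q \<and> forces_eq E P r x y"
  shows "forces_eq E P p x y"
proof (rule forces_eqI)
  fix u s q assume a: "E (vpair E u s) x" "q \<preceq> p" "q \<preceq> s"
  then obtain r where r: "r \<preceq> q" "forces_eq E P r x y" using assms by blast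
  show "\<exists>r w t. r \<preceq> q \<and> E (vpair E w t) y \<and> r \<preceq> t \<and> forces_eq E P r u w"
    using forces_eqD1[OF r(2) a(1) le_refl[OF le_cond(1)[OF r(1)]] le_trans[OF r(1) a(3)]]
      le_trans[OF _ r(1)] by blast
next
  fix w t q assume a: "E (vpair E w t) y" "q \<preceq> p" "q \<preceq> t"
  then obtain r where r: "r \<preceq> q" "forces_eq E P r x y" using assms by blast
  show "\<exists>r u s. r \<preceq> q \<and> E (vpair E u s) x \<and> r \<preceq> s \<and> forces_eq E P r u w"
    using forces_eqD2[OF r(2) a(1) le_refl[OF le_cond(1)[OF r(1)]] le_trans[OF r(1) a(3)]]
      le_trans[OF _ r(1)] by blast
qed

text \<open>A first coordinate \<open>u\<close> is not a member of \<open>x\<close> but lies in the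
  transitive closure of membership: \<open>u\<close> is in its singleton, which is in the pair,
  which is in \<open>x\<close>. Well-foundedness passes to this closure.\<close>

lemma vpair_induct:
  assumes "\<And>x. (\<And>u s. E (vpair E u s) x \<Longrightarrow> Q u) \<Longrightarrow> Q x"
  shows "Q x"
proof -
  have "wfp E\<^sup>+\<^sup>+" using foundation wfp_tranclp by blast
  then show ?thesis
  proof (induction x rule: wfp_induct_rule)
    case (less x)
    show ?case
    proof (rule assms)
      fix u s assume us: "E (vpair E u s) x"
      have "E u (vset E {u})" "E (vset E {u}) (vpair E u s)"
        unfolding vpair_def using small_pair by simp_all
      then have "E\<^sup>+\<^sup>+ u x" using us tranclp.r_into_trancl[of E] tranclp.trancl_into_trancl[of E] by blast
      then show "Q u" by (rule less)
    qed
  qed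
qed

lemma forces_eq_refl [simp]: "forces_eq E P p x x"
proof (induction x arbitrary: p rule: vpair_induct)
  case (1 x)
  show ?case using 1 le_refl le_cond(1) by (intro forces_eqI) blast+
qed

lemma forces_eq_sym: "forces_eq E P p x y \<Longrightarrow> forces_eq E P p y x"
proof (induction x arbitrary: p y rule: vpair_induct)
  case (1 x)
  show ?case
  proof (rule forces_eqI)
    fix u s q assume a: "E (vpair E u s) y" "q \<preceq> p" "q \<preceq> s"
    show "\<exists>r w t. r \<preceq> q \<and> E (vpair E w t) x \<and> r \<preceq> t \<and> forces_eq E P r u w"
      using 1(1) forces_eqD2[OF 1(2) a] by blast
  next
    fix w t q assume a: "E (vpair E w t) x" "q \<preceq> p" "q \<preceq> t"
    show "\<exists>r u s. r \<preceq> q \<and> E (vpair E u s) y \<and> r \<preceq> s \<and> forces_eq E P r u w"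
      using 1(1)[OF a(1)] forces_eqD1[OF 1(2) a] by blast
  qed
qed

lemma forces_eq_trans: "forces_eq E P p x y \<Longrightarrow> forces_eq E P p y z \<Longrightarrow> forces_eq E P p x z"
proof (induction x arbitrary: p y z rule: vpair_induct)
  case (1 x)
  show ?case
  proof (rule forces_eqI)
    fix u s q assume a: "E (vpair E u s) x" "q \<preceq> p" "q \<preceq> s"
    obtain r w t where r: "r \<preceq> q" "E (vpair E w t) y" "r \<preceq> t" "forces_eq E P r u w"
      using forces_eqD1[OF 1(2) a] by blast
    obtain r' v t' where r': "r' \<preceq> r" "E (vpair E v t') z" "r' \<preceq> t'" "forces_eq E P r' w v"
      using forces_eqD1[OF 1(3) r(2) le_trans[OF r(1) a(2)] r(3)] by blast
    have "forces_eq E P r' u v" using 1(1)[OF a(1) forces_eq_mono[OF r(4) r'(1)] r'(4)] .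
    then show "\<exists>r w t. r \<preceq> q \<and> E (vpair E w t) z \<and> r \<preceq> t \<and> forces_eq E P r u w"
      using r'(2,3) le_trans[OF r'(1) r(1)] by blast
  next
    fix v t' q assume a: "E (vpair E v t') z" "q \<preceq> p" "q \<preceq> t'"
    obtain r w t where r: "r \<preceq> q" "E (vpair E w t) y" "r \<preceq> t" "forces_eq E P r w v"
      using forces_eqD2[OF 1(3) a] by blast
    obtain r' u s where r': "r' \<preceq> r" "E (vpair E u s) x" "r' \<preceq> s" "forces_eq E P r' u w"
      using forces_eqD2[OF 1(2) r(2) le_trans[OF r(1) a(2)] r(3)] by blast
    have "forces_eq E P r' u v" using 1(1)[OF r'(2) r'(4) forces_eq_mono[OF r(4) r'(1)]] .
    then show "\<exists>r u s. r \<preceq> q \<and> E (vpair E u s) x \<and> r \<preceq> s \<and> forces_eq E P r u v"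
      using r'(2,3) le_trans[OF r'(1) r(1)] by blast
  qed
qed

lemma forces_mono: "p \<tturnstile> \<phi> \<Longrightarrow> q \<preceq> p \<Longrightarrow> q \<tturnstile> \<phi>"
proof (induction \<phi> arbitrary: p q)
  case (Mem x y)
  then show ?case using le_trans[OF _ \<open>q \<preceq> p\<close>] unfolding forces.simps forces_mem_def by blast
next
  case (Equ x y)
  then show ?case using forces_eq_mono by simp
next
  case (Neg \<phi>)
  then show ?case using le_trans[OF _ \<open>q \<preceq> p\<close>] by simp
next
  case (Conj \<phi> \<psi>)
  then show ?case by (simp, blast)
next
  case (Forall \<Phi>)
  then show ?case by (simp, blast)
qed

text \<open>The atomic clauses already ask only for dense sets of witnesses. A negation that fails
  below \<open>p\<close> would conflict with an extension forcing it. Conjunction and quantifier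
  inherit the property. The elimination rules below all pass to dense sets of conditions in this
  way.\<close>

lemma forces_dense: "(\<And>q. q \<preceq> p \<Longrightarrow> \<exists>r. r \<preceq> q \<and> r \<tturnstile> \<phi>) \<Longrightarrow> p \<tturnstile> \<phi>"
proof (induction \<phi> arbitrary: p)
  case (Mem x y)
  show ?case unfolding forces.simps forces_mem_def
  proof (intro allI impI)
    fix q assume "q \<preceq> p"
    then obtain r where "r \<preceq> q" "forces_mem E P r x y" using Mem by auto
    then show "\<exists>r w t. r \<preceq> q \<and> E (vpair E w t) y \<and> r \<preceq> t \<and> forces_eq E P r x w"
      unfolding forces_mem_def using le_trans[OF _ \<open>r \<preceq> q\<close>] le_refl le_cond(1) by blast
  qed
next
  case (Equ x y)
  then show ?case using forces_eq_dense by simp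
next
  case (Neg \<phi>)
  show ?case unfolding forces.simps
  proof (intro allI impI notI)
    fix q assume q: "q \<preceq> p" "q \<tturnstile> \<phi>"
    then obtain r where r: "r \<preceq> q" "r \<tturnstile> (\<^bold>\<not> \<phi>)" using Neg(2) by blast
    have "r \<tturnstile> \<phi>" using forces_mono[OF q(2) r(1)] .
    then show False using r(2) le_refl[OF le_cond(1)[OF r(1)]] by auto
  qed
next
  case (Conj \<phi> \<psi>)
  have "p \<tturnstile> \<phi>" by (rule Conj.IH(1)) (use Conj.prems in \<open>force\<close>)
  moreover have "p \<tturnstile> \<psi>" by (rule Conj.IH(2)) (use Conj.prems in \<open>force\<close>)
  ultimately show ?case by simp
next
  case (Forall \<Phi>)
  have "p \<tturnstile> \<Phi> x" if "name x" for x
    by (rule Forall.IH) (use Forall.prems that in \<open>force\<close>)+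
  then show ?case by simp
qed

lemma forces_contr: "(\<And>q. q \<preceq> p \<Longrightarrow> q \<tturnstile> (\<^bold>\<not> \<phi>) \<Longrightarrow> False) \<Longrightarrow> p \<tturnstile> \<phi>"
  by (rule forces_dense) (metis forces.simps(3))

lemma forces_imp: "p \<tturnstile> (\<phi> \<^bold>\<longrightarrow> \<psi>) \<longleftrightarrow> (\<forall>q. q \<preceq> p \<longrightarrow> q \<tturnstile> \<phi> \<longrightarrow> q \<tturnstile> \<psi>)"
proof
  assume a: "p \<tturnstile> (\<phi> \<^bold>\<longrightarrow> \<psi>)"
  show "\<forall>q. q \<preceq> p \<longrightarrow> q \<tturnstile> \<phi> \<longrightarrow> q \<tturnstile> \<psi>"
  proof (intro allI impI)
    fix q assume q: "q \<preceq> p" "q \<tturnstile> \<phi>"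
    show "q \<tturnstile> \<psi>"
    proof (rule forces_contr)
      fix r assume r: "r \<preceq> q" "r \<tturnstile> (\<^bold>\<not> \<psi>)"
      have "r \<tturnstile> (\<phi> \<^bold>\<and> \<^bold>\<not> \<psi>)" using forces_mono[OF q(2) r(1)] r(2) by simp
      then show False using a le_trans[OF r(1) q(1)] unfolding Imp_def by auto
    qed
  qed
next
  assume a: "\<forall>q. q \<preceq> p \<longrightarrow> q \<tturnstile> \<phi> \<longrightarrow> q \<tturnstile> \<psi>"
  then show "p \<tturnstile> (\<phi> \<^bold>\<longrightarrow> \<psi>)" unfolding Imp_def using le_refl le_cond(1) by (simp, blast)
qed

lemma forces_iff: "p \<tturnstile> (\<phi> \<^bold>\<longleftrightarrow> \<psi>) \<longleftrightarrow> (\<forall>q. q \<preceq> p \<longrightarrow> q \<tturnstile> \<phi> \<longleftrightarrow> q \<tturnstile> \<psi>)"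
  unfolding Iff_def by (auto simp: forces_imp)

lemma forces_disj: "p \<tturnstile> (\<phi> \<^bold>\<or> \<psi>) \<longleftrightarrow> (\<forall>q. q \<preceq> p \<longrightarrow> (\<exists>r. r \<preceq> q \<and> (r \<tturnstile> \<phi> \<or> r \<tturnstile> \<psi>)))"
proof -
  have "q \<tturnstile> (\<^bold>\<not> \<phi> \<^bold>\<and> \<^bold>\<not> \<psi>) \<longleftrightarrow> \<not> (\<exists>r. r \<preceq> q \<and> (r \<tturnstile> \<phi> \<or> r \<tturnstile> \<psi>))" for q
    by auto
  then show ?thesis unfolding Disj_def by (simp only: forces.simps) blast
qed

lemma forces_ex: "p \<tturnstile> Exists \<Phi> \<longleftrightarrow> (\<forall>q. q \<preceq> p \<longrightarrow> (\<exists>r x. r \<preceq> q \<and> name x \<and> r \<tturnstile> \<Phi> x))"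
proof -
  have "q \<tturnstile> (\<^bold>\<forall>x. \<^bold>\<not> \<Phi> x) \<longleftrightarrow> \<not> (\<exists>r x. r \<preceq> q \<and> name x \<and> r \<tturnstile> \<Phi> x)" for q
    by auto
  then show ?thesis unfolding Exists_def by (simp only: forces.simps) blast
qed

lemma f_disjI1: "p \<tturnstile> \<phi> \<Longrightarrow> p \<tturnstile> (\<phi> \<^bold>\<or> \<psi>)"
  and f_disjI2: "p \<tturnstile> \<psi> \<Longrightarrow> p \<tturnstile> (\<phi> \<^bold>\<or> \<psi>)"
  unfolding forces_disj using forces_mono le_refl le_cond(1) by blast+

lemma f_disjE:
  assumes "p \<tturnstile> (\<phi> \<^bold>\<or> \<psi>)" "\<And>q. q \<preceq> p \<Longrightarrow> q \<tturnstile> \<phi> \<Longrightarrow> q \<tturnstile> \<chi>" "\<And>q. q \<preceq> p \<Longrightarrow> q \<tturnstile> \<psi> \<Longrightarrow> q \<tturnstile> \<chi>"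
  shows "p \<tturnstile> \<chi>"
proof (rule forces_dense)
  fix q assume q: "q \<preceq> p"
  then obtain r where r: "r \<preceq> q" "r \<tturnstile> \<phi> \<or> r \<tturnstile> \<psi>" using assms(1) unfolding forces_disj by blast
  then have "r \<tturnstile> \<chi>" using assms(2,3) le_trans[OF r(1) q] by blast
  then show "\<exists>r. r \<preceq> q \<and> r \<tturnstile> \<chi>" using r by blast
qed

lemma f_exI: "p \<tturnstile> \<Phi> x \<Longrightarrow> name x \<Longrightarrow> p \<tturnstile> Exists \<Phi>"
  unfolding forces_ex using forces_mono le_refl le_cond(1) by blast

lemma f_exE:
  assumes "p \<tturnstile> Exists \<Phi>" "\<And>q x. q \<preceq> p \<Longrightarrow> name x \<Longrightarrow> q \<tturnstile> \<Phi> x \<Longrightarrow> q \<tturnstile> \<chi>"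
  shows "p \<tturnstile> \<chi>"
proof (rule forces_dense)
  fix q assume q: "q \<preceq> p"
  then obtain r x where r: "r \<preceq> q" "name x" "r \<tturnstile> \<Phi> x" using assms(1) unfolding forces_ex by blast
  then have "r \<tturnstile> \<chi>" using assms(2) le_trans[OF r(1) q] by blast
  then show "\<exists>r. r \<preceq> q \<and> r \<tturnstile> \<chi>" using r by blast
qed

lemma ex_obtain:
  assumes "p \<tturnstile> Exists \<Phi>" "cond p"
  obtains q x where "q \<preceq> p" "name x" "q \<tturnstile> \<Phi> x"
  using assms unfolding forces_ex using le_refl by blast

lemma f_allI: "(\<And>x. name x \<Longrightarrow> p \<tturnstile> \<Phi> x) \<Longrightarrow> p \<tturnstile> Forall \<Phi>"
  by simp

lemma f_impI: "(\<And>q. q \<preceq> p \<Longrightarrow> q \<tturnstile> \<phi> \<Longrightarrow> q \<tturnstile> \<psi>) \<Longrightarrow> p \<tturnstile> (\<phi> \<^bold>\<longrightarrow> \<psi>)"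
  by (simp add: forces_imp)

lemma f_iffI: "(\<And>q. q \<preceq> p \<Longrightarrow> q \<tturnstile> \<phi> \<longleftrightarrow> q \<tturnstile> \<psi>) \<Longrightarrow> p \<tturnstile> (\<phi> \<^bold>\<longleftrightarrow> \<psi>)"
  by (simp add: forces_iff)

lemma f_negI: "(\<And>q. q \<preceq> p \<Longrightarrow> q \<tturnstile> \<phi> \<Longrightarrow> False) \<Longrightarrow> p \<tturnstile> (\<^bold>\<not> \<phi>)"
  by auto

lemma f_negE: "p \<tturnstile> (\<^bold>\<not> \<phi>) \<Longrightarrow> p \<tturnstile> \<phi> \<Longrightarrow> cond p \<Longrightarrow> False"
  by simp

subsection \<open>Congruence\<close>

text \<open>\<open>Forall\<close> accepts any HOL function, even one that distinguishes names forced
  to be equal, so substitutivity is not provable for all formulas. It is carried as a property of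
  contexts and derived along the syntax of each concrete formula by
  \<open>cong_intros\<close>.\<close>

definition congr :: "('v \<Rightarrow> 'v fm) \<Rightarrow> bool" where
  "congr \<Phi> \<longleftrightarrow> (\<forall>p x y. p \<tturnstile> (x \<^bold>= y) \<longrightarrow> p \<tturnstile> \<Phi> x \<longrightarrow> p \<tturnstile> \<Phi> y)"

text \<open>The formula language has no function symbols, so the argument positions that arise are
  the variable itself and constants; both satisfy this.\<close>

definition cterm :: "('v \<Rightarrow> 'v) \<Rightarrow> bool" where
  "cterm a \<longleftrightarrow> (\<forall>p x y. p \<tturnstile> (x \<^bold>= y) \<longrightarrow> p \<tturnstile> (a x \<^bold>= a y))"

lemma congrD: "congr \<Phi> \<Longrightarrow> p \<tturnstile> (x \<^bold>= y) \<Longrightarrow> p \<tturnstile> \<Phi> x \<Longrightarrow> p \<tturnstile> \<Phi> y"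
  unfolding congr_def by blast

lemma eq_refl [simp]: "p \<tturnstile> (x \<^bold>= x)"
  by simp

lemma eq_sym: "p \<tturnstile> (x \<^bold>= y) \<Longrightarrow> p \<tturnstile> (y \<^bold>= x)"
  using forces_eq_sym by simp

lemma eq_trans: "p \<tturnstile> (x \<^bold>= y) \<Longrightarrow> p \<tturnstile> (y \<^bold>= z) \<Longrightarrow> p \<tturnstile> (x \<^bold>= z)"
  using forces_eq_trans by simp

lemma congr_iff: "congr \<Phi> \<Longrightarrow> p \<tturnstile> (x \<^bold>= y) \<Longrightarrow> p \<tturnstile> \<Phi> x \<longleftrightarrow> p \<tturnstile> \<Phi> y"
  unfolding congr_def using eq_sym by blast

lemma congrD': "congr \<Phi> \<Longrightarrow> p \<tturnstile> (y \<^bold>= x) \<Longrightarrow> p \<tturnstile> \<Phi> x \<Longrightarrow> p \<tturnstile> \<Phi> y"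
  using congr_iff by blast

named_theorems cong_intros

lemma cterm_id [cong_intros]: "cterm (\<lambda>x. x)"
  and cterm_const [cong_intros]: "cterm (\<lambda>x. t)"
  unfolding cterm_def by simp_all

lemma congr_const [cong_intros]: "congr (\<lambda>x. \<phi>)"
  unfolding congr_def by simp

lemma mem_eq_right:
  assumes "p \<tturnstile> (x \<^bold>\<in> y)" "p \<tturnstile> (y \<^bold>= z)"
  shows "p \<tturnstile> (x \<^bold>\<in> z)"
  unfolding forces.simps forces_mem_def
proof (intro allI impI)
  fix q assume q: "q \<preceq> p"
  have yz: "forces_eq E P p y z" using assms(2) by simp
  obtain r w t where r: "r \<preceq> q" "E (vpair E w t) y" "r \<preceq> t" "forces_eq E P r x w"
    using assms(1) q by (auto simp: forces_mem_def)
  obtain r' v t' where r': "r' \<preceq> r" "E (vpair E v t') z" "r' \<preceq> t'" "forces_eq E P r' w v"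
    using forces_eqD1[OF yz r(2) le_trans[OF r(1) q] r(3)] by blast
  have "forces_eq E P r' x v" using forces_eq_trans[OF forces_eq_mono[OF r(4) r'(1)] r'(4)] .
  then show "\<exists>r w t. r \<preceq> q \<and> E (vpair E w t) z \<and> r \<preceq> t \<and> forces_eq E P r x w"
    using r'(2,3) le_trans[OF r'(1) r(1)] by blast
qed

lemma mem_eq_left:
  assumes "p \<tturnstile> (x \<^bold>\<in> y)" "p \<tturnstile> (x \<^bold>= z)"
  shows "p \<tturnstile> (z \<^bold>\<in> y)"
  unfolding forces.simps forces_mem_def
proof (intro allI impI)
  fix q assume q: "q \<preceq> p"
  obtain r w t where r: "r \<preceq> q" "E (vpair E w t) y" "r \<preceq> t" "forces_eq E P r x w"
    using assms(1) q by (auto simp: forces_mem_def)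
  have "forces_eq E P r z x" using assms(2) forces_eq_mono[OF _ le_trans[OF r(1) q]] forces_eq_sym by simp
  then have "forces_eq E P r z w" using r(4) forces_eq_trans by blast
  then show "\<exists>r w t. r \<preceq> q \<and> E (vpair E w t) y \<and> r \<preceq> t \<and> forces_eq E P r z w"
    using r by blast
qed

lemma congr_mem [cong_intros]: "cterm a \<Longrightarrow> cterm b \<Longrightarrow> congr (\<lambda>x. a x \<^bold>\<in> b x)"
  unfolding congr_def cterm_def by (meson mem_eq_left mem_eq_right)

lemma congr_equ [cong_intros]: "cterm a \<Longrightarrow> cterm b \<Longrightarrow> congr (\<lambda>x. a x \<^bold>= b x)"
  unfolding congr_def cterm_def by (meson eq_sym eq_trans)

lemma congr_neg [cong_intros]: "congr \<Phi> \<Longrightarrow> congr (\<lambda>x. \<^bold>\<not> \<Phi> x)"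
  unfolding congr_def[of "\<lambda>x. \<^bold>\<not> \<Phi> x"]
proof (intro allI impI f_negI)
  fix p x y q assume "congr \<Phi>" "p \<tturnstile> (x \<^bold>= y)" "p \<tturnstile> (\<^bold>\<not> \<Phi> x)" "q \<preceq> p" "q \<tturnstile> \<Phi> y"
  moreover from this have "q \<tturnstile> \<Phi> x" using congr_iff forces_mono by blast
  ultimately show False by auto
qed

lemma congr_conj [cong_intros]: "congr \<Phi> \<Longrightarrow> congr \<Psi> \<Longrightarrow> congr (\<lambda>x. \<Phi> x \<^bold>\<and> \<Psi> x)"
  unfolding congr_def by auto

lemma congr_all [cong_intros]: "(\<And>z. congr (\<lambda>x. \<Phi> x z)) \<Longrightarrow> congr (\<lambda>x. Forall (\<Phi> x))"
  unfolding congr_def forces.simps(5) by blast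

lemma congr_derived [cong_intros]:
  "congr \<Phi> \<Longrightarrow> congr \<Psi> \<Longrightarrow> congr (\<lambda>x. \<Phi> x \<^bold>\<or> \<Psi> x)"
  "congr \<Phi> \<Longrightarrow> congr \<Psi> \<Longrightarrow> congr (\<lambda>x. \<Phi> x \<^bold>\<longrightarrow> \<Psi> x)"
  "congr \<Phi> \<Longrightarrow> congr \<Psi> \<Longrightarrow> congr (\<lambda>x. \<Phi> x \<^bold>\<longleftrightarrow> \<Psi> x)"
  "(\<And>z. congr (\<lambda>x. X x z)) \<Longrightarrow> congr (\<lambda>x. Exists (X x))"
  unfolding Disj_def Imp_def Iff_def Exists_def by (intro cong_intros | assumption)+

lemma congr_set [cong_intros]:
  "cterm a \<Longrightarrow> congr (\<lambda>x. is_empty (a x))"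
  "cterm a \<Longrightarrow> cterm b \<Longrightarrow> congr (\<lambda>x. is_subset (a x) (b x))"
  "cterm a \<Longrightarrow> cterm b \<Longrightarrow> cterm c \<Longrightarrow> congr (\<lambda>x. is_upair (a x) (b x) (c x))"
  "cterm a \<Longrightarrow> cterm b \<Longrightarrow> cterm c \<Longrightarrow> congr (\<lambda>x. is_pair (a x) (b x) (c x))"
  "cterm a \<Longrightarrow> cterm b \<Longrightarrow> cterm c \<Longrightarrow> congr (\<lambda>x. maps (a x) (b x) (c x))"
  "cterm a \<Longrightarrow> cterm b \<Longrightarrow> congr (\<lambda>x. is_succ (a x) (b x))"
  "cterm a \<Longrightarrow> congr (\<lambda>x. is_transitive (a x))"
  "cterm a \<Longrightarrow> congr (\<lambda>x. is_ord (a x))"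
  "cterm a \<Longrightarrow> cterm b \<Longrightarrow> congr (\<lambda>x. ord_le (a x) (b x))"
  "cterm a \<Longrightarrow> congr (\<lambda>x. is_limit (a x))"
  "cterm a \<Longrightarrow> congr (\<lambda>x. is_omega (a x))"
  "cterm a \<Longrightarrow> cterm b \<Longrightarrow> cterm c \<Longrightarrow> congr (\<lambda>x. is_fun (a x) (b x) (c x))"
  "cterm a \<Longrightarrow> cterm b \<Longrightarrow> congr (\<lambda>x. is_fun_on (a x) (b x))"
  "cterm a \<Longrightarrow> cterm b \<Longrightarrow> congr (\<lambda>x. equipotent (a x) (b x))"
  unfolding is_empty_def is_subset_def is_upair_def is_pair_def maps_def is_succ_def is_ord_def
    is_transitive_def ord_le_def is_limit_def is_fun_def is_fun_on_def is_omega_def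
    equipotent_def is_bij_def is_surj_def
  by (intro cong_intros | assumption)+

lemma congr_app [cong_intros]:
  assumes "cterm a" "cterm b" "\<And>y. congr (\<lambda>x. \<Phi> x y)"
  shows "congr (\<lambda>x. app (a x) (b x) (\<Phi> x))"
  unfolding app_def by (intro cong_intros assms)

lemma congr_app2 [cong_intros]:
  assumes "cterm a" "cterm b" "cterm c" "\<And>y. congr (\<lambda>x. \<Phi> x y)"
  shows "congr (\<lambda>x. app2 (a x) (b x) (c x) (\<Phi> x))"
  unfolding app2_def by (intro cong_intros assms)

end

context forcing
begin

declare forces.simps(1,2) [simp del]

subsection \<open>Canonical names\<close>

text \<open>A non-condition has no extensions, so the density criterion holds vacuously. Several
  rules are proved for conditions and extended to all \<open>p\<close> in this way.\<close>

lemma not_cond_forces: "\<not> cond p \<Longrightarrow> p \<tturnstile> \<phi>"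
  using forces_dense le_cond(2) by blast

lemma check_unfold: "ck x = vset E ((\<lambda>y. vpair E (ck y) (maxc P)) ` ext E x)"
proof -
  have wf: "wf {(y, x). E y x}" using foundation by (simp add: wfp_def)
  have "ck x = vset E {vpair E (cut (check E P) {(y, x). E y x} x y) (maxc P) | y. E y x}"
    unfolding check_def by (subst wfrec[OF wf]) (rule refl)
  also have "{vpair E (cut (check E P) {(y, x). E y x} x y) (maxc P) | y. E y x} =
      (\<lambda>y. vpair E (ck y) (maxc P)) ` ext E x"
    by (auto simp: cut_def image_iff)
  finally show ?thesis .
qed

lemma mem_check: "E z (ck x) \<longleftrightarrow> (\<exists>y. E y x \<and> z = vpair E (ck y) (maxc P))"
  by (subst check_unfold, subst mem_vset) auto

lemma vpair_mem_check [simp]: "E (vpair E u s) (ck x) \<longleftrightarrow> s = maxc P \<and> (\<exists>y. E y x \<and> u = ck y)"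
  by (auto simp: mem_check)

lemma name_check [simp]: "name (ck x)"
proof (induction x rule: E_induct)
  case (1 x)
  then show ?case by (intro is_name.intros) (auto simp: mem_check)
qed

lemma name_elem: "name x \<Longrightarrow> E (vpair E u s) x \<Longrightarrow> name u \<and> cond s"
  by (erule is_name.cases) auto

lemma check_memI: "E x X \<Longrightarrow> p \<tturnstile> (ck x \<^bold>\<in> ck X)"
  unfolding forces.simps forces_mem_def
proof (intro allI impI)
  fix q assume "E x X" "q \<preceq> p"
  then show "\<exists>r w t. r \<preceq> q \<and> E (vpair E w t) (ck X) \<and> r \<preceq> t \<and> forces_eq E P r (ck x) w"
    by (intro exI[of _ q] exI[of _ "ck x"] exI[of _ "maxc P"]) (auto simp: le_cond)
qed

lemma check_mem_dense:
  assumes "p \<tturnstile> (t \<^bold>\<in> ck X)" "q \<preceq> p"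
  shows "\<exists>r x. r \<preceq> q \<and> E x X \<and> r \<tturnstile> (t \<^bold>= ck x)"
  using assms unfolding forces.simps forces_mem_def vpair_mem_check by blast

lemma check_memE:
  assumes "p \<tturnstile> (t \<^bold>\<in> ck X)" "\<And>q x. q \<preceq> p \<Longrightarrow> E x X \<Longrightarrow> q \<tturnstile> (t \<^bold>= ck x) \<Longrightarrow> q \<tturnstile> \<chi>"
  shows "p \<tturnstile> \<chi>"
proof (rule forces_dense)
  fix q assume q: "q \<preceq> p"
  obtain r x where r: "r \<preceq> q" "E x X" "r \<tturnstile> (t \<^bold>= ck x)" using check_mem_dense[OF assms(1) q] by blast
  then have "r \<tturnstile> \<chi>" using assms(2) le_trans[OF r(1) q] by blast
  then show "\<exists>r. r \<preceq> q \<and> r \<tturnstile> \<chi>" using r by blast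
qed

text \<open>Membership induction: an element of one side is forced into the other, hence some
  extension identifies it with the check name of an element there, and the induction hypothesis
  turns this into an actual equality.\<close>

lemma check_eqD:
  assumes "p \<tturnstile> (ck x \<^bold>= ck y)" "cond p"
  shows "x = y"
  using assms
proof (induction x arbitrary: y p rule: E_induct)
  case (1 x)
  have "E z y" if "E z x" for z
  proof -
    have "p \<tturnstile> (ck z \<^bold>\<in> ck y)" using check_memI[OF that] mem_eq_right 1(2) by blast
    then obtain r w where r: "r \<preceq> p" "E w y" "r \<tturnstile> (ck z \<^bold>= ck w)"
      using check_mem_dense le_refl[OF 1(3)] by blast
    then show ?thesis using 1(1)[OF that r(3)] le_cond by blast
  qed
  moreover have "E z x" if "E z y" for z
  proof -
    have "p \<tturnstile> (ck z \<^bold>\<in> ck x)" using check_memI[OF that] mem_eq_right eq_sym[OF 1(2)] by blast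
    then obtain r w where r: "r \<preceq> p" "E w x" "r \<tturnstile> (ck z \<^bold>= ck w)"
      using check_mem_dense le_refl[OF 1(3)] by blast
    then show ?thesis using 1(1)[OF r(2) eq_sym[OF r(3)]] le_cond by blast
  qed
  ultimately show ?case using extensionality by blast
qed

lemma check_eq [simp]: "cond p \<Longrightarrow> p \<tturnstile> (ck x \<^bold>= ck y) \<longleftrightarrow> x = y"
  using check_eqD eq_refl by blast

lemma check_mem [simp]:
  assumes "cond p"
  shows "p \<tturnstile> (ck x \<^bold>\<in> ck y) \<longleftrightarrow> E x y"
proof
  assume "p \<tturnstile> (ck x \<^bold>\<in> ck y)"
  then obtain r w where r: "r \<preceq> p" "E w y" "r \<tturnstile> (ck x \<^bold>= ck w)"
    using check_mem_dense le_refl[OF assms] by blast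
  then show "E x y" using le_cond(1) by auto
qed (rule check_memI)

text \<open>An entry of \<open>x\<close> is itself a name and is forced into \<open>x\<close> below
  its attached condition. Testing on names therefore produces the witnesses that the recursive
  clause for equality demands.\<close>

lemma f_extI:
  assumes "name x" "name y"
    and "\<And>q z. q \<preceq> p \<Longrightarrow> name z \<Longrightarrow> q \<tturnstile> (z \<^bold>\<in> x) \<Longrightarrow> q \<tturnstile> (z \<^bold>\<in> y)"
    and "\<And>q z. q \<preceq> p \<Longrightarrow> name z \<Longrightarrow> q \<tturnstile> (z \<^bold>\<in> y) \<Longrightarrow> q \<tturnstile> (z \<^bold>\<in> x)"
  shows "p \<tturnstile> (x \<^bold>= y)"
proof -
  have mem: "q \<tturnstile> (u \<^bold>\<in> x)" if "E (vpair E u s) x" "q \<preceq> s" for q u s x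
    using that le_trans le_refl le_cond(1) forces_eq_refl
    unfolding forces.simps forces_mem_def by blast
  have memD: "\<exists>r w t. r \<preceq> q \<and> E (vpair E w t) x \<and> r \<preceq> t \<and> forces_eq E P r u w"
    if "q \<tturnstile> (u \<^bold>\<in> x)" "q \<preceq> p" for q u x
    using that le_refl[OF le_cond(1)] unfolding forces.simps forces_mem_def by blast
  show ?thesis unfolding forces.simps
  proof (rule forces_eqI)
    fix u s q assume a: "E (vpair E u s) x" "q \<preceq> p" "q \<preceq> s"
    then have "q \<tturnstile> (u \<^bold>\<in> y)" using assms mem name_elem by blast
    then show "\<exists>r w t. r \<preceq> q \<and> E (vpair E w t) y \<and> r \<preceq> t \<and> forces_eq E P r u w"
      using memD a by blast
  next
    fix u s q assume a: "E (vpair E u s) y" "q \<preceq> p" "q \<preceq> s"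
    then have "q \<tturnstile> (u \<^bold>\<in> x)" using assms mem name_elem by blast
    then show "\<exists>r w t. r \<preceq> q \<and> E (vpair E w t) x \<and> r \<preceq> t \<and> forces_eq E P r w u"
      using memD a forces_eq_sym by blast
  qed
qed

lemma f_allD: "p \<tturnstile> Forall \<Phi> \<Longrightarrow> name x \<Longrightarrow> p \<tturnstile> \<Phi> x"
  by simp

lemma f_all_impD: "p \<tturnstile> (\<^bold>\<forall>x. \<Phi> x \<^bold>\<longrightarrow> \<Psi> x) \<Longrightarrow> name x \<Longrightarrow> q \<preceq> p \<Longrightarrow> q \<tturnstile> \<Phi> x \<Longrightarrow> q \<tturnstile> \<Psi> x"
  by (simp add: forces_imp)

lemma f_all_iffD: "p \<tturnstile> (\<^bold>\<forall>x. \<Phi> x \<^bold>\<longleftrightarrow> \<Psi> x) \<Longrightarrow> name x \<Longrightarrow> q \<preceq> p \<Longrightarrow> q \<tturnstile> \<Phi> x \<longleftrightarrow> q \<tturnstile> \<Psi> x"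
  by (simp add: forces_iff)

lemma ext_subset: "ext E x \<subseteq> ext E y \<longleftrightarrow> (\<forall>z. E z x \<longrightarrow> E z y)"
  by (auto simp: subset_iff)

lemma f_conj [simp]: "p \<tturnstile> (\<phi> \<^bold>\<and> \<psi>) \<longleftrightarrow> p \<tturnstile> \<phi> \<and> p \<tturnstile> \<psi>"
  by simp

lemma f_impD: "p \<tturnstile> (\<phi> \<^bold>\<longrightarrow> \<psi>) \<Longrightarrow> q \<preceq> p \<Longrightarrow> q \<tturnstile> \<phi> \<Longrightarrow> q \<tturnstile> \<psi>"
  by (simp add: forces_imp)

lemma f_iffD: "p \<tturnstile> (\<phi> \<^bold>\<longleftrightarrow> \<psi>) \<Longrightarrow> q \<preceq> p \<Longrightarrow> q \<tturnstile> \<phi> \<longleftrightarrow> q \<tturnstile> \<psi>"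
  by (simp add: forces_iff)

lemma f_iff_ext:
  assumes "name x" "name y" "p \<tturnstile> (\<^bold>\<forall>z. z \<^bold>\<in> x \<^bold>\<longleftrightarrow> \<Phi> z)" "p \<tturnstile> (\<^bold>\<forall>z. z \<^bold>\<in> y \<^bold>\<longleftrightarrow> \<Phi> z)"
  shows "p \<tturnstile> (x \<^bold>= y)"
  using f_iffD[OF f_allD[OF assms(3)]] f_iffD[OF f_allD[OF assms(4)]] assms(1,2)
  by (intro f_extI) blast+

lemma upair_unique:
  "name s \<Longrightarrow> name t \<Longrightarrow> p \<tturnstile> is_upair s x y \<Longrightarrow> p \<tturnstile> is_upair t x y \<Longrightarrow> p \<tturnstile> (s \<^bold>= t)"
  unfolding is_upair_def by (rule f_iff_ext)

lemma pair_unique: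
  assumes "name s" "name t" "p \<tturnstile> is_pair s x y" "p \<tturnstile> is_pair t x y"
  shows "p \<tturnstile> (s \<^bold>= t)"
proof -
  note d = assms(3,4)[unfolded is_pair_def]
  show ?thesis
  proof (rule f_exE[OF d(1)], erule f_exE)
    fix q q' u v assume q: "q \<preceq> p" "q' \<preceq> q" "name u" "name v"
      and 1: "q' \<tturnstile> (is_upair u x x \<^bold>\<and> is_upair v x y \<^bold>\<and> is_upair s u v)"
    have d2: "q' \<tturnstile> (\<^bold>\<exists>u. \<^bold>\<exists>v. is_upair u x x \<^bold>\<and> is_upair v x y \<^bold>\<and> is_upair t u v)"
      using forces_mono[OF d(2) le_trans[OF q(2,1)]] .
    show "q' \<tturnstile> (s \<^bold>= t)"
    proof (rule f_exE[OF d2], erule f_exE)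
      fix r r' u' v' assume r: "r \<preceq> q'" "r' \<preceq> r" "name u'" "name v'"
        and 2: "r' \<tturnstile> (is_upair u' x x \<^bold>\<and> is_upair v' x y \<^bold>\<and> is_upair t u' v')"
      have 3: "r' \<tturnstile> (is_upair u x x \<^bold>\<and> is_upair v x y \<^bold>\<and> is_upair s u v)"
        using forces_mono[OF 1 le_trans[OF r(2,1)]] .
      have u: "r' \<tturnstile> (u' \<^bold>= u)" and v: "r' \<tturnstile> (v' \<^bold>= v)"
        using 2 3 upair_unique[OF r(3) q(3)] upair_unique[OF r(4) q(4)] by auto
      have "congr (\<lambda>z. is_upair t z v')" "congr (\<lambda>z. is_upair t u z)"
        by (intro cong_intros)+
      then have "r' \<tturnstile> is_upair t u v" using u v 2 congrD by (metis f_conj)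
      then show "r' \<tturnstile> (s \<^bold>= t)" using upair_unique assms(1,2) 3 by auto
    qed
  qed
qed

lemma upair_check0: "p \<tturnstile> is_upair (ck (vset E {x, y})) (ck x) (ck y)"
  unfolding is_upair_def
proof (intro f_allI f_iffI iffI)
  fix z q assume "q \<tturnstile> (z \<^bold>\<in> ck (vset E {x, y}))"
  then show "q \<tturnstile> (z \<^bold>= ck x \<^bold>\<or> z \<^bold>= ck y)"
    by (rule check_memE) (auto simp: small_pair intro: f_disjI1 f_disjI2)
next
  fix z q assume "q \<tturnstile> (z \<^bold>= ck x \<^bold>\<or> z \<^bold>= ck y)"
  then show "q \<tturnstile> (z \<^bold>\<in> ck (vset E {x, y}))"
    by (rule f_disjE) (rule mem_eq_left[OF check_memI eq_sym]; simp add: small_pair)+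
qed

lemma pair_check0: "p \<tturnstile> is_pair (ck (vpair E x y)) (ck x) (ck y)"
  unfolding is_pair_def
  by (rule f_exI[where x = "ck (vset E {x})"], rule f_exI[where x = "ck (vset E {x, y})"])
    (use upair_check0[where p = p and x = x and y = x] upair_check0[where p = p and x = x and y = y]
      upair_check0[where p = p and x = "vset E {x}" and y = "vset E {x, y}"] in
      \<open>simp_all add: vpair_def\<close>)

lemma pair_check:
  assumes "name t"
  shows "p \<tturnstile> is_pair t (ck x) (ck y) \<longleftrightarrow> p \<tturnstile> (t \<^bold>= ck (vpair E x y))"
proof
  assume "p \<tturnstile> is_pair t (ck x) (ck y)"
  then show "p \<tturnstile> (t \<^bold>= ck (vpair E x y))" using pair_unique[OF assms name_check] pair_check0 by blast
next
  have c: "congr (\<lambda>t. is_pair t (ck x) (ck y))" by (intro cong_intros)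
  assume "p \<tturnstile> (t \<^bold>= ck (vpair E x y))"
  then show "p \<tturnstile> is_pair t (ck x) (ck y)" using congrD'[OF c] pair_check0 by blast
qed

lemma upair_memI:
  assumes "p \<tturnstile> is_upair u x y"
  shows "name x \<Longrightarrow> p \<tturnstile> (x \<^bold>\<in> u)" "name y \<Longrightarrow> p \<tturnstile> (y \<^bold>\<in> u)"
  using f_all_iffD[OF assms[unfolded is_upair_def] _ le_refl] not_cond_forces
    f_disjI1[OF eq_refl] f_disjI2[OF eq_refl] by blast+

text \<open>Both coordinates lie in one member of \<open>z\<close>. As \<open>z\<close> is a ground
  set, extensions decide first this member and then the coordinates as ground elements, and
  uniqueness of pairs identifies \<open>c\<close>.\<close>

lemma pair_checkE:
  assumes "p \<tturnstile> is_pair z t u" "p \<tturnstile> (z \<^bold>= ck c)" "name t" "name u" "name z"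
    and "\<And>q a b. q \<preceq> p \<Longrightarrow> c = vpair E a b \<Longrightarrow> q \<tturnstile> (t \<^bold>= ck a) \<Longrightarrow> q \<tturnstile> (u \<^bold>= ck b) \<Longrightarrow> q \<tturnstile> \<chi>"
  shows "p \<tturnstile> \<chi>"
proof (rule f_exE[OF assms(1)[unfolded is_pair_def]], erule f_exE, unfold f_conj, elim conjE)
  fix q q' x y
  assume q: "q \<preceq> p" "q' \<preceq> q" "name x" "name y"
    and 1: "q' \<tturnstile> is_upair x t t" "q' \<tturnstile> is_upair y t u" "q' \<tturnstile> is_upair z x y"
  have zc: "q' \<tturnstile> (z \<^bold>= ck c)" using forces_mono[OF assms(2) le_trans[OF q(2,1)]] .
  have y: "q' \<tturnstile> (y \<^bold>\<in> ck c)" using mem_eq_right[OF upair_memI(2)[OF 1(3) q(4)] zc] .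
  have t: "q' \<tturnstile> (t \<^bold>\<in> y)" "q' \<tturnstile> (u \<^bold>\<in> y)" using upair_memI 1 assms(3,4) by blast+
  show "q' \<tturnstile> \<chi>"
  proof (rule check_memE[OF y])
    fix r d assume r: "r \<preceq> q'" "E d c" "r \<tturnstile> (y \<^bold>= ck d)"
    have t': "r \<tturnstile> (t \<^bold>\<in> ck d)" "r \<tturnstile> (u \<^bold>\<in> ck d)"
      using mem_eq_right[OF forces_mono[OF _ r(1)] r(3)] t by blast+
    show "r \<tturnstile> \<chi>"
    proof (rule check_memE[OF t'(1)])
      fix r1 a assume r1: "r1 \<preceq> r" "E a d" "r1 \<tturnstile> (t \<^bold>= ck a)"
      show "r1 \<tturnstile> \<chi>"
      proof (rule check_memE[OF forces_mono[OF t'(2) r1(1)]])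
        fix r2 b assume r2: "r2 \<preceq> r1" "E b d" "r2 \<tturnstile> (u \<^bold>= ck b)"
        have le: "r2 \<preceq> p" using r2(1) r1(1) r(1) q(1,2) le_trans by blast
        have ta: "r2 \<tturnstile> (t \<^bold>= ck a)" using forces_mono[OF r1(3) r2(1)] .
        have c: "congr (\<lambda>w. is_pair z w u)" "congr (\<lambda>w. is_pair z (ck a) w)" by (intro cong_intros)+
        have "r2 \<tturnstile> is_pair z (ck a) (ck b)"
          using congrD[OF c(2) r2(3) congrD[OF c(1) ta forces_mono[OF assms(1) le]]] .
        then have "r2 \<tturnstile> (z \<^bold>= ck (vpair E a b))" using pair_check assms(5) by blast
        then have "r2 \<tturnstile> (ck c \<^bold>= ck (vpair E a b))"
          using forces_mono[OF assms(2) le] eq_sym eq_trans by blast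
        then have "c = vpair E a b" using le_cond[OF le] by simp
        then show "r2 \<tturnstile> \<chi>" using assms(6) le ta r2(3) by blast
      qed
    qed
  qed
qed

lemma maps_check:
  "p \<tturnstile> maps f (ck x) (ck y) \<longleftrightarrow> p \<tturnstile> (ck (vpair E x y) \<^bold>\<in> f)"
proof
  assume "p \<tturnstile> maps f (ck x) (ck y)"
  then show "p \<tturnstile> (ck (vpair E x y) \<^bold>\<in> f)"
    unfolding maps_def
    by (rule f_exE) (auto simp: pair_check intro: mem_eq_left)
next
  assume "p \<tturnstile> (ck (vpair E x y) \<^bold>\<in> f)"
  then show "p \<tturnstile> maps f (ck x) (ck y)"
    unfolding maps_def by (intro f_exI[where x = "ck (vpair E x y)"]) (simp_all add: pair_check0)
qed

lemma maps_checkE: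
  assumes "p \<tturnstile> maps f t u" "name t" "name u"
    and Z: "\<And>q z. q \<preceq> p \<Longrightarrow> name z \<Longrightarrow> q \<tturnstile> (z \<^bold>\<in> f) \<Longrightarrow> q \<tturnstile> (z \<^bold>\<in> ck Z)"
    and "\<And>q a b. q \<preceq> p \<Longrightarrow> E (vpair E a b) Z \<Longrightarrow> q \<tturnstile> (t \<^bold>= ck a) \<Longrightarrow> q \<tturnstile> (u \<^bold>= ck b) \<Longrightarrow> q \<tturnstile> \<chi>"
  shows "p \<tturnstile> \<chi>"
proof (rule f_exE[OF assms(1)[unfolded maps_def]])
  fix q z assume q: "q \<preceq> p" "name z" and z: "q \<tturnstile> (is_pair z t u \<^bold>\<and> z \<^bold>\<in> f)"
  have zz: "q \<tturnstile> (z \<^bold>\<in> ck Z)" using Z q z by simp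
  show "q \<tturnstile> \<chi>"
  proof (rule check_memE[OF zz])
    fix r c assume r: "r \<preceq> q" "E c Z" "r \<tturnstile> (z \<^bold>= ck c)"
    have "r \<tturnstile> is_pair z t u" using z forces_mono r(1) by (metis f_conj)
    then show "r \<tturnstile> \<chi>"
    proof (rule pair_checkE[OF _ r(3) assms(2,3) q(2)])
      fix s a b assume s: "s \<preceq> r" "c = vpair E a b" "s \<tturnstile> (t \<^bold>= ck a)" "s \<tturnstile> (u \<^bold>= ck b)"
      then show "s \<tturnstile> \<chi>" using assms(5) r(2) le_trans[OF s(1) le_trans[OF r(1) q(1)]] by blast
    qed
  qed
qed

text \<open>Densely often an element of a check name is decided to be a ground element, and
  \<open>congr\<close> carries \<open>\<Phi>\<close> back along the forced equality. Quantifiers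
  bounded by ground sets thus become HOL quantifiers, on which most absoluteness results
  rest.\<close>

lemma f_ballI:
  assumes "congr \<Phi>" "\<And>x. E x X \<Longrightarrow> p \<tturnstile> \<Phi> (ck x)"
  shows "p \<tturnstile> (\<^bold>\<forall>x. x \<^bold>\<in> ck X \<^bold>\<longrightarrow> \<Phi> x)"
proof (intro f_allI f_impI)
  fix x q assume q: "q \<preceq> p" "q \<tturnstile> (x \<^bold>\<in> ck X)"
  show "q \<tturnstile> \<Phi> x"
    by (rule check_memE[OF q(2)])
      (use congrD'[OF assms(1)] assms(2) forces_mono[OF _ le_trans[OF _ q(1)]] in blast)
qed

lemma f_ballD:
  assumes "p \<tturnstile> (\<^bold>\<forall>x. x \<^bold>\<in> ck X \<^bold>\<longrightarrow> \<Phi> x)" "E x X"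
  shows "p \<tturnstile> \<Phi> (ck x)"
proof (cases "cond p")
  case True
  then show ?thesis using f_all_impD[OF assms(1) name_check le_refl check_memI] assms(2) by blast
qed (rule not_cond_forces)

lemma f_ball: "congr \<Phi> \<Longrightarrow> p \<tturnstile> (\<^bold>\<forall>x. x \<^bold>\<in> ck X \<^bold>\<longrightarrow> \<Phi> x) \<longleftrightarrow> (\<forall>x. E x X \<longrightarrow> p \<tturnstile> \<Phi> (ck x))"
  using f_ballI f_ballD by metis

lemma f_ball2I:
  assumes "\<And>y. congr (\<lambda>x. \<Phi> x y)" "\<And>x. congr (\<Phi> x)"
    "\<And>x y. E x X \<Longrightarrow> E y Y \<Longrightarrow> p \<tturnstile> \<Phi> (ck x) (ck y)"
  shows "p \<tturnstile> (\<^bold>\<forall>x y. x \<^bold>\<in> ck X \<^bold>\<and> y \<^bold>\<in> ck Y \<^bold>\<longrightarrow> \<Phi> x y)"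
proof (intro f_allI f_impI, unfold f_conj, elim conjE)
  fix x y q assume q: "q \<preceq> p" "q \<tturnstile> (x \<^bold>\<in> ck X)" "q \<tturnstile> (y \<^bold>\<in> ck Y)"
  show "q \<tturnstile> \<Phi> x y"
  proof (rule check_memE[OF q(2)])
    fix r a assume r: "r \<preceq> q" "E a X" "r \<tturnstile> (x \<^bold>= ck a)"
    have "r \<tturnstile> \<Phi> (ck a) y"
      by (rule check_memE[OF forces_mono[OF q(3) r(1)]])
        (metis assms(2,3) congrD' forces_mono le_trans r(1,2) q(1))
    then show "r \<tturnstile> \<Phi> x y" using congrD'[OF assms(1) r(3)] by blast
  qed
qed

lemma f_ball3I:
  assumes "\<And>y z. congr (\<lambda>x. \<Phi> x y z)" "\<And>x z. congr (\<lambda>y. \<Phi> x y z)" "\<And>x y. congr (\<Phi> x y)"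
    "\<And>x y z. E x X \<Longrightarrow> E y Y \<Longrightarrow> E z Z \<Longrightarrow> p \<tturnstile> \<Phi> (ck x) (ck y) (ck z)"
  shows "p \<tturnstile> (\<^bold>\<forall>x y z. x \<^bold>\<in> ck X \<^bold>\<and> y \<^bold>\<in> ck Y \<^bold>\<and> z \<^bold>\<in> ck Z \<^bold>\<longrightarrow> \<Phi> x y z)"
proof (intro f_allI f_impI, unfold f_conj, elim conjE)
  fix x y z q assume q: "q \<preceq> p" "q \<tturnstile> (x \<^bold>\<in> ck X)" "q \<tturnstile> (y \<^bold>\<in> ck Y)" "q \<tturnstile> (z \<^bold>\<in> ck Z)" "name y" "name z"
  show "q \<tturnstile> \<Phi> x y z"
  proof (rule check_memE[OF q(2)])
    fix r a assume r: "r \<preceq> q" "E a X" "r \<tturnstile> (x \<^bold>= ck a)"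
    have "r \<tturnstile> (\<^bold>\<forall>y z. y \<^bold>\<in> ck Y \<^bold>\<and> z \<^bold>\<in> ck Z \<^bold>\<longrightarrow> \<Phi> (ck a) y z)"
      using assms(2-4) r(2) forces_mono[OF _ le_trans[OF r(1) q(1)]] by (intro f_ball2I) blast+
    then have "r \<tturnstile> (y \<^bold>\<in> ck Y \<^bold>\<and> z \<^bold>\<in> ck Z \<^bold>\<longrightarrow> \<Phi> (ck a) y z)" using f_allD q(5,6) by blast
    then have "r \<tturnstile> \<Phi> (ck a) y z"
      using f_impD le_refl[OF le_cond(1)[OF r(1)]] forces_mono[OF _ r(1)] q(3,4) by (metis f_conj)
    then show "r \<tturnstile> \<Phi> x y z" using congrD'[OF assms(1) r(3)] by blast
  qed
qed

lemma subset_check [simp]: "cond p \<Longrightarrow> p \<tturnstile> is_subset (ck x) (ck y) \<longleftrightarrow> ext E x \<subseteq> ext E y"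
  unfolding is_subset_def by (subst f_ball) (auto intro: cong_intros)

lemma transitive_check: "cond p \<Longrightarrow> p \<tturnstile> is_transitive (ck x) \<longleftrightarrow> (\<forall>y. E y x \<longrightarrow> (\<forall>z. E z y \<longrightarrow> E z x))"
  unfolding is_transitive_def by (subst f_ball) (auto intro!: cong_intros simp: ext_subset)

lemma ord_check [simp]: "cond p \<Longrightarrow> p \<tturnstile> is_ord (ck x) \<longleftrightarrow> Ord E x"
  unfolding is_ord_def Ord_def f_conj
  by (subst f_ball) (auto intro!: cong_intros simp: transitive_check)

lemma empty_check [simp]:
  assumes "cond p"
  shows "p \<tturnstile> is_empty (ck x) \<longleftrightarrow> x = vset E {}"
proof
  assume "p \<tturnstile> is_empty (ck x)"
  then have "\<not> E y x" for y
    using assms check_memI f_allD[OF _ name_check] f_negE unfolding is_empty_def by blast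
  then show "x = vset E {}" by (intro extensionality) simp
next
  assume "x = vset E {}"
  then show "p \<tturnstile> is_empty (ck x)" unfolding is_empty_def
    using check_mem_dense[OF _ le_refl] le_cond(1) by (intro f_allI f_negI) (metis empty_iff mem_vset small_empty)
qed

lemma succ_check0: "p \<tturnstile> is_succ (ck (vsucc E x)) (ck x)"
  unfolding is_succ_def
proof (intro f_allI f_iffI iffI)
  fix z q assume "q \<tturnstile> (z \<^bold>\<in> ck (vsucc E x))"
  then show "q \<tturnstile> (z \<^bold>\<in> ck x \<^bold>\<or> z \<^bold>= ck x)"
    by (rule check_memE) (auto intro: f_disjI1 f_disjI2 mem_eq_left[OF check_memI eq_sym])
next
  fix z q assume "q \<tturnstile> (z \<^bold>\<in> ck x \<^bold>\<or> z \<^bold>= ck x)"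
  then show "q \<tturnstile> (z \<^bold>\<in> ck (vsucc E x))"
  proof (rule f_disjE)
    fix r assume "r \<tturnstile> (z \<^bold>\<in> ck x)"
    then show "r \<tturnstile> (z \<^bold>\<in> ck (vsucc E x))"
      by (rule check_memE) (auto intro: mem_eq_left[OF check_memI eq_sym])
  qed (auto intro: mem_eq_left[OF check_memI eq_sym])
qed

lemma succ_unique: "name s \<Longrightarrow> name t \<Longrightarrow> p \<tturnstile> is_succ s x \<Longrightarrow> p \<tturnstile> is_succ t x \<Longrightarrow> p \<tturnstile> (s \<^bold>= t)"
  unfolding is_succ_def by (rule f_iff_ext)

lemma succ_check:
  assumes "name t"
  shows "p \<tturnstile> is_succ t (ck x) \<longleftrightarrow> p \<tturnstile> (t \<^bold>= ck (vsucc E x))"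
proof
  assume "p \<tturnstile> is_succ t (ck x)"
  then show "p \<tturnstile> (t \<^bold>= ck (vsucc E x))" using succ_unique[OF assms name_check] succ_check0 by blast
next
  have c: "congr (\<lambda>t. is_succ t (ck x))" by (intro cong_intros)
  assume "p \<tturnstile> (t \<^bold>= ck (vsucc E x))"
  then show "p \<tturnstile> is_succ t (ck x)" using congrD'[OF c] succ_check0 by blast
qed

lemma succ_checkE:
  assumes "p \<tturnstile> is_succ (ck y) t" "name t"
    "\<And>q x. q \<preceq> p \<Longrightarrow> y = vsucc E x \<Longrightarrow> q \<tturnstile> (t \<^bold>= ck x) \<Longrightarrow> q \<tturnstile> \<chi>"
  shows "p \<tturnstile> \<chi>"
proof -
  have "p \<tturnstile> (t \<^bold>\<in> ck y)"
    using f_all_iffD[OF assms(1)[unfolded is_succ_def] assms(2) le_refl] f_disjI2[OF eq_refl] not_cond_forces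
    by blast
  then show ?thesis
  proof (rule check_memE)
    fix q x assume q: "q \<preceq> p" "q \<tturnstile> (t \<^bold>= ck x)"
    have c: "congr (\<lambda>t. is_succ (ck y) t)" by (intro cong_intros)
    have "q \<tturnstile> is_succ (ck y) (ck x)" using congrD[OF c q(2)] forces_mono[OF assms(1) q(1)] .
    then have "y = vsucc E x" using succ_check[OF name_check] le_cond(1)[OF q(1)] by simp
    then show "q \<tturnstile> \<chi>" using assms(3) q by blast
  qed
qed

lemma limit_check [simp]:
  assumes "cond p"
  shows "p \<tturnstile> is_limit (ck x) \<longleftrightarrow> sat E (is_limit x)"
proof -
  have "p \<tturnstile> (\<^bold>\<not> (\<^bold>\<exists>y. is_succ (ck x) y)) \<longleftrightarrow> (\<forall>y. x \<noteq> vsucc E y)"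
  proof
    assume "p \<tturnstile> (\<^bold>\<not> (\<^bold>\<exists>y. is_succ (ck x) y))"
    then show "\<forall>y. x \<noteq> vsucc E y"
      using f_negE[OF _ _ assms] f_exI[where \<Phi> = "\<lambda>y. is_succ (ck x) y", OF _ name_check] succ_check0 by metis
  next
    assume a: "\<forall>y. x \<noteq> vsucc E y"
    have "q \<tturnstile> Exists (\<lambda>y. is_succ (ck x) y) \<Longrightarrow> q \<preceq> p \<Longrightarrow> q \<tturnstile> (ck x \<^bold>\<in> ck x)" for q
      by (erule f_exE, erule succ_checkE) (use a in auto)
    then show "p \<tturnstile> (\<^bold>\<not> (\<^bold>\<exists>y. is_succ (ck x) y))" using le_cond(1) by (intro f_negI) fastforce
  qed
  moreover have "p \<tturnstile> (\<^bold>\<not> is_empty (ck x)) \<longleftrightarrow> x \<noteq> vset E {}"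
    using le_refl[OF assms] le_cond(1) by auto
  ultimately show ?thesis using assms unfolding is_limit_def f_conj sat_is_limit[unfolded is_limit_def] by simp
qed

lemma omega_check [simp]:
  assumes "cond p"
  shows "p \<tturnstile> is_omega (ck x) \<longleftrightarrow> sat E (is_omega x)"
proof -
  have "p \<tturnstile> (\<^bold>\<not> is_limit (ck y)) \<longleftrightarrow> \<not> sat E (is_limit y)" for y
    using le_refl[OF assms] limit_check[OF le_cond(1)] by auto
  then show ?thesis unfolding is_omega_def f_conj
    using assms by (subst f_ball) (auto intro!: cong_intros)
qed

lemma is_fun_checkE:
  assumes f: "p \<tturnstile> is_fun f (ck X) (ck Y)" and "p \<tturnstile> maps f t u" "name t" "name u"
    and "\<And>q a b. q \<preceq> p \<Longrightarrow> E a X \<Longrightarrow> E b Y \<Longrightarrow> q \<tturnstile> (t \<^bold>= ck a) \<Longrightarrow> q \<tturnstile> (u \<^bold>= ck b) \<Longrightarrow> q \<tturnstile> \<chi>"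
  shows "p \<tturnstile> \<chi>"
proof -
  define Z where "Z = vset E {vpair E a b | a b. a \<in> ext E X \<and> b \<in> ext E Y}"
  have Z: "E z Z \<longleftrightarrow> (\<exists>a b. E a X \<and> E b Y \<and> z = vpair E a b)" for z
    unfolding Z_def using small_pairs[of "ext E X" "\<lambda>_. ext E Y"] by auto
  show ?thesis
  proof (rule maps_checkE[OF assms(2-4)])
    fix q z assume q: "q \<preceq> p" "name z" "q \<tturnstile> (z \<^bold>\<in> f)"
    have "q \<tturnstile> (\<^bold>\<exists>x. \<^bold>\<exists>y. x \<^bold>\<in> ck X \<^bold>\<and> y \<^bold>\<in> ck Y \<^bold>\<and> is_pair z x y)"
      using f q unfolding is_fun_def f_conj by (meson f_allD f_impD)
    from this show "q \<tturnstile> (z \<^bold>\<in> ck Z)"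
    proof (rule f_exE, elim f_exE, unfold f_conj, elim conjE)
      fix r r' x y assume r: "r' \<preceq> r" "r' \<tturnstile> (x \<^bold>\<in> ck X)" "r' \<tturnstile> (y \<^bold>\<in> ck Y)" "r' \<tturnstile> is_pair z x y"
      show "r' \<tturnstile> (z \<^bold>\<in> ck Z)"
      proof (rule check_memE[OF r(2)])
        fix s a assume s: "s \<preceq> r'" "E a X" "s \<tturnstile> (x \<^bold>= ck a)"
        show "s \<tturnstile> (z \<^bold>\<in> ck Z)"
        proof (rule check_memE[OF forces_mono[OF r(3) s(1)]])
          fix v b assume v: "v \<preceq> s" "E b Y" "v \<tturnstile> (y \<^bold>= ck b)"
          have c: "congr (\<lambda>w. is_pair z w y)" "congr (\<lambda>w. is_pair z (ck a) w)" by (intro cong_intros)+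
          have "v \<tturnstile> is_pair z x y" using forces_mono[OF r(4) le_trans[OF v(1) s(1)]] .
          then have "v \<tturnstile> is_pair z (ck a) (ck b)"
            using congrD[OF c(2) v(3) congrD[OF c(1) forces_mono[OF s(3) v(1)]]] by blast
          then have "v \<tturnstile> (z \<^bold>= ck (vpair E a b))" using pair_check q(2) by blast
          then show "v \<tturnstile> (z \<^bold>\<in> ck Z)" using mem_eq_left[OF check_memI eq_sym] Z s(2) v(2) by blast
        qed
      qed
    qed
  next
    fix q a b assume "q \<preceq> p" "E (vpair E a b) Z" "q \<tturnstile> (t \<^bold>= ck a)" "q \<tturnstile> (u \<^bold>= ck b)"
    then show "q \<tturnstile> \<chi>" using assms(5) Z by auto
  qed
qed

subsection \<open>Ordinals of the extension\<close>

text \<open>Burali-Forti: if a small set contained all ordinals, they would form an ordinal that is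
  a member of itself.\<close>

lemma no_small_Ord: "small E S \<Longrightarrow> \<exists>x. Ord E x \<and> x \<notin> S"
proof (rule ccontr)
  assume S: "small E S" and n: "\<not> ?thesis"
  have sm: "small E {x. Ord E x}" using small_subset[OF S] n by blast
  have "Ord E (vset E {x. Ord E x})"
    unfolding Ord_def[of _ "vset E {x. Ord E x}"] mem_vset[OF sm] mem_Collect_eq
    using Ord_mem Ord_trans by blast
  then have "E (vset E {x. Ord E x}) (vset E {x. Ord E x})" using mem_vset[OF sm] by blast
  then show False by simp
qed

lemma is_ord_elem:
  assumes "p \<tturnstile> is_ord x" "p \<tturnstile> (y \<^bold>\<in> x)" "name y"
  shows "p \<tturnstile> is_ord y"
proof -
  have t: "p \<tturnstile> is_transitive x" "p \<tturnstile> (\<^bold>\<forall>y. y \<^bold>\<in> x \<^bold>\<longrightarrow> is_transitive y)"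
    using assms(1) unfolding is_ord_def by auto
  have "q \<tturnstile> is_transitive z" if "q \<preceq> p" "name z" "q \<tturnstile> (z \<^bold>\<in> y)" for q z
  proof -
    have "q \<tturnstile> is_subset y x" using t(1) assms(2,3) that(1) forces_mono unfolding is_transitive_def
      by (meson f_allD f_impD)
    then have "q \<tturnstile> (z \<^bold>\<in> x)" using that le_refl[OF le_cond(1)] unfolding is_subset_def
      by (meson f_allD f_impD)
    then show ?thesis using f_impD[OF f_allD[OF t(2) that(2)] that(1)] by blast
  qed
  moreover have "p \<tturnstile> is_transitive y"
    using t(2) assms(2,3) f_allD f_impD le_refl not_cond_forces by metis
  ultimately show ?thesis unfolding is_ord_def by (simp add: forces_imp)
qed

text \<open>Forcing adds no ordinals. Some ground ordinal is not forced into \<open>x\<close>, since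
  only a small set of values is available. Let \<open>c\<close> be least such that an extension
  \<open>q\<close> of \<open>p\<close> forces \<open>c\<close> out of \<open>x\<close>. By
  minimality \<open>q\<close> forces all smaller ordinals into \<open>x\<close>. By the induction
  hypothesis the elements of \<open>x\<close> are densely ground ordinals, and transitivity of
  \<open>x\<close> keeps them below \<open>c\<close>. So \<open>q\<close> forces \<open>x\<close> to
  equal \<open>c\<close>.\<close>

lemma ord_decide:
  assumes "name x" "p \<tturnstile> is_ord x" "cond p"
  shows "\<exists>q a. q \<preceq> p \<and> Ord E a \<and> q \<tturnstile> (x \<^bold>= ck a)"
  using assms
proof (induction x arbitrary: p rule: vpair_induct)
  case (1 x)
  define U where "U = (\<lambda>z. SOME u. \<exists>s. z = vpair E u s) ` ext E x"
  \<comment> \<open>A condition forces an entry to equal at most one check name, which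
    \<open>SOME\<close> picks. The values that entries of \<open>x\<close> can take are therefore
    covered by the image of a small set of pairs.\<close>
  define S where "S = (\<lambda>z. SOME a. \<exists>r u. z = vpair E r u \<and> r \<tturnstile> (u \<^bold>= ck a)) `
      {vpair E r u | r u. r \<in> ext E (conds P) \<and> u \<in> U}"
  have U: "u \<in> U" if "E (vpair E u s) x" for u s
    unfolding U_def image_iff using that by (intro bexI[of _ "vpair E u s"]) auto
  have "small E S" unfolding S_def U_def by (intro small_image small_pairs small_ext)
  then obtain c0 where c0: "Ord E c0" "c0 \<notin> S" using no_small_Ord by blast
  have "\<not> p \<tturnstile> (ck c0 \<^bold>\<in> x)"
  proof
    assume "p \<tturnstile> (ck c0 \<^bold>\<in> x)"
    then obtain r u s where r: "r \<preceq> p" "E (vpair E u s) x" "r \<tturnstile> (ck c0 \<^bold>= u)"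
      using le_refl[OF 1(4)] unfolding forces.simps forces_mem_def by blast
    have "(SOME a. \<exists>r' u'. vpair E r u = vpair E r' u' \<and> r' \<tturnstile> (u' \<^bold>= ck a)) = c0"
    proof (rule some_equality)
      show "\<exists>r' u'. vpair E r u = vpair E r' u' \<and> r' \<tturnstile> (u' \<^bold>= ck c0)" using eq_sym r(3) by blast
      fix a assume "\<exists>r' u'. vpair E r u = vpair E r' u' \<and> r' \<tturnstile> (u' \<^bold>= ck a)"
      then have "r \<tturnstile> (u \<^bold>= ck a)" by auto
      then have "r \<tturnstile> (ck c0 \<^bold>= ck a)" using r(3) eq_trans by blast
      then show "a = c0" using le_cond(1)[OF r(1)] by simp
    qed
    moreover have "r \<in> ext E (conds P)" "u \<in> U" using U r le_cond by auto
    ultimately have "c0 \<in> S" unfolding S_def image_iff by (intro bexI[of _ "vpair E r u"]) auto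
    then show False using c0 by blast
  qed
  then obtain q0 where "q0 \<preceq> p" "q0 \<tturnstile> (\<^bold>\<not> ck c0 \<^bold>\<in> x)" using forces_contr by blast
  then have "Ord E c0 \<and> (\<exists>q. q \<preceq> p \<and> q \<tturnstile> (\<^bold>\<not> ck c0 \<^bold>\<in> x))" using c0 by blast
  from E_minimal[of "\<lambda>c. Ord E c \<and> (\<exists>q. q \<preceq> p \<and> q \<tturnstile> (\<^bold>\<not> ck c \<^bold>\<in> x))", OF this]
  obtain c q where c: "Ord E c" and q: "q \<preceq> p" "q \<tturnstile> (\<^bold>\<not> ck c \<^bold>\<in> x)"
    and min: "\<And>b. E b c \<Longrightarrow> \<not> (Ord E b \<and> (\<exists>q. q \<preceq> p \<and> q \<tturnstile> (\<^bold>\<not> ck b \<^bold>\<in> x)))" by blast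
  have sub: "q \<tturnstile> (ck b \<^bold>\<in> x)" if "E b c" for b
    by (rule forces_contr) (use min[OF that] Ord_mem[OF c that] le_trans[OF _ q(1)] in blast)
  have "q \<tturnstile> (x \<^bold>= ck c)"
  proof (rule f_extI[OF 1(2) name_check])
    fix r z assume r: "r \<preceq> q" "name z" "r \<tturnstile> (z \<^bold>\<in> ck c)"
    show "r \<tturnstile> (z \<^bold>\<in> x)"
      by (rule check_memE[OF r(3)])
        (use mem_eq_left[OF _ eq_sym] sub forces_mono[OF _ le_trans[OF _ r(1)]] in blast)
  next
    fix r z assume r: "r \<preceq> q" "name z" "r \<tturnstile> (z \<^bold>\<in> x)"
    show "r \<tturnstile> (z \<^bold>\<in> ck c)"
    proof (rule forces_dense)
      fix r0 assume r0: "r0 \<preceq> r"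
      then obtain r1 u s where r1: "r1 \<preceq> r0" "E (vpair E u s) x" "r1 \<tturnstile> (z \<^bold>= u)"
        using r(3) unfolding forces.simps forces_mem_def by blast
      have le1: "r1 \<preceq> q" using r1(1) r0 r(1) le_trans by blast
      have nu: "name u" using name_elem 1(2) r1(2) by blast
      have ux: "r1 \<tturnstile> (u \<^bold>\<in> x)"
        using mem_eq_left[OF _ r1(3)] forces_mono[OF r(3) le_trans[OF r1(1) r0]] by blast
      have ox: "r1 \<tturnstile> is_ord x" using forces_mono[OF 1(3) le_trans[OF le1 q(1)]] .
      obtain r2 a where r2: "r2 \<preceq> r1" "Ord E a" "r2 \<tturnstile> (u \<^bold>= ck a)"
        using 1(1)[OF r1(2) nu is_ord_elem[OF ox ux nu] le_cond(1)[OF r1(1)]] by blast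
      have ax: "r2 \<tturnstile> (ck a \<^bold>\<in> x)" using mem_eq_left[OF forces_mono[OF ux r2(1)] r2(3)] .
      have ncx: "\<not> r2 \<tturnstile> (ck c \<^bold>\<in> x)" using q(2) le_trans[OF r2(1) le1] by simp
      have "\<not> E c a"
      proof
        assume "E c a"
        have "r2 \<tturnstile> is_transitive x" using ox forces_mono[OF _ r2(1)] unfolding is_ord_def by auto
        then have "r2 \<tturnstile> is_subset (ck a) x" unfolding is_transitive_def
          using f_all_impD[where \<Phi> = "\<lambda>y. y \<^bold>\<in> x" and \<Psi> = "\<lambda>y. is_subset y x", OF _ name_check le_refl[OF le_cond(1)[OF r2(1)]] ax] by blast
        then have "r2 \<tturnstile> (ck c \<^bold>\<in> x)" unfolding is_subset_def
          using f_all_impD[where \<Phi> = "\<lambda>y. y \<^bold>\<in> ck a" and \<Psi> = "\<lambda>y. y \<^bold>\<in> x", OF _ name_check le_refl[OF le_cond(1)[OF r2(1)]]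
            check_memI[OF \<open>E c a\<close>]] by blast
        then show False using ncx by blast
      qed
      moreover have "a \<noteq> c" using ax ncx by blast
      ultimately have "E a c" using Ord_linear c r2(2) by blast
      moreover have "r2 \<tturnstile> (z \<^bold>= ck a)" using eq_trans[OF forces_mono[OF r1(3) r2(1)] r2(3)] .
      ultimately have "r2 \<tturnstile> (z \<^bold>\<in> ck c)" using mem_eq_left[OF check_memI eq_sym] by blast
      then show "\<exists>r. r \<preceq> r0 \<and> r \<tturnstile> (z \<^bold>\<in> ck c)" using le_trans[OF r2(1) r1(1)] by blast
    qed
  qed
  then show ?case using q(1) c by blast
qed

end

context forcing
begin

subsection \<open>Functions between ground sets\<close>

text \<open>When \<open>f\<close> is forced into a ground set of pairs, arguments and values are
  densely ground elements, so totality and uniqueness need only be tested there.\<close>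

lemma is_fun_checkI:
  assumes Z: "\<And>q z. q \<preceq> p \<Longrightarrow> name z \<Longrightarrow> q \<tturnstile> (z \<^bold>\<in> f) \<Longrightarrow> q \<tturnstile> (z \<^bold>\<in> ck Z)"
    "\<And>z. E z Z \<Longrightarrow> \<exists>a b. E a X \<and> E b Y \<and> z = vpair E a b"
    and tot: "\<And>a. E a X \<Longrightarrow> p \<tturnstile> (\<^bold>\<exists>y. maps f (ck a) y)"
    and fnl: "\<And>q a b c. q \<preceq> p \<Longrightarrow> q \<tturnstile> (ck (vpair E a b) \<^bold>\<in> f) \<Longrightarrow> q \<tturnstile> (ck (vpair E a c) \<^bold>\<in> f) \<Longrightarrow> b = c"
  shows "p \<tturnstile> is_fun f (ck X) (ck Y)"
  unfolding is_fun_def f_conj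
proof (intro conjI)
  show "p \<tturnstile> (\<^bold>\<forall>p. p \<^bold>\<in> f \<^bold>\<longrightarrow> (\<^bold>\<exists>x y. x \<^bold>\<in> ck X \<^bold>\<and> y \<^bold>\<in> ck Y \<^bold>\<and> is_pair p x y))"
  proof (intro f_allI f_impI)
    fix z q assume q: "q \<preceq> p" "name z" "q \<tturnstile> (z \<^bold>\<in> f)"
    show "q \<tturnstile> (\<^bold>\<exists>x y. x \<^bold>\<in> ck X \<^bold>\<and> y \<^bold>\<in> ck Y \<^bold>\<and> is_pair z x y)"
    proof (rule check_memE[OF Z(1)[OF q]])
      fix r c assume r: "r \<preceq> q" "E c Z" "r \<tturnstile> (z \<^bold>= ck c)"
      then obtain a b where ab: "E a X" "E b Y" "c = vpair E a b" using Z(2) by blast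
      show "r \<tturnstile> (\<^bold>\<exists>x y. x \<^bold>\<in> ck X \<^bold>\<and> y \<^bold>\<in> ck Y \<^bold>\<and> is_pair z x y)"
        by (rule f_exI[where x = "ck a"], rule f_exI[where x = "ck b"])
          (use ab r(3) q(2) in \<open>simp_all add: pair_check check_memI\<close>)
    qed
  qed
next
  show "p \<tturnstile> (\<^bold>\<forall>x. x \<^bold>\<in> ck X \<^bold>\<longrightarrow> Exists (maps f x))"
    by (rule f_ballI) (intro cong_intros, rule tot)
next
  show "p \<tturnstile> (\<^bold>\<forall>x y z. maps f x y \<^bold>\<and> maps f x z \<^bold>\<longrightarrow> y \<^bold>= z)"
  proof (intro f_allI f_impI, unfold f_conj, elim conjE)
    fix x y z q assume n: "name x" "name y" "name z" and q: "q \<preceq> p"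
      and m: "q \<tturnstile> maps f x y" "q \<tturnstile> maps f x z"
    have Zq: "r \<tturnstile> (z \<^bold>\<in> ck Z)" if "r \<preceq> q" "name z" "r \<tturnstile> (z \<^bold>\<in> f)" for r z
      using Z(1) le_trans[OF that(1) q] that by blast
    show "q \<tturnstile> (y \<^bold>= z)"
    proof (rule maps_checkE[OF m(1) n(1,2) Zq])
      fix r a b assume r: "r \<preceq> q" "r \<tturnstile> (x \<^bold>= ck a)" "r \<tturnstile> (y \<^bold>= ck b)"
      have Zr: "s \<tturnstile> (z \<^bold>\<in> ck Z)" if "s \<preceq> r" "name z" "s \<tturnstile> (z \<^bold>\<in> f)" for s z
        using Zq le_trans[OF that(1) r(1)] that by blast
      show "r \<tturnstile> (y \<^bold>= z)"
      proof (rule maps_checkE[OF forces_mono[OF m(2) r(1)] n(1,3) Zr])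
        fix s a' c assume s: "s \<preceq> r" "s \<tturnstile> (x \<^bold>= ck a')" "s \<tturnstile> (z \<^bold>= ck c)"
        have xa: "s \<tturnstile> (x \<^bold>= ck a)" "s \<tturnstile> (y \<^bold>= ck b)" using forces_mono r(2,3) s(1) by blast+
        have le: "s \<preceq> q" using le_trans[OF s(1) r(1)] .
        have c: "congr (\<lambda>t. maps f t y)" "congr (\<lambda>t. maps f (ck a) t)" "congr (\<lambda>t. maps f t z)"
          by (intro cong_intros)+
        have "s \<tturnstile> maps f (ck a) (ck b)" "s \<tturnstile> maps f (ck a) (ck c)"
          using forces_mono[OF m(1) le] forces_mono[OF m(2) le] xa s(3) congrD c by blast+
        then have "b = c" using fnl[OF le_trans[OF le q]] maps_check by blast
        then show "s \<tturnstile> (y \<^bold>= z)" using xa(2) s(3) eq_trans eq_sym by blast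
      qed
    qed
  qed
qed

lemma maps_graph [simp]: "cond p \<Longrightarrow> small E X \<Longrightarrow>
    p \<tturnstile> maps (ck (vgraph E g X)) (ck x) (ck y) \<longleftrightarrow> x \<in> X \<and> y = g x"
  by (simp add: maps_check)

lemma maps_graphE:
  assumes "p \<tturnstile> maps (ck (vgraph E g X)) t u" "small E X" "name t" "name u"
    and "\<And>q x. q \<preceq> p \<Longrightarrow> x \<in> X \<Longrightarrow> q \<tturnstile> (t \<^bold>= ck x) \<Longrightarrow> q \<tturnstile> (u \<^bold>= ck (g x)) \<Longrightarrow> q \<tturnstile> \<chi>"
  shows "p \<tturnstile> \<chi>"
  by (rule maps_checkE[OF assms(1,3,4), where Z = "vgraph E g X"]) (use assms(2,5) in auto)

lemma fun_graph:
  assumes "\<And>x. E x X \<Longrightarrow> E (g x) Y"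
  shows "p \<tturnstile> is_fun (ck (vgraph E g (ext E X))) (ck X) (ck Y)"
proof (rule is_fun_checkI[where Z = "vgraph E g (ext E X)"])
  fix a assume a: "E a X"
  show "p \<tturnstile> (\<^bold>\<exists>y. maps (ck (vgraph E g (ext E X))) (ck a) y)"
    by (rule f_exI[where x = "ck (g a)"]) (use a in \<open>simp_all add: maps_check check_memI\<close>)
next
  fix q a b c assume "q \<preceq> p" "q \<tturnstile> (ck (vpair E a b) \<^bold>\<in> ck (vgraph E g (ext E X)))"
    "q \<tturnstile> (ck (vpair E a c) \<^bold>\<in> ck (vgraph E g (ext E X)))"
  then show "b = c" using le_cond(1) by simp
qed (use assms in \<open>auto simp: mem_vgraph\<close>)

lemma surj_graph:
  assumes "g ` ext E X = ext E Y"
  shows "p \<tturnstile> is_surj (ck (vgraph E g (ext E X))) (ck X) (ck Y)"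
  unfolding is_surj_def f_conj
proof (intro conjI fun_graph f_ballI)
  show "E (g x) Y" if "E x X" for x using assms that by auto
  fix y assume "E y Y"
  then have "y \<in> g ` ext E X" using assms by simp
  then obtain x where x: "E x X" "y = g x" by auto
  show "p \<tturnstile> (\<^bold>\<exists>x. maps (ck (vgraph E g (ext E X))) x (ck y))"
    by (rule f_exI[where x = "ck x"]) (use x in \<open>simp_all add: maps_check check_memI\<close>)
qed (intro cong_intros)

lemma equipotent_check:
  assumes "bij_betw g (ext E X) (ext E Y)"
  shows "p \<tturnstile> equipotent (ck X) (ck Y)"
  unfolding equipotent_def
proof (rule f_exI[where x = "ck (vgraph E g (ext E X))"], unfold is_bij_def f_conj, intro conjI f_allI f_impI, goal_cases)
  case 1
  show ?case using assms by (intro surj_graph) (simp add: bij_betw_def)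
next
  case (2 x x' y q)
  then have m: "q \<tturnstile> maps (ck (vgraph E g (ext E X))) x y" "q \<tturnstile> maps (ck (vgraph E g (ext E X))) x' y" by auto
  show ?case
  proof (rule maps_graphE[OF m(1) _ 2(1,3)])
    fix r a assume r: "r \<preceq> q" "a \<in> ext E X" "r \<tturnstile> (x \<^bold>= ck a)" "r \<tturnstile> (y \<^bold>= ck (g a))"
    show "r \<tturnstile> (x \<^bold>= x')"
    proof (rule maps_graphE[OF forces_mono[OF m(2) r(1)] _ 2(2,3)])
      fix s b assume s: "s \<preceq> r" "b \<in> ext E X" "s \<tturnstile> (x' \<^bold>= ck b)" "s \<tturnstile> (y \<^bold>= ck (g b))"
      have "s \<tturnstile> (ck (g a) \<^bold>= ck (g b))" using s(4) forces_mono[OF r(4) s(1)] eq_sym eq_trans by blast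
      then have "g a = g b" using le_cond(1)[OF s(1)] by simp
      then have "a = b" using assms r(2) s(2) by (auto simp: bij_betw_def inj_on_def)
      then show "s \<tturnstile> (x \<^bold>= x')" using s(3) forces_mono[OF r(3) s(1)] eq_sym eq_trans by blast
    qed simp
  qed simp
qed simp

lemma app_check:
  assumes "congr \<Phi>" "E a X"
  shows "p \<tturnstile> app (ck (vgraph E g (ext E X))) (ck a) \<Phi> \<longleftrightarrow> p \<tturnstile> \<Phi> (ck (g a))"
proof
  assume "p \<tturnstile> app (ck (vgraph E g (ext E X))) (ck a) \<Phi>"
  then show "p \<tturnstile> \<Phi> (ck (g a))" unfolding app_def
  proof (rule f_exE, unfold f_conj, elim conjE)
    fix q y assume q: "q \<preceq> p" "name y" "q \<tturnstile> maps (ck (vgraph E g (ext E X))) (ck a) y" "q \<tturnstile> \<Phi> y"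
    show "q \<tturnstile> \<Phi> (ck (g a))"
    proof (rule maps_graphE[OF q(3) _ name_check q(2)])
      fix r x assume r: "r \<preceq> q" "r \<tturnstile> (ck a \<^bold>= ck x)" "r \<tturnstile> (y \<^bold>= ck (g x))"
      then have "a = x" using le_cond(1) by simp
      then show "r \<tturnstile> \<Phi> (ck (g a))" using congrD[OF assms(1)] r(3) forces_mono[OF q(4) r(1)] by blast
    qed simp
  qed
next
  assume "p \<tturnstile> \<Phi> (ck (g a))"
  then show "p \<tturnstile> app (ck (vgraph E g (ext E X))) (ck a) \<Phi>" unfolding app_def
    by (intro f_exI[where x = "ck (g a)"]) (use assms(2) in \<open>simp_all add: maps_check check_memI\<close>)
qed

lemma fun_unique:
  assumes "p \<tturnstile> is_fun f X Y" "p \<tturnstile> maps f x y" "p \<tturnstile> maps f x z" "name x" "name y" "name z"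
  shows "p \<tturnstile> (y \<^bold>= z)"
proof (cases "cond p")
  case True
  have "p \<tturnstile> (\<^bold>\<forall>x y z. maps f x y \<^bold>\<and> maps f x z \<^bold>\<longrightarrow> y \<^bold>= z)" using assms(1) by (simp add: is_fun_def)
  then have "p \<tturnstile> (maps f x y \<^bold>\<and> maps f x z \<^bold>\<longrightarrow> y \<^bold>= z)" using assms(4-6) by (simp del: f_conj)
  then show ?thesis using f_impD[OF _ le_refl[OF True]] assms(2,3) by (metis f_conj)
qed (rule not_cond_forces)

subsection \<open>The countable chain condition\<close>

definition ccc :: bool where
  "ccc \<longleftrightarrow> (\<forall>A. (\<forall>p\<in>A. cond p) \<and> (\<forall>p\<in>A. \<forall>q\<in>A. p \<noteq> q \<longrightarrow> \<not> (\<exists>r. r \<preceq> p \<and> r \<preceq> q)) \<longrightarrow> countable A)"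

text \<open>Choose for each possible value \<open>b\<close> a condition \<open>h b\<close> forcing
  it. Compatible conditions cannot force different values, since \<open>f\<close> is a function; so
  \<open>h\<close> is injective and its range is an antichain.\<close>

lemma countable_values:
  assumes ccc and f: "q \<tturnstile> is_fun f (ck a) (ck k)"
  shows "countable {b. \<exists>r. r \<preceq> q \<and> r \<tturnstile> maps f (ck x) (ck b)}" (is "countable ?B")
proof -
  define h where "h b = (SOME r. r \<preceq> q \<and> r \<tturnstile> maps f (ck x) (ck b))" for b
  have h: "h b \<preceq> q" "h b \<tturnstile> maps f (ck x) (ck b)" if "b \<in> ?B" for b
    using someI_ex[of "\<lambda>r. r \<preceq> q \<and> r \<tturnstile> maps f (ck x) (ck b)"] that unfolding h_def by blast+
  have eq: "b = c" if "b \<in> ?B" "c \<in> ?B" "r \<preceq> h b" "r \<preceq> h c" for b c r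
  proof -
    have le: "r \<preceq> q" using le_trans[OF that(3) h(1)[OF that(1)]] .
    have "r \<tturnstile> (ck b \<^bold>= ck c)"
      by (rule fun_unique[OF forces_mono[OF f le] forces_mono[OF h(2)[OF that(1)] that(3)]
            forces_mono[OF h(2)[OF that(2)] that(4)]]) simp_all
    then show ?thesis using le_cond(1)[OF le] by simp
  qed
  have c1: "cond x" if "x \<in> h ` ?B" for x using that h(1) le_cond(1) by blast
  have c2: "\<not> (\<exists>r. r \<preceq> x \<and> r \<preceq> y)" if xy: "x \<in> h ` ?B" "y \<in> h ` ?B" "x \<noteq> y" for x y
  proof -
    obtain b where b: "b \<in> ?B" "x = h b" using xy(1) by (rule imageE)
    obtain c where c: "c \<in> ?B" "y = h c" using xy(2) by (rule imageE)
    show ?thesis using eq[OF b(1) c(1)] xy(3) b(2) c(2) by metis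
  qed
  have "countable (h ` ?B)"
    by (rule \<open>ccc\<close>[unfolded ccc_def, rule_format]) (intro conjI ballI HOL.impI c1 c2)
  moreover have "inj_on h ?B"
  proof (rule inj_onI)
    fix b c assume bc: "b \<in> ?B" "c \<in> ?B" "h b = h c"
    have "h b \<preceq> h b" using le_refl[OF le_cond(1)[OF h(1)[OF bc(1)]]] .
    then show "b = c" using eq[OF bc(1,2), of "h b"] bc(3) by simp
  qed
  ultimately show ?thesis by (rule countable_image_inj_on)
qed

text \<open>Each argument in turn is decided by a further extension. This serves the finite case of
  the counting that follows.\<close>

lemma decide_finite:
  assumes "finite S" "\<And>x. x \<in> S \<Longrightarrow> E x a" and f: "q \<tturnstile> is_fun f (ck a) (ck k)" "cond q"
  shows "\<exists>r g. r \<preceq> q \<and> (\<forall>x\<in>S. r \<tturnstile> maps f (ck x) (ck (g x)))"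
  using assms(1,2)
proof (induction S rule: finite_induct)
  case empty
  then show ?case using le_refl[OF f(2)] by blast
next
  case (insert x S)
  then obtain r g where r: "r \<preceq> q" "\<forall>x\<in>S. r \<tturnstile> maps f (ck x) (ck (g x))" by auto
  have "r \<tturnstile> (\<^bold>\<exists>y. maps f (ck x) y)"
    using f(1) f_ballD[where \<Phi> = "\<lambda>x. Exists (maps f x)"] insert(4)[of x] forces_mono[OF _ r(1)] unfolding is_fun_def f_conj by blast
  then obtain r' y where r': "r' \<preceq> r" "name y" "r' \<tturnstile> maps f (ck x) y"
    using ex_obtain le_cond(1)[OF r(1)] by metis
  have "\<exists>s b. s \<preceq> r' \<and> s \<tturnstile> maps f (ck x) (ck b)"
  proof (rule ccontr)
    assume n: "\<not> ?thesis"
    have "r' \<tturnstile> (ck x \<^bold>\<in> ck x)"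
    proof (rule is_fun_checkE[OF forces_mono[OF f(1) le_trans[OF r'(1) r(1)]] r'(3) name_check r'(2)])
      fix s c b assume s: "s \<preceq> r'" "s \<tturnstile> (y \<^bold>= ck b)"
      have c: "congr (\<lambda>t. maps f (ck x) t)" by (intro cong_intros)
      show "s \<tturnstile> (ck x \<^bold>\<in> ck x)" using n s congrD[OF c s(2) forces_mono[OF r'(3) s(1)]] by blast
    qed
    then show False using le_cond(1)[OF r'(1)] by simp
  qed
  then obtain s b where s: "s \<preceq> r'" "s \<tturnstile> maps f (ck x) (ck b)" by blast
  have "s \<preceq> r" using le_trans[OF s(1) r'(1)] .
  then have "\<forall>z\<in>insert x S. s \<tturnstile> maps f (ck z) (ck ((g(x := b)) z))"
    using s(2) r(2) forces_mono insert(2) by auto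
  then show ?case using le_trans[OF \<open>s \<preceq> r\<close> r(1)] by blast
qed

text \<open>Every element of \<open>k\<close> is a possible value at some ground argument. For
  infinite \<open>a\<close> this covers \<open>k\<close> by \<open>|ext E a|\<close> many countable
  sets. For finite \<open>a\<close> such a cover is too weak a bound, so one condition decides the
  whole map.\<close>

lemma ccc_surj_card:
  assumes ccc "cond q" and f: "q \<tturnstile> is_surj f (ck a) (ck k)"
  shows "|ext E k| \<le>o |ext E a|"
proof -
  have fu: "q \<tturnstile> is_fun f (ck a) (ck k)" and su: "q \<tturnstile> (\<^bold>\<forall>y. y \<^bold>\<in> ck k \<^bold>\<longrightarrow> (\<^bold>\<exists>x. maps f x y))"
    using f unfolding is_surj_def by auto
  have val: "\<exists>r x. r \<preceq> q' \<and> E x a \<and> r \<tturnstile> maps f (ck x) (ck b)" if "E b k" "q' \<preceq> q" for b q'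
  proof (rule ccontr)
    assume n: "\<not> ?thesis"
    have "q' \<tturnstile> (\<^bold>\<exists>x. maps f x (ck b))" using f_ballD[OF su that(1)] forces_mono that(2) by blast
    then have "q' \<tturnstile> (ck b \<^bold>\<in> ck b)"
    proof (rule f_exE)
      fix r t assume r: "r \<preceq> q'" "name t" "r \<tturnstile> maps f t (ck b)"
      show "r \<tturnstile> (ck b \<^bold>\<in> ck b)"
      proof (rule is_fun_checkE[OF forces_mono[OF fu le_trans[OF r(1) that(2)]] r(3) r(2) name_check])
        fix s x b' assume s: "s \<preceq> r" "E x a" "s \<tturnstile> (t \<^bold>= ck x)"
        have c: "congr (\<lambda>t. maps f t (ck b))" by (intro cong_intros)
        show "s \<tturnstile> (ck b \<^bold>\<in> ck b)"
          using n s congrD[OF c s(3) forces_mono[OF r(3) s(1)]] le_trans[OF s(1) r(1)] by blast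
      qed
    qed
    then show False using le_cond(1)[OF that(2)] by simp
  qed
  show ?thesis
  proof (cases "finite (ext E a)")
    case True
    then obtain r g where r: "r \<preceq> q" "\<forall>x\<in>ext E a. r \<tturnstile> maps f (ck x) (ck (g x))"
      using decide_finite[OF True _ fu assms(2)] by auto
    have "ext E k \<subseteq> g ` ext E a"
    proof
      fix b assume "b \<in> ext E k"
      then obtain s x where s: "s \<preceq> r" "E x a" "s \<tturnstile> maps f (ck x) (ck b)" using val[OF _ r(1)] mem_ext by metis
      have "s \<tturnstile> maps f (ck x) (ck (g x))" by (rule forces_mono[OF _ s(1)]) (use r(2) s(2) in simp)
      then have "s \<tturnstile> (ck (g x) \<^bold>= ck b)"
        using fun_unique[OF forces_mono[OF fu le_trans[OF s(1) r(1)]]] s(3) name_check by blast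
      then show "b \<in> g ` ext E a" using s le_cond(1)[OF s(1)] by auto
    qed
    then show ?thesis by (rule ordLeq_transitive[OF card_of_mono1 card_of_image])
  next
    case False
    let ?B = "\<lambda>x. {b. \<exists>r. r \<preceq> q \<and> r \<tturnstile> maps f (ck x) (ck b)}"
    have "ext E k \<subseteq> (\<Union>x\<in>ext E a. ?B x)"
    proof
      fix b assume "b \<in> ext E k"
      then obtain r x where "r \<preceq> q" "E x a" "r \<tturnstile> maps f (ck x) (ck b)"
        using val[OF _ le_refl[OF assms(2)], of b] by auto
      then show "b \<in> (\<Union>x\<in>ext E a. ?B x)" by (intro UN_I[of x]) (simp, blast)
    qed
    moreover have "|\<Union>x\<in>ext E a. ?B x| \<le>o |ext E a|"
    proof (rule card_of_UNION_ordLeq_infinite[OF False])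
      show "|ext E a| \<le>o |ext E a|" by (rule card_of_mono1) simp
      show "\<forall>x\<in>ext E a. |?B x| \<le>o |ext E a|"
      proof
        fix x
        have "countable (?B x)" using countable_values[OF assms(1) fu] .
        then show "|?B x| \<le>o |ext E a|"
          by (rule ordLeq_transitive[OF iffD1[OF countable_card_of_nat] iffD1[OF infinite_iff_card_of_nat False]])
      qed
    qed
    ultimately show ?thesis using card_of_mono1 ordLeq_transitive by blast
  qed
qed

lemma card_preserved:
  assumes ccc "sat E (is_card k)" "cond p"
  shows "p \<tturnstile> is_card (ck k)"
proof -
  have k: "Ord E k" "\<And>a. E a k \<Longrightarrow> \<nexists>g. bij_betw g (ext E a) (ext E k)"
    using assms(2) by (auto simp: sat_is_card)
  show ?thesis unfolding is_card_def f_conj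
  proof (intro conjI f_ballI f_negI)
    show "p \<tturnstile> is_ord (ck k)" using k(1) assms(3) by simp
    show "congr (\<lambda>x. \<^bold>\<not> equipotent x (ck k))" by (intro cong_intros)
    fix a q assume a: "E a k" and q: "q \<preceq> p" "q \<tturnstile> equipotent (ck a) (ck k)"
    obtain r f where r: "r \<preceq> q" "name f" "r \<tturnstile> is_bij f (ck a) (ck k)"
      using ex_obtain[OF q(2)[unfolded equipotent_def] le_cond(1)[OF q(1)]] .
    then have "|ext E k| \<le>o |ext E a|"
      using ccc_surj_card[OF assms(1) le_cond(1)[OF r(1)]] unfolding is_bij_def by auto
    moreover have "|ext E a| \<le>o |ext E k|" using a k(1) Ord_subset card_of_mono1 by blast
    ultimately have "|ext E a| =o |ext E k|" using ordIso_iff_ordLeq by blast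
    then show False using k(2)[OF a] card_of_ordIso by blast
  qed
qed

text \<open>Ordinals of the extension are densely ground ordinals, and being \<omega> is absolute
  for ground ordinals.\<close>

lemma is_omega_extension:
  assumes "sat E (is_omega w)" "name t" "p \<tturnstile> is_omega t"
  shows "p \<tturnstile> (t \<^bold>= ck w)"
proof (rule forces_dense)
  fix q assume q: "q \<preceq> p"
  have "p \<tturnstile> is_ord t" using assms(3) by (simp add: is_omega_def is_limit_def)
  then obtain r a where r: "r \<preceq> q" "r \<tturnstile> (t \<^bold>= ck a)"
    using ord_decide[OF assms(2) forces_mono[OF _ q] le_cond(1)[OF q]] by blast
  have c: "congr is_omega" by (intro cong_intros)
  have "r \<tturnstile> is_omega (ck a)" using congrD[OF c r(2)] forces_mono[OF assms(3) le_trans[OF r(1) q]] .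
  then have "a = w" using le_cond(1)[OF r(1)] is_omega_unique[OF _ assms(1)] by simp
  then show "\<exists>r. r \<preceq> q \<and> r \<tturnstile> (t \<^bold>= ck w)" using r by blast
qed

lemma ord_le_check_mem:
  assumes "p \<tturnstile> ord_le t (ck a)" "E a b" "Ord E b"
  shows "p \<tturnstile> (t \<^bold>\<in> ck b)"
  using assms(1) unfolding ord_le_def
proof (rule f_disjE)
  fix q assume q: "q \<tturnstile> (t \<^bold>\<in> ck a)"
  show "q \<tturnstile> (t \<^bold>\<in> ck b)"
    by (rule check_memE[OF q]) (use Ord_trans[OF assms(3,2)] mem_eq_left[OF check_memI eq_sym] in blast)
next
  fix q assume "q \<tturnstile> (t \<^bold>= ck a)"
  then show "q \<tturnstile> (t \<^bold>\<in> ck b)" using mem_eq_left[OF check_memI[OF assms(2)] eq_sym] by blast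
qed

text \<open>\<open>m\<close> is still a cardinal and still exceeds \<open>u\<close>, so the least
  cardinal above \<open>u\<close> in the extension cannot exceed \<open>m\<close>. The upper bound
  is enough to place the ordinals below the \<omega>_2 of the extension inside the ground
  one.\<close>

lemma succ_card_bound:
  assumes ccc "sat E (is_succ_card m k)" "name t" "name u"
    and t: "p \<tturnstile> is_succ_card t u" and u: "p \<tturnstile> ord_le u (ck k)"
  shows "p \<tturnstile> ord_le t (ck m)"
proof (cases "cond p")
  case True
  have m: "sat E (is_card m)" "E k m" using assms(2) by (auto simp: is_succ_card_def)
  then have "Ord E m" by (simp add: sat_is_card)
  have "p \<tturnstile> (is_card (ck m) \<^bold>\<and> u \<^bold>\<in> ck m)"
    using card_preserved[OF assms(1) m(1) True] ord_le_check_mem[OF u m(2) \<open>Ord E m\<close>] by simp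
  then show ?thesis using t f_all_impD[where \<Phi> = "\<lambda>n. is_card n \<^bold>\<and> u \<^bold>\<in> n" and \<Psi> = "ord_le t", OF _ name_check le_refl[OF True]]
    unfolding is_succ_card_def by (metis f_conj)
qed (rule not_cond_forces)

lemma omega2_bound:
  assumes ccc "sat E (is_omega w)" "sat E (is_succ_card w1 w)" "sat E (is_succ_card w2 w1)"
    and "name t" "name x" "p \<tturnstile> is_omega_n 2 t" "p \<tturnstile> (x \<^bold>\<in> t)"
  shows "p \<tturnstile> (x \<^bold>\<in> ck w2)"
proof -
  have "Ord E w2" using assms(4) by (auto simp: is_succ_card_def sat_is_card)
  have "p \<tturnstile> (\<^bold>\<exists>y. (\<^bold>\<exists>z. is_omega z \<^bold>\<and> is_succ_card y z) \<^bold>\<and> is_succ_card t y)"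
    using assms(7) by (simp add: numeral_2_eq_2)
  then have "p \<tturnstile> ord_le t (ck w2)"
  proof (rule f_exE)
    fix q y assume "q \<preceq> p" "name y" "q \<tturnstile> ((\<^bold>\<exists>z. is_omega z \<^bold>\<and> is_succ_card y z) \<^bold>\<and> is_succ_card t y)"
    then have q: "q \<preceq> p" "name y" "q \<tturnstile> is_succ_card t y"
      and y: "q \<tturnstile> (\<^bold>\<exists>z. is_omega z \<^bold>\<and> is_succ_card y z)" by auto
    have "q \<tturnstile> ord_le y (ck w1)" using y
    proof (rule f_exE, unfold f_conj, elim conjE)
      fix r z assume r: "r \<preceq> q" "name z" "r \<tturnstile> is_omega z" "r \<tturnstile> is_succ_card y z"
      have "r \<tturnstile> ord_le z (ck w)"
        unfolding ord_le_def by (rule f_disjI2) (rule is_omega_extension[OF assms(2) r(2,3)])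
      then show "r \<tturnstile> ord_le y (ck w1)" using succ_card_bound[OF assms(1,3) q(2) r(2,4)] by blast
    qed
    then show "q \<tturnstile> ord_le t (ck w2)" using succ_card_bound[OF assms(1,4,5) q(2,3)] by blast
  qed
  then show ?thesis unfolding ord_le_def
  proof (rule f_disjE)
    fix q assume q: "q \<preceq> p" "q \<tturnstile> (t \<^bold>\<in> ck w2)"
    show "q \<tturnstile> (x \<^bold>\<in> ck w2)"
    proof (rule check_memE[OF q(2)])
      fix r b assume r: "r \<preceq> q" "E b w2" "r \<tturnstile> (t \<^bold>= ck b)"
      have "r \<tturnstile> ord_le x (ck b)" unfolding ord_le_def
        by (rule f_disjI1) (rule mem_eq_right[OF forces_mono[OF assms(8) le_trans[OF r(1) q(1)]] r(3)])
      then show "r \<tturnstile> (x \<^bold>\<in> ck w2)" using ord_le_check_mem r(2) \<open>Ord E w2\<close> by blast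
    qed
  next
    fix q assume "q \<preceq> p" "q \<tturnstile> (t \<^bold>= ck w2)"
    then show "q \<tturnstile> (x \<^bold>\<in> ck w2)" using mem_eq_right forces_mono[OF assms(8)] by blast
  qed
qed

end

section \<open>Delta systems and amalgamation of finite conditions\<close>

section \<open>Finite approximations\<close>

lemma uncountable_fibre:
  assumes "uncountable A" "countable (f ` A)"
  obtains c where "uncountable {a \<in> A. f a = c}"
proof -
  have "A = (\<Union>c\<in>f ` A. {a \<in> A. f a = c})" by auto
  then have "\<exists>c. uncountable {a \<in> A. f a = c}" using assms by (metis (no_types, lifting) countable_UN)
  then show ?thesis using that by blast
qed

text \<open>Induction on the common size. A point in uncountably many \<open>D a\<close> is removed
  and later returned to the root. If there is none, a maximal disjoint subfamily cannot be
  countable: by maximality the countable union of its sets meets every \<open>D a\<close>, while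
  each point of this union lies in only countably many of them.\<close>

lemma delta_system_card:
  assumes "uncountable A" "\<And>a. a \<in> A \<Longrightarrow> finite (D a) \<and> card (D a) = n"
  shows "\<exists>B R. B \<subseteq> A \<and> uncountable B \<and> (\<forall>a\<in>B. \<forall>b\<in>B. a \<noteq> b \<longrightarrow> D a \<inter> D b = R)"
  using assms
proof (induction n arbitrary: A D)
  case 0
  then have "D a = {}" if "a \<in> A" for a using that by (metis card_0_eq)
  then show ?case using "0.prems"(1) by (intro exI[of _ A] exI[of _ "{}"]) auto
next
  case (Suc n)
  show ?case
  proof (cases "\<exists>x. uncountable {a \<in> A. x \<in> D a}")
    case True
    then obtain x where x: "uncountable {a \<in> A. x \<in> D a}" by blast
    have "\<exists>B R. B \<subseteq> {a \<in> A. x \<in> D a} \<and> uncountable B \<and>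
        (\<forall>a\<in>B. \<forall>b\<in>B. a \<noteq> b \<longrightarrow> (D a - {x}) \<inter> (D b - {x}) = R)"
      by (rule Suc.IH[OF x]) (use Suc.prems(2) in fastforce)
    then obtain B R where B: "B \<subseteq> {a \<in> A. x \<in> D a}" "uncountable B"
      "\<forall>a\<in>B. \<forall>b\<in>B. a \<noteq> b \<longrightarrow> (D a - {x}) \<inter> (D b - {x}) = R" by (elim exE conjE)
    have "D a \<inter> D b = insert x R" if "a \<in> B" "b \<in> B" "a \<noteq> b" for a b
    proof -
      have "(D a - {x}) \<inter> (D b - {x}) = R" "x \<in> D a" "x \<in> D b" using B(1,3) that by auto
      then show ?thesis by blast
    qed
    moreover have "B \<subseteq> A" using B(1) by blast
    ultimately show ?thesis using B(2) by (intro exI[of _ B] exI[of _ "insert x R"]) simp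
  next
    case False
    define \<D> where "\<D> = {B. B \<subseteq> A \<and> (\<forall>a\<in>B. \<forall>b\<in>B. a \<noteq> b \<longrightarrow> D a \<inter> D b = {})}"
    have "\<exists>M\<in>\<D>. \<forall>X\<in>\<D>. M \<subseteq> X \<longrightarrow> X = M"
    proof (rule subset_Zorn')
      fix C assume C: "subset.chain \<D> C"
      then have lin: "\<And>X Y. X \<in> C \<Longrightarrow> Y \<in> C \<Longrightarrow> X \<subseteq> Y \<or> Y \<subseteq> X" and sub: "C \<subseteq> \<D>"
        unfolding subset.chain_def by blast+
      have "D a \<inter> D b = {}" if "X \<in> C" "a \<in> X" "Y \<in> C" "b \<in> Y" "a \<noteq> b" for a b X Y
        using lin[OF that(1,3)] sub that unfolding \<D>_def by blast
      then show "\<Union>C \<in> \<D>" using sub unfolding \<D>_def by blast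
    qed
    then obtain M where M: "M \<in> \<D>" "\<And>X. X \<in> \<D> \<Longrightarrow> M \<subseteq> X \<Longrightarrow> X = M" by blast
    have "uncountable M"
    proof
      assume "countable M"
      then have cU: "countable (\<Union>a\<in>M. D a)"
        using Suc.prems(2) M(1) unfolding \<D>_def by (intro countable_UN) (auto intro: countable_finite)
      have "A \<subseteq> (\<Union>x\<in>(\<Union>a\<in>M. D a). {a \<in> A. x \<in> D a})"
      proof
        fix a assume a: "a \<in> A"
        show "a \<in> (\<Union>x\<in>(\<Union>a\<in>M. D a). {a \<in> A. x \<in> D a})"
        proof (rule ccontr)
          assume n: "a \<notin> (\<Union>x\<in>(\<Union>a\<in>M. D a). {a \<in> A. x \<in> D a})"
          then have "\<And>b. b \<in> M \<Longrightarrow> D a \<inter> D b = {}" using a by blast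
          then have "insert a M \<in> \<D>" using M(1) a unfolding \<D>_def by blast
          then have "a \<in> M" using M(2) by blast
          moreover have "D a \<noteq> {}" using Suc.prems(2)[OF a] by auto
          ultimately show False using \<open>\<And>b. b \<in> M \<Longrightarrow> D a \<inter> D b = {}\<close> by blast
        qed
      qed
      moreover have "countable (\<Union>x\<in>(\<Union>a\<in>M. D a). {a \<in> A. x \<in> D a})"
        by (rule countable_UN[OF cU]) (use False in blast)
      ultimately show False using Suc.prems(1) countable_subset by blast
    qed
    then show ?thesis using M(1) unfolding \<D>_def by blast
  qed
qed

lemma delta_system:
  assumes "uncountable A" "\<And>a. a \<in> A \<Longrightarrow> finite (D a)"
  shows "\<exists>B R. B \<subseteq> A \<and> uncountable B \<and> (\<forall>a\<in>B. \<forall>b\<in>B. a \<noteq> b \<longrightarrow> D a \<inter> D b = R)"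
proof -
  obtain n where n: "uncountable {a \<in> A. card (D a) = n}"
    by (rule uncountable_fibre[OF assms(1), of "\<lambda>a. card (D a)"]) auto
  have "\<exists>B R. B \<subseteq> {a \<in> A. card (D a) = n} \<and> uncountable B \<and> (\<forall>a\<in>B. \<forall>b\<in>B. a \<noteq> b \<longrightarrow> D a \<inter> D b = R)"
    using delta_system_card[OF n, of D n] assms(2) by simp
  then obtain B R where B: "B \<subseteq> {a \<in> A. card (D a) = n}" "uncountable B"
      "\<forall>a\<in>B. \<forall>b\<in>B. a \<noteq> b \<longrightarrow> D a \<inter> D b = R" by (elim exE conjE)
  moreover from this(1) have "B \<subseteq> A" by blast
  ultimately show ?thesis by (intro exI[of _ B] exI[of _ R]) simp
qed

text \<open>\<open>prec\<close> is the order that all conditions must respect; a condition chooses a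
  finite suborder. Each fibre will carry one algebra, whose unit is the cone of its
  \<open>apex\<close>. \<open>al x y v\<close> says that \<open>v\<close> is an admissible bound for
  \<open>x\<close> and \<open>y\<close>.\<close>

locale poset_data =
  fixes T :: "'p set" and fib :: "'p \<Rightarrow> 'i" and prec :: "'p \<Rightarrow> 'p \<Rightarrow> bool"
    and apex :: "'i \<Rightarrow> 'p" and al :: "'p \<Rightarrow> 'p \<Rightarrow> 'p \<Rightarrow> bool"
  assumes prec_trans: "prec x y \<Longrightarrow> prec y z \<Longrightarrow> prec x z"
    and prec_irrefl: "\<not> prec x x"
    and apex_T: "x \<in> T \<Longrightarrow> apex (fib x) \<in> T"
    and fib_apex: "x \<in> T \<Longrightarrow> fib (apex (fib x)) = fib x"
    and prec_apex: "x \<in> T \<Longrightarrow> x = apex (fib x) \<or> prec x (apex (fib x))"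
    and al_sym: "al x y v \<Longrightarrow> al y x v"
begin

text \<open>The relation is reflexive on its field, so it also records which points are present,
  even isolated ones, and needs no separate support. The clause about \<open>apex\<close> supplies
  every occurring fibre with its largest point.\<close>

definition is_cond :: "('p \<times> 'p) set \<Rightarrow> bool" where
  "is_cond r \<longleftrightarrow> finite r \<and> trans r \<and>
     (\<forall>x y. (x, y) \<in> r \<longrightarrow> x \<in> T \<and> y \<in> T \<and> fib x = fib y \<and> (x = y \<or> prec x y) \<and>
        (x, x) \<in> r \<and> (y, y) \<in> r \<and> (x, apex (fib x)) \<in> r) \<and>
     (\<forall>x y z. (z, x) \<in> r \<longrightarrow> (z, y) \<in> r \<longrightarrow> (x, y) \<notin> r \<longrightarrow> (y, x) \<notin> r \<longrightarrow>
        (\<exists>v. (z, v) \<in> r \<and> (v, x) \<in> r \<and> (v, y) \<in> r \<and> al x y v))"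

definition pts :: "('p \<times> 'p) set \<Rightarrow> 'p set" where
  "pts r = {x. (x, x) \<in> r}"

text \<open>The last clause is the essential one: a new common lower bound of old points must pass
  through an old one. It makes the old points above a new point downward directed, which is why
  products computed in \<open>r\<close> remain valid in \<open>q\<close>.\<close>

definition refines :: "('p \<times> 'p) set \<Rightarrow> ('p \<times> 'p) set \<Rightarrow> bool" where
  "refines q r \<longleftrightarrow> r \<subseteq> q \<and> (\<forall>x\<in>pts r. \<forall>y\<in>pts r. (x, y) \<in> q \<longrightarrow> (x, y) \<in> r) \<and>
     (\<forall>z. \<forall>x\<in>pts r. \<forall>y\<in>pts r. (z, x) \<in> q \<longrightarrow> (z, y) \<in> q \<longrightarrow>
        (\<exists>v\<in>pts r. (z, v) \<in> q \<and> (v, x) \<in> r \<and> (v, y) \<in> r))"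

lemma mem_pts [simp]: "x \<in> pts r \<longleftrightarrow> (x, x) \<in> r"
  by (simp add: pts_def)

lemma condD:
  assumes "is_cond r" "(x, y) \<in> r"
  shows "x \<in> T" "y \<in> T" "fib x = fib y" "x = y \<or> prec x y" "(x, x) \<in> r" "(y, y) \<in> r" "(x, apex (fib x)) \<in> r"
  using assms unfolding is_cond_def by blast+

lemma is_condI:
  assumes "finite r" "trans r"
    "\<And>x y. (x, y) \<in> r \<Longrightarrow> x \<in> T \<and> y \<in> T \<and> fib x = fib y \<and> (x = y \<or> prec x y) \<and>
        (x, x) \<in> r \<and> (y, y) \<in> r \<and> (x, apex (fib x)) \<in> r"
    "\<And>x y z. (z, x) \<in> r \<Longrightarrow> (z, y) \<in> r \<Longrightarrow> (x, y) \<notin> r \<Longrightarrow> (y, x) \<notin> r \<Longrightarrow>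
        \<exists>v. (z, v) \<in> r \<and> (v, x) \<in> r \<and> (v, y) \<in> r \<and> al x y v"
  shows "is_cond r"
  unfolding is_cond_def using assms by blast

lemma cond_trans: "is_cond r \<Longrightarrow> (x, y) \<in> r \<Longrightarrow> (y, z) \<in> r \<Longrightarrow> (x, z) \<in> r"
  unfolding is_cond_def by (meson transD)

lemma cond_finite: "is_cond r \<Longrightarrow> finite r"
  by (simp add: is_cond_def)

lemma cond_antisym: "is_cond r \<Longrightarrow> (x, y) \<in> r \<Longrightarrow> (y, x) \<in> r \<Longrightarrow> x = y"
  using condD(4) prec_trans prec_irrefl by metis

lemma cond_incomparable:
  assumes "is_cond r" "(z, x) \<in> r" "(z, y) \<in> r" "(x, y) \<notin> r" "(y, x) \<notin> r"
  obtains v where "(z, v) \<in> r" "(v, x) \<in> r" "(v, y) \<in> r" "al x y v"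
  using assms unfolding is_cond_def by blast

lemma finite_pts: "is_cond r \<Longrightarrow> finite (pts r)"
  using cond_finite[of r] finite_subset[of "pts r" "fst ` r"] by (force simp: pts_def)

lemma cond_empty [simp]: "is_cond {}"
  by (simp add: is_cond_def)

lemma refines_empty [simp]: "refines r {}"
  by (simp add: refines_def pts_def)

lemma refines_refl: "is_cond r \<Longrightarrow> refines r r"
  unfolding refines_def Ball_def Bex_def mem_pts using condD(5) by blast

lemma refinesD:
  assumes "refines q r"
  shows "(x, y) \<in> r \<Longrightarrow> (x, y) \<in> q"
    "(x, x) \<in> r \<Longrightarrow> (y, y) \<in> r \<Longrightarrow> (x, y) \<in> q \<Longrightarrow> (x, y) \<in> r"
    "(x, x) \<in> r \<Longrightarrow> (y, y) \<in> r \<Longrightarrow> (z, x) \<in> q \<Longrightarrow> (z, y) \<in> q \<Longrightarrow>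
       \<exists>v. (v, v) \<in> r \<and> (z, v) \<in> q \<and> (v, x) \<in> r \<and> (v, y) \<in> r"
  using assms unfolding refines_def Ball_def Bex_def mem_pts by blast+

lemma refines_trans:
  assumes "is_cond s" "refines s q" "refines q r"
  shows "refines s r"
  unfolding refines_def
proof (intro conjI ballI allI impI)
  show "r \<subseteq> s" using assms(2,3) unfolding refines_def by (elim conjE) (rule subset_trans)
  fix x y assume xy: "x \<in> pts r" "y \<in> pts r"
  then have xyq: "(x, x) \<in> q" "(y, y) \<in> q" using refinesD(1)[OF assms(3)] by simp_all
  { assume "(x, y) \<in> s"
    then show "(x, y) \<in> r" using refinesD(2)[OF assms(3)] refinesD(2)[OF assms(2)] xy xyq by simp }
  fix z assume z: "(z, x) \<in> s" "(z, y) \<in> s"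
  obtain v where v: "(v, v) \<in> q" "(z, v) \<in> s" "(v, x) \<in> q" "(v, y) \<in> q"
    using refinesD(3)[OF assms(2) xyq z] by blast
  obtain u where u: "(u, u) \<in> r" "(v, u) \<in> q" "(u, x) \<in> r" "(u, y) \<in> r"
    using refinesD(3)[OF assms(3) _ _ v(3,4)] xy by auto
  have "(z, u) \<in> s" using cond_trans[OF assms(1) v(2)] refinesD(1)[OF assms(2) u(2)] .
  then show "\<exists>v\<in>pts r. (z, v) \<in> s \<and> (v, x) \<in> r \<and> (v, y) \<in> r" using u by auto
qed

text \<open>Only the relations that transitivity through the root enforces are added.
  \<open>rootp\<close> and \<open>rootq\<close> keep admissible bounds of root points in the root,
  so that both given conditions are refined. \<open>crossp\<close> and \<open>crossq\<close> treat
  points \<open>x\<close> and \<open>y\<close> from different sides: the root point through which a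
  common lower bound reaches the other side, or a bound of \<open>x\<close> or \<open>y\<close> with
  it, is admissible for the pair.\<close>

lemma amalgam:
  assumes p: "is_cond p" and q: "is_cond q"
    and R: "R = pts p \<inter> pts q"
    and agree: "\<And>x y. x \<in> R \<Longrightarrow> y \<in> R \<Longrightarrow> (x, y) \<in> p \<longleftrightarrow> (x, y) \<in> q"
    and rootp: "\<And>w w' v. w \<in> R \<Longrightarrow> w' \<in> R \<Longrightarrow> w \<noteq> w' \<Longrightarrow> al w w' v \<Longrightarrow> (v, w) \<in> p \<Longrightarrow> (v, w') \<in> p \<Longrightarrow> v \<in> R"
    and rootq: "\<And>w w' v. w \<in> R \<Longrightarrow> w' \<in> R \<Longrightarrow> w \<noteq> w' \<Longrightarrow> al w w' v \<Longrightarrow> (v, w) \<in> q \<Longrightarrow> (v, w') \<in> q \<Longrightarrow> v \<in> R"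
    and crossp: "\<And>x y w v. x \<in> pts p - R \<Longrightarrow> y \<in> pts q - R \<Longrightarrow> w \<in> R \<Longrightarrow> (w, y) \<in> q \<Longrightarrow> fib x = fib y \<Longrightarrow>
       al x y w \<and> (al x w v \<longrightarrow> (v, w) \<in> p \<longrightarrow> al x y v)"
    and crossq: "\<And>x y w v. x \<in> pts p - R \<Longrightarrow> y \<in> pts q - R \<Longrightarrow> w \<in> R \<Longrightarrow> (w, x) \<in> p \<Longrightarrow> fib x = fib y \<Longrightarrow>
       al x y w \<and> (al y w v \<longrightarrow> (v, w) \<in> q \<longrightarrow> al x y v)"
  shows "\<exists>r. is_cond r \<and> refines r p \<and> refines r q"
proof -
  define r where "r = p \<union> q \<union> p O q \<union> q O p"
  have rel: "(x, y) \<in> r \<longleftrightarrow> (x, y) \<in> p \<or> (x, y) \<in> q \<or> (\<exists>w. (x, w) \<in> p \<and> (w, y) \<in> q) \<or> (\<exists>w. (x, w) \<in> q \<and> (w, y) \<in> p)" for x y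
    unfolding r_def by auto
  have inR: "w \<in> R" if "(x, w) \<in> p" "(w, y) \<in> q" for x w y using that condD p q R by auto
  have inR': "w \<in> R" if "(x, w) \<in> q" "(w, y) \<in> p" for x w y using that condD p q R by auto
  note tp = cond_trans[OF p] and tq = cond_trans[OF q]
  \<comment> \<open>Alternating chains collapse: where the sides change, the chain is in the root,
    and there \<open>p\<close> and \<open>q\<close> agree. Hence compositions of length two already
    give a transitive relation.\<close>
  have key: "(x, y) \<in> p" if "(x, w) \<in> p" "(w, w') \<in> q" "(w', y) \<in> p" for x w w' y
    using tp tp[OF that(1)] agree[of w w'] inR[OF that(1,2)] inR'[OF that(2,3)] that by blast
  have key': "(x, y) \<in> q" if "(x, w) \<in> q" "(w, w') \<in> p" "(w', y) \<in> q" for x w w' y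
    using tq tq[OF that(1)] agree[of w w'] inR'[OF that(1,2)] inR[OF that(2,3)] that by blast
  have tr: "trans r"
  proof (rule transI)
    fix x y z assume "(x, y) \<in> r" "(y, z) \<in> r"
    then show "(x, z) \<in> r" unfolding rel by (elim disjE exE conjE; meson tp tq key key')
  qed
  have basic: "x \<in> T \<and> y \<in> T \<and> fib x = fib y \<and> (x = y \<or> prec x y) \<and>
        (x, x) \<in> r \<and> (y, y) \<in> r \<and> (x, apex (fib x)) \<in> r" if "(x, y) \<in> r" for x y
  proof -
    have P: "x \<in> T \<and> y \<in> T \<and> fib x = fib y \<and> (x = y \<or> prec x y) \<and>
        (x, x) \<in> r \<and> (y, y) \<in> r \<and> (x, apex (fib x)) \<in> r" if "(x, y) \<in> p" for x y
      using condD[OF p that] rel by blast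
    have Q: "x \<in> T \<and> y \<in> T \<and> fib x = fib y \<and> (x = y \<or> prec x y) \<and>
        (x, x) \<in> r \<and> (y, y) \<in> r \<and> (x, apex (fib x)) \<in> r" if "(x, y) \<in> q" for x y
      using condD[OF q that] rel by blast
    have PQ: ?thesis if "(x, w) \<in> p" "(w, y) \<in> q" for w
      using P[OF that(1)] Q[OF that(2)] prec_trans by metis
    have QP: ?thesis if "(x, w) \<in> q" "(w, y) \<in> p" for w
      using Q[OF that(1)] P[OF that(2)] prec_trans by metis
    show ?thesis using that unfolding rel[of x y]
      by (elim disjE exE conjE) (erule P, erule Q, erule (1) PQ, erule (1) QP)
  qed
  have resp: "(x, y) \<in> p" if "(x, x) \<in> p" "(y, y) \<in> p" "(x, y) \<in> r" for x y
    using that tp tq key agree[of x] agree[of _ y] condD[OF p] condD[OF q] inR inR' R unfolding rel by (metis IntI mem_pts)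
  have resq: "(x, y) \<in> q" if "(x, x) \<in> q" "(y, y) \<in> q" "(x, y) \<in> r" for x y
    using that tp tq key' agree[of x] agree[of _ y] condD[OF p] condD[OF q] inR inR' R unfolding rel by (metis IntI mem_pts)
  have viap: "\<exists>w\<in>R. (z, w) \<in> q \<and> (w, x) \<in> p" if "(z, x) \<in> r" "(x, x) \<in> p" "(z, z) \<notin> p" for z x
  proof -
    have "(z, z) \<in> q" using basic[OF that(1)] that(3) condD(5)[OF p] condD(5)[OF q] unfolding rel[of z x]
      using that(1) rel by blast
    then show ?thesis using that condD[OF p] condD[OF q] inR' R unfolding rel by (metis IntI mem_pts)
  qed
  have viaq: "\<exists>w\<in>R. (z, w) \<in> p \<and> (w, x) \<in> q" if "(z, x) \<in> r" "(x, x) \<in> q" "(z, z) \<notin> q" for z x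
  proof -
    have "(z, z) \<in> p" using basic[OF that(1)] that(3) condD(5)[OF p] condD(5)[OF q] unfolding rel[of z x]
      using that(1) rel by blast
    then show ?thesis using that condD[OF p] condD[OF q] inR R unfolding rel by (metis IntI mem_pts)
  qed
  \<comment> \<open>This is the third clause of \<open>refines\<close>. For \<open>z\<close> outside
    \<open>p\<close>, the ways up to \<open>x\<close> and \<open>y\<close> enter \<open>p\<close> at
    root points \<open>w\<close> and \<open>w'\<close>; an admissible bound of these in
    \<open>q\<close> stays in the root, so it counts as a point of \<open>p\<close>.\<close>
  have dirp: "\<exists>v. (v, v) \<in> p \<and> (z, v) \<in> r \<and> (v, x) \<in> p \<and> (v, y) \<in> p"
    if t: "(x, x) \<in> p" "(y, y) \<in> p" "(z, x) \<in> r" "(z, y) \<in> r" for x y z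
  proof (cases "(z, z) \<in> p")
    case True
    then show ?thesis using resp[OF True t(1,3)] resp[OF True t(2,4)] rel by blast
  next
    case False
    obtain w where w: "w \<in> R" "(z, w) \<in> q" "(w, x) \<in> p" using viap[OF t(3,1) False] by blast
    obtain w' where w': "w' \<in> R" "(z, w') \<in> q" "(w', y) \<in> p" using viap[OF t(4,2) False] by blast
    have "\<exists>v\<in>R. (z, v) \<in> q \<and> (v, w) \<in> p \<and> (v, w') \<in> p"
    proof (cases "(w, w') \<in> q \<or> (w', w) \<in> q")
      case True
      then have "(w, w') \<in> p \<or> (w', w) \<in> p" using agree w(1) w'(1) by blast
      moreover have "(w, w) \<in> p" "(w', w') \<in> p" using w(1) w'(1) R by auto
      ultimately show ?thesis using w(1,2) w'(1,2) by blast
    next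
      case False
      then obtain v where v: "(z, v) \<in> q" "(v, w) \<in> q" "(v, w') \<in> q" "al w w' v"
        using cond_incomparable[OF q w(2) w'(2)] by blast
      moreover have "w \<noteq> w'" using False w R by auto
      ultimately have "v \<in> R" using rootq w(1) w'(1) by blast
      then show ?thesis using v agree w(1) w'(1) by blast
    qed
    then obtain v where v: "v \<in> R" "(z, v) \<in> q" "(v, w) \<in> p" "(v, w') \<in> p" by blast
    then have "(v, x) \<in> p" "(v, y) \<in> p" using tp w(3) w'(3) by blast+
    then show ?thesis using v(1,2) R rel by auto
  qed
  have dirq: "\<exists>v. (v, v) \<in> q \<and> (z, v) \<in> r \<and> (v, x) \<in> q \<and> (v, y) \<in> q"
    if t: "(x, x) \<in> q" "(y, y) \<in> q" "(z, x) \<in> r" "(z, y) \<in> r" for x y z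
  proof (cases "(z, z) \<in> q")
    case True
    then show ?thesis using resq[OF True t(1,3)] resq[OF True t(2,4)] rel by blast
  next
    case False
    obtain w where w: "w \<in> R" "(z, w) \<in> p" "(w, x) \<in> q" using viaq[OF t(3,1) False] by blast
    obtain w' where w': "w' \<in> R" "(z, w') \<in> p" "(w', y) \<in> q" using viaq[OF t(4,2) False] by blast
    have "\<exists>v\<in>R. (z, v) \<in> p \<and> (v, w) \<in> q \<and> (v, w') \<in> q"
    proof (cases "(w, w') \<in> p \<or> (w', w) \<in> p")
      case True
      then have "(w, w') \<in> q \<or> (w', w) \<in> q" using agree w(1) w'(1) by blast
      moreover have "(w, w) \<in> q" "(w', w') \<in> q" using w(1) w'(1) R by auto
      ultimately show ?thesis using w(1,2) w'(1,2) by blast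
    next
      case False
      then obtain v where v: "(z, v) \<in> p" "(v, w) \<in> p" "(v, w') \<in> p" "al w w' v"
        using cond_incomparable[OF p w(2) w'(2)] by blast
      moreover have "w \<noteq> w'" using False w R by auto
      ultimately have "v \<in> R" using rootp w(1) w'(1) by blast
      then show ?thesis using v agree w(1) w'(1) by blast
    qed
    then obtain v where v: "v \<in> R" "(z, v) \<in> p" "(v, w) \<in> q" "(v, w') \<in> q" by blast
    then have "(v, x) \<in> q" "(v, y) \<in> q" using tq w(3) w'(3) by blast+
    then show ?thesis using v(1,2) R rel by auto
  qed
  \<comment> \<open>If \<open>z\<close> is on the side of \<open>x\<close>, it reaches
    \<open>y\<close> through a root point \<open>w\<close>. If \<open>w\<close> lies below
    \<open>x\<close>, then \<open>w\<close> is the bound; \<open>x\<close> below \<open>w\<close>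
    would make \<open>x\<close> and \<open>y\<close> comparable; otherwise an admissible bound of
    \<open>x\<close> and \<open>w\<close> serves. The other side is symmetric.\<close>
  have cross: "\<exists>v. (z, v) \<in> r \<and> (v, x) \<in> r \<and> (v, y) \<in> r \<and> al x y v"
    if x: "(x, x) \<in> p" "(x, x) \<notin> q" and y: "(y, y) \<in> q" "(y, y) \<notin> p"
      and z: "(z, x) \<in> r" "(z, y) \<in> r" and n: "(x, y) \<notin> r" "(y, x) \<notin> r" for x y z
  proof -
    have xR: "x \<in> pts p - R" and yR: "y \<in> pts q - R" using x y R by auto
    have f: "fib x = fib y" using basic[OF z(1)] basic[OF z(2)] by simp
    show ?thesis
    proof (cases "(z, z) \<in> p")
      case True
      have zx: "(z, x) \<in> p" using resp[OF True x(1) z(1)] .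
      obtain w where w: "w \<in> R" "(z, w) \<in> p" "(w, y) \<in> q"
      proof (cases "(z, z) \<in> q")
        case True
        then show ?thesis using that[of z] resq[OF True y(1) z(2)] \<open>(z, z) \<in> p\<close> R by auto
      qed (use viaq z(2) y(1) in blast)
      note c = crossp[OF xR yR w(1,3) f]
      show ?thesis
      proof (cases "(w, x) \<in> p \<or> (x, w) \<in> p")
        case True
        moreover have "(x, w) \<notin> p" using n w(3) rel by blast
        ultimately show ?thesis using c w rel by blast
      next
        case False
        then obtain v where v: "(z, v) \<in> p" "(v, x) \<in> p" "(v, w) \<in> p" "al x w v"
          using cond_incomparable[OF p zx w(2)] by blast
        then show ?thesis using c w(3) rel by blast
      qed
    next
      case False
      then have zq: "(z, z) \<in> q" using z(1) basic[OF z(1)] condD(5)[OF p] condD(5)[OF q] rel by blast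
      have zy: "(z, y) \<in> q" using resq[OF zq y(1) z(2)] .
      obtain w where w: "w \<in> R" "(z, w) \<in> q" "(w, x) \<in> p" using viap[OF z(1) x(1) False] by blast
      note c = crossq[OF xR yR w(1,3) f]
      show ?thesis
      proof (cases "(w, y) \<in> q \<or> (y, w) \<in> q")
        case True
        moreover have "(y, w) \<notin> q" using n w(3) rel by blast
        ultimately show ?thesis using c w rel by blast
      next
        case False
        then obtain v where v: "(z, v) \<in> q" "(v, y) \<in> q" "(v, w) \<in> q" "al y w v"
          using cond_incomparable[OF q zy w(2)] by blast
        then show ?thesis using c w(3) rel by blast
      qed
    qed
  qed
  have constr: "\<exists>v. (z, v) \<in> r \<and> (v, x) \<in> r \<and> (v, y) \<in> r \<and> al x y v"
    if z: "(z, x) \<in> r" "(z, y) \<in> r" and n: "(x, y) \<notin> r" "(y, x) \<notin> r" for x y z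
  proof -
    have pq: "(u, u) \<in> p \<or> (u, u) \<in> q" if "(u, u) \<in> r" for u
      using that condD(5)[OF p] condD(5)[OF q] rel by blast
    have xx: "(x, x) \<in> r" and yy: "(y, y) \<in> r" using basic z by blast+
    consider "(x, x) \<in> p" "(y, y) \<in> p" | "(x, x) \<in> q" "(y, y) \<in> q"
      | "(x, x) \<in> p" "(x, x) \<notin> q" "(y, y) \<in> q" "(y, y) \<notin> p"
      | "(y, y) \<in> p" "(y, y) \<notin> q" "(x, x) \<in> q" "(x, x) \<notin> p"
      using pq[OF xx] pq[OF yy] by blast
    then show ?thesis
    proof cases
      case 1
      obtain v where v: "(z, v) \<in> r" "(v, x) \<in> p" "(v, y) \<in> p" using dirp[OF 1 z] by blast
      have "(x, y) \<notin> p" "(y, x) \<notin> p" using n rel by blast+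
      then obtain u where "(v, u) \<in> p" "(u, x) \<in> p" "(u, y) \<in> p" "al x y u"
        using cond_incomparable[OF p v(2,3)] by blast
      then show ?thesis using v(1) transD[OF tr] rel by blast
    next
      case 2
      obtain v where v: "(z, v) \<in> r" "(v, x) \<in> q" "(v, y) \<in> q" using dirq[OF 2 z] by blast
      have "(x, y) \<notin> q" "(y, x) \<notin> q" using n rel by blast+
      then obtain u where "(v, u) \<in> q" "(u, x) \<in> q" "(u, y) \<in> q" "al x y u"
        using cond_incomparable[OF q v(2,3)] by blast
      then show ?thesis using v(1) transD[OF tr] rel by blast
    next
      case 3
      then show ?thesis using cross z n by blast
    next
      case 4
      then show ?thesis using cross[OF 4 z(2,1) n(2,1)] al_sym by blast
    qed
  qed
  have "finite r" unfolding r_def using cond_finite p q by (simp add: finite_relcomp)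
  then have "is_cond r" using tr basic constr by (intro is_condI)
  moreover have "refines r p" unfolding refines_def Ball_def Bex_def mem_pts
  proof (intro conjI)
    show "p \<subseteq> r" unfolding r_def by blast
  qed (use resp dirp in blast)+
  moreover have "refines r q" unfolding refines_def Ball_def Bex_def mem_pts
  proof (intro conjI)
    show "q \<subseteq> r" unfolding r_def by blast
  qed (use resq dirq in blast)+
  ultimately show ?thesis by blast
qed

text \<open>The new point lies below exactly the points above \<open>y\<close>, so \<open>y\<close>
  can stand in for it as a common lower bound of old points, and incomparable points above it keep
  the admissible bound they have above \<open>y\<close>.\<close>

lemma add_point:
  assumes p: "is_cond p" and y: "(y, y) \<in> p" and z: "z \<in> T" "(z, z) \<notin> p" "fib z = fib y" "prec z y"
  defines "r \<equiv> p \<union> {(z, z)} \<union> {(z, u) | u. (y, u) \<in> p}"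
  shows "is_cond r" "refines r p"
proof -
  have rel: "(a, b) \<in> r \<longleftrightarrow> (a, b) \<in> p \<or> a = z \<and> (b = z \<or> (y, b) \<in> p)" for a b
    unfolding r_def by auto
  have np: "(a, z) \<notin> p" "(z, a) \<notin> p" for a using condD(5,6)[OF p] z(2) by blast+
  have zu: "u \<in> T \<and> fib z = fib u \<and> prec z u \<and> (u, u) \<in> p" if "(y, u) \<in> p" for u
    using condD[OF p that] z prec_trans by metis
  have "finite {(z, u) | u. (y, u) \<in> p}"
    by (rule finite_subset[of _ "Pair z ` snd ` p"]) (use cond_finite[OF p] in force)+
  then have fin: "finite r" unfolding r_def using cond_finite[OF p] by simp
  have tr: "trans r" by (rule transI) (use rel np cond_trans[OF p] in metis)
  have b: "a \<in> T \<and> b \<in> T \<and> fib a = fib b \<and> (a = b \<or> prec a b) \<and>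
        (a, a) \<in> r \<and> (b, b) \<in> r \<and> (a, apex (fib a)) \<in> r" if "(a, b) \<in> r" for a b
  proof (cases "(a, b) \<in> p")
    case True
    then show ?thesis using condD[OF p True] rel by blast
  next
    case False
    then have a: "a = z" "b = z \<or> (y, b) \<in> p" using that rel by blast+
    have "(z, apex (fib z)) \<in> r" using condD(7)[OF p y] z(3) rel by simp
    moreover have "(z, z) \<in> r" "(b, b) \<in> r" "b \<in> T \<and> fib z = fib b \<and> (z = b \<or> prec z b)"
      using a(2) zu z(1) rel by blast+
    ultimately show ?thesis using a(1) z(1) by blast
  qed
  have c: "\<exists>v. (t, v) \<in> r \<and> (v, a) \<in> r \<and> (v, b) \<in> r \<and> al a b v"
    if t: "(t, a) \<in> r" "(t, b) \<in> r" and n: "(a, b) \<notin> r" "(b, a) \<notin> r" for a b t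
  proof (cases "t = z")
    case True
    then have "a \<noteq> z" "b \<noteq> z" using t n by auto
    then have "(y, a) \<in> p" "(y, b) \<in> p" using t True rel np by auto
    moreover have "(a, b) \<notin> p" "(b, a) \<notin> p" using n rel by auto
    ultimately obtain v where "(y, v) \<in> p" "(v, a) \<in> p" "(v, b) \<in> p" "al a b v"
      using cond_incomparable[OF p] by blast
    then show ?thesis using True rel by blast
  next
    case False
    then have "(t, a) \<in> p" "(t, b) \<in> p" using t rel by auto
    moreover have "(a, b) \<notin> p" "(b, a) \<notin> p" using n rel by auto
    ultimately obtain v where "(t, v) \<in> p" "(v, a) \<in> p" "(v, b) \<in> p" "al a b v"
      using cond_incomparable[OF p] by blast
    then show ?thesis using rel by blast
  qed
  show "is_cond r" by (rule is_condI[OF fin tr b c])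
  show "refines r p" unfolding refines_def
  proof (intro conjI ballI allI impI)
    show "p \<subseteq> r" unfolding r_def by blast
    fix a b assume ab: "a \<in> pts p" "b \<in> pts p"
    { assume "(a, b) \<in> r" then show "(a, b) \<in> p" using rel ab np by auto }
    fix t assume t: "(t, a) \<in> r" "(t, b) \<in> r"
    show "\<exists>v\<in>pts p. (t, v) \<in> r \<and> (v, a) \<in> p \<and> (v, b) \<in> p"
    proof (cases "t = z")
      case True
      then show ?thesis using t rel ab np y by (intro bexI[of _ y]) auto
    next
      case False
      then have "(t, a) \<in> p" "(t, b) \<in> p" using t rel by auto
      then show ?thesis using condD(5)[OF p] rel by (intro bexI[of _ t]) auto
    qed
  qed
qed

text \<open>No pair of \<open>p\<close> mentions an absent apex, so it can be added as an isolated
  point without touching any bound. It has to come before the other points of its fibre.\<close>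

lemma add_apex:
  assumes p: "is_cond p" and x: "x \<in> T" "(apex (fib x), apex (fib x)) \<notin> p"
  defines "a \<equiv> apex (fib x)"
  shows "is_cond (insert (a, a) p)" "refines (insert (a, a) p) p"
proof -
  have np: "(u, a) \<notin> p" "(a, u) \<notin> p" for u using condD(5,6)[OF p] x(2) unfolding a_def by blast+
  have a: "a \<in> T" "apex (fib a) = a" using apex_T fib_apex x(1) unfolding a_def by auto
  have tr: "trans (insert (a, a) p)"
  proof (rule transI)
    fix u v w assume "(u, v) \<in> insert (a, a) p" "(v, w) \<in> insert (a, a) p"
    then show "(u, w) \<in> insert (a, a) p" using np cond_trans[OF p, of u v w] by auto
  qed
  have b: "u \<in> T \<and> w \<in> T \<and> fib u = fib w \<and> (u = w \<or> prec u w) \<and> (u, u) \<in> insert (a, a) p \<and>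
      (w, w) \<in> insert (a, a) p \<and> (u, apex (fib u)) \<in> insert (a, a) p" if "(u, w) \<in> insert (a, a) p" for u w
  proof (cases "(u, w) \<in> p")
    case True
    then show ?thesis using condD[OF p True] by simp
  next
    case False
    then have "u = a" "w = a" using that by auto
    then show ?thesis using a by simp
  qed
  have c: "\<exists>v. (t, v) \<in> insert (a, a) p \<and> (v, u) \<in> insert (a, a) p \<and> (v, w) \<in> insert (a, a) p \<and> al u w v"
    if t: "(t, u) \<in> insert (a, a) p" "(t, w) \<in> insert (a, a) p" "(u, w) \<notin> insert (a, a) p" "(w, u) \<notin> insert (a, a) p" for t u w
  proof -
    have "(t, u) \<in> p" "(t, w) \<in> p" using t np by auto
    moreover have "(u, w) \<notin> p" "(w, u) \<notin> p" using t(3,4) by blast+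
    ultimately obtain v where "(t, v) \<in> p" "(v, u) \<in> p" "(v, w) \<in> p" "al u w v"
      by (rule cond_incomparable[OF p])
    then show ?thesis by blast
  qed
  have fin: "finite (insert (a, a) p)" using cond_finite[OF p] by simp
  show "is_cond (insert (a, a) p)" by (rule is_condI[OF fin tr b c])
  show "refines (insert (a, a) p) p" unfolding refines_def
  proof (intro conjI ballI allI impI)
    fix u w assume uw: "u \<in> pts p" "w \<in> pts p"
    { assume "(u, w) \<in> insert (a, a) p" then show "(u, w) \<in> p" using np uw by auto }
    fix t assume "(t, u) \<in> insert (a, a) p" "(t, w) \<in> insert (a, a) p"
    then have "(t, u) \<in> p" "(t, w) \<in> p" using np uw by auto
    then show "\<exists>v\<in>pts p. (t, v) \<in> insert (a, a) p \<and> (v, u) \<in> p \<and> (v, w) \<in> p"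
      using condD(5)[OF p] by (intro bexI[of _ t]) auto
  qed blast
qed

lemma dense_point:
  assumes p: "is_cond p" and x: "x \<in> T"
  shows "\<exists>r. is_cond r \<and> refines r p \<and> (x, x) \<in> r"
proof (cases "(x, x) \<in> p")
  case True
  then show ?thesis using p refines_refl by blast
next
  case False
  define a where "a = apex (fib x)"
  obtain q where q: "is_cond q" "refines q p" "(a, a) \<in> q"
    using add_apex[OF p x] p refines_refl unfolding a_def by (metis insertI1)
  show ?thesis
  proof (cases "(x, x) \<in> q")
    case True
    then show ?thesis using q by blast
  next
    case False
    then have "x \<noteq> a" using q by auto
    then have "prec x a" using prec_apex[OF x] unfolding a_def by blast
    moreover have "fib x = fib a" using fib_apex x unfolding a_def by simp
    ultimately have "is_cond (q \<union> {(x, x)} \<union> {(x, u) | u. (a, u) \<in> q})"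
        "refines (q \<union> {(x, x)} \<union> {(x, u) | u. (a, u) \<in> q}) q"
      using add_point[OF q(1,3) x False] by blast+
    moreover have "(x, x) \<in> q \<union> {(x, x)} \<union> {(x, u) | u. (a, u) \<in> q}" by blast
    ultimately show ?thesis using refines_trans q(2) by blast
  qed
qed

lemma dense_points:
  assumes "finite S" "S \<subseteq> T" "is_cond p"
  shows "\<exists>r. is_cond r \<and> refines r p \<and> S \<subseteq> pts r"
  using assms
proof (induction S rule: finite_induct)
  case empty
  then show ?case using refines_refl by blast
next
  case (insert x S)
  then obtain r where r: "is_cond r" "refines r p" "S \<subseteq> pts r" by auto
  obtain q where q: "is_cond q" "refines q r" "(x, x) \<in> q" using dense_point[OF r(1)] insert by blast
  have "S \<subseteq> pts q" using r(3) refinesD(1)[OF q(2)] by auto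
  then show ?case using q r refines_trans by (intro exI[of _ q]) auto
qed

end

section \<open>The countable chain condition from strong unboundedness\<close>

subsection \<open>The chain condition\<close>

text \<open>\<open>W\<close> with \<open>ls\<close> plays the role of \<omega>_1, \<open>e\<close>
  codes the low points of each fibre in \<open>W\<close>, and \<open>idx\<close> labels the top
  points of a fibre by elements of \<lambda>. Unboundedness is stated for disjoint families indexed
  by \<open>W\<close>, which spares a coding of families as sets.\<close>

locale ccc_data =
  fixes T :: "'p set" and fib :: "'p \<Rightarrow> 'i" and prec :: "'p \<Rightarrow> 'p \<Rightarrow> bool" and apex :: "'i \<Rightarrow> 'p"
    and low tp :: "'p \<Rightarrow> bool" and e :: "'p \<Rightarrow> 'o" and idx :: "'p \<Rightarrow> 'l" and F :: "'l \<Rightarrow> 'l \<Rightarrow> 'o"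
    and W :: "'o set" and ls :: "'o \<Rightarrow> 'o \<Rightarrow> bool"
  assumes prec_trans: "prec x y \<Longrightarrow> prec y z \<Longrightarrow> prec x z"
    and prec_irrefl: "\<not> prec x x"
    and apex_T: "x \<in> T \<Longrightarrow> apex (fib x) \<in> T"
    and fib_apex: "x \<in> T \<Longrightarrow> fib (apex (fib x)) = fib x"
    and prec_apex: "x \<in> T \<Longrightarrow> x = apex (fib x) \<or> prec x (apex (fib x))"
    and kinds: "x \<in> T \<Longrightarrow> low x \<or> tp x \<or> x = apex (fib x)"
    and low_not_tp: "low x \<Longrightarrow> \<not> tp x"
    and tp_prec: "x \<in> T \<Longrightarrow> y \<in> T \<Longrightarrow> tp x \<Longrightarrow> fib x = fib y \<Longrightarrow> prec x y \<Longrightarrow> y = apex (fib y)"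
    and tp_inj: "x \<in> T \<Longrightarrow> y \<in> T \<Longrightarrow> tp x \<Longrightarrow> tp y \<Longrightarrow> fib x = fib y \<Longrightarrow> idx x = idx y \<Longrightarrow> x = y"
    and ls_trans: "a \<in> W \<Longrightarrow> b \<in> W \<Longrightarrow> c \<in> W \<Longrightarrow> ls a b \<Longrightarrow> ls b c \<Longrightarrow> ls a c"
    and ls_linear: "a \<in> W \<Longrightarrow> b \<in> W \<Longrightarrow> ls a b \<or> a = b \<or> ls b a"
    and ls_wf: "wf {(a, b). ls a b}"
    and ls_countable: "b \<in> W \<Longrightarrow> countable {a \<in> W. ls a b}"
    and ls_ub: "a \<in> W \<Longrightarrow> b \<in> W \<Longrightarrow> \<exists>c\<in>W. ls a c \<and> ls b c"
    and W_ne: "W \<noteq> {}"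
    and e_W: "x \<in> T \<Longrightarrow> low x \<Longrightarrow> e x \<in> W"
    and e_countable: "d \<in> W \<Longrightarrow> countable {x \<in> T. low x \<and> fib x = i \<and> ls (e x) d}"
    and F_W: "k \<in> idx ` {x \<in> T. tp x} \<Longrightarrow> k' \<in> idx ` {x \<in> T. tp x} \<Longrightarrow> k \<noteq> k' \<Longrightarrow> F k k' \<in> W"
    and F_sym: "F k k' = F k' k"
    and F_unbounded: "d \<in> W \<Longrightarrow> n > 0 \<Longrightarrow>
      (\<And>w. w \<in> W \<Longrightarrow> g w \<subseteq> idx ` {x \<in> T. tp x} \<and> finite (g w) \<and> card (g w) = n) \<Longrightarrow>
      (\<And>w w'. w \<in> W \<Longrightarrow> w' \<in> W \<Longrightarrow> w \<noteq> w' \<Longrightarrow> g w \<inter> g w' = {}) \<Longrightarrow>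
      \<exists>w\<in>W. \<exists>w'\<in>W. w \<noteq> w' \<and> (\<forall>i\<in>g w. \<forall>j\<in>g w'. ls d (F i j))"
begin

definition al :: "'p \<Rightarrow> 'p \<Rightarrow> 'p \<Rightarrow> bool" where
  "al x y v \<longleftrightarrow> low v \<and> ((low x \<and> ls (e v) (e x)) \<or> (low y \<and> ls (e v) (e y)) \<or>
     (tp x \<and> tp y \<and> ls (e v) (F (idx x) (idx y))))"

sublocale poset_data T fib prec apex al
  by unfold_locales (use prec_trans prec_irrefl apex_T fib_apex prec_apex F_sym in \<open>auto simp: al_def\<close>)

text \<open>Initial segments of \<open>W\<close> are countable, so recursion along \<open>ls\<close>
  can always pick a fresh element of \<open>S\<close>. This turns an uncountable family of
  conditions into one indexed by \<open>W\<close>, as \<open>F_unbounded\<close> requires.\<close>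

lemma W_embeds:
  assumes "uncountable S"
  obtains f where "inj_on f W" "f ` W \<subseteq> S"
proof -
  define f where "f = wfrec {(a, b). ls a b} (\<lambda>f b. SOME s. s \<in> S \<and> s \<notin> f ` {a \<in> W. ls a b})"
  have f: "f b \<in> S \<and> f b \<notin> f ` {a \<in> W. ls a b}" if b: "b \<in> W" for b
  proof -
    have "f b = (SOME s. s \<in> S \<and> s \<notin> cut f {(a, b). ls a b} b ` {a \<in> W. ls a b})"
      unfolding f_def by (subst wfrec[OF ls_wf]) (rule refl)
    also have "cut f {(a, b). ls a b} b ` {a \<in> W. ls a b} = f ` {a \<in> W. ls a b}"
      by (auto simp: cut_def image_iff)
    finally have eq: "f b = (SOME s. s \<in> S \<and> s \<notin> f ` {a \<in> W. ls a b})" .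
    have "countable (f ` {a \<in> W. ls a b})" using ls_countable[OF b] by blast
    then have "\<not> S \<subseteq> f ` {a \<in> W. ls a b}" using assms countable_subset by blast
    then have "\<exists>s. s \<in> S \<and> s \<notin> f ` {a \<in> W. ls a b}" by blast
    then show ?thesis unfolding eq by (rule someI_ex)
  qed
  have "inj_on f W"
  proof (rule inj_onI)
    fix a b assume ab: "a \<in> W" "b \<in> W" "f a = f b"
    then have "\<not> ls a b" "\<not> ls b a" using f by (metis (mono_tags, lifting) imageI mem_Collect_eq)+
    then show "a = b" using ls_linear ab by blast
  qed
  moreover have "f ` W \<subseteq> S" using f by blast
  ultimately show ?thesis using that by blast
qed

lemma finite_ub: "finite X \<Longrightarrow> X \<subseteq> W \<Longrightarrow> \<exists>d\<in>W. \<forall>a\<in>X. ls a d"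
proof (induction X rule: finite_induct)
  case empty
  then show ?case using W_ne by blast
next
  case (insert a X)
  then obtain d where d: "d \<in> W" "\<forall>a\<in>X. ls a d" by auto
  obtain c where "c \<in> W" "ls a c" "ls d c" using ls_ub insert.prems d(1) by blast
  moreover have "ls b c" if "b \<in> X" for b
    using ls_trans[of b d c] insert.prems d that \<open>ls d c\<close> \<open>c \<in> W\<close> by blast
  ultimately show ?case by blast
qed

text \<open>An uncountable antichain is thinned until two members meet the hypotheses of
  \<open>amalgam\<close>. Let \<open>d\<close> bound all codes below which root pairs admit points.
  In the fibres of the root the thinning gives low points outside the root codes of at least
  \<open>d\<close>, and the values of \<open>F\<close> on new indices exceed \<open>d\<close>. Then
  every low point of these fibres with code below \<open>d\<close> is admissible across the two
  conditions.\<close>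

lemma countable_conditions:
  assumes S: "\<And>r. r \<in> S \<Longrightarrow> is_cond r"
    and inc: "\<And>p q. p \<in> S \<Longrightarrow> q \<in> S \<Longrightarrow> p \<noteq> q \<Longrightarrow> \<not> (\<exists>r. is_cond r \<and> refines r p \<and> refines r q)"
  shows "countable S"
proof (rule ccontr)
  assume unc: "uncountable S"
  define tops where "tops r = idx ` {x \<in> pts r. tp x}" for r
  have tops: "finite (tops r)" if "r \<in> S" for r unfolding tops_def
    by (rule finite_imageI, rule finite_subset[OF _ finite_pts[OF S[OF that]]]) blast
  \<comment> \<open>Indices of top points enter the delta system next to the points themselves: top
    points of different fibres can share an index, so disjoint sets of points would not give
    disjoint sets of indices.\<close>
  define D :: "('p \<times> 'p) set \<Rightarrow> ('p + 'l) set" where "D r = Inl ` pts r \<union> Inr ` tops r" for r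
  have finD: "finite (D r)" if "r \<in> S" for r unfolding D_def using finite_pts[OF S] tops that by simp
  have "\<exists>B R. B \<subseteq> S \<and> uncountable B \<and> (\<forall>a\<in>B. \<forall>b\<in>B. a \<noteq> b \<longrightarrow> D a \<inter> D b = R)"
    by (rule delta_system[OF unc]) (rule finD)
  then obtain S1 Rt where S1: "S1 \<subseteq> S" "uncountable S1" "\<forall>p\<in>S1. \<forall>q\<in>S1. p \<noteq> q \<longrightarrow> D p \<inter> D q = Rt"
    by (elim exE conjE)
  define R where "R = {x. Inl x \<in> Rt}"
  define Q where "Q = {i. Inr i \<in> Rt}"
  have RQ: "pts p \<inter> pts q = R" "tops p \<inter> tops q = Q" if "p \<in> S1" "q \<in> S1" "p \<noteq> q" for p q
    using S1(3)[rule_format, OF that] unfolding R_def Q_def D_def by auto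
  have two: "\<exists>q\<in>X. q \<noteq> p" if "uncountable X" for X :: "('p \<times> 'p) set set" and p
  proof (rule ccontr)
    assume "\<not> ?thesis"
    then have "X \<subseteq> {p}" by blast
    then have "countable X" by (rule countable_subset) simp
    then show False using that by blast
  qed
  have sub: "R \<subseteq> pts p" "Q \<subseteq> tops p" if "p \<in> S1" for p
  proof -
    obtain q where q: "q \<in> S1" "q \<noteq> p" using two[OF S1(2), of p] by (rule bexE)
    show "R \<subseteq> pts p" "Q \<subseteq> tops p" using RQ[OF that q(1)] q(2) by blast+
  qed
  obtain p0 where p0: "p0 \<in> S1" using S1(2) by (metis all_not_in_conv countable_empty)
  have finR: "finite R" and finQ: "finite Q"
    using sub[OF p0] finite_pts[OF S] tops p0 S1(1) finite_subset by blast+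
  have RT: "R \<subseteq> T"
  proof
    fix x assume "x \<in> R"
    then have "(x, x) \<in> p0" using sub(1)[OF p0] by auto
    then show "x \<in> T" using condD(1)[OF S] p0 S1(1) by blast
  qed
  \<comment> \<open>These are the finitely many top points that could have a root index in a fibre
    of the root. Making all conditions agree on them forces those that occur into the root.\<close>
  define X where "X = {x \<in> T. tp x \<and> fib x \<in> fib ` R \<and> idx x \<in> Q}"
  have "inj_on (\<lambda>x. (fib x, idx x)) X" unfolding X_def using tp_inj by (intro inj_onI) auto
  moreover have "(\<lambda>x. (fib x, idx x)) ` X \<subseteq> fib ` R \<times> Q" unfolding X_def by auto
  ultimately have finX: "finite X" using finR finQ by (meson finite_SigmaI finite_imageI finite_subset inj_on_finite)
  \<comment> \<open>The last component equalises the number of indices outside the root, which is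
    the \<open>n\<close> of \<open>F_unbounded\<close>.\<close>
  define f where "f r = (r \<inter> R \<times> R, pts r \<inter> X, card (tops r - Q))" for r
  have "f ` S1 \<subseteq> Pow (R \<times> R) \<times> Pow X \<times> UNIV" unfolding f_def by auto
  moreover have "countable (Pow (R \<times> R) \<times> Pow X \<times> (UNIV :: nat set))"
    using finR finX by (intro countable_SIGMA) (auto intro: countable_finite)
  ultimately have "countable (f ` S1)" by (rule countable_subset)
  then obtain c where "uncountable {r \<in> S1. f r = c}" using uncountable_fibre[OF S1(2)] by blast
  then obtain S2 where S2: "S2 \<subseteq> S1" "uncountable S2" "\<And>p q. p \<in> S2 \<Longrightarrow> q \<in> S2 \<Longrightarrow> f p = f q"
    using that[of "{r \<in> S1. f r = c}"] by (metis (mono_tags, lifting) mem_Collect_eq subsetI)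
  have FW: "F (idx x) (idx y) \<in> W" if "x \<in> T" "y \<in> T" "tp x" "tp y" "idx x \<noteq> idx y" for x y
    by (rule F_W) (use that in auto)
  \<comment> \<open>Admissible bounds of two root points have codes below one of these finitely many
    elements of \<open>W\<close>; \<open>d\<close> is chosen above all of them.\<close>
  define B where "B = e ` {x \<in> R. low x} \<union> (\<lambda>(x, y). F (idx x) (idx y)) ` {(x, y). x \<in> R \<and> y \<in> R \<and> tp x \<and> tp y \<and> idx x \<noteq> idx y}"
  have "finite {(x, y). x \<in> R \<and> y \<in> R \<and> tp x \<and> tp y \<and> idx x \<noteq> idx y}"
    by (rule finite_subset[of _ "R \<times> R"]) (use finR in auto)
  moreover have "finite {x \<in> R. low x}" by (rule finite_subset[OF _ finR]) blast
  ultimately have "finite B" unfolding B_def by (intro finite_UnI finite_imageI)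
  moreover have "B \<subseteq> W" unfolding B_def using RT e_W FW by (auto simp: subset_iff)
  ultimately have "\<exists>d\<in>W. \<forall>a\<in>B. ls a d" by (rule finite_ub)
  then obtain d where d: "d \<in> W" "\<And>a. a \<in> B \<Longrightarrow> ls a d" by auto
  have dR: "ls (e x) d" if "x \<in> R" "low x" for x using d(2) that unfolding B_def by auto
  have dF: "ls (F (idx x) (idx y)) d" if "x \<in> R" "y \<in> R" "tp x" "tp y" "idx x \<noteq> idx y" for x y
    using that by (intro d(2)) (auto simp: B_def)
  \<comment> \<open>Only countably many low points in fibres of the root have codes below
    \<open>d\<close>. Outside the root different conditions share no points, so all but countably
    many conditions meet \<open>L\<close> only in the root.\<close>
  define L where "L = {x \<in> T. low x \<and> fib x \<in> fib ` R \<and> ls (e x) d}"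
  have "L = (\<Union>i\<in>fib ` R. {x \<in> T. low x \<and> fib x = i \<and> ls (e x) d})" unfolding L_def by auto
  then have cL: "countable L" using e_countable[OF d(1)] finR by (auto intro: countable_finite)
  define S3 where "S3 = {r \<in> S2. pts r \<inter> L \<subseteq> R}"
  have cb: "countable {r \<in> S2. \<not> pts r \<inter> L \<subseteq> R}"
  proof -
    let ?h = "\<lambda>r. SOME x. x \<in> pts r \<inter> L - R"
    have h: "?h r \<in> pts r \<inter> L - R" if "\<not> pts r \<inter> L \<subseteq> R" for r
      using someI_ex[of "\<lambda>x. x \<in> pts r \<inter> L - R"] that by blast
    have inj: "inj_on ?h {r \<in> S2. \<not> pts r \<inter> L \<subseteq> R}"
    proof (rule inj_onI, rule ccontr)
      fix p q assume pq: "p \<in> {r \<in> S2. \<not> pts r \<inter> L \<subseteq> R}" "q \<in> {r \<in> S2. \<not> pts r \<inter> L \<subseteq> R}" "?h p = ?h q" "p \<noteq> q"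
      have 1: "?h p \<in> pts p \<inter> L - R" "?h p \<in> pts q \<inter> L - R" using h[of p] h[of q] pq by auto
      have "p \<in> S1" "q \<in> S1" using pq S2(1) by auto
      then show False using RQ(1)[OF _ _ pq(4)] 1 by blast
    qed
    have im: "?h ` {r \<in> S2. \<not> pts r \<inter> L \<subseteq> R} \<subseteq> L" using h by blast
    show ?thesis by (rule countable_image_inj_on[OF countable_subset[OF im cL] inj])
  qed
  have S2eq: "S2 = S3 \<union> {r \<in> S2. \<not> pts r \<inter> L \<subseteq> R}" unfolding S3_def by blast
  have unc3: "uncountable S3"
  proof
    assume "countable S3"
    from countable_Un[OF this cb] show False unfolding S2eq[symmetric] using S2(2) by blast
  qed
  have S3: "r \<in> S2" "r \<in> S1" "r \<in> S" "is_cond r" "pts r \<inter> L \<subseteq> R" if "r \<in> S3" for r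
    using that S2(1) S1(1) S unfolding S3_def by blast+
  obtain p q where pq: "p \<in> S3" "q \<in> S3" "p \<noteq> q"
    and big: "\<And>i j. i \<in> tops p - Q \<Longrightarrow> j \<in> tops q - Q \<Longrightarrow> ls d (F i j)"
  proof -
    obtain p1 where p1: "p1 \<in> S3" using unc3 by (metis all_not_in_conv countable_empty)
    have card: "card (tops r - Q) = card (tops p1 - Q)" if "r \<in> S3" for r
      using S2(3)[of r p1] S3(1) that p1 unfolding f_def by auto
    show ?thesis
    \<comment> \<open>Unboundedness is assumed for nonempty sets only. Without indices outside the
      root the requirement on \<open>F\<close> is void, and any two conditions do.\<close>
    proof (cases "card (tops p1 - Q) = 0")
      case True
      then have "tops p1 - Q = {}" using tops S3(3)[OF p1] by (metis card_0_eq finite_Diff)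
      then show ?thesis using that[OF p1] two[OF unc3, of p1] by blast
    next
      case False
      obtain h where h: "inj_on h W" "h ` W \<subseteq> S3" using W_embeds[OF unc3] .
      have "\<exists>w\<in>W. \<exists>w'\<in>W. w \<noteq> w' \<and> (\<forall>i\<in>tops (h w) - Q. \<forall>j\<in>tops (h w') - Q. ls d (F i j))"
      proof (rule F_unbounded[OF d(1), of "card (tops p1 - Q)"])
        show "0 < card (tops p1 - Q)" using False by simp
        fix w assume w: "w \<in> W"
        then have "h w \<in> S3" using h by blast
        moreover have "tops (h w) \<subseteq> idx ` {x \<in> T. tp x}"
          unfolding tops_def using condD(1)[OF S3(4)[OF \<open>h w \<in> S3\<close>]] by auto
        ultimately show "tops (h w) - Q \<subseteq> idx ` {x \<in> T. tp x} \<and> finite (tops (h w) - Q) \<and>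
            card (tops (h w) - Q) = card (tops p1 - Q)"
          using card tops S3(3) by auto
      next
        fix w w' assume w: "w \<in> W" "w' \<in> W" "w \<noteq> w'"
        then have "h w \<in> S1" "h w' \<in> S1" "h w \<noteq> h w'" using h S3(2) by (auto dest: inj_onD)
        then show "(tops (h w) - Q) \<inter> (tops (h w') - Q) = {}" using RQ(2) by blast
      qed
      then obtain w w' where w: "w \<in> W" "w' \<in> W" "w \<noteq> w'"
        "\<forall>i\<in>tops (h w) - Q. \<forall>j\<in>tops (h w') - Q. ls d (F i j)" by blast
      then have "h w \<in> S3" "h w' \<in> S3" "h w \<noteq> h w'" using h by (auto dest: inj_onD)
      then show ?thesis using that w(4) by blast
    qed
  qed
  note p = S3(4)[OF pq(1)] and q = S3(4)[OF pq(2)]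
  have R: "R = pts p \<inter> pts q" using RQ(1)[OF S3(2)[OF pq(1)] S3(2)[OF pq(2)] pq(3)] by simp
  have fpq: "p \<inter> R \<times> R = q \<inter> R \<times> R" "pts p \<inter> X = pts q \<inter> X"
    using S2(3)[OF S3(1)[OF pq(1)] S3(1)[OF pq(2)]] unfolding f_def by auto
  have agree: "(x, y) \<in> p \<longleftrightarrow> (x, y) \<in> q" if "x \<in> R" "y \<in> R" for x y using fpq(1) that by blast
  have W1: "e x \<in> W" if "x \<in> T" "low x" for x using e_W that by blast
  have root: "v \<in> R" if r: "r \<in> S3" and w: "w \<in> R" "w' \<in> R" "w \<noteq> w'" "al w w' v" "(v, w) \<in> r" "(v, w') \<in> r" for r w w' v
  proof -
    note cr = condD[OF S3(4)[OF r]]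
    have v: "v \<in> T" "v \<in> pts r" "fib v = fib w" "fib w = fib w'" using cr(1)[OF w(5)] cr(3,5)[OF w(5)] cr(3)[OF w(6)] by auto
    have "low v" using w(4) unfolding al_def by blast
    have wT: "w \<in> T" "w' \<in> T" using w RT by auto
    have "ls (e v) d"
    proof -
      consider "low w" "ls (e v) (e w)" | "low w'" "ls (e v) (e w')" | "tp w" "tp w'" "ls (e v) (F (idx w) (idx w'))"
        using w(4) unfolding al_def by blast
      then show ?thesis
      proof cases
        case 1 then show ?thesis using ls_trans[OF W1 W1 d(1)] v(1) \<open>low v\<close> wT dR w(1) by blast
      next
        case 2 then show ?thesis using ls_trans[OF W1 W1 d(1)] v(1) \<open>low v\<close> wT dR w(2) by blast
      next
        case 3
        then have "idx w \<noteq> idx w'" using tp_inj wT v(4) w(3) by blast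
        then show ?thesis using ls_trans[OF W1 FW d(1)] 3 v(1) \<open>low v\<close> wT dF w(1,2) by blast
      qed
    qed
    then have "v \<in> L" unfolding L_def using v \<open>low v\<close> w(1) by blast
    then show ?thesis using S3(5)[OF r] v(2) by blast
  qed
  have apexR: "apex (fib w) \<in> R" if "w \<in> R" for w
  proof -
    have "(w, w) \<in> p" "(w, w) \<in> q" using that R by auto
    then have "(apex (fib w), apex (fib w)) \<in> p" "(apex (fib w), apex (fib w)) \<in> q"
      using condD(6)[OF p condD(7)[OF p]] condD(6)[OF q condD(7)[OF q]] by blast+
    then show ?thesis using R by auto
  qed
  \<comment> \<open>Neither point is an apex, since the apex of a root fibre is in the root. A low
    \<open>x\<close> or \<open>y\<close> has a code of at least \<open>d\<close>, being outside
    \<open>L\<close>. If both are top points, their indices are not in \<open>Q\<close>, as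
    otherwise they would belong to \<open>X\<close> and hence to the root; so \<open>big\<close>
    applies.\<close>
  have key: "al x y v" if x: "x \<in> pts p - R" and y: "y \<in> pts q - R" and w: "w \<in> R" "fib x = fib w" "fib y = fib w"
      and v: "v \<in> T" "low v" "ls (e v) d" for x y w v
  proof -
    have xT: "x \<in> T" "y \<in> T" using x y condD(1)[OF p] condD(1)[OF q] by auto
    have na: "x \<noteq> apex (fib x)" "y \<noteq> apex (fib y)" using apexR[OF w(1)] w x y by auto
    have lo: "ls (e v) (e x)" if "low x" "x \<in> T" "x \<notin> L" "fib x \<in> fib ` R" for x
    proof -
      have "\<not> ls (e x) d" using that unfolding L_def by blast
      then have "e x = d \<or> ls d (e x)" using ls_linear[OF W1[OF that(2,1)] d(1)] by blast
      then show ?thesis using v(3) ls_trans[OF W1[OF v(1,2)] d(1) W1[OF that(2,1)]] by auto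
    qed
    have "x \<notin> L" "y \<notin> L" using S3(5)[OF pq(1)] S3(5)[OF pq(2)] x y by blast+
    then have lx: "low x \<Longrightarrow> ls (e v) (e x)" and ly: "low y \<Longrightarrow> ls (e v) (e y)"
      using lo xT w by auto
    show ?thesis
    proof (cases "low x \<or> low y")
      case True
      then show ?thesis unfolding al_def using lx ly v(2) by blast
    next
      case False
      then have t: "tp x" "tp y" using kinds xT na by blast+
      have "idx x \<notin> Q"
      proof
        assume "idx x \<in> Q"
        then have "x \<in> X" unfolding X_def using xT t w by auto
        then show False using fpq(2) x R by blast
      qed
      moreover have "idx y \<notin> Q"
      proof
        assume "idx y \<in> Q"
        then have "y \<in> X" unfolding X_def using xT t w by auto
        then show False using fpq(2) y R by blast
      qed
      ultimately have i: "idx x \<in> tops p - Q" "idx y \<in> tops q - Q" unfolding tops_def using x y t by auto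
      have "idx x \<noteq> idx y" using i RQ(2)[OF S3(2)[OF pq(1)] S3(2)[OF pq(2)] pq(3)] by auto
      then have "ls (e v) (F (idx x) (idx y))"
        using ls_trans[OF W1[OF v(1,2)] d(1) FW] v(3) big[OF i] xT t by blast
      then show ?thesis unfolding al_def using v(2) t by blast
    qed
  qed
  \<comment> \<open>In its fibre a top point has only the apex above it, and the apex is in the
    root; so a root point below a non-root point must be low.\<close>
  have lowR: "low w" if w: "w \<in> R" and y: "y \<notin> R" and r: "is_cond r" "(w, y) \<in> r" for w y r
  proof -
    have wy: "w \<in> T" "y \<in> T" "fib w = fib y" "prec w y" using condD[OF r] w y by auto
    have "w \<noteq> apex (fib w)"
      using prec_apex[OF wy(2)] wy(3,4) prec_trans prec_irrefl by metis
    moreover have "\<not> tp w" using tp_prec[OF wy(1,2) _ wy(3,4)] apexR[OF w] wy(3) y by auto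
    ultimately show ?thesis using kinds wy(1) by blast
  qed
  have cross: "al x y w \<and> (low v \<longrightarrow> v \<in> T \<longrightarrow> ls (e v) (e w) \<longrightarrow> al x y v)"
    if x: "x \<in> pts p - R" and y: "y \<in> pts q - R" and w: "w \<in> R" "low w" "fib x = fib w" "fib y = fib w" for x y w v
  proof -
    have wT: "w \<in> T" using w RT by blast
    have "al x y w" using key[OF x y w(1,3,4) wT w(2)] dR w by blast
    moreover have "al x y v" if "low v" "v \<in> T" "ls (e v) (e w)"
      using key[OF x y w(1,3,4) that(2,1)] ls_trans[OF W1[OF that(2,1)] W1[OF wT w(2)] d(1) that(3)] dR w by blast
    ultimately show ?thesis by blast
  qed
  have "\<exists>r. is_cond r \<and> refines r p \<and> refines r q"
  proof (rule amalgam[OF p q R agree])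
    fix x y w v assume a: "x \<in> pts p - R" "y \<in> pts q - R" "w \<in> R" "(w, y) \<in> q" "fib x = fib y"
    have lw: "low w" using lowR[OF a(3) _ q a(4)] a(2) by blast
    have fw: "fib w = fib y" using condD(3)[OF q a(4)] .
    have xw: "fib x = fib w" "fib y = fib w" using fw a(5) by simp_all
    note c = cross[OF a(1,2,3) lw xw]
    show "al x y w \<and> (al x w v \<longrightarrow> (v, w) \<in> p \<longrightarrow> al x y v)"
    proof (intro conjI impI)
      show "al x y w" using c by blast
      assume v: "al x w v" "(v, w) \<in> p"
      have "v \<in> T" using condD(1)[OF p v(2)] .
      show "al x y v"
      proof (cases "low x \<and> ls (e v) (e x)")
        case True
        then show ?thesis using v(1) unfolding al_def by blast
      next
        case False
        then have "low v" "ls (e v) (e w)" using v(1) low_not_tp[OF lw] unfolding al_def by blast+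
        then show ?thesis using c \<open>v \<in> T\<close> by blast
      qed
    qed
  next
    fix x y w v assume a: "x \<in> pts p - R" "y \<in> pts q - R" "w \<in> R" "(w, x) \<in> p" "fib x = fib y"
    have lw: "low w" using lowR[OF a(3) _ p a(4)] a(1) by blast
    have fw: "fib w = fib x" using condD(3)[OF p a(4)] .
    have xw: "fib x = fib w" "fib y = fib w" using fw a(5) by simp_all
    note c = cross[OF a(1,2,3) lw xw]
    show "al x y w \<and> (al y w v \<longrightarrow> (v, w) \<in> q \<longrightarrow> al x y v)"
    proof (intro conjI impI)
      show "al x y w" using c by blast
      assume v: "al y w v" "(v, w) \<in> q"
      have "v \<in> T" using condD(1)[OF q v(2)] .
      show "al x y v"
      proof (cases "low y \<and> ls (e v) (e y)")
        case True
        then show ?thesis using v(1) unfolding al_def by blast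
      next
        case False
        then have "low v" "ls (e v) (e w)" using v(1) low_not_tp[OF lw] unfolding al_def by blast+
        then show ?thesis using c \<open>v \<in> T\<close> by blast
      qed
    qed
  qed (use root[OF pq(1)] root[OF pq(2)] in blast)+
  then show False using inc[OF S3(3)[OF pq(1)] S3(3)[OF pq(2)] pq(3)] by blast
qed

end

section \<open>The ring of cones of a finite order\<close>

subsection \<open>The ring of a condition\<close>

abbreviation sd :: "'a set \<Rightarrow> 'a set \<Rightarrow> 'a set" where
  "sd s t \<equiv> (s - t) \<union> (t - s)"

lemma odd_card_sd:
  assumes "finite s" "finite t"
  shows "odd (card (sd s t)) \<longleftrightarrow> odd (card s) \<noteq> odd (card t)"
proof -
  have "card (sd s t) = card (s - t) + card (t - s)" using assms by (intro card_Un_disjoint) auto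
  moreover have "card s = card (s - t) + card (s \<inter> t)" using card_Int_Diff[OF assms(1), of t] by simp
  moreover have "card t = card (t - s) + card (s \<inter> t)" using card_Int_Diff[OF assms(2), of s] by (simp add: Int_commute)
  ultimately show ?thesis by presburger
qed

context poset_data
begin

text \<open>
  \<open>val r s\<close> is the sum, over the field with two elements, of the cones \<open>{z. z \<le> x}\<close> for \<open>x \<in> s\<close> in the
  finite partial order \<open>r\<close>.  The cones form a basis of the ring of subsets of \<open>pts r\<close>, and \<open>mul r\<close> is
  the multiplication of this ring in terms of the basis.
\<close>

definition val :: "('p \<times> 'p) set \<Rightarrow> 'p set \<Rightarrow> 'p set" where
  "val r s = {z \<in> pts r. odd (card {x \<in> s. (z, x) \<in> r})}"

definition mul :: "('p \<times> 'p) set \<Rightarrow> 'p set \<Rightarrow> 'p set \<Rightarrow> 'p set" where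
  "mul r s t = (THE d. d \<subseteq> pts r \<and> val r d = val r s \<inter> val r t)"

lemma finite_sub_pts: "is_cond r \<Longrightarrow> s \<subseteq> pts r \<Longrightarrow> finite s"
  using finite_pts finite_subset by blast

lemma val_sd:
  assumes "is_cond r" "s \<subseteq> pts r" "t \<subseteq> pts r"
  shows "val r (sd s t) = sd (val r s) (val r t)"
proof -
  have "odd (card {x \<in> sd s t. (z, x) \<in> r}) \<longleftrightarrow> odd (card {x \<in> s. (z, x) \<in> r}) \<noteq> odd (card {x \<in> t. (z, x) \<in> r})" for z
  proof -
    have "{x \<in> sd s t. (z, x) \<in> r} = sd {x \<in> s. (z, x) \<in> r} {x \<in> t. (z, x) \<in> r}" by auto
    then show ?thesis using odd_card_sd[of "{x \<in> s. (z, x) \<in> r}" "{x \<in> t. (z, x) \<in> r}"]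
      finite_sub_pts[OF assms(1,2)] finite_sub_pts[OF assms(1,3)] by simp
  qed
  then show ?thesis unfolding val_def by auto
qed

lemma val_empty [simp]: "val r {} = {}"
  by (simp add: val_def)

lemma val_sub: "val r s \<subseteq> pts r"
  by (auto simp: val_def)

lemma maximal_above:
  assumes r: "is_cond r" and s: "s \<subseteq> pts r" "x \<in> s"
  shows "\<exists>y\<in>s. (x, y) \<in> r \<and> (\<forall>z\<in>s. (y, z) \<in> r \<longrightarrow> z = y)"
proof -
  let ?up = "\<lambda>y. {z \<in> s. (y, z) \<in> r}"
  have "x \<in> s \<and> (x, x) \<in> r" using s by auto
  then obtain y where y: "y \<in> s" "(x, y) \<in> r"
    and min: "\<And>z. z \<in> s \<and> (x, z) \<in> r \<Longrightarrow> card (?up y) \<le> card (?up z)"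
    using ex_has_least_nat[of "\<lambda>y. y \<in> s \<and> (x, y) \<in> r" x "\<lambda>y. card (?up y)"] by blast
  have "z = y" if z: "z \<in> s" "(y, z) \<in> r" for z
  proof (rule ccontr)
    assume "z \<noteq> y"
    then have "(z, y) \<notin> r" using cond_antisym[OF r] z by blast
    moreover have "(y, y) \<in> r" using condD(5)[OF r z(2)] .
    ultimately have "?up z \<subset> ?up y" using cond_trans[OF r z(2)] y by blast
    moreover have "finite (?up y)" using finite_sub_pts[OF r s(1)] by simp
    ultimately have "card (?up z) < card (?up y)" by (rule psubset_card_mono[rotated])
    then show False using min[of z] z cond_trans[OF r y(2) z(2)] by simp
  qed
  then show ?thesis using y by blast
qed

text \<open>If no element of \<open>s\<close> except possibly \<open>y\<close> lies above
  \<open>y\<close>, the count is 0 or 1, so its parity decides membership.\<close>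

lemma maximal_mem_val:
  assumes "s \<subseteq> pts r" "y \<in> pts r" "\<And>z. z \<in> s \<Longrightarrow> (y, z) \<in> r \<Longrightarrow> z = y"
  shows "y \<in> val r s \<longleftrightarrow> y \<in> s"
proof -
  have "{x \<in> s. (y, x) \<in> r} = (if y \<in> s then {y} else {})" using assms by auto
  then show ?thesis unfolding val_def using assms(2) by simp
qed

text \<open>A maximal element of \<open>d\<close> above \<open>x\<close> belongs to the value of
  \<open>d\<close>, hence to that of \<open>s\<close>; so the number of elements of \<open>s\<close>
  above it is odd, in particular not zero.\<close>

lemma val_below:
  assumes r: "is_cond r" and d: "d \<subseteq> pts r" and "val r d \<subseteq> val r s" and x: "x \<in> d"
  shows "\<exists>y\<in>s. (x, y) \<in> r"
proof -
  obtain y where y: "y \<in> d" "(x, y) \<in> r" "\<forall>z\<in>d. (y, z) \<in> r \<longrightarrow> z = y"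
    using maximal_above[OF r d x] by blast
  then have "y \<in> val r d" using maximal_mem_val[OF d, of y] d by blast
  then have "y \<in> val r s" using assms(3) by blast
  then have "{z \<in> s. (y, z) \<in> r} \<noteq> {}" unfolding val_def by (auto simp del: Collect_empty_eq)
  then show ?thesis using cond_trans[OF r y(2)] by blast
qed

text \<open>Linear independence of the cones: by \<open>val_below\<close> a nonempty set of points
  cannot have an empty value, and \<open>val\<close> is additive.\<close>

lemma val_eqI:
  assumes r: "is_cond r" and s: "s \<subseteq> pts r" "t \<subseteq> pts r" and "val r s = val r t"
  shows "s = t"
proof -
  have "val r (sd s t) = {}" using val_sd[OF r s] assms(4) by simp
  then have "sd s t = {}" using val_below[OF r, of "sd s t" "{}"] s by auto
  then show ?thesis by blast
qed

text \<open>An injective map of a finite power set into itself is onto, so no explicit inversion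
  formula is needed to express products in terms of cones.\<close>

lemma val_surj:
  assumes r: "is_cond r" and "A \<subseteq> pts r"
  shows "\<exists>d. d \<subseteq> pts r \<and> val r d = A"
proof -
  have "inj_on (val r) (Pow (pts r))" using val_eqI[OF r] by (intro inj_onI) auto
  moreover have "val r ` Pow (pts r) \<subseteq> Pow (pts r)" using val_sub by blast
  ultimately have "val r ` Pow (pts r) = Pow (pts r)"
    using finite_pts[OF r] by (intro endo_inj_surj) auto
  then have "A \<in> val r ` Pow (pts r)" using assms(2) by simp
  then show ?thesis by auto
qed

lemma mul:
  assumes r: "is_cond r" and "s \<subseteq> pts r" "t \<subseteq> pts r"
  shows mul_sub: "mul r s t \<subseteq> pts r" and val_mul: "val r (mul r s t) = val r s \<inter> val r t"
proof -
  obtain d where d: "d \<subseteq> pts r \<and> val r d = val r s \<inter> val r t"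
    using val_surj[OF r, of "val r s \<inter> val r t"] val_sub by blast
  then have "mul r s t = d"
    unfolding mul_def using val_eqI[OF r] by (intro the_equality) auto
  then have "mul r s t \<subseteq> pts r \<and> val r (mul r s t) = val r s \<inter> val r t" using d by simp
  then show "mul r s t \<subseteq> pts r" "val r (mul r s t) = val r s \<inter> val r t" by blast+
qed

lemma mul_eqI:
  assumes "is_cond r" "s \<subseteq> pts r" "t \<subseteq> pts r" "d \<subseteq> pts r" "val r d = val r s \<inter> val r t"
  shows "mul r s t = d"
  using val_eqI[OF assms(1)] mul[OF assms(1-3)] assms(4,5) by simp

text \<open>The old points above \<open>z\<close> form a finite set that is downward directed by the
  last clause of \<open>refines\<close>; so it has a least element \<open>w\<close>, and from the
  old points \<open>z\<close> looks like \<open>w\<close>.\<close>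

lemma least_above:
  assumes r: "is_cond r" and q: "is_cond q" and qr: "refines q r" and x: "(x, x) \<in> r" "(z, x) \<in> q"
  obtains w where "(w, w) \<in> r" "\<And>y. (y, y) \<in> r \<Longrightarrow> (z, y) \<in> q \<longleftrightarrow> (w, y) \<in> r"
proof -
  let ?Z = "{y \<in> pts r. (z, y) \<in> q}"
  have "\<exists>w\<in>?Z. \<forall>y\<in>X. (w, y) \<in> r" if "finite X" "X \<subseteq> ?Z" for X using that
  proof (induction X rule: finite_induct)
    case empty
    then show ?case using x by auto
  next
    case (insert y X)
    then obtain w where w: "w \<in> ?Z" "\<forall>y\<in>X. (w, y) \<in> r" by auto
    obtain v where v: "(v, v) \<in> r" "(z, v) \<in> q" "(v, w) \<in> r" "(v, y) \<in> r"
      using refinesD(3)[OF qr, of w y z] w(1) insert.prems by auto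
    then have "\<forall>u\<in>insert y X. (v, u) \<in> r" using w(2) cond_trans[OF r v(3)] by auto
    then show ?case using v by auto
  qed
  moreover have "finite ?Z" by (rule finite_subset[OF _ finite_pts[OF r]]) blast
  ultimately have "\<exists>w\<in>?Z. \<forall>y\<in>?Z. (w, y) \<in> r" by blast
  then obtain w where w: "w \<in> ?Z" "\<forall>y\<in>?Z. (w, y) \<in> r" by blast
  have "(z, y) \<in> q \<longleftrightarrow> (w, y) \<in> r" if "(y, y) \<in> r" for y
  proof
    assume "(w, y) \<in> r"
    then show "(z, y) \<in> q" using cond_trans[OF q] refinesD(1)[OF qr] w(1) by blast
  qed (use w(2) that in auto)
  then show ?thesis using that w(1) by auto
qed

text \<open>A point of \<open>q\<close> sees every set of old points as its least old upper bound
  does, or lies below none of them. An identity of values that holds in \<open>r\<close> therefore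
  holds at every point of \<open>q\<close>.\<close>

lemma val_refines:
  assumes r: "is_cond r" and q: "is_cond q" and qr: "refines q r" and s: "s \<subseteq> pts r" "t \<subseteq> pts r" "d \<subseteq> pts r"
    and v: "val r d = val r s \<inter> val r t"
  shows "val q d = val q s \<inter> val q t"
proof (rule set_eqI)
  fix z
  show "z \<in> val q d \<longleftrightarrow> z \<in> val q s \<inter> val q t"
  proof (cases "\<exists>x. (x, x) \<in> r \<and> (z, x) \<in> q")
    case True
    then obtain x where "(x, x) \<in> r" "(z, x) \<in> q" by blast
    then obtain w where w: "(w, w) \<in> r" "\<And>y. (y, y) \<in> r \<Longrightarrow> (z, y) \<in> q \<longleftrightarrow> (w, y) \<in> r"
      using least_above[OF r q qr] by blast
    have zq: "(z, z) \<in> q" using True condD(5)[OF q] by blast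
    have "z \<in> val q u \<longleftrightarrow> w \<in> val r u" if "u \<subseteq> pts r" for u
    proof -
      have "{x \<in> u. (z, x) \<in> q} = {x \<in> u. (w, x) \<in> r}" using w(2) that by auto
      then show ?thesis unfolding val_def using zq w(1) by simp
    qed
    then show ?thesis using s v by auto
  next
    case False
    then have "{x \<in> u. (z, x) \<in> q} = {}" if "u \<subseteq> pts r" for u using that by auto
    then have "z \<notin> val q u" if "u \<subseteq> pts r" for u using that unfolding val_def by (auto simp del: Collect_empty_eq)
    then show ?thesis using s by auto
  qed
qed

lemma pts_refines: "refines q r \<Longrightarrow> pts r \<subseteq> pts q"
  using refinesD(1) by auto

lemma mul_refines:
  assumes "is_cond r" "is_cond q" "refines q r" "s \<subseteq> pts r" "t \<subseteq> pts r"
  shows "mul q s t = mul r s t"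
proof (rule mul_eqI[OF assms(2)])
  have "pts r \<subseteq> pts q" using pts_refines[OF assms(3)] .
  then show "s \<subseteq> pts q" "t \<subseteq> pts q" "mul r s t \<subseteq> pts q"
    using assms(4,5) mul_sub[OF assms(1,4,5)] by (meson subset_trans)+
  show "val q (mul r s t) = val q s \<inter> val q t"
    using val_refines[OF assms(1-5) mul_sub[OF assms(1,4,5)] val_mul[OF assms(1,4,5)]] .
qed

subsection \<open>Fibres and ideals\<close>

definition FA :: "'i \<Rightarrow> 'p set set" where
  "FA i = {s. finite s \<and> s \<subseteq> T \<and> (\<forall>x\<in>s. fib x = i)}"

definition down :: "('p \<Rightarrow> bool) \<Rightarrow> bool" where
  "down L \<longleftrightarrow> (\<forall>x y. L y \<longrightarrow> prec x y \<longrightarrow> L x)"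

lemma mul_fibre:
  assumes r: "is_cond r" and s: "s \<subseteq> pts r" "t \<subseteq> pts r" "s \<in> FA i"
  shows "mul r s t \<in> FA i"
proof -
  have "x \<in> T \<and> fib x = i" if x: "x \<in> mul r s t" for x
  proof -
    obtain y where "y \<in> s" "(x, y) \<in> r"
      using val_below[OF r mul_sub[OF r s(1,2)] _ x, of s] val_mul[OF r s(1,2)] by blast
    then show ?thesis using condD[OF r] s(3) unfolding FA_def by auto
  qed
  then show ?thesis unfolding FA_def using finite_sub_pts[OF r mul_sub[OF r s(1,2)]] by blast
qed

lemma sd_FA: "s \<in> FA i \<Longrightarrow> t \<in> FA i \<Longrightarrow> sd s t \<in> FA i"
  unfolding FA_def by blast

lemma down_below: "is_cond r \<Longrightarrow> down L \<Longrightarrow> L y \<Longrightarrow> (x, y) \<in> r \<Longrightarrow> L x"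
  unfolding down_def using condD(4) by blast

text \<open>Elements below \<open>s\<close> in the ring have their points below points of
  \<open>s\<close>. This is how bounds on levels pass to products and differences.\<close>

lemma val_down:
  assumes "is_cond r" "d \<subseteq> pts r" "val r d \<subseteq> val r s" "down L" "\<And>x. x \<in> s \<Longrightarrow> L x" "x \<in> d"
  shows "L x"
  using val_below[OF assms(1-3,6)] down_below[OF assms(1,4)] assms(5) by blast

lemma val_apex:
  assumes r: "is_cond r" and a: "(apex i, apex i) \<in> r" "fib (apex i) = i"
  shows "val r {apex i} = {x \<in> pts r. fib x = i}"
proof -
  have "{x \<in> {apex i}. (z, x) \<in> r} = (if fib z = i then {apex i} else {})" if "(z, z) \<in> r" for z
  proof (cases "fib z = i")
    case True
    then have "(z, apex i) \<in> r" using condD(7)[OF r that] by simp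
    then show ?thesis using True by auto
  next
    case False
    then have "(z, apex i) \<notin> r" using condD(3)[OF r, of z "apex i"] a(2) by auto
    then show ?thesis using False by auto
  qed
  then show ?thesis unfolding val_def by (auto split: if_splits)
qed

lemma val_fibre:
  assumes r: "is_cond r" and s: "s \<subseteq> pts r" "s \<in> FA i"
  shows "val r s \<subseteq> {x \<in> pts r. fib x = i}"
proof
  fix z assume z: "z \<in> val r s"
  then have "{x \<in> s. (z, x) \<in> r} \<noteq> {}" unfolding val_def by (auto simp del: Collect_empty_eq)
  then show "z \<in> {x \<in> pts r. fib x = i}"
    using z val_sub s(2) condD(3)[OF r] unfolding FA_def by fastforce
qed

text \<open>A new point just below \<open>y\<close> is an atom of the ring, below \<open>s\<close> iff \<open>y\<close> belongs to the value of \<open>s\<close>.\<close>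

lemma new_atom:
  assumes p: "is_cond p" and y: "(y, y) \<in> p" and z: "z \<in> T" "(z, z) \<notin> p" "fib z = fib y" "prec z y"
    and s: "s \<subseteq> pts p" "y \<in> val p s"
  obtains r where "is_cond r" "refines r p" "(z, z) \<in> r" "mul r {z} s = {z}"
proof -
  define r where "r = p \<union> {(z, z)} \<union> {(z, u) | u. (y, u) \<in> p}"
  have r: "is_cond r" "refines r p" using add_point[OF p y z] unfolding r_def by blast+
  have zz: "(z, z) \<in> r" unfolding r_def by blast
  have np: "(a, z) \<notin> p" for a using condD(6)[OF p] z(2) by blast
  have 1: "(w, z) \<in> r \<longleftrightarrow> w = z" for w unfolding r_def using np y z(2) by auto
  have sp: "s \<subseteq> pts r" using s(1) pts_refines[OF r(2)] by blast
  have "{x \<in> s. (z, x) \<in> r} = {x \<in> s. (y, x) \<in> p}"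
    unfolding r_def using s(1) np condD(5)[OF p] z(2) by auto
  then have zs: "z \<in> val r s" using s(2) zz unfolding val_def by simp
  have vz: "val r {z} = {z}"
  proof -
    have "{x \<in> {z}. (w, x) \<in> r} = (if w = z then {z} else {})" for w using 1 by auto
    then show ?thesis unfolding val_def using zz by (auto split: if_splits)
  qed
  have "mul r {z} s = {z}"
    by (rule mul_eqI[OF r(1) _ sp]) (use zz zs vz in auto)
  then show ?thesis using that r zz by blast
qed

end

section \<open>Names for the generic algebra and for its quotients\<close>

section \<open>The generic Boolean algebras\<close>

locale algebra_forcing = zfc_universe E + poset_data T fib prec apex al
  for E :: "'v \<Rightarrow> 'v \<Rightarrow> bool" and T :: "'v set" and fib :: "'v \<Rightarrow> 'i" and prec apex al +
  assumes small_T: "small E T"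
begin

definition enc :: "('v \<times> 'v) set \<Rightarrow> 'v" where
  "enc r = vset E ((\<lambda>(x, y). vpair E x y) ` r)"

definition rel :: "'v \<Rightarrow> ('v \<times> 'v) set" where
  "rel p = (THE r. is_cond r \<and> enc r = p)"

definition Pos :: "'v forcing_notion" where
  "Pos = \<lparr>conds = vset E (enc ` Collect is_cond),
     leq = (\<lambda>q p. \<exists>s r. is_cond s \<and> is_cond r \<and> q = enc s \<and> p = enc r \<and> refines s r),
     maxc = enc {}\<rparr>"

lemma enc_inj: "is_cond r \<Longrightarrow> is_cond s \<Longrightarrow> enc r = enc s \<longleftrightarrow> r = s"
proof -
  assume "is_cond r" "is_cond s"
  then have "finite r" "finite s" using cond_finite by blast+
  then have "enc r = enc s \<longleftrightarrow> (\<lambda>(x, y). vpair E x y) ` r = (\<lambda>(x, y). vpair E x y) ` s"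
    unfolding enc_def by (intro vset_inject) auto
  moreover have "inj (\<lambda>(x, y). vpair E x y)" by (auto simp: inj_def)
  ultimately show ?thesis by (simp add: inj_image_eq_iff)
qed

lemma rel_enc [simp]: "is_cond r \<Longrightarrow> rel (enc r) = r"
  unfolding rel_def using enc_inj by (intro the_equality) auto

lemma small_conds: "small E (enc ` Collect is_cond)"
proof -
  have "enc ` Collect is_cond = vset E ` (\<lambda>r. (\<lambda>(x, y). vpair E x y) ` r) ` Collect is_cond"
    unfolding enc_def by (simp add: image_image)
  moreover have "small E \<dots>"
  proof (rule small_vset_image)
    show "small E {vpair E x y | x y. x \<in> T \<and> y \<in> T}" using small_pairs[OF small_T, of "\<lambda>_. T"] small_T by simp
    fix S assume "S \<in> (\<lambda>r. (\<lambda>(x, y). vpair E x y) ` r) ` Collect is_cond"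
    then obtain r where r: "is_cond r" "S = (\<lambda>(x, y). vpair E x y) ` r" by blast
    show "S \<subseteq> {vpair E x y | x y. x \<in> T \<and> y \<in> T}" unfolding r(2) using condD(1,2)[OF r(1)] by auto
  qed
  ultimately show ?thesis by simp
qed

lemma cond_iff: "E p (conds Pos) \<longleftrightarrow> (\<exists>r. is_cond r \<and> p = enc r)"
  unfolding Pos_def using mem_vset[OF small_conds] by auto

sublocale forcing E Pos
proof unfold_locales
  show "leq Pos q p \<Longrightarrow> E q (conds Pos) \<and> E p (conds Pos)" for q p
    unfolding cond_iff by (auto simp: Pos_def)
  show "E p (conds Pos) \<Longrightarrow> leq Pos p p" for p
    unfolding cond_iff using refines_refl by (auto simp: Pos_def)
  show "leq Pos r q \<Longrightarrow> leq Pos q p \<Longrightarrow> leq Pos r p" for p q r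
    using refines_trans enc_inj by (simp add: Pos_def) metis
  show "E p (conds Pos) \<Longrightarrow> leq Pos p (maxc Pos)" for p
    unfolding cond_iff
  proof (elim exE conjE)
    fix r assume "is_cond r" "p = enc r"
    then have "\<exists>s r'. is_cond s \<and> is_cond r' \<and> p = enc s \<and> enc {} = enc r' \<and> refines s r'"
      by (metis cond_empty refines_empty)
    then show "leq Pos p (maxc Pos)" by (simp add: Pos_def)
  qed
  show "E (maxc Pos) (conds Pos)"
    unfolding cond_iff by (intro exI[of _ "{}"]) (simp add: Pos_def)
qed

end

context algebra_forcing
begin

abbreviation le_Pos (infix "\<preceq>" 50) where "q \<preceq> p \<equiv> extends E Pos q p"
abbreviation frc_Pos (infix "\<tturnstile>" 50) where "p \<tturnstile> \<phi> \<equiv> forces E Pos \<phi> p"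

lemma rel_cond: "cond p \<Longrightarrow> is_cond (rel p)" "cond p \<Longrightarrow> enc (rel p) = p"
  unfolding cond_iff by auto

lemma cond_enc: "is_cond r \<Longrightarrow> cond (enc r)"
  unfolding cond_iff by blast

lemma le_iff: "q \<preceq> p \<longleftrightarrow> cond q \<and> cond p \<and> refines (rel q) (rel p)"
proof -
  have "leq Pos q p \<longleftrightarrow> (\<exists>s r. is_cond s \<and> is_cond r \<and> q = enc s \<and> p = enc r \<and> refines s r)"
    by (simp add: Pos_def)
  moreover have "(\<exists>s r. is_cond s \<and> is_cond r \<and> q = enc s \<and> p = enc r \<and> refines s r) \<longleftrightarrow>
      cond q \<and> cond p \<and> refines (rel q) (rel p)"
    unfolding cond_iff by (metis rel_enc)
  ultimately show ?thesis unfolding extends_def by metis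
qed

lemma le_refines: "q \<preceq> p \<Longrightarrow> refines (rel q) (rel p)"
  by (simp add: le_iff)

lemma pts_le: "q \<preceq> p \<Longrightarrow> pts (rel p) \<subseteq> pts (rel q)"
  using pts_refines le_refines by blast

lemma extend_support:
  assumes "cond p" "finite S" "S \<subseteq> T"
  obtains q where "q \<preceq> p" "S \<subseteq> pts (rel q)"
proof -
  obtain r where "is_cond r" "refines r (rel p)" "S \<subseteq> pts r"
    using dense_points[OF assms(2,3) rel_cond(1)[OF assms(1)]] by blast
  then have "enc r \<preceq> p" "S \<subseteq> pts (rel (enc r))" using assms(1) cond_enc by (auto simp: le_iff)
  then show ?thesis using that by blast
qed

lemma support_forces:
  assumes "finite S" "S \<subseteq> T" "\<And>q. q \<preceq> p \<Longrightarrow> S \<subseteq> pts (rel q) \<Longrightarrow> q \<tturnstile> \<phi>"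
  shows "p \<tturnstile> \<phi>"
proof (rule forces_dense)
  fix q assume q: "q \<preceq> p"
  obtain r where r: "r \<preceq> q" "S \<subseteq> pts (rel r)" using extend_support[OF le_cond(1)[OF q] assms(1,2)] .
  then show "\<exists>r. r \<preceq> q \<and> r \<tturnstile> \<phi>" using assms(3) le_trans[OF r(1) q] by blast
qed

lemma ccc_Pos:
  assumes "\<And>S. (\<And>r. r \<in> S \<Longrightarrow> is_cond r) \<Longrightarrow>
    (\<And>p q. p \<in> S \<Longrightarrow> q \<in> S \<Longrightarrow> p \<noteq> q \<Longrightarrow> \<not> (\<exists>r. is_cond r \<and> refines r p \<and> refines r q)) \<Longrightarrow> countable S"
  shows ccc
  unfolding ccc_def
proof (intro allI impI, elim conjE)
  fix A assume A: "\<forall>p\<in>A. cond p" "\<forall>p\<in>A. \<forall>q\<in>A. p \<noteq> q \<longrightarrow> \<not> (\<exists>r. r \<preceq> p \<and> r \<preceq> q)"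
  have "countable (rel ` A)"
  proof (rule assms)
    fix r assume "r \<in> rel ` A"
    then show "is_cond r" using A(1) rel_cond(1) by blast
  next
    fix r s assume rs: "r \<in> rel ` A" "s \<in> rel ` A" "r \<noteq> s"
    then obtain p q where pq: "p \<in> A" "q \<in> A" "r = rel p" "s = rel q" by blast
    then have "p \<noteq> q" using rs(3) by blast
    show "\<not> (\<exists>t. is_cond t \<and> refines t r \<and> refines t s)"
    proof
      assume "\<exists>t. is_cond t \<and> refines t r \<and> refines t s"
      then obtain t where "is_cond t" "refines t r" "refines t s" by blast
      then have "enc t \<preceq> p \<and> enc t \<preceq> q" using pq A(1) cond_enc by (auto simp: le_iff)
      then show False using A(2) pq(1,2) \<open>p \<noteq> q\<close> by blast
    qed
  qed
  moreover have "inj_on rel A"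
  proof (rule inj_onI)
    fix p q assume "p \<in> A" "q \<in> A" "rel p = rel q"
    then show "p = q" using rel_cond(2) A(1) by metis
  qed
  ultimately show "countable A" using countable_image_inj_on by blast
qed

subsection \<open>Ring computations\<close>

text \<open>For these elements the condition \<open>p\<close> already decides all products and
  joins.\<close>

definition LS :: "'i \<Rightarrow> 'v \<Rightarrow> 'v set set" where
  "LS i p = {s \<in> FA i. s \<subseteq> pts (rel p)}"

definition mt :: "'v \<Rightarrow> 'v set \<Rightarrow> 'v set \<Rightarrow> 'v set" where
  "mt p s t = mul (rel p) s t"

text \<open>The join of a Boolean ring, \<open>s + t + st\<close>, with symmetric difference as
  addition.\<close>

definition jn :: "'v \<Rightarrow> 'v set \<Rightarrow> 'v set \<Rightarrow> 'v set" where
  "jn p s t = sd (sd s t) (mt p s t)"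

abbreviation vl :: "'v \<Rightarrow> 'v set \<Rightarrow> 'v set" where
  "vl p \<equiv> val (rel p)"

lemma LS_mono: "q \<preceq> p \<Longrightarrow> s \<in> LS i p \<Longrightarrow> s \<in> LS i q"
  unfolding LS_def using pts_le by blast

lemma LS_FA: "s \<in> LS i p \<Longrightarrow> s \<in> FA i"
  by (simp add: LS_def)

lemma empty_LS [simp]: "{} \<in> LS i p"
  by (simp add: LS_def FA_def)

lemma sd_LS [simp]: "s \<in> LS i p \<Longrightarrow> t \<in> LS i p \<Longrightarrow> sd s t \<in> LS i p"
  unfolding LS_def using sd_FA by blast

lemma mt_LS [simp]: "cond p \<Longrightarrow> s \<in> LS i p \<Longrightarrow> t \<in> LS i p \<Longrightarrow> mt p s t \<in> LS i p"
  using mul_fibre[OF rel_cond(1), of p s t i] mul_sub[OF rel_cond(1), of p s t] unfolding LS_def mt_def by simp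

lemma jn_LS [simp]: "cond p \<Longrightarrow> s \<in> LS i p \<Longrightarrow> t \<in> LS i p \<Longrightarrow> jn p s t \<in> LS i p"
  unfolding jn_def by simp

lemma vl_mt [simp]: "cond p \<Longrightarrow> s \<in> LS i p \<Longrightarrow> t \<in> LS i p \<Longrightarrow> vl p (mt p s t) = vl p s \<inter> vl p t"
  unfolding LS_def mt_def using val_mul rel_cond(1) by blast

lemma vl_sd [simp]: "cond p \<Longrightarrow> s \<in> LS i p \<Longrightarrow> t \<in> LS i p \<Longrightarrow> vl p (sd s t) = sd (vl p s) (vl p t)"
  unfolding LS_def using val_sd rel_cond(1) by blast

lemma vl_jn [simp]: "cond p \<Longrightarrow> s \<in> LS i p \<Longrightarrow> t \<in> LS i p \<Longrightarrow> vl p (jn p s t) = vl p s \<union> vl p t"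
  unfolding jn_def using vl_sd[of p "sd s t" i "mt p s t"] by auto

lemma LS_eqI: "cond p \<Longrightarrow> s \<in> LS i p \<Longrightarrow> t \<in> LS i p \<Longrightarrow> vl p s = vl p t \<Longrightarrow> s = t"
  unfolding LS_def using val_eqI rel_cond(1) by blast

lemma mt_le: "q \<preceq> p \<Longrightarrow> s \<in> LS i p \<Longrightarrow> t \<in> LS i p \<Longrightarrow> mt q s t = mt p s t"
  using mul_refines[of "rel p" "rel q" s t] rel_cond(1) le_cond le_refines unfolding LS_def mt_def by simp

lemma jn_le: "q \<preceq> p \<Longrightarrow> s \<in> LS i p \<Longrightarrow> t \<in> LS i p \<Longrightarrow> jn q s t = jn p s t"
  unfolding jn_def using mt_le by simp

lemma down_LS:
  assumes "cond p" "d \<in> LS i p" "vl p d \<subseteq> vl p s" "down L" "\<And>x. x \<in> s \<Longrightarrow> L x" "x \<in> d"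
  shows "L x"
  using val_down[OF rel_cond(1)[OF assms(1)] _ assms(3-6)] assms(2) unfolding LS_def by blast

end

locale fibre = algebra_forcing E T fib prec apex al
  for E :: "'v \<Rightarrow> 'v \<Rightarrow> bool" and T :: "'v set" and fib :: "'v \<Rightarrow> 'i" and prec apex al +
  fixes i :: 'i
  assumes apex_i: "apex i \<in> T" "fib (apex i) = i"
begin

lemma vl_one [simp]: "cond p \<Longrightarrow> {apex i} \<in> LS i p \<Longrightarrow> vl p {apex i} = {x \<in> pts (rel p). fib x = i}"
  unfolding LS_def using val_apex[OF rel_cond(1) _ apex_i(2)] by auto

lemma vl_fibre: "cond p \<Longrightarrow> s \<in> LS i p \<Longrightarrow> vl p s \<subseteq> {x \<in> pts (rel p). fib x = i}"
  unfolding LS_def using val_fibre rel_cond(1) by blast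

lemma one_FA: "{apex i} \<in> FA i"
  using apex_i by (simp add: FA_def)

text \<open>\<open>val\<close> embeds the ring into the subsets of a finite set, so each law becomes
  an identity of sets. The laws with the unit use that values stay within the fibre, where adding
  the unit is complementation.\<close>

lemma ring_laws:
  assumes p: "cond p" and ls: "s \<in> LS i p" "t \<in> LS i p" "u \<in> LS i p" and o: "{apex i} \<in> LS i p"
  shows "mt p s t = mt p t s" "jn p s t = jn p t s"
    "mt p (mt p s t) u = mt p s (mt p t u)" "jn p (jn p s t) u = jn p s (jn p t u)"
    "mt p s (jn p t u) = jn p (mt p s t) (mt p s u)" "jn p s (mt p t u) = mt p (jn p s t) (jn p s u)"
    "mt p s {apex i} = s" "jn p s {} = s"
    "mt p s (sd s {apex i}) = {}" "jn p s (sd s {apex i}) = {apex i}" "mt p s s = s"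
    "jn p (mt p s t) (sd s (mt p s t)) = s" "mt p s (sd t {apex i}) = sd s (mt p s t)"
    "jn p (mt p s (sd t {apex i})) (mt p (sd s {apex i}) t) = sd s t"
proof -
  note v = vl_mt[OF p, of _ i] vl_jn[OF p, of _ i] vl_sd[OF p, of _ i] mt_LS[OF p, of _ i] jn_LS[OF p, of _ i]
    sd_LS[of _ i p] vl_one[OF p o] ls o val_empty empty_LS
  note f = vl_fibre[OF p ls(1)] vl_fibre[OF p ls(2)] vl_fibre[OF p ls(3)]
  note eq = LS_eqI[OF p, of _ i]
  show "mt p s t = mt p t s" by (rule eq) (simp_all only: v Int_commute)
  show "jn p s t = jn p t s" by (rule eq) (simp_all only: v Un_commute)
  show "mt p (mt p s t) u = mt p s (mt p t u)" by (rule eq) (simp_all only: v Int_assoc)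
  show "jn p (jn p s t) u = jn p s (jn p t u)" by (rule eq) (simp_all only: v Un_assoc)
  show "mt p s (jn p t u) = jn p (mt p s t) (mt p s u)" by (rule eq) (simp_all only: v Int_Un_distrib)
  show "jn p s (mt p t u) = mt p (jn p s t) (jn p s u)" by (rule eq) (simp_all only: v Un_Int_distrib)
  show "mt p s {apex i} = s" by (rule eq) (simp_all only: v, use f in blast)
  show "jn p s {} = s" by (rule eq) (simp_all only: v Un_empty_right)
  show "mt p s (sd s {apex i}) = {}" by (rule eq) (simp_all only: v, use f in blast)
  show "jn p s (sd s {apex i}) = {apex i}" by (rule eq) (simp_all only: v, use f in blast)
  show "mt p s s = s" by (rule eq) (simp_all only: v Int_absorb)
  show "jn p (mt p s t) (sd s (mt p s t)) = s" by (rule eq) (simp_all only: v, blast)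
  show "mt p s (sd t {apex i}) = sd s (mt p s t)" by (rule eq) (simp_all only: v, use f in blast)
  show "jn p (mt p s (sd t {apex i})) (mt p (sd s {apex i}) t) = sd s t" by (rule eq) (simp_all only: v, use f in blast)
qed

end

text \<open>One construction serves the algebra itself and its Cantor-Bendixson quotients:
  \<open>L\<close> describes the points allowed in elements of the ideal, and \<open>pi\<close> maps
  a finite set to its class. In the first instance \<open>L\<close> is empty and \<open>pi\<close>
  codes the set; in the second \<open>L\<close> bounds levels and \<open>pi\<close> is the
  coset.\<close>

locale quotient_algebra = fibre E T fib prec apex al i
  for E :: "'v \<Rightarrow> 'v \<Rightarrow> bool" and T :: "'v set" and fib :: "'v \<Rightarrow> 'i" and prec apex al i +
  fixes L :: "'v \<Rightarrow> bool" and pi :: "'v set \<Rightarrow> 'v"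
  assumes down_L: "down L"
    and pi_eq: "s \<in> FA i \<Longrightarrow> t \<in> FA i \<Longrightarrow> pi s = pi t \<longleftrightarrow> (\<forall>x\<in>sd s t. L x)"
begin

definition X :: 'v where
  "X = vset E (pi ` FA i)"

text \<open>Replacement applies to elements of the universe, so \<open>f\<close> is transported to
  the codes \<open>vset E s\<close>, from which \<open>ext E\<close> recovers the finite
  set.\<close>

lemma small_FA: "small E (f ` FA i)"
proof -
  have "small E (vset E ` FA i)" by (rule small_vset_image[OF small_T]) (auto simp: FA_def)
  then have "small E ((\<lambda>x. f (ext E x)) ` vset E ` FA i)" by (rule small_image)
  moreover have "(\<lambda>x. f (ext E x)) ` vset E ` FA i = f ` FA i"
    unfolding image_image by (rule image_cong) (auto simp: FA_def intro!: arg_cong[where f = f] ext_vset)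
  ultimately show ?thesis by simp
qed

lemma mem_X [simp]: "E x X \<longleftrightarrow> (\<exists>s\<in>FA i. x = pi s)"
  unfolding X_def using mem_vset[OF small_FA] by blast

definition XX :: 'v where
  "XX = vset E {vpair E x y | x y. x \<in> ext E X \<and> y \<in> ext E X}"

lemma mem_XX [simp]: "E z XX \<longleftrightarrow> (\<exists>x y. E x X \<and> E y X \<and> z = vpair E x y)"
  unfolding XX_def using mem_vset[OF small_pairs[of "ext E X" "\<lambda>_. ext E X"]] by auto

definition XXX :: 'v where
  "XXX = vset E {vpair E x y | x y. x \<in> ext E XX \<and> y \<in> ext E X}"

lemma mem_XXX [simp]: "E z XXX \<longleftrightarrow> (\<exists>x y. E x XX \<and> E y X \<and> z = vpair E x y)"
  unfolding XXX_def using mem_vset[OF small_pairs[of "ext E XX" "\<lambda>_. ext E X"]] by auto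

definition triple :: "('v \<Rightarrow> 'v set \<Rightarrow> 'v set \<Rightarrow> 'v set) \<Rightarrow> 'v \<Rightarrow> 'v set \<Rightarrow> 'v set \<Rightarrow> 'v" where
  "triple f p s t = vpair E (vpair E (pi s) (pi t)) (pi (f p s t))"

text \<open>The entry for \<open>s\<close> and \<open>t\<close> is attached to every condition that
  contains their points, with the value computed there. For a \<open>good\<close> operation
  extensions compute the same value, so the entries are consistent.\<close>

definition opn :: "('v \<Rightarrow> 'v set \<Rightarrow> 'v set \<Rightarrow> 'v set) \<Rightarrow> 'v" where
  "opn f = vset E {vpair E (ck (triple f p s t)) p | p s t. cond p \<and> s \<in> LS i p \<and> t \<in> LS i p}"

definition good :: "('v \<Rightarrow> 'v set \<Rightarrow> 'v set \<Rightarrow> 'v set) \<Rightarrow> bool" where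
  "good f \<longleftrightarrow> (\<forall>p s t. cond p \<longrightarrow> s \<in> LS i p \<longrightarrow> t \<in> LS i p \<longrightarrow> f p s t \<in> LS i p \<and>
     (\<forall>q. q \<preceq> p \<longrightarrow> f q s t = f p s t) \<and>
     (\<forall>s'\<in>LS i p. \<forall>t'\<in>LS i p. pi s = pi s' \<longrightarrow> pi t = pi t' \<longrightarrow> pi (f p s t) = pi (f p s' t')))"

lemma good_LS: "good f \<Longrightarrow> cond p \<Longrightarrow> s \<in> LS i p \<Longrightarrow> t \<in> LS i p \<Longrightarrow> f p s t \<in> LS i p"
  unfolding good_def by blast

lemma good_le: "good f \<Longrightarrow> q \<preceq> p \<Longrightarrow> s \<in> LS i p \<Longrightarrow> t \<in> LS i p \<Longrightarrow> f q s t = f p s t"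
  unfolding good_def using le_cond(2) by blast

lemma good_pi:
  assumes "good f" "cond p" "s \<in> LS i p" "t \<in> LS i p" "s' \<in> LS i p" "t' \<in> LS i p" "pi s = pi s'" "pi t = pi t'"
  shows "pi (f p s t) = pi (f p s' t')"
  using assms unfolding good_def by blast

lemma pi_eq_LS: "s \<in> LS i p \<Longrightarrow> t \<in> LS i p \<Longrightarrow> pi s = pi t \<longleftrightarrow> (\<forall>x\<in>sd s t. L x)"
  using pi_eq LS_FA by blast

text \<open>The difference of the two products has its value inside the union of the values of
  \<open>sd s s'\<close> and \<open>sd t t'\<close>. The join representing this union has all its
  points in \<open>L\<close>, and as \<open>L\<close> is downward closed, so has the
  difference.\<close>

lemma good_mt: "good mt"
  unfolding good_def
proof (intro allI impI conjI ballI)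
  fix p s t s' t' assume p: "cond p" and st: "s \<in> LS i p" "t \<in> LS i p" "s' \<in> LS i p" "t' \<in> LS i p"
    and eq: "pi s = pi s'" "pi t = pi t'"
  let ?d = "sd (mt p s t) (mt p s' t')"
  have "vl p ?d \<subseteq> vl p (jn p (sd s s') (sd t t'))"
    using p st by (auto simp: vl_sd[of _ _ i] vl_jn[of _ _ i])
  moreover have base: "L x" if "x \<in> sd s s' \<union> sd t t'" for x
    using eq that iffD1[OF pi_eq_LS[OF st(1,3)]] iffD1[OF pi_eq_LS[OF st(2,4)]] by blast
  moreover have "L x" if x: "x \<in> jn p (sd s s') (sd t t')" for x
  proof (cases "x \<in> sd s s' \<union> sd t t'")
    case False
    then have xm: "x \<in> mt p (sd s s') (sd t t')" using x unfolding jn_def by blast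
    have ls: "sd s s' \<in> LS i p" "sd t t' \<in> LS i p" using st by simp_all
    have "vl p (mt p (sd s s') (sd t t')) \<subseteq> vl p (sd s s')" using vl_mt[OF p ls] by blast
    then show ?thesis using down_LS[OF p mt_LS[OF p ls] _ down_L _ xm] base by blast
  qed (use base in blast)
  ultimately have "L x" if "x \<in> ?d" for x
    using down_LS[OF p sd_LS[OF mt_LS[OF p st(1,2)] mt_LS[OF p st(3,4)]] _ down_L _ that] by blast
  then show "pi (mt p s t) = pi (mt p s' t')"
    using iffD2[OF pi_eq_LS[OF mt_LS[OF p st(1,2)] mt_LS[OF p st(3,4)]]] by blast
qed (use mt_le in auto)

lemma good_jn: "good jn"
  unfolding good_def
proof (intro allI impI conjI ballI)
  fix p s t s' t' assume p: "cond p" and st: "s \<in> LS i p" "t \<in> LS i p" "s' \<in> LS i p" "t' \<in> LS i p"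
    and eq: "pi s = pi s'" "pi t = pi t'"
  have "pi (mt p s t) = pi (mt p s' t')" using good_pi[OF good_mt p st eq] .
  then have "\<forall>x\<in>sd (mt p s t) (mt p s' t'). L x"
    using iffD1[OF pi_eq_LS[OF mt_LS[OF p st(1,2)] mt_LS[OF p st(3,4)]]] by blast
  moreover have "\<forall>x\<in>sd s s'. L x" "\<forall>x\<in>sd t t'. L x"
    using eq iffD1[OF pi_eq_LS[OF st(1,3)]] iffD1[OF pi_eq_LS[OF st(2,4)]] by blast+
  ultimately have "\<forall>x\<in>sd (jn p s t) (jn p s' t'). L x" unfolding jn_def by blast
  then show "pi (jn p s t) = pi (jn p s' t')"
    using iffD2[OF pi_eq_LS[OF jn_LS[OF p st(1,2)] jn_LS[OF p st(3,4)]]] by blast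
qed (use jn_le in auto)

lemma small_opn: "small E {vpair E (ck (triple f p s t)) p | p s t. cond p \<and> s \<in> LS i p \<and> t \<in> LS i p}"
proof -
  have "small E (\<Union>p\<in>ext E (conds Pos). \<Union>s\<in>vset E ` FA i. (\<lambda>t. vpair E (ck (triple f p (ext E s) (ext E t))) p) ` vset E ` FA i)"
    by (intro small_UN small_image[OF small_FA[of "vset E"]] small_FA small_ext)
  moreover have "{vpair E (ck (triple f p s t)) p | p s t. cond p \<and> s \<in> LS i p \<and> t \<in> LS i p} \<subseteq>
      (\<Union>p\<in>ext E (conds Pos). \<Union>s\<in>vset E ` FA i. (\<lambda>t. vpair E (ck (triple f p (ext E s) (ext E t))) p) ` vset E ` FA i)"
  proof
    fix z assume "z \<in> {vpair E (ck (triple f p s t)) p | p s t. cond p \<and> s \<in> LS i p \<and> t \<in> LS i p}"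
    then obtain p s t where z: "z = vpair E (ck (triple f p s t)) p" "cond p" "s \<in> FA i" "t \<in> FA i"
      using LS_FA by blast
    then have "finite s" "finite t" by (auto simp: FA_def)
    then have "ext E (vset E s) = s" "ext E (vset E t) = t" using small_finite by auto
    then have "z = vpair E (ck (triple f p (ext E (vset E s)) (ext E (vset E t)))) p" using z(1) by simp
    then have "z \<in> (\<lambda>t. vpair E (ck (triple f p (ext E (vset E s)) (ext E t))) p) ` vset E ` FA i"
      using z(4) by blast
    then show "z \<in> (\<Union>p\<in>ext E (conds Pos). \<Union>s\<in>vset E ` FA i. (\<lambda>t. vpair E (ck (triple f p (ext E s) (ext E t))) p) ` vset E ` FA i)"
      using z(2,3) mem_ext[of p "conds Pos"] by blast
  qed
  ultimately show ?thesis by (rule small_subset)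
qed

lemma mem_opn: "E z (opn f) \<longleftrightarrow> (\<exists>p s t. z = vpair E (ck (triple f p s t)) p \<and> cond p \<and> s \<in> LS i p \<and> t \<in> LS i p)"
  unfolding opn_def using mem_vset[OF small_opn] by auto

lemma name_opn [simp]: "name (opn f)"
  by (rule is_name.intros) (use mem_opn name_check in blast)

lemma opn_memI:
  assumes "s \<in> LS i p" "t \<in> LS i p"
  shows "p \<tturnstile> (ck (triple f p s t) \<^bold>\<in> opn f)"
proof (cases "cond p")
  case True
  then have "E (vpair E (ck (triple f p s t)) p) (opn f)" using mem_opn assms by blast
  then show ?thesis using le_refl[OF le_cond(1)] forces_eq_refl unfolding forces.simps forces_mem_def by blast
qed (rule not_cond_forces)

lemma opn_mem_dense:
  assumes "good f" "p \<tturnstile> (u \<^bold>\<in> opn f)" "q \<preceq> p"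
  shows "\<exists>r s t. r \<preceq> q \<and> s \<in> LS i r \<and> t \<in> LS i r \<and> r \<tturnstile> (u \<^bold>= ck (triple f r s t))"
proof -
  obtain r w t where r: "r \<preceq> q" "E (vpair E w t) (opn f)" "r \<preceq> t" "r \<tturnstile> (u \<^bold>= w)"
    using assms(2,3) unfolding forces.simps forces_mem_def by blast
  obtain s s' where s: "w = ck (triple f t s s')" "cond t" "s \<in> LS i t" "s' \<in> LS i t"
    using r(2) unfolding mem_opn by auto
  have "triple f t s s' = triple f r s s'" unfolding triple_def using good_le[OF assms(1) r(3) s(3,4)] by simp
  then show ?thesis using r s LS_mono by metis
qed

lemma opn_sub: "good f \<Longrightarrow> p \<tturnstile> (u \<^bold>\<in> opn f) \<Longrightarrow> p \<tturnstile> (u \<^bold>\<in> ck XXX)"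
proof (rule forces_dense)
  fix q assume f: "good f" "p \<tturnstile> (u \<^bold>\<in> opn f)" "q \<preceq> p"
  obtain r s t where r: "r \<preceq> q" "s \<in> LS i r" "t \<in> LS i r" "r \<tturnstile> (u \<^bold>= ck (triple f r s t))"
    using opn_mem_dense[OF f] by blast
  have "E (triple f r s t) XXX"
    unfolding triple_def using r(2,3) LS_FA good_LS[OF f(1) le_cond(1)[OF r(1)] r(2,3)] by auto
  then have "r \<tturnstile> (u \<^bold>\<in> ck XXX)" using mem_eq_left[OF check_memI eq_sym[OF r(4)]] by blast
  then show "\<exists>r. r \<preceq> q \<and> r \<tturnstile> (u \<^bold>\<in> ck XXX)" using r by blast
qed

lemma opn_value:
  assumes f: "good f" and p: "cond p" and st: "s \<in> LS i p" "t \<in> LS i p"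
    and "p \<tturnstile> (ck (vpair E (vpair E (pi s) (pi t)) b) \<^bold>\<in> opn f)"
  shows "b = pi (f p s t)"
proof -
  obtain r s' t' where r: "r \<preceq> p" "s' \<in> LS i r" "t' \<in> LS i r"
    "r \<tturnstile> (ck (vpair E (vpair E (pi s) (pi t)) b) \<^bold>= ck (triple f r s' t'))"
    using opn_mem_dense[OF f assms(5) le_refl[OF p]] by blast
  then have "pi s = pi s'" "pi t = pi t'" "b = pi (f r s' t')"
    using le_cond(1)[OF r(1)] by (auto simp: triple_def)
  moreover have "pi (f r s t) = pi (f r s' t')"
    using good_pi[OF f le_cond(1)[OF r(1)] LS_mono[OF r(1) st(1)] LS_mono[OF r(1) st(2)] r(2,3)] calculation by blast
  ultimately show ?thesis using good_le[OF f r(1) st] by simp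
qed

text \<open>Once a condition contains the points of both arguments, its own ring computes the
  generic operation. Nested formulas about the algebra are thereby reduced to
  \<open>ring_laws\<close>.\<close>

lemma op_eval:
  assumes f: "good f" and p: "cond p" and st: "s \<in> LS i p" "t \<in> LS i p" and c: "congr \<Phi>"
  shows "p \<tturnstile> app2 (opn f) (ck (pi s)) (ck (pi t)) \<Phi> \<longleftrightarrow> p \<tturnstile> \<Phi> (ck (pi (f p s t)))"
proof
  assume "p \<tturnstile> app2 (opn f) (ck (pi s)) (ck (pi t)) \<Phi>"
  then show "p \<tturnstile> \<Phi> (ck (pi (f p s t)))" unfolding app2_def app_def
  proof (rule f_exE, unfold f_conj, elim conjE)
    fix q z assume q: "q \<preceq> p" "name z" "q \<tturnstile> is_pair z (ck (pi s)) (ck (pi t))"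
      and ex: "q \<tturnstile> (\<^bold>\<exists>y. maps (opn f) z y \<^bold>\<and> \<Phi> y)"
    have z: "q \<tturnstile> (z \<^bold>= ck (vpair E (pi s) (pi t)))" using pair_check q(2,3) by blast
    show "q \<tturnstile> \<Phi> (ck (pi (f p s t)))"
    proof (rule f_exE[OF ex], unfold f_conj, elim conjE)
      fix r y assume r: "r \<preceq> q" "name y" "r \<tturnstile> maps (opn f) z y" "r \<tturnstile> \<Phi> y"
      show "r \<tturnstile> \<Phi> (ck (pi (f p s t)))"
      proof (rule maps_checkE[OF r(3) q(2) r(2), of XXX])
        show "w \<tturnstile> (x \<^bold>\<in> ck XXX)" if "w \<tturnstile> (x \<^bold>\<in> opn f)" for w x using opn_sub[OF f that] .
        fix v a b assume v: "v \<preceq> r" "v \<tturnstile> (z \<^bold>= ck a)" "v \<tturnstile> (y \<^bold>= ck b)"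
        have le: "v \<preceq> q" "v \<preceq> p" using le_trans v(1) r(1) q(1) by blast+
        have "v \<tturnstile> (ck a \<^bold>= ck (vpair E (pi s) (pi t)))"
          using eq_trans[OF eq_sym[OF v(2)] forces_mono[OF z le(1)]] .
        then have a: "a = vpair E (pi s) (pi t)" using le_cond(1)[OF le(1)] by simp
        have c2: "congr (\<lambda>w. maps (opn f) w y)" "congr (\<lambda>w. maps (opn f) (ck a) w)" by (intro cong_intros)+
        have "v \<tturnstile> maps (opn f) (ck a) (ck b)"
          using congrD[OF c2(2), OF v(3) congrD[OF c2(1), OF v(2) forces_mono[OF r(3) v(1)]]] .
        then have "v \<tturnstile> (ck (vpair E (vpair E (pi s) (pi t)) b) \<^bold>\<in> opn f)" using a maps_check by simp
        then have "b = pi (f v s t)"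
          using opn_value[OF f le_cond(1)[OF v(1)] LS_mono[OF le(2) st(1)] LS_mono[OF le(2) st(2)]] by blast
        then have "b = pi (f p s t)" using good_le[OF f le(2) st] by simp
        then show "v \<tturnstile> \<Phi> (ck (pi (f p s t)))" using congrD[OF c, OF v(3) forces_mono[OF r(4) v(1)]] by simp
      qed
    qed
  qed
next
  assume a: "p \<tturnstile> \<Phi> (ck (pi (f p s t)))"
  have m: "p \<tturnstile> maps (opn f) (ck (vpair E (pi s) (pi t))) (ck (pi (f p s t)))"
    using opn_memI[OF st, of f] by (simp add: maps_check triple_def)
  show "p \<tturnstile> app2 (opn f) (ck (pi s)) (ck (pi t)) \<Phi>" unfolding app2_def app_def
  proof (rule f_exI[where x = "ck (vpair E (pi s) (pi t))"], unfold f_conj, intro conjI)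
    show "p \<tturnstile> (\<^bold>\<exists>y. maps (opn f) (ck (vpair E (pi s) (pi t))) y \<^bold>\<and> \<Phi> y)"
      by (rule f_exI[where x = "ck (pi (f p s t))"]) (use a m in simp_all)
  qed (use pair_check0 in simp_all)
qed

lemma product_check: "p \<tturnstile> is_product (ck XX) (ck X) (ck X)"
  unfolding is_product_def
proof (intro f_allI f_iffI iffI)
  fix z q assume z: "name z" "q \<tturnstile> (z \<^bold>\<in> ck XX)"
  show "q \<tturnstile> (\<^bold>\<exists>x y. x \<^bold>\<in> ck X \<^bold>\<and> y \<^bold>\<in> ck X \<^bold>\<and> is_pair z x y)"
  proof (rule check_memE[OF z(2)])
    fix r w assume r: "r \<preceq> q" "E w XX" "r \<tturnstile> (z \<^bold>= ck w)"
    then obtain x y where xy: "E x X" "E y X" "w = vpair E x y" unfolding mem_XX by blast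
    show "r \<tturnstile> (\<^bold>\<exists>x y. x \<^bold>\<in> ck X \<^bold>\<and> y \<^bold>\<in> ck X \<^bold>\<and> is_pair z x y)"
      by (rule f_exI[where x = "ck x"], rule f_exI[where x = "ck y"])
        (use xy r(3) z(1) check_memI pair_check in simp_all)
  qed
next
  fix z q assume z: "name z" "q \<tturnstile> (\<^bold>\<exists>x y. x \<^bold>\<in> ck X \<^bold>\<and> y \<^bold>\<in> ck X \<^bold>\<and> is_pair z x y)"
  show "q \<tturnstile> (z \<^bold>\<in> ck XX)"
  proof (rule f_exE[OF z(2)], erule f_exE, unfold f_conj, elim conjE)
    fix r r' x y assume r: "r' \<preceq> r" "r' \<tturnstile> (x \<^bold>\<in> ck X)" "r' \<tturnstile> (y \<^bold>\<in> ck X)" "r' \<tturnstile> is_pair z x y"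
    show "r' \<tturnstile> (z \<^bold>\<in> ck XX)"
    proof (rule check_memE[OF r(2)])
      fix s a assume s: "s \<preceq> r'" "E a X" "s \<tturnstile> (x \<^bold>= ck a)"
      show "s \<tturnstile> (z \<^bold>\<in> ck XX)"
      proof (rule check_memE[OF forces_mono[OF r(3) s(1)]])
        fix v b assume v: "v \<preceq> s" "E b X" "v \<tturnstile> (y \<^bold>= ck b)"
        have c: "congr (\<lambda>w. is_pair z w y)" "congr (\<lambda>w. is_pair z (ck a) w)" by (intro cong_intros)+
        have "v \<tturnstile> is_pair z (ck a) (ck b)"
          using congrD[OF c(2), OF v(3) congrD[OF c(1), OF forces_mono[OF s(3) v(1)] forces_mono[OF r(4) le_trans[OF v(1) s(1)]]]] .
        then have "v \<tturnstile> (z \<^bold>= ck (vpair E a b))" using pair_check z(1) by blast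
        moreover have "E (vpair E a b) XX" unfolding mem_XX using s(2) v(2) by blast
        ultimately show "v \<tturnstile> (z \<^bold>\<in> ck XX)" using mem_eq_left[OF check_memI eq_sym] by blast
      qed
    qed
  qed
qed

text \<open>Conditions containing finitely many given points are dense, so a formula may be tested
  there. Associativity and distributivity ask for three sets, and complements for the unit.\<close>

lemma support2:
  assumes "s \<in> FA i" "t \<in> FA i" "u \<in> FA i" "\<And>q. q \<preceq> p \<Longrightarrow> s \<in> LS i q \<Longrightarrow> t \<in> LS i q \<Longrightarrow> u \<in> LS i q \<Longrightarrow> {apex i} \<in> LS i q \<Longrightarrow> q \<tturnstile> \<phi>"
  shows "p \<tturnstile> \<phi>"
proof (rule support_forces[of "s \<union> t \<union> u \<union> {apex i}"])
  show "finite (s \<union> t \<union> u \<union> {apex i})" "s \<union> t \<union> u \<union> {apex i} \<subseteq> T" using assms(1-3) apex_i by (auto simp: FA_def)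
  fix q assume "q \<preceq> p" "s \<union> t \<union> u \<union> {apex i} \<subseteq> pts (rel q)"
  then show "q \<tturnstile> \<phi>" using assms(1-3) one_FA by (intro assms(4)) (auto simp: LS_def)
qed

lemma binop_check:
  assumes f: "good f"
  shows "p \<tturnstile> is_binop (opn f) (ck X)"
  unfolding is_binop_def
proof (rule f_exI[where x = "ck XX"], unfold f_conj, intro conjI product_check is_fun_checkI[where Z = XXX])
  show "q \<tturnstile> (z \<^bold>\<in> ck XXX)" if "q \<tturnstile> (z \<^bold>\<in> opn f)" for q z using opn_sub[OF f that] .
  show "\<exists>a b. E a XX \<and> E b X \<and> z = vpair E a b" if "E z XXX" for z using that by (simp only: mem_XXX)
  show "p \<tturnstile> Exists (maps (opn f) (ck a))" if a: "E a XX" for a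
  proof -
    obtain s t where st: "s \<in> FA i" "t \<in> FA i" "a = vpair E (pi s) (pi t)" using a by auto
    show ?thesis
    proof (rule support2[OF st(1,2,2)])
      fix q assume q: "q \<preceq> p" "s \<in> LS i q" "t \<in> LS i q"
      show "q \<tturnstile> Exists (maps (opn f) (ck a))"
        by (rule f_exI[where x = "ck (pi (f q s t))"])
          (use opn_memI[OF q(2,3), of f] st(3) in \<open>simp_all add: maps_check triple_def\<close>)
    qed
  qed
  fix q a b c assume q: "q \<preceq> p" "q \<tturnstile> (ck (vpair E a b) \<^bold>\<in> opn f)" "q \<tturnstile> (ck (vpair E a c) \<^bold>\<in> opn f)"
  obtain r s t where r: "r \<preceq> q" "s \<in> LS i r" "t \<in> LS i r" "r \<tturnstile> (ck (vpair E a b) \<^bold>= ck (triple f r s t))"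
    using opn_mem_dense[OF f q(2) le_refl[OF le_cond(1)[OF q(1)]]] by blast
  then have a: "a = vpair E (pi s) (pi t)" using le_cond(1)[OF r(1)] by (simp add: triple_def)
  show "b = c"
    using opn_value[OF f le_cond(1)[OF r(1)] r(2,3)] forces_mono[OF q(2) r(1)] forces_mono[OF q(3) r(1)] a by metis
qed simp

text \<open>Complementation acts on classes but is computed on representatives; \<open>pi_sd\<close>
  shows that the chosen one does not matter.\<close>

definition lab :: "'v \<Rightarrow> 'v set" where
  "lab x = (SOME s. s \<in> FA i \<and> pi s = x)"

lemma lab: "s \<in> FA i \<Longrightarrow> lab (pi s) \<in> FA i \<and> pi (lab (pi s)) = pi s"
  unfolding lab_def by (rule someI_ex) blast

definition cm :: 'v where
  "cm = vgraph E (\<lambda>x. pi (sd (lab x) {apex i})) (ext E X)"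

lemma pi_sd:
  assumes "s \<in> FA i" "s' \<in> FA i" "t \<in> FA i" "pi s = pi s'"
  shows "pi (sd s t) = pi (sd s' t)"
proof -
  have "\<forall>x\<in>sd s s'. L x" using assms pi_eq by blast
  then have "\<forall>x\<in>sd (sd s t) (sd s' t). L x" by blast
  then show ?thesis using pi_eq sd_FA assms by blast
qed

lemma cm_fun: "s \<in> FA i \<Longrightarrow> pi (sd (lab (pi s)) {apex i}) = pi (sd s {apex i})"
  using pi_sd lab one_FA by blast

lemma cm_eval:
  assumes "s \<in> FA i" "congr \<Phi>"
  shows "p \<tturnstile> app (ck cm) (ck (pi s)) \<Phi> \<longleftrightarrow> p \<tturnstile> \<Phi> (ck (pi (sd s {apex i})))"
proof -
  have "E (pi s) X" using assms(1) by auto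
  then show ?thesis unfolding cm_def by (simp only: app_check[OF assms(2)] cm_fun[OF assms(1)])
qed

definition Alg :: "'v balg" where
  "Alg = \<lparr>car = ck X, meet = opn mt, join = opn jn, cmpl = ck cm, bzero = ck (pi {}), bone = ck (pi {apex i})\<rparr>"

lemma Alg_simps [simp]:
  "car Alg = ck X" "meet Alg = opn mt" "join Alg = opn jn" "cmpl Alg = ck cm"
  "bzero Alg = ck (pi {})" "bone Alg = ck (pi {apex i})"
  by (simp_all add: Alg_def)

lemmas eval = op_eval[OF good_mt] op_eval[OF good_jn]

lemma empty_FA [simp]: "{} \<in> FA i"
  by (simp add: FA_def)

lemma BA_check: "p \<tturnstile> is_BA Alg"
proof -
  note [cong_intros] = cterm_id cterm_const
  have comm: "p \<tturnstile> (\<^bold>\<forall>x y. x \<^bold>\<in> ck X \<^bold>\<and> y \<^bold>\<in> ck X \<^bold>\<longrightarrow> app2 (opn f) x y (\<lambda>s. app2 (opn f) y x (\<lambda>t. s \<^bold>= t)))"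
    if f: "f = mt \<or> f = jn" for f
  proof (rule f_ball2I)
    fix x y assume "E x X" "E y X"
    then obtain s t where st: "s \<in> FA i" "x = pi s" "t \<in> FA i" "y = pi t" by auto
    show "p \<tturnstile> app2 (opn f) (ck x) (ck y) (\<lambda>s. app2 (opn f) (ck y) (ck x) (\<lambda>t. s \<^bold>= t))"
      unfolding st(2,4)
    proof (rule support2[OF st(1,3,3)])
      fix q assume q: "q \<preceq> p" "s \<in> LS i q" "t \<in> LS i q" "{apex i} \<in> LS i q"
      note c = le_cond(1)[OF q(1)]
      show "q \<tturnstile> app2 (opn f) (ck (pi s)) (ck (pi t)) (\<lambda>s'. app2 (opn f) (ck (pi t)) (ck (pi s)) (\<lambda>t'. s' \<^bold>= t'))"
        using f ring_laws(1,2)[OF c q(2,3,3,4)] by (auto simp: eval[OF c] q cong_intros)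
    qed
  qed (intro cong_intros)+
  have assoc: "p \<tturnstile> (\<^bold>\<forall>x y z. x \<^bold>\<in> ck X \<^bold>\<and> y \<^bold>\<in> ck X \<^bold>\<and> z \<^bold>\<in> ck X \<^bold>\<longrightarrow>
         app2 (opn f) x y (\<lambda>xy. app2 (opn f) xy z (\<lambda>s. app2 (opn f) y z (\<lambda>yz. app2 (opn f) x yz (\<lambda>t. s \<^bold>= t)))))"
    if f: "f = mt \<or> f = jn" for f
  proof (rule f_ball3I)
    fix x y z assume "E x X" "E y X" "E z X"
    then obtain s t u where st: "s \<in> FA i" "x = pi s" "t \<in> FA i" "y = pi t" "u \<in> FA i" "z = pi u" by auto
    show "p \<tturnstile> app2 (opn f) (ck x) (ck y) (\<lambda>xy. app2 (opn f) xy (ck z) (\<lambda>s. app2 (opn f) (ck y) (ck z) (\<lambda>yz. app2 (opn f) (ck x) yz (\<lambda>t. s \<^bold>= t))))"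
      unfolding st(2,4,6)
    proof (rule support2[OF st(1,3,5)])
      fix q assume q: "q \<preceq> p" "s \<in> LS i q" "t \<in> LS i q" "u \<in> LS i q" "{apex i} \<in> LS i q"
      note c = le_cond(1)[OF q(1)]
      show "q \<tturnstile> app2 (opn f) (ck (pi s)) (ck (pi t)) (\<lambda>xy. app2 (opn f) xy (ck (pi u))
          (\<lambda>s'. app2 (opn f) (ck (pi t)) (ck (pi u)) (\<lambda>yz. app2 (opn f) (ck (pi s)) yz (\<lambda>t'. s' \<^bold>= t'))))"
        using f ring_laws(3,4)[OF c q(2-5)] by (auto simp: eval[OF c] q c cong_intros)
    qed
  qed (intro cong_intros)+
  have dist: "p \<tturnstile> (\<^bold>\<forall>x y z. x \<^bold>\<in> ck X \<^bold>\<and> y \<^bold>\<in> ck X \<^bold>\<and> z \<^bold>\<in> ck X \<^bold>\<longrightarrow>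
        app2 (opn g) y z (\<lambda>yz. app2 (opn f) x yz (\<lambda>s.
          app2 (opn f) x y (\<lambda>xy. app2 (opn f) x z (\<lambda>xz. app2 (opn g) xy xz (\<lambda>t. s \<^bold>= t))))))"
    if f: "f = mt \<and> g = jn \<or> f = jn \<and> g = mt" for f g
  proof (rule f_ball3I)
    fix x y z assume "E x X" "E y X" "E z X"
    then obtain s t u where st: "s \<in> FA i" "x = pi s" "t \<in> FA i" "y = pi t" "u \<in> FA i" "z = pi u" by auto
    show "p \<tturnstile> app2 (opn g) (ck y) (ck z) (\<lambda>yz. app2 (opn f) (ck x) yz (\<lambda>s.
          app2 (opn f) (ck x) (ck y) (\<lambda>xy. app2 (opn f) (ck x) (ck z) (\<lambda>xz. app2 (opn g) xy xz (\<lambda>t. s \<^bold>= t)))))"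
      unfolding st(2,4,6)
    proof (rule support2[OF st(1,3,5)])
      fix q assume q: "q \<preceq> p" "s \<in> LS i q" "t \<in> LS i q" "u \<in> LS i q" "{apex i} \<in> LS i q"
      note c = le_cond(1)[OF q(1)]
      show "q \<tturnstile> app2 (opn g) (ck (pi t)) (ck (pi u)) (\<lambda>yz. app2 (opn f) (ck (pi s)) yz (\<lambda>s'.
          app2 (opn f) (ck (pi s)) (ck (pi t)) (\<lambda>xy. app2 (opn f) (ck (pi s)) (ck (pi u)) (\<lambda>xz. app2 (opn g) xy xz (\<lambda>t'. s' \<^bold>= t')))))"
        using f ring_laws(5,6)[OF c q(2-5)] by (auto simp: eval[OF c] q c cong_intros)
    qed
  qed (intro cong_intros)+
  have unit: "p \<tturnstile> (\<^bold>\<forall>x. x \<^bold>\<in> ck X \<^bold>\<longrightarrow>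
         app2 (opn mt) x (ck (pi {apex i})) (\<lambda>s. s \<^bold>= x) \<^bold>\<and> app2 (opn jn) x (ck (pi {})) (\<lambda>s. s \<^bold>= x) \<^bold>\<and>
         app (ck cm) x (\<lambda>x'. app2 (opn mt) x x' (\<lambda>s. s \<^bold>= ck (pi {})) \<^bold>\<and>
                              app2 (opn jn) x x' (\<lambda>s. s \<^bold>= ck (pi {apex i}))))"
  proof (rule f_ballI)
    fix x assume "E x X"
    then obtain s where st: "s \<in> FA i" "x = pi s" by auto
    show "p \<tturnstile> (app2 (opn mt) (ck x) (ck (pi {apex i})) (\<lambda>s. s \<^bold>= ck x) \<^bold>\<and> app2 (opn jn) (ck x) (ck (pi {})) (\<lambda>s. s \<^bold>= ck x) \<^bold>\<and>
         app (ck cm) (ck x) (\<lambda>x'. app2 (opn mt) (ck x) x' (\<lambda>s. s \<^bold>= ck (pi {})) \<^bold>\<and>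
                              app2 (opn jn) (ck x) x' (\<lambda>s. s \<^bold>= ck (pi {apex i}))))"
      unfolding st(2)
    proof (rule support2[OF st(1,1,1)])
      fix q assume q: "q \<preceq> p" "s \<in> LS i q" "{apex i} \<in> LS i q"
      note c = le_cond(1)[OF q(1)]
      have s: "sd s {apex i} \<in> LS i q" using sd_LS[OF q(2,3)] .
      note r = ring_laws[OF c q(2,2,2,3)]
      show "q \<tturnstile> (app2 (opn mt) (ck (pi s)) (ck (pi {apex i})) (\<lambda>s'. s' \<^bold>= ck (pi s)) \<^bold>\<and> app2 (opn jn) (ck (pi s)) (ck (pi {})) (\<lambda>s'. s' \<^bold>= ck (pi s)) \<^bold>\<and>
         app (ck cm) (ck (pi s)) (\<lambda>x'. app2 (opn mt) (ck (pi s)) x' (\<lambda>s'. s' \<^bold>= ck (pi {})) \<^bold>\<and>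
                              app2 (opn jn) (ck (pi s)) x' (\<lambda>s'. s' \<^bold>= ck (pi {apex i}))))"
        by (simp only: eval[OF c] q s c cong_intros f_conj cm_eval[OF st(1)] r(7-10) empty_LS eq_refl simp_thms)
    qed
  qed (intro cong_intros)
  have "p \<tturnstile> is_fun (ck cm) (ck X) (ck X)"
    unfolding cm_def by (rule fun_graph) (use lab sd_FA one_FA in fastforce)
  moreover have "p \<tturnstile> (ck (pi {}) \<^bold>\<in> ck X)" "p \<tturnstile> (ck (pi {apex i}) \<^bold>\<in> ck X)"
    using one_FA empty_FA unfolding mem_X by (auto intro!: check_memI bexI)
  ultimately show ?thesis
    unfolding is_BA_def f_conj Alg_simps comm_assoc_def distributes_def
    using comm[of mt] comm[of jn] assoc[of mt] assoc[of jn] dist[of mt jn] dist[of jn mt] unit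
      binop_check[OF good_mt] binop_check[OF good_jn] by simp
qed

end

section \<open>Ideals given by levels, their quotients and atoms\<close>

section \<open>Cantor-Bendixson ideals of the generic algebra\<close>

context forcing
begin

lemma f_ball2I':
  assumes "\<And>y. congr (\<lambda>x. \<Psi> x y)" "\<And>x. congr (\<Psi> x)" "\<And>y. congr (\<lambda>x. \<Phi> x y)" "\<And>x. congr (\<Phi> x)"
    "\<And>x y q. E x X \<Longrightarrow> E y Y \<Longrightarrow> q \<preceq> p \<Longrightarrow> q \<tturnstile> \<Psi> (ck x) (ck y) \<Longrightarrow> q \<tturnstile> \<Phi> (ck x) (ck y)"
  shows "p \<tturnstile> (\<^bold>\<forall>x y. x \<^bold>\<in> ck X \<^bold>\<and> y \<^bold>\<in> ck Y \<^bold>\<and> \<Psi> x y \<^bold>\<longrightarrow> \<Phi> x y)"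
proof -
  have "p \<tturnstile> (\<^bold>\<forall>x y. x \<^bold>\<in> ck X \<^bold>\<and> y \<^bold>\<in> ck Y \<^bold>\<longrightarrow> (\<Psi> x y \<^bold>\<longrightarrow> \<Phi> x y))"
    by (rule f_ball2I) (use assms in \<open>auto intro!: cong_intros f_impI\<close>)
  then show ?thesis by (simp add: forces_imp) (use le_refl le_cond(1) in blast)
qed

lemma f_ballI':
  assumes "congr \<Psi>" "congr \<Phi>" "\<And>x q. E x X \<Longrightarrow> q \<preceq> p \<Longrightarrow> q \<tturnstile> \<Psi> (ck x) \<Longrightarrow> q \<tturnstile> \<Phi> (ck x)"
  shows "p \<tturnstile> (\<^bold>\<forall>x. x \<^bold>\<in> ck X \<^bold>\<and> \<Psi> x \<^bold>\<longrightarrow> \<Phi> x)"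
proof -
  have "p \<tturnstile> (\<^bold>\<forall>x. x \<^bold>\<in> ck X \<^bold>\<longrightarrow> (\<Psi> x \<^bold>\<longrightarrow> \<Phi> x))"
    by (rule f_ballI) (use assms in \<open>auto intro!: cong_intros f_impI\<close>)
  then show ?thesis by (simp add: forces_imp) (use le_refl le_cond(1) in blast)
qed

lemma neg_eq_check: "x \<noteq> y \<Longrightarrow> p \<tturnstile> (\<^bold>\<not> ck x \<^bold>= ck y)"
  using le_cond(1) by (intro f_negI) auto

end

context quotient_algebra
begin

lemma congr_le [cong_intros]: "cterm a \<Longrightarrow> cterm b \<Longrightarrow> congr (\<lambda>x. ba_le A (a x) (b x))"
  unfolding ba_le_def by (intro cong_intros)

lemma congr_atom [cong_intros]: "cterm a \<Longrightarrow> congr (\<lambda>x. is_atom A (a x))"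
  unfolding is_atom_def by (intro cong_intros)

lemma le_eval:
  assumes "cond p" "s \<in> LS i p" "t \<in> LS i p"
  shows "p \<tturnstile> ba_le Alg (ck (pi s)) (ck (pi t)) \<longleftrightarrow> pi (mt p s t) = pi s"
  unfolding ba_le_def Alg_simps by (simp add: eval[OF assms] cong_intros assms(1))

lemma down_mt:
  assumes p: "cond p" and ls: "s \<in> LS i p" "t \<in> LS i p" and M: "down M" "\<And>x. x \<in> t \<Longrightarrow> M x" and x: "x \<in> mt p s t"
  shows "M x"
proof -
  have "vl p (mt p s t) \<subseteq> vl p t" using vl_mt[OF p ls] by blast
  then show ?thesis using down_LS[OF p mt_LS[OF p ls] _ M(1) _ x] M(2) by blast
qed

definition ideal_of :: "('v \<Rightarrow> bool) \<Rightarrow> 'v" where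
  "ideal_of M = vset E (pi ` {s \<in> FA i. \<forall>x\<in>s. M x})"

lemma mem_ideal_of: "E z (ideal_of M) \<longleftrightarrow> (\<exists>s\<in>FA i. (\<forall>x\<in>s. M x) \<and> z = pi s)"
proof -
  have "small E (pi ` {s \<in> FA i. \<forall>x\<in>s. M x})" by (rule small_subset[OF small_FA[of pi]]) blast
  then show ?thesis unfolding ideal_of_def by auto
qed

lemma pi_mem_ideal_of:
  assumes "s \<in> FA i" "\<And>x. L x \<Longrightarrow> M x"
  shows "E (pi s) (ideal_of M) \<longleftrightarrow> (\<forall>x\<in>s. M x)"
proof
  assume "E (pi s) (ideal_of M)"
  then obtain t where t: "t \<in> FA i" "\<forall>x\<in>t. M x" "pi s = pi t" unfolding mem_ideal_of by blast
  then have "\<forall>x\<in>sd s t. L x" using pi_eq[OF assms(1) t(1)] by blast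
  then show "\<forall>x\<in>s. M x" using t(2) assms(2) by blast
qed (use assms(1) mem_ideal_of in blast)

text \<open>Downward closure of \<open>M\<close> passes from an element to the products below it,
  and a join involves only the two elements and their product. That \<open>L\<close> implies
  \<open>M\<close> makes membership independent of the representative.\<close>

lemma ideal_check:
  assumes M: "down M" and LM: "\<And>x. L x \<Longrightarrow> M x"
  shows "p \<tturnstile> is_ideal Alg (ck (ideal_of M))"
proof -
  have mem: "E (pi s) (ideal_of M)" if "s \<in> FA i" "\<And>x. x \<in> s \<Longrightarrow> M x" for s
    using pi_mem_ideal_of[of s M] LM that by blast
  have 1: "p \<tturnstile> is_subset (ck (ideal_of M)) (ck X)"
  proof (cases "cond p")
    case True
    then show ?thesis using mem_ideal_of by (simp add: ext_subset) blast
  qed (rule not_cond_forces)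
  have 2: "p \<tturnstile> (ck (pi {}) \<^bold>\<in> ck (ideal_of M))" by (rule check_memI, rule mem) simp_all
  have 3: "p \<tturnstile> (\<^bold>\<forall>x y. x \<^bold>\<in> ck X \<^bold>\<and> y \<^bold>\<in> ck (ideal_of M) \<^bold>\<and> ba_le Alg x y \<^bold>\<longrightarrow> x \<^bold>\<in> ck (ideal_of M))"
  proof (rule f_ball2I')
    fix x y q assume xy: "E x X" "E y (ideal_of M)" and q: "q \<preceq> p" and le: "q \<tturnstile> ba_le Alg (ck x) (ck y)"
    obtain s where s: "s \<in> FA i" "x = pi s" using xy(1) by auto
    obtain t where t: "t \<in> FA i" "\<forall>x\<in>t. M x" "y = pi t" using xy(2) unfolding mem_ideal_of by blast
    show "q \<tturnstile> (ck x \<^bold>\<in> ck (ideal_of M))"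
    proof (rule support2[OF s(1) t(1,1)])
      fix r assume r: "r \<preceq> q" "s \<in> LS i r" "t \<in> LS i r"
      note c = le_cond(1)[OF r(1)]
      have "pi (mt r s t) = pi s"
        using forces_mono[OF le r(1)] le_eval[OF c r(2,3)] unfolding s(2) t(3) by blast
      moreover have "E (pi (mt r s t)) (ideal_of M)"
        using down_mt[OF c r(2,3) M] t(2) by (intro mem LS_FA[OF mt_LS[OF c r(2,3)]]) blast
      ultimately show "r \<tturnstile> (ck x \<^bold>\<in> ck (ideal_of M))" using s(2) check_memI by simp
    qed
  qed (intro cong_intros)+
  have 4: "p \<tturnstile> (\<^bold>\<forall>x y. x \<^bold>\<in> ck (ideal_of M) \<^bold>\<and> y \<^bold>\<in> ck (ideal_of M) \<^bold>\<longrightarrow> app2 (opn jn) x y (\<lambda>s. s \<^bold>\<in> ck (ideal_of M)))"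
  proof (rule f_ball2I)
    fix x y assume xy: "E x (ideal_of M)" "E y (ideal_of M)"
    obtain s where s: "s \<in> FA i" "\<forall>x\<in>s. M x" "x = pi s" using xy(1) unfolding mem_ideal_of by blast
    obtain t where t: "t \<in> FA i" "\<forall>x\<in>t. M x" "y = pi t" using xy(2) unfolding mem_ideal_of by blast
    show "p \<tturnstile> app2 (opn jn) (ck x) (ck y) (\<lambda>s. s \<^bold>\<in> ck (ideal_of M))"
    proof (rule support2[OF s(1) t(1,1)])
      fix r assume r: "r \<preceq> p" "s \<in> LS i r" "t \<in> LS i r"
      note c = le_cond(1)[OF r(1)]
      have jM: "M x" if "x \<in> jn r s t" for x
        using that s(2) t(2) down_mt[OF c r(2,3) M] unfolding jn_def by blast
      have "r \<tturnstile> (ck (pi (jn r s t)) \<^bold>\<in> ck (ideal_of M))"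
        by (rule check_memI, rule mem[OF LS_FA[OF jn_LS[OF c r(2,3)]] jM])
      then show "r \<tturnstile> app2 (opn jn) (ck x) (ck y) (\<lambda>s. s \<^bold>\<in> ck (ideal_of M))"
        unfolding s(3) t(3) by (simp add: eval[OF c r(2,3)] cong_intros)
    qed
  qed (intro cong_intros)+
  show ?thesis unfolding is_ideal_def f_conj Alg_simps using 1 2 3 4 by blast
qed

end

text \<open>Levels up to \<eta> carry the cardinal sequence, and \<open>fresh\<close> makes them
  infinite; the apex sits on level \<eta>+1, hence the two successors in \<open>lev_le\<close>. As
  \<open>prec\<close> compares levels, cutting off at an ordinal gives a downward closed set of
  points.\<close>

locale leveled = fibre E T fib prec apex al i
  for E :: "'v \<Rightarrow> 'v \<Rightarrow> bool" and T :: "'v set" and fib :: "'v \<Rightarrow> 'i" and prec apex al i +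
  fixes lev :: "'v \<Rightarrow> 'v" and \<eta> :: 'v
  assumes prec_lev: "prec x y \<longleftrightarrow> E (lev x) (lev y)"
    and lev_le: "x \<in> T \<Longrightarrow> fib x = i \<Longrightarrow> E (lev x) (vsucc E (vsucc E \<eta>))"
    and lev_apex: "lev (apex i) = vsucc E \<eta>"
    and Ord_eta: "Ord E \<eta>"
    and fresh: "E a (vsucc E \<eta>) \<Longrightarrow> finite F \<Longrightarrow> \<exists>z\<in>T - F. fib z = i \<and> lev z = a"
begin

sublocale base: quotient_algebra E T fib prec apex al i "\<lambda>_. False" "vset E"
proof unfold_locales
  show "down (\<lambda>_. False)" by (simp add: down_def)
  fix s t assume "s \<in> FA i" "t \<in> FA i"
  then have "small E s" "small E t" by (auto simp: FA_def)
  then have "vset E s = vset E t \<longleftrightarrow> s = t" by (rule vset_inject)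
  then show "vset E s = vset E t \<longleftrightarrow> (\<forall>x\<in>sd s t. False)" by blast
qed

text \<open>\<open>is_quotient\<close> asks for literal cosets as elements, so a class is coded by
  the set of the codes of its members.\<close>

definition coset :: "'v \<Rightarrow> 'v set \<Rightarrow> 'v" where
  "coset a s = vset E (vset E ` {t \<in> FA i. \<forall>x\<in>sd s t. E (lev x) a})"

lemma mem_coset: "E z (coset a s) \<longleftrightarrow> (\<exists>t\<in>FA i. z = vset E t \<and> (\<forall>x\<in>sd s t. E (lev x) a))"
proof -
  have "small E (vset E ` {t \<in> FA i. \<forall>x\<in>sd s t. E (lev x) a})"
    by (rule small_subset[OF base.small_FA[of "vset E"]]) blast
  then show ?thesis unfolding coset_def by auto
qed

lemma coset_eq:
  assumes "s \<in> FA i" "t \<in> FA i"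
  shows "coset a s = coset a t \<longleftrightarrow> (\<forall>x\<in>sd s t. E (lev x) a)"
proof
  assume "coset a s = coset a t"
  moreover have "E (vset E s) (coset a s)" unfolding mem_coset using assms(1) by blast
  ultimately have "E (vset E s) (coset a t)" by simp
  then obtain u where u: "u \<in> FA i" "vset E s = vset E u" "\<forall>x\<in>sd t u. E (lev x) a" unfolding mem_coset by blast
  then have "s = u" using base.pi_eq[OF assms(1) u(1)] by auto
  then show "\<forall>x\<in>sd s t. E (lev x) a" using u(3) by blast
next
  assume a: "\<forall>x\<in>sd s t. E (lev x) a"
  have "(\<forall>x\<in>sd s u. E (lev x) a) \<longleftrightarrow> (\<forall>x\<in>sd t u. E (lev x) a)" for u using a by blast
  then show "coset a s = coset a t" unfolding coset_def by simp
qed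

lemma down_lev: "Ord E a \<Longrightarrow> down (\<lambda>x. E (lev x) a)"
  unfolding down_def prec_lev using Ord_trans by blast

text \<open>Defined outright for every \<open>a\<close> instead of by recursion; that these ideals
  obey the Cantor-Bendixson recursion is what the density argument about atoms yields.\<close>

definition J :: "'v \<Rightarrow> 'v" where
  "J a = base.ideal_of (\<lambda>x. E (lev x) a)"

lemma mem_J: "s \<in> FA i \<Longrightarrow> E (vset E s) (J a) \<longleftrightarrow> (\<forall>x\<in>s. E (lev x) a)"
  unfolding J_def by (rule base.pi_mem_ideal_of) auto

lemma mem_J_iff: "E z (J a) \<longleftrightarrow> (\<exists>s\<in>FA i. (\<forall>x\<in>s. E (lev x) a) \<and> z = vset E s)"
  unfolding J_def by (rule base.mem_ideal_of)

end

text \<open>The bound on \<alpha> admits \<eta>+1, because the step from \<eta>+1 to \<eta>+2 is the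
  one that exhausts the algebra.\<close>

locale leveled_at = leveled E T fib prec apex al i lev \<eta>
  for E :: "'v \<Rightarrow> 'v \<Rightarrow> bool" and T :: "'v set" and fib :: "'v \<Rightarrow> 'i" and prec apex al i lev \<eta> +
  fixes \<alpha> :: 'v
  assumes alpha: "E \<alpha> (vsucc E (vsucc E \<eta>))"
begin

lemma Ord_alpha: "Ord E \<alpha>"
  using Ord_mem[OF _ alpha] Ord_eta by simp

sublocale quot: quotient_algebra E T fib prec apex al i "\<lambda>x. E (lev x) \<alpha>" "coset \<alpha>"
  by unfold_locales (use down_lev[OF Ord_alpha] coset_eq in auto)

definition proj :: 'v where
  "proj = vgraph E (\<lambda>x. coset \<alpha> (ext E x)) (ext E base.X)"

lemma ext_FA [simp]: "s \<in> FA i \<Longrightarrow> ext E (vset E s) = s"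
  by (rule ext_vset) (auto simp: FA_def)

lemma base_X: "s \<in> FA i \<Longrightarrow> E (vset E s) base.X"
  by auto

lemma quot_X: "s \<in> FA i \<Longrightarrow> E (coset \<alpha> s) quot.X"
  by auto

lemma proj_eval: "s \<in> FA i \<Longrightarrow> congr \<Phi> \<Longrightarrow> p \<tturnstile> app (ck proj) (ck (vset E s)) \<Phi> \<longleftrightarrow> p \<tturnstile> \<Phi> (ck (coset \<alpha> s))"
  unfolding proj_def
  using app_check[where \<Phi> = \<Phi> and a = "vset E s" and X = base.X and g = "\<lambda>x. coset \<alpha> (ext E x)" and p = p] base_X[of s]
  by (simp del: base.mem_X)

lemma proj_maps: "s \<in> FA i \<Longrightarrow> p \<tturnstile> maps (ck proj) (ck (vset E s)) (ck (coset \<alpha> s))"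
  unfolding proj_def maps_check using base_X[of s] by (intro check_memI) (simp del: base.mem_X)

lemma Ord_level: "x \<in> T \<Longrightarrow> fib x = i \<Longrightarrow> Ord E (lev x)"
  using Ord_mem[OF Ord_vsucc[OF Ord_vsucc[OF Ord_eta]] lev_le] .

lemma proj_hom: "p \<tturnstile> is_surj_hom (ck proj) base.Alg quot.Alg"
  unfolding is_surj_hom_def f_conj base.Alg_simps quot.Alg_simps
proof (intro conjI)
  have "(\<lambda>x. coset \<alpha> (ext E x)) ` ext E base.X = ext E quot.X"
  proof (rule set_eqI)
    fix z
    show "z \<in> (\<lambda>x. coset \<alpha> (ext E x)) ` ext E base.X \<longleftrightarrow> z \<in> ext E quot.X"
    proof
      assume "z \<in> (\<lambda>x. coset \<alpha> (ext E x)) ` ext E base.X"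
      then obtain x where "E x base.X" "z = coset \<alpha> (ext E x)" by auto
      moreover from this(1) obtain s where "s \<in> FA i" "x = vset E s" by auto
      ultimately show "z \<in> ext E quot.X" using quot_X[of s] by simp
    next
      assume "z \<in> ext E quot.X"
      then obtain s where s: "s \<in> FA i" "z = coset \<alpha> s" by auto
      then show "z \<in> (\<lambda>x. coset \<alpha> (ext E x)) ` ext E base.X"
        using base_X[OF s(1)] by (intro image_eqI[of _ _ "vset E s"]) (simp_all del: base.mem_X)
    qed
  qed
  then show "p \<tturnstile> is_surj (ck proj) (ck base.X) (ck quot.X)" unfolding proj_def by (rule surj_graph)
  show "p \<tturnstile> maps (ck proj) (ck (vset E {})) (ck (coset \<alpha> {}))"
    "p \<tturnstile> maps (ck proj) (ck (vset E {apex i})) (ck (coset \<alpha> {apex i}))"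
    using proj_maps one_FA base.empty_FA by blast+
  show "p \<tturnstile> (\<^bold>\<forall>x. x \<^bold>\<in> ck base.X \<^bold>\<longrightarrow>
         app (ck base.cm) x (\<lambda>s. app (ck proj) x (\<lambda>x'. app (ck quot.cm) x' (\<lambda>t. maps (ck proj) s t))))"
  proof (rule f_ballI)
    fix x assume "E x base.X"
    then obtain s where s: "s \<in> FA i" "x = vset E s" by auto
    show "p \<tturnstile> app (ck base.cm) (ck x) (\<lambda>s. app (ck proj) (ck x) (\<lambda>x'. app (ck quot.cm) x' (\<lambda>t. maps (ck proj) s t)))"
      unfolding s(2) by (simp only: base.cm_eval[OF s(1)] quot.cm_eval[OF s(1)] proj_eval[OF s(1)] cong_intros
          proj_maps[OF sd_FA[OF s(1) one_FA]])
  qed (intro cong_intros)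
  show "p \<tturnstile> (\<^bold>\<forall>x y. x \<^bold>\<in> ck base.X \<^bold>\<and> y \<^bold>\<in> ck base.X \<^bold>\<longrightarrow>
         app (ck proj) x (\<lambda>x'. app (ck proj) y (\<lambda>y'.
           app2 (base.opn mt) x y (\<lambda>s. app2 (quot.opn mt) x' y' (\<lambda>t. maps (ck proj) s t)) \<^bold>\<and>
           app2 (base.opn jn) x y (\<lambda>s. app2 (quot.opn jn) x' y' (\<lambda>t. maps (ck proj) s t)))))"
  proof (rule f_ball2I)
    fix x y assume xy: "E x base.X" "E y base.X"
    then obtain s t where s: "s \<in> FA i" "x = vset E s" "t \<in> FA i" "y = vset E t" by auto
    show "p \<tturnstile> app (ck proj) (ck x) (\<lambda>x'. app (ck proj) (ck y) (\<lambda>y'.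
           app2 (base.opn mt) (ck x) (ck y) (\<lambda>s. app2 (quot.opn mt) x' y' (\<lambda>t. maps (ck proj) s t)) \<^bold>\<and>
           app2 (base.opn jn) (ck x) (ck y) (\<lambda>s. app2 (quot.opn jn) x' y' (\<lambda>t. maps (ck proj) s t))))"
      unfolding s(2,4)
    proof (rule base.support2[OF s(1,3,3)])
      fix q assume q: "q \<preceq> p" "s \<in> LS i q" "t \<in> LS i q"
      note c = le_cond(1)[OF q(1)]
      show "q \<tturnstile> app (ck proj) (ck (vset E s)) (\<lambda>x'. app (ck proj) (ck (vset E t)) (\<lambda>y'.
           app2 (base.opn mt) (ck (vset E s)) (ck (vset E t)) (\<lambda>s. app2 (quot.opn mt) x' y' (\<lambda>t. maps (ck proj) s t)) \<^bold>\<and>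
           app2 (base.opn jn) (ck (vset E s)) (ck (vset E t)) (\<lambda>s. app2 (quot.opn jn) x' y' (\<lambda>t. maps (ck proj) s t))))"
        by (simp only: proj_eval[OF s(1)] proj_eval[OF s(3)] base.eval[OF c q(2,3)] quot.eval[OF c q(2,3)] cong_intros
          f_conj proj_maps[OF LS_FA[OF mt_LS[OF c q(2,3)]]] proj_maps[OF LS_FA[OF jn_LS[OF c q(2,3)]]] simp_thms)
    qed
  qed (intro cong_intros)+
qed

text \<open>At conditions containing the points of both elements and the unit, the formula for the
  symmetric difference evaluates to \<open>sd s t\<close>; membership of this set in the ideal is
  the condition that defines the coset.\<close>

lemma quotient_check: "p \<tturnstile> is_quotient base.Alg (ck (J \<alpha>)) quot.Alg (ck proj)"
  unfolding is_quotient_def f_conj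
proof (intro conjI quot.BA_check proj_hom)
  show "p \<tturnstile> is_ideal base.Alg (ck (J \<alpha>))" unfolding J_def by (rule base.ideal_check[OF down_lev[OF Ord_alpha]]) simp
  show "p \<tturnstile> (\<^bold>\<forall>x. x \<^bold>\<in> car base.Alg \<^bold>\<longrightarrow> app (ck proj) x (\<lambda>c. \<^bold>\<forall>y. y \<^bold>\<in> c \<^bold>\<longleftrightarrow>
      y \<^bold>\<in> car base.Alg \<^bold>\<and> sym_diff base.Alg x y (\<lambda>d. d \<^bold>\<in> ck (J \<alpha>))))"
    unfolding base.Alg_simps sym_diff_def
  proof (rule f_ballI)
    fix x assume "E x base.X"
    then obtain s where s: "s \<in> FA i" "x = vset E s" by auto
    let ?sd = "\<lambda>x y. app (ck base.cm) x (\<lambda>x'. app (ck base.cm) y (\<lambda>y'.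
       app2 (base.opn mt) x y' (\<lambda>s. app2 (base.opn mt) x' y (\<lambda>t. app2 (base.opn jn) s t (\<lambda>d. d \<^bold>\<in> ck (J \<alpha>))))))"
    have csd: "congr (\<lambda>y. ?sd x y)" for x by (intro cong_intros)
    have sd_eval: "q \<tturnstile> ?sd (ck (vset E s)) (ck (vset E t)) \<longleftrightarrow> (\<forall>x\<in>sd s t. E (lev x) \<alpha>)"
      if q: "cond q" "s \<in> LS i q" "t \<in> LS i q" "{apex i} \<in> LS i q" for q t
    proof -
      have ls: "sd s {apex i} \<in> LS i q" "sd t {apex i} \<in> LS i q" using sd_LS q by blast+
      note e = base.eval[OF q(1)] base.cm_eval[OF LS_FA[OF q(2)]] base.cm_eval[OF LS_FA[OF q(3)]]
      have "q \<tturnstile> ?sd (ck (vset E s)) (ck (vset E t)) \<longleftrightarrow> q \<tturnstile> (ck (vset E (sd s t)) \<^bold>\<in> ck (J \<alpha>))"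
        by (simp only: e q ls cong_intros mt_LS ring_laws(14)[OF q(1) q(2,3,3,4)])
      then show ?thesis using q(1) mem_J[OF sd_FA[OF LS_FA[OF q(2)] LS_FA[OF q(3)]]] by simp
    qed
    have "p \<tturnstile> (\<^bold>\<forall>y. y \<^bold>\<in> ck (coset \<alpha> s) \<^bold>\<longleftrightarrow> y \<^bold>\<in> ck base.X \<^bold>\<and> ?sd (ck (vset E s)) y)"
    proof (intro f_allI f_iffI iffI)
      fix y q assume y: "q \<tturnstile> (y \<^bold>\<in> ck (coset \<alpha> s))"
      show "q \<tturnstile> (y \<^bold>\<in> ck base.X \<^bold>\<and> ?sd (ck (vset E s)) y)"
      proof (rule check_memE[OF y])
        fix r z assume r: "r \<preceq> q" "E z (coset \<alpha> s)" "r \<tturnstile> (y \<^bold>= ck z)"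
        then obtain t where t: "t \<in> FA i" "z = vset E t" "\<forall>x\<in>sd s t. E (lev x) \<alpha>" unfolding mem_coset by blast
        have "r \<tturnstile> ?sd (ck (vset E s)) (ck z)"
        proof (rule base.support2[OF s(1) t(1,1)])
          fix q assume q: "q \<preceq> r" "s \<in> LS i q" "t \<in> LS i q" "{apex i} \<in> LS i q"
          show "q \<tturnstile> ?sd (ck (vset E s)) (ck z)"
            unfolding t(2) using sd_eval[OF le_cond(1)[OF q(1)] q(2-4)] t(3) by blast
        qed
        then have "r \<tturnstile> ?sd (ck (vset E s)) y" using congrD'[OF csd, OF r(3)] by blast
        moreover have "r \<tturnstile> (y \<^bold>\<in> ck base.X)"
          using mem_eq_left[OF check_memI[OF base_X[OF t(1)]] eq_sym] r(3) unfolding t(2) by blast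
        ultimately show "r \<tturnstile> (y \<^bold>\<in> ck base.X \<^bold>\<and> ?sd (ck (vset E s)) y)" by simp
      qed
    next
      fix y q assume y: "q \<tturnstile> (y \<^bold>\<in> ck base.X \<^bold>\<and> ?sd (ck (vset E s)) y)"
      then have y1: "q \<tturnstile> (y \<^bold>\<in> ck base.X)" and y2: "q \<tturnstile> ?sd (ck (vset E s)) y" by simp_all
      show "q \<tturnstile> (y \<^bold>\<in> ck (coset \<alpha> s))"
      proof (rule check_memE[OF y1])
        fix r z assume r: "r \<preceq> q" "E z base.X" "r \<tturnstile> (y \<^bold>= ck z)"
        then obtain t where t: "t \<in> FA i" "z = vset E t" by auto
        have z: "r \<tturnstile> ?sd (ck (vset E s)) (ck z)" using congrD[OF csd, OF r(3) forces_mono[OF y2 r(1)]] .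
        have "r \<tturnstile> (ck z \<^bold>\<in> ck (coset \<alpha> s))"
        proof (rule base.support2[OF s(1) t(1,1)])
          fix q assume q: "q \<preceq> r" "s \<in> LS i q" "t \<in> LS i q" "{apex i} \<in> LS i q"
          have "\<forall>x\<in>sd s t. E (lev x) \<alpha>"
            using sd_eval[OF le_cond(1)[OF q(1)] q(2-4)] forces_mono[OF z q(1)] unfolding t(2) by blast
          then show "q \<tturnstile> (ck z \<^bold>\<in> ck (coset \<alpha> s))" using t by (intro check_memI) (auto simp: mem_coset)
        qed
        then show "r \<tturnstile> (y \<^bold>\<in> ck (coset \<alpha> s))" using mem_eq_left eq_sym r(3) by blast
      qed
    qed
    moreover have "congr (\<lambda>c. \<^bold>\<forall>y. y \<^bold>\<in> c \<^bold>\<longleftrightarrow> y \<^bold>\<in> ck base.X \<^bold>\<and> ?sd (ck (vset E s)) y)" by (intro cong_intros)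
    ultimately show "p \<tturnstile> app (ck proj) (ck x) (\<lambda>c. \<^bold>\<forall>y. y \<^bold>\<in> c \<^bold>\<longleftrightarrow> y \<^bold>\<in> ck base.X \<^bold>\<and> ?sd (ck x) y)"
      unfolding s(2) using proj_eval[OF s(1)] by blast
  qed (intro cong_intros)
qed

text \<open>The points of a product with \<open>{x}\<close> are \<open>x\<close> or lie on a level
  below \<alpha>, so modulo the ideal only two classes are possible.\<close>

lemma atom_point:
  assumes x: "x \<in> T" "fib x = i" "lev x = \<alpha>"
  shows "p \<tturnstile> is_atom quot.Alg (ck (coset \<alpha> {x}))"
proof -
  have xF: "{x} \<in> FA i" using x by (simp add: FA_def)
  have ne: "coset \<alpha> {x} \<noteq> coset \<alpha> {}" using coset_eq[OF xF base.empty_FA] x(3) by simp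
  have "p \<tturnstile> (\<^bold>\<forall>y. y \<^bold>\<in> ck quot.X \<^bold>\<and> ba_le quot.Alg y (ck (coset \<alpha> {x})) \<^bold>\<longrightarrow>
      y \<^bold>= ck (coset \<alpha> {}) \<^bold>\<or> y \<^bold>= ck (coset \<alpha> {x}))"
  proof (rule f_ballI')
    fix y q assume y: "E y quot.X" and q: "q \<preceq> p" and le: "q \<tturnstile> ba_le quot.Alg (ck y) (ck (coset \<alpha> {x}))"
    obtain s where s: "s \<in> FA i" "y = coset \<alpha> s" using y by auto
    show "q \<tturnstile> (ck y \<^bold>= ck (coset \<alpha> {}) \<^bold>\<or> ck y \<^bold>= ck (coset \<alpha> {x}))"
    proof (rule base.support2[OF s(1) xF xF])
      fix r assume r: "r \<preceq> q" "s \<in> LS i r" "{x} \<in> LS i r"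
      note c = le_cond(1)[OF r(1)]
      let ?d = "mt r s {x}"
      have dF: "?d \<in> FA i" using LS_FA[OF mt_LS[OF c r(2,3)]] .
      have eq: "coset \<alpha> ?d = y" using forces_mono[OF le r(1)] quot.le_eval[OF c r(2,3)] unfolding s(2) by blast
      have "down (\<lambda>z. z = x \<or> E (lev z) \<alpha>)"
        unfolding down_def prec_lev using x(3) Ord_trans[OF Ord_alpha] by blast
      then have "z = x \<or> E (lev z) \<alpha>" if "z \<in> ?d" for z using quot.down_mt[OF c r(2,3) _ _ that] by blast
      then have "coset \<alpha> ?d = coset \<alpha> {} \<or> coset \<alpha> ?d = coset \<alpha> {x}"
        using coset_eq[OF dF base.empty_FA] coset_eq[OF dF xF] by (cases "x \<in> ?d") auto
      then show "r \<tturnstile> (ck y \<^bold>= ck (coset \<alpha> {}) \<^bold>\<or> ck y \<^bold>= ck (coset \<alpha> {x}))"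
        using f_disjI1 f_disjI2 eq_refl unfolding eq by metis
    qed
  qed (intro cong_intros)+
  then show ?thesis unfolding is_atom_def f_conj quot.Alg_simps
    using neg_eq_check[OF ne] check_memI[OF quot_X[OF xF]] by blast
qed

text \<open>The density argument: an element with a point above level \<open>\<alpha>\<close> lies above a new point of level \<open>\<alpha>\<close>.\<close>

lemma atom_level:
  assumes p: "cond p" and s: "s \<in> FA i" and a: "p \<tturnstile> is_atom quot.Alg (ck (coset \<alpha> s))" and x: "x \<in> s"
  shows "E (lev x) (vsucc E \<alpha>)"
proof (rule ccontr)
  assume nx: "\<not> ?thesis"
  obtain r where r: "r \<preceq> p" "s \<in> LS i r"
  proof -
    have "finite s" "s \<subseteq> T" using s by (auto simp: FA_def)
    then show ?thesis using extend_support[OF p] that s unfolding LS_def by (metis (mono_tags, lifting) mem_Collect_eq)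
  qed
  note c = le_cond(1)[OF r(1)] and rc = rel_cond(1)[OF le_cond(1)[OF r(1)]]
  have sp: "s \<subseteq> pts (rel r)" using r(2) unfolding LS_def by blast
  \<comment> \<open>Maximality puts \<open>y\<close> into the value of \<open>s\<close>, so a new
    point just below \<open>y\<close> is an element below \<open>s\<close>. Its level is at least
    that of \<open>x\<close>, hence still above \<alpha>.\<close>
  obtain y where y: "y \<in> s" "(x, y) \<in> rel r" "\<forall>z\<in>s. (y, z) \<in> rel r \<longrightarrow> z = y"
    using maximal_above[OF rc sp x] by blast
  have yT: "y \<in> T" "fib y = i" "x \<in> T" "fib x = i" using s x y(1) by (auto simp: FA_def)
  have yv: "y \<in> val (rel r) s" using maximal_mem_val[OF sp, of y] y sp by blast
  have "E \<alpha> (lev x)" using nx Ord_linear[OF Ord_alpha Ord_level[OF yT(3,4)]] by auto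
  moreover have "x = y \<or> E (lev x) (lev y)" using condD(4)[OF rc y(2)] prec_lev by blast
  ultimately have ay: "E \<alpha> (lev y)" using Ord_trans[OF Ord_level[OF yT(1,2)]] by blast
  have "lev y = vsucc E \<eta> \<or> E (lev y) (vsucc E \<eta>)" using lev_le[OF yT(1,2)] by simp
  \<comment> \<open>\<open>fresh\<close> supplies points on levels up to \<eta> only. As the level
    of \<open>y\<close> is above \<alpha> and at most \<eta>+1, \<alpha> is one of these.\<close>
  then have "E \<alpha> (vsucc E \<eta>)" using ay Ord_trans[OF Ord_vsucc[OF Ord_eta]] by metis
  then obtain z where z: "z \<in> T - pts (rel r)" "fib z = i" "lev z = \<alpha>" using fresh finite_pts[OF rc] by blast
  have "(y, y) \<in> rel r" "z \<in> T" "(z, z) \<notin> rel r" "fib z = fib y" "prec z y"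
    using y(1) sp z yT(2) ay prec_lev by auto
  then obtain r' where r': "is_cond r'" "refines r' (rel r)" "(z, z) \<in> r'" "mul r' {z} s = {z}"
    using new_atom[OF rc _ _ _ _ _ sp yv] by blast
  let ?q = "enc r'"
  have q: "?q \<preceq> r" using r' c cond_enc by (auto simp: le_iff)
  have zF: "{z} \<in> FA i" using z by (simp add: FA_def)
  have zl: "{z} \<in> LS i ?q" "s \<in> LS i ?q" using r' zF LS_mono[OF q r(2)] by (auto simp: LS_def)
  note cq = le_cond(1)[OF q]
  have "?q \<tturnstile> ba_le quot.Alg (ck (coset \<alpha> {z})) (ck (coset \<alpha> s))"
    using quot.le_eval[OF cq zl] r'(1,4) by (simp add: mt_def)
  then have "?q \<tturnstile> (ck (coset \<alpha> {z}) \<^bold>\<in> ck quot.X \<^bold>\<and> ba_le quot.Alg (ck (coset \<alpha> {z})) (ck (coset \<alpha> s)))"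
    using check_memI[OF quot_X[OF zF]] by simp
  moreover have "p \<tturnstile> (\<^bold>\<forall>x. x \<^bold>\<in> ck quot.X \<^bold>\<and> ba_le quot.Alg x (ck (coset \<alpha> s)) \<^bold>\<longrightarrow>
      x \<^bold>= ck (coset \<alpha> {}) \<^bold>\<or> x \<^bold>= ck (coset \<alpha> s))"
    using a unfolding is_atom_def f_conj quot.Alg_simps by blast
  ultimately have "?q \<tturnstile> (ck (coset \<alpha> {z}) \<^bold>= ck (coset \<alpha> {}) \<^bold>\<or> ck (coset \<alpha> {z}) \<^bold>= ck (coset \<alpha> s))"
    using f_impD[OF f_allD[OF _ name_check] le_trans[OF q r(1)]] by fast
  then obtain v where "v \<preceq> ?q" "v \<tturnstile> (ck (coset \<alpha> {z}) \<^bold>= ck (coset \<alpha> {})) \<or> v \<tturnstile> (ck (coset \<alpha> {z}) \<^bold>= ck (coset \<alpha> s))"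
    unfolding forces_disj using le_refl[OF cq] by blast
  then have "coset \<alpha> {z} = coset \<alpha> {} \<or> coset \<alpha> {z} = coset \<alpha> s" using le_cond(1) by auto
  moreover have "coset \<alpha> {z} \<noteq> coset \<alpha> {}" using coset_eq[OF zF base.empty_FA] z(3) by simp
  moreover have "coset \<alpha> {z} \<noteq> coset \<alpha> s"
  proof
    assume "coset \<alpha> {z} = coset \<alpha> s"
    moreover have "y \<noteq> z" using z y(1) sp by auto
    ultimately have "E (lev y) \<alpha>" using coset_eq[OF zF s] y(1) by auto
    then show False using ay E_asym by blast
  qed
  ultimately show False by blast
qed

definition K :: 'v where
  "K = quot.ideal_of (\<lambda>x. E (lev x) (vsucc E \<alpha>))"

text \<open>Atoms lie in \<open>K\<close> by \<open>atom_level\<close>. For minimality, an ideal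
  containing all atoms is followed along a finite set: a single point gives an atom or zero, and a
  sum lies below the join.\<close>

lemma atom_ideal_check: "p \<tturnstile> is_atom_ideal quot.Alg (ck K)"
  unfolding is_atom_ideal_def f_conj
proof (intro conjI)
  show "p \<tturnstile> is_ideal quot.Alg (ck K)"
    unfolding K_def by (rule quot.ideal_check[OF down_lev]) (use Ord_alpha in auto)
  show "p \<tturnstile> (\<^bold>\<forall>a. is_atom quot.Alg a \<^bold>\<longrightarrow> a \<^bold>\<in> ck K)"
  proof (intro f_allI f_impI)
    fix a q assume a: "q \<tturnstile> is_atom quot.Alg a"
    then have aX: "q \<tturnstile> (a \<^bold>\<in> ck quot.X)" unfolding is_atom_def by simp
    show "q \<tturnstile> (a \<^bold>\<in> ck K)"
    proof (rule check_memE[OF aX])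
      fix r z assume r: "r \<preceq> q" "E z quot.X" "r \<tturnstile> (a \<^bold>= ck z)"
      then obtain s where s: "s \<in> FA i" "z = coset \<alpha> s" by auto
      have "congr (\<lambda>a. is_atom quot.Alg a)" by (intro cong_intros quot.congr_atom)
      then have "r \<tturnstile> is_atom quot.Alg (ck (coset \<alpha> s))"
        using congrD r(3) forces_mono[OF a r(1)] unfolding s(2) by blast
      then have "\<forall>x\<in>s. E (lev x) (vsucc E \<alpha>)" using atom_level[OF le_cond(1)[OF r(1)] s(1)] by blast
      then have "E z K" unfolding K_def quot.mem_ideal_of using s by blast
      then show "r \<tturnstile> (a \<^bold>\<in> ck K)" using mem_eq_left[OF check_memI eq_sym[OF r(3)]] by blast
    qed
  qed
  show "p \<tturnstile> (\<^bold>\<forall>I. is_ideal quot.Alg I \<^bold>\<and> (\<^bold>\<forall>a. is_atom quot.Alg a \<^bold>\<longrightarrow> a \<^bold>\<in> I) \<^bold>\<longrightarrow> is_subset (ck K) I)"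
  proof (intro f_allI f_impI, unfold f_conj, elim conjE)
    fix I q assume I: "q \<tturnstile> is_ideal quot.Alg I" and at: "q \<tturnstile> (\<^bold>\<forall>a. is_atom quot.Alg a \<^bold>\<longrightarrow> a \<^bold>\<in> I)"
    note I' = I[unfolded is_ideal_def f_conj quot.Alg_simps]
    have I0: "q \<tturnstile> (ck (coset \<alpha> {}) \<^bold>\<in> I)" using I' by blast
    have Ile: "q \<tturnstile> (\<^bold>\<forall>x y. x \<^bold>\<in> ck quot.X \<^bold>\<and> y \<^bold>\<in> I \<^bold>\<and> ba_le quot.Alg x y \<^bold>\<longrightarrow> x \<^bold>\<in> I)" using I' by blast
    have Ijn: "q \<tturnstile> (\<^bold>\<forall>x y. x \<^bold>\<in> I \<^bold>\<and> y \<^bold>\<in> I \<^bold>\<longrightarrow> app2 (quot.opn jn) x y (\<lambda>s. s \<^bold>\<in> I))" using I' by blast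
    have "q \<tturnstile> (ck (coset \<alpha> s) \<^bold>\<in> I)" if "finite s" "s \<in> FA i" "\<forall>x\<in>s. E (lev x) (vsucc E \<alpha>)" for s
      using that
    proof (induction s rule: finite_induct)
      case empty
      then show ?case using I0 by simp
    next
      case (insert x s)
      have F: "{x} \<in> FA i" "s \<in> FA i" using insert.prems by (auto simp: FA_def)
      have sI: "q \<tturnstile> (ck (coset \<alpha> s) \<^bold>\<in> I)" using insert F by blast
      have xI: "q \<tturnstile> (ck (coset \<alpha> {x}) \<^bold>\<in> I)"
      proof (cases "lev x = \<alpha>")
        case True
        then have "q \<tturnstile> is_atom quot.Alg (ck (coset \<alpha> {x}))" using F by (intro atom_point) (auto simp: FA_def)
        then show ?thesis
          using f_all_impD[where \<Phi> = "is_atom quot.Alg" and \<Psi> = "\<lambda>a. a \<^bold>\<in> I", OF at name_check le_refl] not_cond_forces by blast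
      next
        case False
        then have "coset \<alpha> {x} = coset \<alpha> {}" using insert.prems coset_eq[OF F(1) base.empty_FA] by auto
        then show ?thesis using I0 by simp
      qed
      show ?case
      proof (rule base.support2[OF F F(1)])
        fix r assume r: "r \<preceq> q" "{x} \<in> LS i r" "s \<in> LS i r"
        note c = le_cond(1)[OF r(1)]
        let ?j = "jn r {x} s"
        have jl: "?j \<in> LS i r" using jn_LS[OF c r(2,3)] .
        have ins: "insert x s = sd {x} s" using insert.hyps by blast
        then have il: "insert x s \<in> LS i r" using sd_LS[OF r(2,3)] by simp
        \<comment> \<open>Ideals are closed under joins and under smaller elements, while inserting
          a point adds its cone by symmetric difference; the value of the sum is contained in that
          of the join.\<close>
        have "mt r (insert x s) ?j = insert x s"
        proof (rule LS_eqI[OF c mt_LS[OF c il jl] il])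
          have "vl r (insert x s) = sd (vl r {x}) (vl r s)" unfolding ins by (rule vl_sd[OF c r(2,3)])
          then show "vl r (mt r (insert x s) ?j) = vl r (insert x s)"
            unfolding vl_mt[OF c il jl] vl_jn[OF c r(2,3)] by blast
        qed
        then have le: "r \<tturnstile> ba_le quot.Alg (ck (coset \<alpha> (insert x s))) (ck (coset \<alpha> ?j))"
          using quot.le_eval[OF c il jl] by simp
        have "q \<tturnstile> (ck (coset \<alpha> {x}) \<^bold>\<in> I \<^bold>\<and> ck (coset \<alpha> s) \<^bold>\<in> I \<^bold>\<longrightarrow>
            app2 (quot.opn jn) (ck (coset \<alpha> {x})) (ck (coset \<alpha> s)) (\<lambda>s. s \<^bold>\<in> I))"
          using Ijn f_allD[OF f_allD name_check] name_check by fast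
        then have "r \<tturnstile> app2 (quot.opn jn) (ck (coset \<alpha> {x})) (ck (coset \<alpha> s)) (\<lambda>s. s \<^bold>\<in> I)"
          using f_impD[OF _ r(1)] forces_mono[OF xI r(1)] forces_mono[OF sI r(1)] by simp
        then have jI: "r \<tturnstile> (ck (coset \<alpha> ?j) \<^bold>\<in> I)" by (simp add: quot.eval[OF c r(2,3)] cong_intros)
        have "q \<tturnstile> (ck (coset \<alpha> (insert x s)) \<^bold>\<in> ck quot.X \<^bold>\<and> ck (coset \<alpha> ?j) \<^bold>\<in> I \<^bold>\<and>
            ba_le quot.Alg (ck (coset \<alpha> (insert x s))) (ck (coset \<alpha> ?j)) \<^bold>\<longrightarrow> ck (coset \<alpha> (insert x s)) \<^bold>\<in> I)"
          using Ile f_allD[OF f_allD name_check] name_check by fast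
        then show "r \<tturnstile> (ck (coset \<alpha> (insert x s)) \<^bold>\<in> I)"
          using f_impD[OF _ r(1)] le jI check_memI[OF quot_X[OF LS_FA[OF il]]] by simp
      qed
    qed
    then have Kin: "q \<tturnstile> (ck z \<^bold>\<in> I)" if "E z K" for z
      using that unfolding K_def quot.mem_ideal_of by (auto simp: FA_def)
    show "q \<tturnstile> is_subset (ck K) I" unfolding is_subset_def
      by (rule f_ballI) (intro cong_intros, rule Kin)
  qed
qed

lemma coset_mem_K: "s \<in> FA i \<Longrightarrow> E (coset \<alpha> s) K \<longleftrightarrow> (\<forall>x\<in>s. E (lev x) (vsucc E \<alpha>))"
  unfolding K_def by (rule quot.pi_mem_ideal_of) auto

lemma cb_step_check: "p \<tturnstile> cb_step base.Alg (ck (J \<alpha>)) (ck (J (vsucc E \<alpha>)))"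
proof -
  have app_iff: "q \<tturnstile> app (ck proj) (ck x) (\<lambda>c. c \<^bold>\<in> ck K) \<longleftrightarrow> E x (J (vsucc E \<alpha>))"
    if "cond q" "E x base.X" for q x
  proof -
    obtain s where s: "s \<in> FA i" "x = vset E s" using \<open>E x base.X\<close> by auto
    show ?thesis unfolding s(2) using that(1) coset_mem_K[OF s(1)] mem_J[OF s(1)]
      by (simp add: proj_eval[OF s(1)] cong_intros)
  qed
  have "p \<tturnstile> (\<^bold>\<forall>x. x \<^bold>\<in> ck (J (vsucc E \<alpha>)) \<^bold>\<longleftrightarrow> x \<^bold>\<in> ck base.X \<^bold>\<and> app (ck proj) x (\<lambda>c. c \<^bold>\<in> ck K))"
  proof (intro f_allI f_iffI iffI)
    have c: "congr (\<lambda>x. app (ck proj) x (\<lambda>c. c \<^bold>\<in> ck K))" by (intro cong_intros)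
    fix x q assume x: "q \<tturnstile> (x \<^bold>\<in> ck (J (vsucc E \<alpha>)))"
    show "q \<tturnstile> (x \<^bold>\<in> ck base.X \<^bold>\<and> app (ck proj) x (\<lambda>c. c \<^bold>\<in> ck K))"
    proof (rule check_memE[OF x])
      fix r z assume r: "r \<preceq> q" "E z (J (vsucc E \<alpha>))" "r \<tturnstile> (x \<^bold>= ck z)"
      have zX: "E z base.X" using r(2) unfolding mem_J_iff by auto
      have "r \<tturnstile> app (ck proj) x (\<lambda>c. c \<^bold>\<in> ck K)"
        using congrD'[OF c, OF r(3)] app_iff[OF le_cond(1)[OF r(1)] zX] r(2) by blast
      moreover have "r \<tturnstile> (x \<^bold>\<in> ck base.X)" using mem_eq_left[OF check_memI[OF zX] eq_sym[OF r(3)]] .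
      ultimately show "r \<tturnstile> (x \<^bold>\<in> ck base.X \<^bold>\<and> app (ck proj) x (\<lambda>c. c \<^bold>\<in> ck K))" by simp
    qed
  next
    have c: "congr (\<lambda>x. app (ck proj) x (\<lambda>c. c \<^bold>\<in> ck K))" by (intro cong_intros)
    fix x q assume "q \<tturnstile> (x \<^bold>\<in> ck base.X \<^bold>\<and> app (ck proj) x (\<lambda>c. c \<^bold>\<in> ck K))"
    then have x: "q \<tturnstile> (x \<^bold>\<in> ck base.X)" "q \<tturnstile> app (ck proj) x (\<lambda>c. c \<^bold>\<in> ck K)" by simp_all
    show "q \<tturnstile> (x \<^bold>\<in> ck (J (vsucc E \<alpha>)))"
    proof (rule check_memE[OF x(1)])
      fix r z assume r: "r \<preceq> q" "E z base.X" "r \<tturnstile> (x \<^bold>= ck z)"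
      have "E z (J (vsucc E \<alpha>))"
        using congrD[OF c, OF r(3) forces_mono[OF x(2) r(1)]] app_iff[OF le_cond(1)[OF r(1)] r(2)] by blast
      then show "r \<tturnstile> (x \<^bold>\<in> ck (J (vsucc E \<alpha>)))" using mem_eq_left[OF check_memI eq_sym[OF r(3)]] by blast
    qed
  qed
  then have main: "p \<tturnstile> (is_quotient base.Alg (ck (J \<alpha>)) quot.Alg (ck proj) \<^bold>\<and> is_atom_ideal quot.Alg (ck K) \<^bold>\<and>
      (\<^bold>\<forall>x. x \<^bold>\<in> ck (J (vsucc E \<alpha>)) \<^bold>\<longleftrightarrow> x \<^bold>\<in> car base.Alg \<^bold>\<and> app (ck proj) x (\<lambda>c. c \<^bold>\<in> ck K)))"
    unfolding f_conj base.Alg_simps using quotient_check atom_ideal_check by blast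
  show ?thesis unfolding cb_step_def ExistsBA_def
    by (rule f_exI[where x = "ck quot.X"], rule f_exI[where x = "quot.opn mt"], rule f_exI[where x = "quot.opn jn"],
        rule f_exI[where x = "ck quot.cm"], rule f_exI[where x = "ck (coset \<alpha> {})"],
        rule f_exI[where x = "ck (coset \<alpha> {apex i})"], rule f_exI[where x = "ck proj"], rule f_exI[where x = "ck K"])
      (use main in \<open>simp_all add: quot.Alg_def\<close>)
qed

definition W :: 'v where
  "W = vset E (coset \<alpha> ` {s \<in> FA i. (\<forall>x\<in>s. E (lev x) (vsucc E \<alpha>)) \<and> (\<exists>x\<in>s. lev x = \<alpha>)})"

lemma mem_W: "E z W \<longleftrightarrow> (\<exists>s\<in>FA i. (\<forall>x\<in>s. E (lev x) (vsucc E \<alpha>)) \<and> (\<exists>x\<in>s. lev x = \<alpha>) \<and> z = coset \<alpha> s)"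
proof -
  have "small E (coset \<alpha> ` {s \<in> FA i. (\<forall>x\<in>s. E (lev x) (vsucc E \<alpha>)) \<and> (\<exists>x\<in>s. lev x = \<alpha>)})"
    by (rule small_subset[OF quot.small_FA[of "coset \<alpha>"]]) blast
  then show ?thesis unfolding W_def by auto
qed

lemma level_check: "p \<tturnstile> is_level base.Alg (ck (J \<alpha>)) (ck (J (vsucc E \<alpha>))) (ck W)"
proof -
  have "p \<tturnstile> (\<^bold>\<forall>c. c \<^bold>\<in> ck W \<^bold>\<longleftrightarrow> (\<^bold>\<exists>x. x \<^bold>\<in> ck (J (vsucc E \<alpha>)) \<^bold>\<and> \<^bold>\<not> x \<^bold>\<in> ck (J \<alpha>) \<^bold>\<and> maps (ck proj) x c))"
  proof (intro f_allI f_iffI iffI)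
    fix y q assume n: "name y" and y: "q \<tturnstile> (y \<^bold>\<in> ck W)"
    show "q \<tturnstile> (\<^bold>\<exists>x. x \<^bold>\<in> ck (J (vsucc E \<alpha>)) \<^bold>\<and> \<^bold>\<not> x \<^bold>\<in> ck (J \<alpha>) \<^bold>\<and> maps (ck proj) x y)"
    proof (rule check_memE[OF y])
      fix r z assume r: "r \<preceq> q" "E z W" "r \<tturnstile> (y \<^bold>= ck z)"
      then obtain s where s: "s \<in> FA i" "\<forall>x\<in>s. E (lev x) (vsucc E \<alpha>)" "\<exists>x\<in>s. lev x = \<alpha>" "z = coset \<alpha> s"
        unfolding mem_W by blast
      have c: "congr (\<lambda>y. maps (ck proj) (ck (vset E s)) y)" by (intro cong_intros)
      have "r \<tturnstile> maps (ck proj) (ck (vset E s)) y"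
        using congrD'[OF c, OF r(3)] proj_maps[OF s(1)] unfolding s(4) by blast
      moreover have "E (vset E s) (J (vsucc E \<alpha>))" "\<not> E (vset E s) (J \<alpha>)"
        using mem_J[OF s(1)] s(2,3) E_irrefl by metis+
      moreover from this have "r \<tturnstile> (\<^bold>\<not> ck (vset E s) \<^bold>\<in> ck (J \<alpha>))" using le_cond(1) by (intro f_negI) auto
      ultimately show "r \<tturnstile> (\<^bold>\<exists>x. x \<^bold>\<in> ck (J (vsucc E \<alpha>)) \<^bold>\<and> \<^bold>\<not> x \<^bold>\<in> ck (J \<alpha>) \<^bold>\<and> maps (ck proj) x y)"
        using check_memI by (intro f_exI[where x = "ck (vset E s)"]) (simp_all del: forces.simps)
    qed
  next
    fix y q assume n: "name y" and y: "q \<tturnstile> (\<^bold>\<exists>x. x \<^bold>\<in> ck (J (vsucc E \<alpha>)) \<^bold>\<and> \<^bold>\<not> x \<^bold>\<in> ck (J \<alpha>) \<^bold>\<and> maps (ck proj) x y)"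
    show "q \<tturnstile> (y \<^bold>\<in> ck W)"
    proof (rule f_exE[OF y], unfold f_conj, elim conjE)
      fix r x assume r: "r \<preceq> q" "name x" "r \<tturnstile> (x \<^bold>\<in> ck (J (vsucc E \<alpha>)))" "r \<tturnstile> (\<^bold>\<not> x \<^bold>\<in> ck (J \<alpha>))" "r \<tturnstile> maps (ck proj) x y"
      show "r \<tturnstile> (y \<^bold>\<in> ck W)"
      proof (rule maps_graphE[OF r(5)[unfolded proj_def] _ r(2) n])
        fix v z assume v: "v \<preceq> r" "z \<in> ext E base.X" "v \<tturnstile> (x \<^bold>= ck z)" "v \<tturnstile> (y \<^bold>= ck (coset \<alpha> (ext E z)))"
        then obtain s where s: "s \<in> FA i" "z = vset E s" by auto
        note c = le_cond(1)[OF v(1)]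
        have "v \<tturnstile> (ck z \<^bold>\<in> ck (J (vsucc E \<alpha>)))" using mem_eq_left[OF forces_mono[OF r(3) v(1)] v(3)] .
        then have 1: "\<forall>x\<in>s. E (lev x) (vsucc E \<alpha>)" using c mem_J[OF s(1)] s(2) by simp
        have "\<not> v \<tturnstile> (ck z \<^bold>\<in> ck (J \<alpha>))"
        proof
          assume "v \<tturnstile> (ck z \<^bold>\<in> ck (J \<alpha>))"
          then have "v \<tturnstile> (x \<^bold>\<in> ck (J \<alpha>))" using mem_eq_left eq_sym[OF v(3)] by blast
          then show False using f_negE[OF forces_mono[OF r(4) v(1)] _ c] by blast
        qed
        then have "\<not> (\<forall>x\<in>s. E (lev x) \<alpha>)" using c mem_J[OF s(1)] s(2) by simp
        then have "\<exists>x\<in>s. lev x = \<alpha>" using 1 by auto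
        then have "E (coset \<alpha> (ext E z)) W" unfolding mem_W using 1 s by auto
        then show "v \<tturnstile> (y \<^bold>\<in> ck W)" using mem_eq_left[OF check_memI eq_sym[OF v(4)]] by blast
      qed simp
    qed
  qed
  then have main: "p \<tturnstile> (is_quotient base.Alg (ck (J \<alpha>)) quot.Alg (ck proj) \<^bold>\<and>
      (\<^bold>\<forall>c. c \<^bold>\<in> ck W \<^bold>\<longleftrightarrow> (\<^bold>\<exists>x. x \<^bold>\<in> ck (J (vsucc E \<alpha>)) \<^bold>\<and> \<^bold>\<not> x \<^bold>\<in> ck (J \<alpha>) \<^bold>\<and> maps (ck proj) x c)))"
    unfolding f_conj using quotient_check by blast
  show ?thesis unfolding is_level_def ExistsBA_def
    by (rule f_exI[where x = "ck quot.X"], rule f_exI[where x = "quot.opn mt"], rule f_exI[where x = "quot.opn jn"],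
        rule f_exI[where x = "ck quot.cm"], rule f_exI[where x = "ck (coset \<alpha> {})"],
        rule f_exI[where x = "ck (coset \<alpha> {apex i})"], rule f_exI[where x = "ck proj"])
      (use main in \<open>simp_all add: quot.Alg_def\<close>)
qed

end

section \<open>Superatomicity: homomorphic images in the extension are atomic\<close>

subsection \<open>Homomorphic images\<close>

context forcing
begin

text \<open>The singleton of \<open>a\<close> is one of the two members of \<open>z\<close>, and
  \<open>x\<close> belongs to both of them. This covers pairs that are not ground objects, as in the
  graph of a homomorphism onto a generic algebra.\<close>

lemma pair_fst:
  assumes "p \<tturnstile> is_pair z x y" "p \<tturnstile> is_pair z a b" "name x" "name a"
  shows "p \<tturnstile> (x \<^bold>= a)"
  using assms(2) unfolding is_pair_def
proof (rule f_exE)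
  fix q u' assume q: "q \<preceq> p" "name u'" and ex: "q \<tturnstile> (\<^bold>\<exists>v. is_upair u' a a \<^bold>\<and> is_upair v a b \<^bold>\<and> is_upair z u' v)"
  show "q \<tturnstile> (x \<^bold>= a)"
  proof (rule f_exE[OF ex], unfold f_conj, elim conjE)
    fix r v' assume r: "r \<preceq> q" "name v'" "r \<tturnstile> is_upair u' a a" "r \<tturnstile> is_upair z u' v'"
    have u'z: "r \<tturnstile> (u' \<^bold>\<in> z)" using upair_memI(1)[OF r(4) q(2)] .
    have "r \<tturnstile> is_pair z x y" using forces_mono[OF assms(1) le_trans[OF r(1) q(1)]] .
    then show "r \<tturnstile> (x \<^bold>= a)" unfolding is_pair_def
    proof (rule f_exE)
      fix s u assume s: "s \<preceq> r" "name u" and ex2: "s \<tturnstile> (\<^bold>\<exists>v. is_upair u x x \<^bold>\<and> is_upair v x y \<^bold>\<and> is_upair z u v)"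
      show "s \<tturnstile> (x \<^bold>= a)"
      proof (rule f_exE[OF ex2], unfold f_conj, elim conjE)
        fix t v assume t: "t \<preceq> s" "name v" "t \<tturnstile> is_upair u x x" "t \<tturnstile> is_upair v x y" "t \<tturnstile> is_upair z u v"
        have tr: "t \<preceq> r" using le_trans[OF t(1) s(1)] .
        have "t \<tturnstile> (u' \<^bold>= u \<^bold>\<or> u' \<^bold>= v)"
          using f_all_iffD[OF t(5)[unfolded is_upair_def] q(2) le_refl[OF le_cond(1)[OF t(1)]]] forces_mono[OF u'z tr] by blast
        then have "t \<tturnstile> (x \<^bold>\<in> u')"
        proof (rule f_disjE)
          fix w assume "w \<preceq> t" "w \<tturnstile> (u' \<^bold>= u)"
          then show "w \<tturnstile> (x \<^bold>\<in> u')" using mem_eq_right[OF upair_memI(1)[OF forces_mono[OF t(3)] assms(3)] eq_sym] by blast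
        next
          fix w assume "w \<preceq> t" "w \<tturnstile> (u' \<^bold>= v)"
          then show "w \<tturnstile> (x \<^bold>\<in> u')" using mem_eq_right[OF upair_memI(1)[OF forces_mono[OF t(4)] assms(3)] eq_sym] by blast
        qed
        then have "t \<tturnstile> (x \<^bold>= a \<^bold>\<or> x \<^bold>= a)"
          using f_all_iffD[OF forces_mono[OF r(3) tr, unfolded is_upair_def] assms(3) le_refl[OF le_cond(1)[OF t(1)]]] by blast
        then show "t \<tturnstile> (x \<^bold>= a)" by (rule f_disjE)
      qed
    qed
  qed
qed

text \<open>Here the codomain is an arbitrary name, so only the argument can be decided as a ground
  element.\<close>

lemma maps_domE:
  assumes f: "p \<tturnstile> is_fun f (ck X) Y" and m: "p \<tturnstile> maps f t u" and n: "name t" "name u"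
    and "\<And>q a. q \<preceq> p \<Longrightarrow> E a X \<Longrightarrow> q \<tturnstile> (t \<^bold>= ck a) \<Longrightarrow> q \<tturnstile> (u \<^bold>\<in> Y) \<Longrightarrow> q \<tturnstile> \<chi>"
  shows "p \<tturnstile> \<chi>"
  using m unfolding maps_def
proof (rule f_exE, unfold f_conj, elim conjE)
  fix q z assume q: "q \<preceq> p" "name z" "q \<tturnstile> is_pair z t u" "q \<tturnstile> (z \<^bold>\<in> f)"
  have "p \<tturnstile> (\<^bold>\<forall>z. z \<^bold>\<in> f \<^bold>\<longrightarrow> (\<^bold>\<exists>x y. x \<^bold>\<in> ck X \<^bold>\<and> y \<^bold>\<in> Y \<^bold>\<and> is_pair z x y))"
    using f unfolding is_fun_def f_conj by blast
  note ex = f_all_impD[OF this, OF q(2,1,4)]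
  show "q \<tturnstile> \<chi>"
  proof (rule f_exE[OF ex], erule f_exE, unfold f_conj, elim conjE)
    fix r s x y assume r: "r \<preceq> q" "name x" "s \<preceq> r" "name y" "s \<tturnstile> (x \<^bold>\<in> ck X)" "s \<tturnstile> (y \<^bold>\<in> Y)" "s \<tturnstile> is_pair z x y"
    have sq: "s \<preceq> q" and sp: "s \<preceq> p" using le_trans r(3,1) q(1) by blast+
    have tx: "s \<tturnstile> (t \<^bold>= x)" using pair_fst[OF forces_mono[OF q(3) sq] r(7) n(1) r(2)] .
    have c: "congr (\<lambda>w. maps f w y)" by (intro cong_intros)
    have "s \<tturnstile> maps f x y" unfolding maps_def
      by (rule f_exI[where x = z]) (use r(7) forces_mono[OF q(4) sq] q(2) in simp_all)
    then have "s \<tturnstile> maps f t y" using congrD'[OF c, OF tx] by blast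
    then have yu: "s \<tturnstile> (y \<^bold>= u)"
      using fun_unique[OF forces_mono[OF f sp] _ forces_mono[OF m sp] n(1) r(4) n(2)] by blast
    show "s \<tturnstile> \<chi>"
    proof (rule check_memE[OF r(5)])
      fix v a assume v: "v \<preceq> s" "E a X" "v \<tturnstile> (x \<^bold>= ck a)"
      show "v \<tturnstile> \<chi>"
      proof (rule assms(5)[OF le_trans[OF v(1) sp] v(2)])
        show "v \<tturnstile> (t \<^bold>= ck a)" using eq_trans[OF forces_mono[OF tx v(1)] v(3)] .
        show "v \<tturnstile> (u \<^bold>\<in> Y)" using mem_eq_left[OF forces_mono[OF r(6) v(1)] forces_mono[OF yu v(1)]] .
      qed
    qed
  qed
qed

lemma app2E:
  assumes "p \<tturnstile> app2 m x y \<Phi>"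
    "\<And>q z e. q \<preceq> p \<Longrightarrow> name z \<Longrightarrow> name e \<Longrightarrow> q \<tturnstile> is_pair z x y \<Longrightarrow> q \<tturnstile> maps m z e \<Longrightarrow> q \<tturnstile> \<Phi> e \<Longrightarrow> q \<tturnstile> \<chi>"
  shows "p \<tturnstile> \<chi>"
  using assms(1) unfolding app2_def app_def
proof (rule f_exE, unfold f_conj, elim conjE)
  fix q z assume q: "q \<preceq> p" "name z" "q \<tturnstile> is_pair z x y" and ex: "q \<tturnstile> (\<^bold>\<exists>e. maps m z e \<^bold>\<and> \<Phi> e)"
  show "q \<tturnstile> \<chi>"
  proof (rule f_exE[OF ex], unfold f_conj, elim conjE)
    fix r e assume r: "r \<preceq> q" "name e" "r \<tturnstile> maps m z e" "r \<tturnstile> \<Phi> e"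
    show "r \<tturnstile> \<chi>" using assms(2)[OF le_trans[OF r(1) q(1)] q(2) r(2) forces_mono[OF q(3) r(1)] r(3,4)] .
  qed
qed

lemma app2_fun:
  assumes f: "p \<tturnstile> is_fun m D B" and a: "p \<tturnstile> app2 m x y \<Phi>" "p \<tturnstile> app2 m x y \<Psi>" and c: "congr \<Phi>"
    and "\<And>q e. q \<preceq> p \<Longrightarrow> name e \<Longrightarrow> q \<tturnstile> \<Phi> e \<Longrightarrow> q \<tturnstile> \<Psi> e \<Longrightarrow> q \<tturnstile> \<chi>"
  shows "p \<tturnstile> \<chi>"
proof (rule app2E[OF a(1)])
  fix q z e assume q: "q \<preceq> p" "name z" "name e" "q \<tturnstile> is_pair z x y" "q \<tturnstile> maps m z e" "q \<tturnstile> \<Phi> e"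
  show "q \<tturnstile> \<chi>"
  proof (rule app2E[OF forces_mono[OF a(2) q(1)]])
    fix r z' e' assume r: "r \<preceq> q" "name z'" "name e'" "r \<tturnstile> is_pair z' x y" "r \<tturnstile> maps m z' e'" "r \<tturnstile> \<Psi> e'"
    have zz: "r \<tturnstile> (z \<^bold>= z')" using pair_unique[OF q(2) r(2) forces_mono[OF q(4) r(1)] r(4)] .
    have c2: "congr (\<lambda>w. maps m w e)" by (intro cong_intros)
    have "r \<tturnstile> maps m z' e" using congrD[OF c2, OF zz forces_mono[OF q(5) r(1)]] .
    then have "r \<tturnstile> (e \<^bold>= e')"
      using fun_unique[OF forces_mono[OF f le_trans[OF r(1) q(1)]] _ r(5) r(2) q(3) r(3)] by blast
    then have "r \<tturnstile> \<Phi> e'" using congrD[OF c] forces_mono[OF q(6) r(1)] by blast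
    then show "r \<tturnstile> \<chi>" using assms(5)[OF le_trans[OF r(1) q(1)] r(3) _ r(6)] by blast
  qed
qed

lemma app2_imp:
  assumes "p \<tturnstile> app2 m x y \<Phi>" "\<And>q e. q \<preceq> p \<Longrightarrow> name e \<Longrightarrow> q \<tturnstile> \<Phi> e \<Longrightarrow> q \<tturnstile> \<Psi> e"
  shows "p \<tturnstile> app2 m x y \<Psi>"
proof (rule app2E[OF assms(1)])
  fix q z e assume q: "q \<preceq> p" "name z" "name e" "q \<tturnstile> is_pair z x y" "q \<tturnstile> maps m z e" "q \<tturnstile> \<Phi> e"
  show "q \<tturnstile> app2 m x y \<Psi>" unfolding app2_def app_def
    by (rule f_exI[where x = z], unfold f_conj, rule conjI[OF q(4)], rule f_exI[where x = e])
      (use q assms(2) in simp_all)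
qed

end

context leveled
begin

lemma ext_FA [simp]: "s \<in> FA i \<Longrightarrow> ext E (vset E s) = s"
  by (rule ext_vset) (auto simp: FA_def)

lemma base_X: "s \<in> FA i \<Longrightarrow> E (vset E s) base.X"
  by auto

lemma Ord_level: "x \<in> T \<Longrightarrow> fib x = i \<Longrightarrow> Ord E (lev x)"
  using Ord_mem[OF Ord_vsucc[OF Ord_vsucc[OF Ord_eta]] lev_le] .

text \<open>Finiteness provides a highest level \<open>b\<close>; the successor of \<open>b\<close>
  in the bound admits the points on level \<open>b\<close> themselves.\<close>

lemma max_level:
  assumes "finite s" "s \<noteq> {}" "\<And>x. x \<in> s \<Longrightarrow> E (lev x) a" "Ord E a"
  shows "\<exists>b. E b a \<and> (\<forall>x\<in>s. E (lev x) (vsucc E b))"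
  using assms(1-3)
proof (induction s rule: finite_ne_induct)
  case (singleton x)
  then show ?case by (intro exI[of _ "lev x"]) simp
next
  case (insert x s)
  then obtain b where b: "E b a" "\<forall>x\<in>s. E (lev x) (vsucc E b)" by auto
  have xa: "E (lev x) a" using insert.prems by simp
  have O: "Ord E b" "Ord E (lev x)" using Ord_mem[OF assms(4)] b(1) xa by blast+
  consider "E (lev x) (vsucc E b)" | "E b (lev x)" using Ord_linear[OF O] by auto
  then show ?case
  proof cases
    case 1
    then show ?thesis using b by blast
  next
    case 2
    have "E (lev y) (vsucc E (lev x))" if "y \<in> s" for y
    proof -
      have "lev y = b \<or> E (lev y) b" using b(2) that by simp
      then have "E (lev y) (lev x)" using 2 Ord_trans[OF O(2) 2] by blast
      then show ?thesis by simp
    qed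
    then show ?thesis using xa by (intro exI[of _ "lev x"]) simp
  qed
qed

end

text \<open>\<open>C\<close> stands for an arbitrary algebra of the extension, given by names.
  Surjectivity of \<open>h\<close> below \<open>p0\<close> lets its elements be handled as images of
  finite sets of points.\<close>

locale homomorphic_image = leveled E T fib prec apex al i lev \<eta>
  for E :: "'v \<Rightarrow> 'v \<Rightarrow> bool" and T :: "'v set" and fib :: "'v \<Rightarrow> 'i" and prec apex al i lev \<eta> +
  fixes C :: "'v balg" and h p0
  assumes names: "name (bzero C)" "name h"
    and BA: "forces E Pos (is_BA C) p0"
    and hom: "forces E Pos (is_surj_hom h base.Alg C) p0"
begin

lemma h_fun: "p \<preceq> p0 \<Longrightarrow> p \<tturnstile> is_fun h (ck base.X) (car C)"
  using forces_mono[OF hom] unfolding is_surj_hom_def is_surj_def f_conj base.Alg_simps by blast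

lemma h_zero: "p \<preceq> p0 \<Longrightarrow> p \<tturnstile> maps h (ck (vset E {})) (bzero C)"
  using forces_mono[OF hom] unfolding is_surj_hom_def f_conj base.Alg_simps by blast

lemma h_unique:
  assumes "p \<preceq> p0" "p \<tturnstile> maps h (ck x) c" "p \<tturnstile> maps h (ck x) d" "name c" "name d"
  shows "p \<tturnstile> (c \<^bold>= d)"
  using fun_unique[OF h_fun[OF assms(1)] assms(2,3) name_check assms(4,5)] .

lemma h_value:
  assumes "p \<preceq> p0" "s \<in> FA i"
  obtains q c where "q \<preceq> p" "name c" "q \<tturnstile> maps h (ck (vset E s)) c"
proof -
  have "p \<tturnstile> (\<^bold>\<forall>x. x \<^bold>\<in> ck base.X \<^bold>\<longrightarrow> Exists (maps h x))"
    using h_fun[OF assms(1)] unfolding is_fun_def f_conj by blast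
  note f_ballD[OF this, OF base_X[OF assms(2)]]
  from ex_obtain[OF this le_cond(1)[OF assms(1)]] show ?thesis using that by blast
qed

lemma h_surj:
  assumes "p \<preceq> p0" "name c" "p \<tturnstile> (c \<^bold>\<in> car C)"
  obtains q s where "q \<preceq> p" "s \<in> FA i" "q \<tturnstile> maps h (ck (vset E s)) c"
proof -
  have "p \<tturnstile> (\<^bold>\<forall>y. y \<^bold>\<in> car C \<^bold>\<longrightarrow> (\<^bold>\<exists>x. maps h x y))"
    using forces_mono[OF hom assms(1)] unfolding is_surj_hom_def is_surj_def f_conj by blast
  note ex = f_all_impD[OF this, OF assms(2) le_refl[OF le_cond(1)[OF assms(1)]] assms(3)]
  show ?thesis
  proof (rule ccontr)
    assume n: "\<not> thesis"
    have "p \<tturnstile> (ck p \<^bold>\<in> ck p)"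
    proof (rule f_exE[OF ex])
      fix q x assume q: "q \<preceq> p" "name x" "q \<tturnstile> maps h x c"
      show "q \<tturnstile> (ck p \<^bold>\<in> ck p)"
      proof (rule maps_domE[OF h_fun[OF le_trans[OF q(1) assms(1)]] q(3,2) assms(2)])
        fix r a assume r: "r \<preceq> q" "E a base.X" "r \<tturnstile> (x \<^bold>= ck a)"
        have c: "congr (\<lambda>x. maps h x c)" by (intro cong_intros)
        have m: "r \<tturnstile> maps h (ck a) c" using congrD[OF c, OF r(3) forces_mono[OF q(3) r(1)]] .
        obtain s where "s \<in> FA i" "a = vset E s" using r(2) by auto
        then show "r \<tturnstile> (ck p \<^bold>\<in> ck p)" using that[OF le_trans[OF r(1) q(1)]] m n by blast
      qed
    qed
    then show False using le_cond(1)[OF assms(1)] by simp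
  qed
qed

lemma h_range:
  assumes "p \<preceq> p0" "name c" "p \<tturnstile> maps h (ck x) c"
  shows "p \<tturnstile> (c \<^bold>\<in> car C)"
  by (rule maps_domE[OF h_fun[OF assms(1)] assms(3) name_check assms(2)])

text \<open>The condition knows the product and the join of the arguments, and functionality of
  \<open>h\<close> replaces the images provided by the homomorphism clause with the given names
  \<open>c\<close> and \<open>d\<close>.\<close>

lemma h_op:
  assumes p: "p \<preceq> p0" and ls: "s \<in> LS i p" "t \<in> LS i p" and n: "name c" "name d"
    and m: "p \<tturnstile> maps h (ck (vset E s)) c" "p \<tturnstile> maps h (ck (vset E t)) d"
  shows "p \<tturnstile> app2 (meet C) c d (\<lambda>e. maps h (ck (vset E (mt p s t))) e)"
    "p \<tturnstile> app2 (join C) c d (\<lambda>e. maps h (ck (vset E (jn p s t))) e)"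
proof -
  let ?mt = "vset E (mt p s t)" and ?jn = "vset E (jn p s t)"
  let ?\<Phi> = "\<lambda>c d. app2 (meet C) c d (\<lambda>e. maps h (ck ?mt) e) \<^bold>\<and> app2 (join C) c d (\<lambda>e. maps h (ck ?jn) e)"
  let ?\<Psi> = "\<lambda>x y. app h x (\<lambda>x'. app h y (\<lambda>y'.
           app2 (base.opn mt) x y (\<lambda>s. app2 (meet C) x' y' (\<lambda>t. maps h s t)) \<^bold>\<and>
           app2 (base.opn jn) x y (\<lambda>s. app2 (join C) x' y' (\<lambda>t. maps h s t))))"
  note sF = LS_FA[OF ls(1)] and tF = LS_FA[OF ls(2)] and cp = le_cond(1)[OF p]
  have "p \<tturnstile> (\<^bold>\<forall>x y. x \<^bold>\<in> ck base.X \<^bold>\<and> y \<^bold>\<in> ck base.X \<^bold>\<longrightarrow> ?\<Psi> x y)"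
    using forces_mono[OF hom p] unfolding is_surj_hom_def f_conj base.Alg_simps by blast
  then have "p \<tturnstile> (ck (vset E s) \<^bold>\<in> ck base.X \<^bold>\<and> ck (vset E t) \<^bold>\<in> ck base.X \<^bold>\<longrightarrow> ?\<Psi> (ck (vset E s)) (ck (vset E t)))"
    by (simp del: f_conj)
  then have "p \<tturnstile> ?\<Psi> (ck (vset E s)) (ck (vset E t))"
    by (rule f_impD[OF _ le_refl[OF cp]]) (use check_memI[OF base_X[OF sF]] check_memI[OF base_X[OF tF]] in simp)
  then have "p \<tturnstile> ?\<Phi> c d"
    unfolding app_def[of h]
  proof (rule f_exE)
    fix q c' assume q: "q \<preceq> p" "name c'"
      and a: "q \<tturnstile> (maps h (ck (vset E s)) c' \<^bold>\<and> (\<^bold>\<exists>y'. maps h (ck (vset E t)) y' \<^bold>\<and>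
           app2 (base.opn mt) (ck (vset E s)) (ck (vset E t)) (\<lambda>s. app2 (meet C) c' y' (\<lambda>t. maps h s t)) \<^bold>\<and>
           app2 (base.opn jn) (ck (vset E s)) (ck (vset E t)) (\<lambda>s. app2 (join C) c' y' (\<lambda>t. maps h s t))))"
    have a1: "q \<tturnstile> maps h (ck (vset E s)) c'" using a by simp
    from a have "q \<tturnstile> (\<^bold>\<exists>y'. maps h (ck (vset E t)) y' \<^bold>\<and>
           app2 (base.opn mt) (ck (vset E s)) (ck (vset E t)) (\<lambda>s. app2 (meet C) c' y' (\<lambda>t. maps h s t)) \<^bold>\<and>
           app2 (base.opn jn) (ck (vset E s)) (ck (vset E t)) (\<lambda>s. app2 (join C) c' y' (\<lambda>t. maps h s t)))" by simp
    then show "q \<tturnstile> ?\<Phi> c d"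
    proof (rule f_exE, unfold f_conj, elim conjE)
      fix r d' assume r: "r \<preceq> q" "name d'" "r \<tturnstile> maps h (ck (vset E t)) d'"
        "r \<tturnstile> app2 (base.opn mt) (ck (vset E s)) (ck (vset E t)) (\<lambda>s. app2 (meet C) c' d' (\<lambda>t. maps h s t))"
        "r \<tturnstile> app2 (base.opn jn) (ck (vset E s)) (ck (vset E t)) (\<lambda>s. app2 (join C) c' d' (\<lambda>t. maps h s t))"
      have rp: "r \<preceq> p" using le_trans[OF r(1) q(1)] .
      have rp0: "r \<preceq> p0" using le_trans[OF rp p] .
      note lr = LS_mono[OF rp ls(1)] LS_mono[OF rp ls(2)] and cr = le_cond(1)[OF r(1)]
      have cc: "r \<tturnstile> (c' \<^bold>= c)" using h_unique[OF rp0 forces_mono[OF a1 r(1)] forces_mono[OF m(1) rp] q(2) n(1)] .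
      have dd: "r \<tturnstile> (d' \<^bold>= d)" using h_unique[OF rp0 r(3) forces_mono[OF m(2) rp] r(2) n(2)] .
      have "r \<tturnstile> app2 (meet C) c' d' (\<lambda>e. maps h (ck ?mt) e)"
        using r(4) by (simp add: base.eval[OF cr lr] cong_intros mt_le[OF rp ls])
      moreover have "r \<tturnstile> app2 (join C) c' d' (\<lambda>e. maps h (ck ?jn) e)"
        using r(5) by (simp add: base.eval[OF cr lr] cong_intros jn_le[OF rp ls])
      ultimately have "r \<tturnstile> ?\<Phi> c' d'" by simp
      moreover have k: "congr (\<lambda>c. ?\<Phi> c d')" "congr (\<lambda>d. ?\<Phi> c d)" by (intro cong_intros)+
      ultimately have "r \<tturnstile> ?\<Phi> c d" using congrD[OF k(2), OF dd] congrD[OF k(1), OF cc] by blast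
      then show "r \<tturnstile> app2 (meet C) c d (\<lambda>e. maps h (ck ?mt) e) \<and> r \<tturnstile> app2 (join C) c d (\<lambda>e. maps h (ck ?jn) e)" by simp
    qed
  qed
  then show "p \<tturnstile> app2 (meet C) c d (\<lambda>e. maps h (ck (vset E (mt p s t))) e)"
    "p \<tturnstile> app2 (join C) c d (\<lambda>e. maps h (ck (vset E (jn p s t))) e)" by simp_all
qed

lemma op_fun:
  assumes p: "p \<preceq> p0" and f: "f = meet C \<or> f = join C" and a: "p \<tturnstile> app2 f x y \<Phi>" "p \<tturnstile> app2 f x y \<Psi>" and c: "congr \<Phi>"
    and "\<And>q e. q \<preceq> p \<Longrightarrow> name e \<Longrightarrow> q \<tturnstile> \<Phi> e \<Longrightarrow> q \<tturnstile> \<Psi> e \<Longrightarrow> q \<tturnstile> \<chi>"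
  shows "p \<tturnstile> \<chi>"
proof -
  have "p \<tturnstile> is_binop f (car C)" using forces_mono[OF BA p] f unfolding is_BA_def f_conj by blast
  then show ?thesis unfolding is_binop_def
  proof (rule f_exE, unfold f_conj, elim conjE)
    fix q D assume q: "q \<preceq> p" "q \<tturnstile> is_fun f D (car C)"
    show "q \<tturnstile> \<chi>"
      by (rule app2_fun[OF q(2) forces_mono[OF a(1) q(1)] forces_mono[OF a(2) q(1)] c])
        (use assms(6) le_trans[OF _ q(1)] in blast)
  qed
qed

lemma join_zero:
  assumes "p \<preceq> p0" "name c" "p \<tturnstile> (c \<^bold>\<in> car C)"
  shows "p \<tturnstile> app2 (join C) c (bzero C) (\<lambda>s. s \<^bold>= c)"
proof -
  have "p \<tturnstile> (\<^bold>\<forall>x. x \<^bold>\<in> car C \<^bold>\<longrightarrow>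
         app2 (meet C) x (bone C) (\<lambda>s. s \<^bold>= x) \<^bold>\<and> app2 (join C) x (bzero C) (\<lambda>s. s \<^bold>= x) \<^bold>\<and>
         app (cmpl C) x (\<lambda>x'. app2 (meet C) x x' (\<lambda>s. s \<^bold>= bzero C) \<^bold>\<and>
                              app2 (join C) x x' (\<lambda>s. s \<^bold>= bone C)))"
    using forces_mono[OF BA assms(1)] unfolding is_BA_def f_conj by blast
  from f_all_impD[OF this, OF assms(2) le_refl[OF le_cond(1)[OF assms(1)]] assms(3)] show ?thesis by simp
qed

text \<open>Both \<open>c\<close> and the image of the product are the meet of \<open>c\<close> and
  \<open>d\<close>. A preimage of \<open>c\<close> can thus be taken below the given preimage of
  \<open>d\<close>.\<close>

lemma le_value:
  assumes p: "p \<preceq> p0" and n: "name c" "name d" and le: "p \<tturnstile> ba_le C c d"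
    and ls: "s \<in> LS i p" "t \<in> LS i p" and m: "p \<tturnstile> maps h (ck (vset E s)) c" "p \<tturnstile> maps h (ck (vset E t)) d"
  shows "p \<tturnstile> maps h (ck (vset E (mt p s t))) c"
proof (rule op_fun[OF p _ h_op(1)[OF p ls n m] le[unfolded ba_le_def]])
  fix q e assume "q \<tturnstile> maps h (ck (vset E (mt p s t))) e" "q \<tturnstile> (e \<^bold>= c)"
  moreover have "congr (\<lambda>e. maps h (ck (vset E (mt p s t))) e)" by (intro cong_intros)
  ultimately show "q \<tturnstile> maps h (ck (vset E (mt p s t))) c" using congrD by blast
qed (auto intro!: cong_intros)

text \<open>The minimisation ranges over extensions together with elements, because stronger
  conditions bring new elements below \<open>s0\<close>.\<close>

definition cand :: "'v \<Rightarrow> 'v set \<Rightarrow> 'v \<Rightarrow> 'v set \<Rightarrow> bool" where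
  "cand q s0 r s \<longleftrightarrow> r \<preceq> q \<and> s \<in> LS i r \<and> s0 \<in> LS i r \<and> vl r s \<subseteq> vl r s0 \<and>
     (\<exists>d. name d \<and> r \<tturnstile> maps h (ck (vset E s)) d \<and> r \<tturnstile> (\<^bold>\<not> d \<^bold>= bzero C))"

text \<open>Minimise first the highest level \<open>g\<close>, then the number \<open>k\<close> of
  points on level \<open>g\<close>. The image \<open>d\<close> of a minimal candidate
  \<open>s\<close> is an atom: an element below it is the image of some \<open>u\<close> below
  \<open>s\<close>. If this image is nonzero, \<open>u\<close> and \<open>s\<close> have the same
  points on level \<open>g\<close> by the choice of \<open>k\<close>, so their difference lives
  below \<open>g\<close> and has image zero by the choice of \<open>g\<close>; hence
  \<open>u\<close> and \<open>s\<close> have the same image.\<close>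

lemma atom_below:
  assumes q: "q \<preceq> p0" and c: "name c" and s0: "s0 \<in> LS i q" "q \<tturnstile> maps h (ck (vset E s0)) c" and ne: "q \<tturnstile> (\<^bold>\<not> c \<^bold>= bzero C)"
  shows "\<exists>r d. r \<preceq> q \<and> name d \<and> r \<tturnstile> (is_atom C d \<^bold>\<and> ba_le C d c)"
proof -
  let ?P = "\<lambda>g. Ord E g \<and> (\<exists>r s. cand q s0 r s \<and> (\<forall>x\<in>s. E (lev x) (vsucc E g)))"
  have "cand q s0 q s0" unfolding cand_def using le_refl[OF le_cond(1)[OF q]] s0 c ne by blast
  moreover have "\<forall>x\<in>s0. E (lev x) (vsucc E (vsucc E \<eta>))" using LS_FA[OF s0(1)] lev_le by (auto simp: FA_def)
  ultimately have "?P (vsucc E \<eta>)" using Ord_eta by auto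
  then obtain g where g: "?P g" and gmin: "\<And>b. E b g \<Longrightarrow> \<not> ?P b" using E_minimal[of ?P] by blast
  let ?lv = "\<lambda>s. {x \<in> s. lev x = g}"
  let ?N = "\<lambda>k. \<exists>r s. cand q s0 r s \<and> (\<forall>x\<in>s. E (lev x) (vsucc E g)) \<and> card (?lv s) = k"
  have "\<exists>k. ?N k" using g by blast
  then obtain k where k: "?N k" and kmin: "\<And>k'. ?N k' \<Longrightarrow> k \<le> k'"
    using LeastI_ex[of ?N] Least_le[of ?N] by blast
  obtain r s where r: "cand q s0 r s" "\<forall>x\<in>s. E (lev x) (vsucc E g)" "card (?lv s) = k" using k by blast
  obtain d where rq: "r \<preceq> q" and ls: "s \<in> LS i r" "s0 \<in> LS i r" and sub: "vl r s \<subseteq> vl r s0"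
    and d: "name d" "r \<tturnstile> maps h (ck (vset E s)) d" "r \<tturnstile> (\<^bold>\<not> d \<^bold>= bzero C)"
    using r(1) unfolding cand_def by blast
  have rp0: "r \<preceq> p0" using le_trans[OF rq q] .
  have Og: "Ord E g" using g by blast
  have vs_sub: "vl v s \<subseteq> vl v s0" if v: "v \<preceq> r" for v
  proof -
    \<comment> \<open>Inclusion of values is rewritten as an equation between products, because such
      equations persist to extensions by \<open>mt_le\<close>.\<close>
    have "mt r s s0 = s"
      by (rule LS_eqI[OF le_cond(1)[OF rp0] mt_LS[OF le_cond(1)[OF rp0] ls] ls(1)])
        (use sub vl_mt[OF le_cond(1)[OF rp0] ls] in blast)
    then have "mt v s s0 = s" using mt_le[OF v ls] by simp
    then show ?thesis using vl_mt[OF le_cond(1)[OF v] LS_mono[OF v ls(1)] LS_mono[OF v ls(2)]] by auto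
  qed
  have small_zero: "v \<tturnstile> (e \<^bold>= bzero C)"
    if v: "v \<preceq> r" and w: "w \<in> LS i v" "vl v w \<subseteq> vl v s0" "\<forall>x\<in>w. E (lev x) g"
      and e: "name e" "v \<tturnstile> maps h (ck (vset E w)) e" for v w e
  proof (rule forces_contr)
    fix v' assume v': "v' \<preceq> v" "v' \<tturnstile> (\<^bold>\<not> e \<^bold>= bzero C)"
    note le1 = le_trans[OF v'(1) v]
    note le = le1 le_trans[OF le1 rq] le_trans[OF le1 rp0]
    show False
    \<comment> \<open>The empty set has no highest level and is treated by \<open>h_zero\<close>; a
      nonempty set would be a candidate on a level below \<open>g\<close>.\<close>
    proof (cases "w = {}")
      case True
      have "v' \<tturnstile> (e \<^bold>= bzero C)"
        using h_unique[OF le(3) _ h_zero[OF le(3)] e(1) names(1)] forces_mono[OF e(2) v'(1)] True by blast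
      then show False using f_negE[OF v'(2) _ le_cond(1)[OF v'(1)]] by blast
    next
      case False
      have "finite w" using LS_FA[OF w(1)] by (simp add: FA_def)
      then obtain b where b: "E b g" "\<forall>x\<in>w. E (lev x) (vsucc E b)" using max_level[OF _ False _ Og] w(3) by blast
      have wl: "w \<in> LS i v'" using LS_mono[OF v'(1) w(1)] .
      have s0v: "s0 \<in> LS i v" using LS_mono[OF v ls(2)] .
      have cv: "cond v" "cond v'" using le_cond(1) v v'(1) by blast+
      have "mt v w s0 = w"
        by (rule LS_eqI[OF cv(1) mt_LS[OF cv(1) w(1) s0v] w(1)]) (use w(2) vl_mt[OF cv(1) w(1) s0v] in blast)
      then have "mt v' w s0 = w" using mt_le[OF v'(1) w(1) s0v] by simp
      then have "vl v' w \<subseteq> vl v' s0" using vl_mt[OF cv(2) wl LS_mono[OF v'(1) s0v]] by auto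
      then have "cand q s0 v' w" unfolding cand_def
        using le(2) wl LS_mono[OF v'(1) s0v] e(1) forces_mono[OF e(2) v'(1)] v'(2) by blast
      then have "?P b" using b(2) Ord_mem[OF Og b(1)] by blast
      then show False using gmin[OF b(1)] by blast
    qed
  qed
  have "r \<tturnstile> (\<^bold>\<forall>e. e \<^bold>\<in> car C \<^bold>\<and> ba_le C e d \<^bold>\<longrightarrow> e \<^bold>= bzero C \<^bold>\<or> e \<^bold>= d)"
  proof (intro f_allI f_impI, unfold f_conj, elim conjE)
    fix e v assume e: "name e" and v: "v \<preceq> r" "v \<tturnstile> (e \<^bold>\<in> car C)" "v \<tturnstile> ba_le C e d"
    show "v \<tturnstile> (e \<^bold>= bzero C \<^bold>\<or> e \<^bold>= d)"
    proof (rule forces_dense)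
      fix v1 assume v1: "v1 \<preceq> v"
      note v1r = le_trans[OF v1 v(1)]
      note v1p0 = le_trans[OF v1r rp0]
      obtain v2 t where v2: "v2 \<preceq> v1" "t \<in> FA i" "v2 \<tturnstile> maps h (ck (vset E t)) e"
        using h_surj[OF v1p0 e forces_mono[OF v(2) v1]] .
      have "finite (t \<union> {apex i})" "t \<union> {apex i} \<subseteq> T" using v2(2) apex_i by (auto simp: FA_def)
      then obtain v3 where v3: "v3 \<preceq> v2" "t \<union> {apex i} \<subseteq> pts (rel v3)"
        using extend_support[OF le_cond(1)[OF v2(1)]] by metis
      note le31 = le_trans[OF v3(1) v2(1)]
      note le3r = le_trans[OF le31 v1r]
      note le3 = le31 le_trans[OF le31 v1] le3r le_trans[OF le3r rq] le_trans[OF le3r rp0]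
      note c3 = le_cond(1)[OF v3(1)]
      have tl: "t \<in> LS i v3" "{apex i} \<in> LS i v3" using v2(2) v3(2) one_FA by (auto simp: LS_def)
      have sl: "s \<in> LS i v3" "s0 \<in> LS i v3" using LS_mono[OF le3(3)] ls by blast+
      let ?u = "mt v3 t s"
      have ul: "?u \<in> LS i v3" using mt_LS[OF c3 tl(1) sl(1)] .
      have ue: "v3 \<tturnstile> maps h (ck (vset E ?u)) e"
        using le_value[OF le3(5) e d(1) forces_mono[OF v(3) le3(2)] tl(1) sl(1)
            forces_mono[OF v2(3) v3(1)] forces_mono[OF d(2) le3(3)]] .
      have uv: "vl v3 ?u \<subseteq> vl v3 s" using vl_mt[OF c3 tl(1) sl(1)] by blast
      have ug: "\<forall>x\<in>?u. E (lev x) (vsucc E g)"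
        using down_LS[OF c3 ul uv down_lev[OF Ord_vsucc[OF Og]]] r(2) by blast
      \<comment> \<open>In both sets the points of level \<open>g\<close> have no other points above
        them, so there the value is plain membership, and inclusion of values gives inclusion of
        these points.\<close>
      have lvsub: "?lv ?u \<subseteq> ?lv s"
      proof
        fix x assume x: "x \<in> ?lv ?u"
        have rc: "is_cond (rel v3)" using rel_cond(1)[OF c3] .
        have mx: "z = x" if "z \<in> w" "(x, z) \<in> rel v3" "\<forall>x\<in>w. E (lev x) (vsucc E g)" for z w
        proof (rule ccontr)
          assume "z \<noteq> x"
          then have "E (lev x) (lev z)" using condD(4)[OF rc that(2)] prec_lev by blast
          then have "E g (lev z)" using x by simp
          moreover have "lev z = g \<or> E (lev z) g" using that(1,3) by simp
          ultimately show False using E_asym by auto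
        qed
        have xp: "x \<in> pts (rel v3)" using x ul unfolding LS_def by blast
        have "x \<in> vl v3 ?u" using maximal_mem_val[of ?u "rel v3" x] ul xp x mx ug unfolding LS_def by blast
        then have "x \<in> vl v3 s" using uv by blast
        then have "x \<in> s" using maximal_mem_val[of s "rel v3" x] sl(1) xp mx r(2) unfolding LS_def by blast
        then show "x \<in> ?lv s" using x by simp
      qed
      show "\<exists>v'. v' \<preceq> v1 \<and> v' \<tturnstile> (e \<^bold>= bzero C \<^bold>\<or> e \<^bold>= d)"
      proof (cases "\<exists>v'. v' \<preceq> v3 \<and> v' \<tturnstile> (e \<^bold>= bzero C)")
        case True
        then show ?thesis using le_trans[OF _ le3(1)] f_disjI1 by blast
      next
        case False
        then have "v3 \<tturnstile> (\<^bold>\<not> e \<^bold>= bzero C)" by (intro f_negI) blast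
        then have "cand q s0 v3 ?u" unfolding cand_def using le3(4) ul sl(2) uv vs_sub[OF le3(3)] e ue by blast
        then have "k \<le> card (?lv ?u)" using kmin ug by blast
        moreover have "finite (?lv s)" using LS_FA[OF ls(1)] by (simp add: FA_def)
        ultimately have lveq: "?lv ?u = ?lv s" using card_subset_eq[OF _ lvsub] card_mono[OF _ lvsub] r(3) by simp
        let ?w = "sd s ?u"
        have wl: "?w \<in> LS i v3" using sd_LS[OF sl(1) ul] .
        have wg: "\<forall>x\<in>?w. E (lev x) g"
        proof
          fix x assume x: "x \<in> ?w"
          then have "E (lev x) (vsucc E g)" using r(2) ug by blast
          moreover have "lev x \<noteq> g" using x lveq by blast
          ultimately show "E (lev x) g" by simp
        qed
        have "vl v3 ?w \<subseteq> vl v3 s" using vl_sd[OF c3 sl(1) ul] uv by blast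
        then have wv: "vl v3 ?w \<subseteq> vl v3 s0" using vs_sub[OF le3(3)] by blast
        obtain v4 f where v4: "v4 \<preceq> v3" "name f" "v4 \<tturnstile> maps h (ck (vset E ?w)) f"
          using h_value[OF le3(5) LS_FA[OF wl]] .
        note c4 = le_cond(1)[OF v4(1)]
        note le4 = le_trans[OF v4(1) le3(3)] le_trans[OF v4(1) le3(5)] le_trans[OF v4(1) le3(1)]
        note l4 = LS_mono[OF v4(1) ul] LS_mono[OF v4(1) wl] LS_mono[OF v4(1) sl(2)]
        have "mt v3 ?w s0 = ?w"
          by (rule LS_eqI[OF c3 mt_LS[OF c3 wl sl(2)] wl]) (use wv vl_mt[OF c3 wl sl(2)] in blast)
        then have "mt v4 ?w s0 = ?w" using mt_le[OF v4(1) wl sl(2)] by simp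
        then have "vl v4 ?w \<subseteq> vl v4 s0" using vl_mt[OF c4 l4(2,3)] by auto
        then have fz: "v4 \<tturnstile> (f \<^bold>= bzero C)" using small_zero[OF le4(1) l4(2) _ wg v4(2,3)] by blast
        \<comment> \<open>The join of \<open>?u\<close> with the remainder recovers
          \<open>s\<close>. As the remainder has image zero, the image of \<open>s\<close> is then
          \<open>e\<close>.\<close>
        have js: "jn v4 ?u ?w = s"
        proof -
          have "jn v3 ?u ?w = s"
            using ring_laws(12)[OF c3 sl(1) tl(1) tl(1) tl(2)] ring_laws(1)[OF c3 sl(1) tl(1) tl(1) tl(2)] by simp
          then show ?thesis using jn_le[OF v4(1) ul wl] by simp
        qed
        have "v4 \<tturnstile> app2 (join C) e f (\<lambda>x. maps h (ck (vset E s)) x)"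
          using h_op(2)[OF le4(2) l4(1,2) e v4(2) forces_mono[OF ue v4(1)] v4(3)] unfolding js .
        moreover have k1: "congr (\<lambda>f. app2 (join C) e f (\<lambda>x. maps h (ck (vset E s)) x))" by (intro cong_intros)
        ultimately have a1: "v4 \<tturnstile> app2 (join C) e (bzero C) (\<lambda>x. maps h (ck (vset E s)) x)"
          using congrD[OF k1, OF fz] by blast
        have a2: "v4 \<tturnstile> app2 (join C) e (bzero C) (\<lambda>x. x \<^bold>= e)"
          using join_zero[OF le4(2) e forces_mono[OF v(2) le_trans[OF v4(1) le3(2)]]] .
        have "v4 \<tturnstile> maps h (ck (vset E s)) e"
        proof (rule op_fun[OF le4(2) _ a1 a2])
          fix v5 x assume "v5 \<tturnstile> maps h (ck (vset E s)) x" "v5 \<tturnstile> (x \<^bold>= e)"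
          moreover have "congr (\<lambda>x. maps h (ck (vset E s)) x)" by (intro cong_intros)
          ultimately show "v5 \<tturnstile> maps h (ck (vset E s)) e" using congrD by blast
        qed (auto intro!: cong_intros)
        then have "v4 \<tturnstile> (e \<^bold>= d)" using h_unique[OF le4(2) _ forces_mono[OF d(2) le4(1)] e d(1)] by blast
        then show ?thesis using le4(3) f_disjI2 by blast
      qed
    qed
  qed
  then have at: "r \<tturnstile> is_atom C d"
    unfolding is_atom_def f_conj using h_range[OF rp0 d(1,2)] d(3) by blast
  have "mt r s s0 = s"
    by (rule LS_eqI[OF le_cond(1)[OF rp0] mt_LS[OF le_cond(1)[OF rp0] ls] ls(1)])
      (use sub vl_mt[OF le_cond(1)[OF rp0] ls] in blast)
  then have "r \<tturnstile> app2 (meet C) d c (\<lambda>e. maps h (ck (vset E s)) e)"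
    using h_op(1)[OF rp0 ls d(1) c d(2) forces_mono[OF s0(2) rq]] by simp
  then have "r \<tturnstile> ba_le C d c" unfolding ba_le_def
  proof (rule app2_imp)
    fix v e assume "v \<preceq> r" "name e" "v \<tturnstile> maps h (ck (vset E s)) e"
    then show "v \<tturnstile> (e \<^bold>= d)" using h_unique[OF le_trans[OF _ rp0] _ forces_mono[OF d(2)] _ d(1)] by blast
  qed
  then show ?thesis using at rq d(1) by auto
qed

lemma atomic_image: "p0 \<tturnstile> atomic C"
  unfolding atomic_def
proof (intro f_allI f_impI, unfold f_conj, elim conjE)
  fix c q assume c: "name c" and q: "q \<preceq> p0" "q \<tturnstile> (c \<^bold>\<in> car C)" "q \<tturnstile> (\<^bold>\<not> c \<^bold>= bzero C)"
  show "q \<tturnstile> (\<^bold>\<exists>a. is_atom C a \<^bold>\<and> ba_le C a c)"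
  proof (rule forces_dense)
    fix q1 assume q1: "q1 \<preceq> q"
    have q1p: "q1 \<preceq> p0" using le_trans[OF q1 q(1)] .
    obtain q2 s where q2: "q2 \<preceq> q1" "s \<in> FA i" "q2 \<tturnstile> maps h (ck (vset E s)) c"
      using h_surj[OF q1p c forces_mono[OF q(2) q1]] .
    have "finite s" "s \<subseteq> T" using q2(2) by (auto simp: FA_def)
    then obtain q3 where q3: "q3 \<preceq> q2" "s \<subseteq> pts (rel q3)" using extend_support[OF le_cond(1)[OF q2(1)]] by blast
    note le1 = le_trans[OF q3(1) q2(1)]
    note le = le1 le_trans[OF le1 q1] le_trans[OF le1 q1p]
    have "s \<in> LS i q3" using q2(2) q3(2) by (simp add: LS_def)
    then obtain r d where r: "r \<preceq> q3" "name d" "r \<tturnstile> (is_atom C d \<^bold>\<and> ba_le C d c)"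
      using atom_below[OF le(3) c _ forces_mono[OF q2(3) q3(1)] forces_mono[OF q(3) le(2)]] by blast
    then have "r \<tturnstile> (\<^bold>\<exists>a. is_atom C a \<^bold>\<and> ba_le C a c)"
      using f_exI[where \<Phi> = "\<lambda>a. is_atom C a \<^bold>\<and> ba_le C a c"] by blast
    then show "\<exists>r. r \<preceq> q1 \<and> r \<tturnstile> (\<^bold>\<exists>a. is_atom C a \<^bold>\<and> ba_le C a c)" using le_trans[OF r(1) le(1)] by blast
  qed
qed

end

lemma (in leveled) superatomic_check: "p \<tturnstile> superatomic base.Alg"
  unfolding superatomic_def f_conj ForallBA_def
proof (intro conjI base.BA_check f_allI f_impI)
  fix B m j c z u h q
  assume n: "name z" "name h"
    and a: "q \<tturnstile> (is_BA \<lparr>car = B, meet = m, join = j, cmpl = c, bzero = z, bone = u\<rparr> \<^bold>\<and>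
       is_surj_hom h base.Alg \<lparr>car = B, meet = m, join = j, cmpl = c, bzero = z, bone = u\<rparr>)"
  interpret homomorphic_image E T fib prec apex al i lev \<eta> "\<lparr>car = B, meet = m, join = j, cmpl = c, bzero = z, bone = u\<rparr>" h q
    by unfold_locales (use n a in simp_all)
  show "q \<tturnstile> atomic \<lparr>car = B, meet = m, join = j, cmpl = c, bzero = z, bone = u\<rparr>" by (rule atomic_image)
qed

section \<open>Heights, level sizes and the cardinal sequence\<close>

section \<open>The cardinal sequence of the generic algebra\<close>

text \<open>A set of size n+1 arises from one of size n by inserting a point, so each size
  contributes at most |X| sets, and there are countably many sizes.\<close>

lemma finite_subsets_le:
  assumes X: "infinite X"
  shows "|{t. t \<subseteq> X \<and> finite t}| \<le>o |X|"
proof -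
  let ?F = "\<lambda>n. {t. t \<subseteq> X \<and> finite t \<and> card t = n}"
  have F: "|?F n| \<le>o |X|" for n
  proof (induction n)
    case 0
    have "?F 0 = {{}}" by auto
    moreover have "|{{}} :: 'a set set| \<le>o |X|" using X by (intro card_of_singl_ordLeq) auto
    ultimately show ?case by simp
  next
    case (Suc n)
    have "?F (Suc n) \<subseteq> (\<lambda>(x, t). insert x t) ` (X \<times> ?F n)"
    proof
      fix t assume t: "t \<in> ?F (Suc n)"
      then obtain x u where u: "t = insert x u" "x \<notin> u" "card u = n" by (auto simp: card_Suc_eq)
      then have "(x, u) \<in> X \<times> ?F n" using t by auto
      then show "t \<in> (\<lambda>(x, t). insert x t) ` (X \<times> ?F n)" using u(1) by (intro image_eqI[of _ _ "(x, u)"]) auto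
    qed
    then have 1: "|?F (Suc n)| \<le>o |(\<lambda>(x, t). insert x t) ` (X \<times> ?F n)|" by (rule card_of_mono1)
    note 2 = ordLeq_transitive[OF 1 card_of_image]
    note 3 = ordLeq_transitive[OF 2 card_of_Times_mono2[OF Suc]]
    show ?case by (rule ordLeq_ordIso_trans[OF 3 card_of_Times_same_infinite[OF X]])
  qed
  have "{t. t \<subseteq> X \<and> finite t} = (\<Union>n\<in>UNIV. ?F n)" by auto
  then show ?thesis
    using card_of_UNION_ordLeq_infinite[of X "UNIV :: nat set" ?F] X F infinite_iff_card_of_nat[of X] by auto
qed

context zfc_universe
begin

lemma vsucc_asym: "E a d \<Longrightarrow> \<not> E d (vsucc E a)"
  unfolding mem_vsucc using E_asym by blast

lemma vsucc_mono: "Ord E d \<Longrightarrow> E a d \<Longrightarrow> E (vsucc E a) (vsucc E d)"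
  using Ord_linear[OF Ord_vsucc[OF Ord_mem]] vsucc_asym unfolding mem_vsucc[of _ d] by blast

lemma infinite_omega: "sat E (is_omega w) \<Longrightarrow> infinite (ext E w)"
  using sat_is_omega inj_natV by (simp add: range_inj_infinite)

lemma omega_is_card:
  assumes w: "sat E (is_omega w)"
  shows "sat E (is_card w)"
proof -
  have "Ord E w" using w unfolding is_omega_def by (simp add: sat_is_limit)
  moreover have "\<nexists>g. bij_betw g (ext E a) (ext E w)" if a: "E a w" for a
  proof -
    have "a \<in> ext E w" using a by simp
    then obtain n where "a = natV E n" unfolding sat_is_omega[OF w] by blast
    then have "finite (ext E a)" by (simp add: ext_natV)
    then show ?thesis using infinite_omega[OF w] bij_betw_finite by blast
  qed
  ultimately show ?thesis unfolding sat_is_card by blast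
qed

end

context forcing
begin

lemma congr_is_ideal: "cterm a \<Longrightarrow> congr (\<lambda>x. is_ideal A (a x))"
  unfolding is_ideal_def ba_le_def by (intro cong_intros | assumption)+

lemma congr_is_quotient: "cterm a \<Longrightarrow> congr (\<lambda>x. is_quotient A (a x) C h)"
  unfolding is_quotient_def sym_diff_def by (intro cong_intros congr_is_ideal | assumption)+

lemma congr_cb_step [cong_intros]: "cterm a \<Longrightarrow> cterm b \<Longrightarrow> congr (\<lambda>x. cb_step A (a x) (b x))"
  unfolding cb_step_def ExistsBA_def by (intro cong_intros congr_is_quotient | assumption)+

lemma congr_is_level [cong_intros]: "cterm a \<Longrightarrow> cterm b \<Longrightarrow> congr (\<lambda>x. is_level A (a x) (b x) W)"
  unfolding is_level_def ExistsBA_def by (intro cong_intros congr_is_quotient | assumption)+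

lemma congr_is_card_of [cong_intros]: "cterm a \<Longrightarrow> congr (\<lambda>x. is_card_of (a x) W)"
  unfolding is_card_of_def is_card_def by (intro cong_intros | assumption)+

lemma congr_app_succ [cong_intros]:
  assumes "cterm a" "cterm b" "\<And>y. congr (\<lambda>x. \<Phi> x y)"
  shows "congr (\<lambda>x. app_succ (a x) (b x) (\<Phi> x))"
  unfolding app_succ_def by (intro cong_intros assms)

lemma app_succ_check:
  assumes c: "congr \<Phi>" and a: "E (vsucc E a) X"
  shows "p \<tturnstile> app_succ (ck (vgraph E g (ext E X))) (ck a) \<Phi> \<longleftrightarrow> p \<tturnstile> \<Phi> (ck (g (vsucc E a)))"
proof
  assume "p \<tturnstile> app_succ (ck (vgraph E g (ext E X))) (ck a) \<Phi>"
  then have ex: "p \<tturnstile> (\<^bold>\<exists>\<beta>. is_succ \<beta> (ck a) \<^bold>\<and> app (ck (vgraph E g (ext E X))) \<beta> \<Phi>)"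
    unfolding app_succ_def .
  show "p \<tturnstile> \<Phi> (ck (g (vsucc E a)))"
  proof (rule f_exE[OF ex], unfold f_conj, elim conjE)
    fix q b assume b: "name b" "q \<tturnstile> is_succ b (ck a)" "q \<tturnstile> app (ck (vgraph E g (ext E X))) b \<Phi>"
    have k: "congr (\<lambda>b. app (ck (vgraph E g (ext E X))) b \<Phi>)" by (intro cong_intros)
    have "q \<tturnstile> (b \<^bold>= ck (vsucc E a))" using b(2) succ_check[OF b(1)] by blast
    then have "q \<tturnstile> app (ck (vgraph E g (ext E X))) (ck (vsucc E a)) \<Phi>" using congrD[OF k _ b(3)] by blast
    then show "q \<tturnstile> \<Phi> (ck (g (vsucc E a)))" using app_check[OF c a] by blast
  qed
next
  assume "p \<tturnstile> \<Phi> (ck (g (vsucc E a)))"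
  then show "p \<tturnstile> app_succ (ck (vgraph E g (ext E X))) (ck a) \<Phi>"
    unfolding app_succ_def using app_check[OF c a] succ_check0
    by (intro f_exI[where x = "ck (vsucc E a)"]) simp_all
qed

lemma fun_on_graph: "p \<tturnstile> is_fun_on (ck (vgraph E g (ext E X))) (ck X)"
  unfolding is_fun_on_def
  by (rule f_exI[where x = "ck (vset E (g ` ext E X))"], rule fun_graph) (simp_all add: small_image)

end

context leveled_at
begin

text \<open>A class of this level is determined by its finitely many points on level \<alpha>, so
  there are at most as many classes as finite subsets of an infinite set. Single points give
  different classes, which is the other inequality.\<close>

lemma ex_bij_W:
  assumes inf: "infinite {x \<in> T. fib x = i \<and> lev x = \<alpha>}"
  shows "\<exists>g. bij_betw g (ext E W) {x \<in> T. fib x = i \<and> lev x = \<alpha>}"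
proof -
  let ?L = "{x \<in> T. fib x = i \<and> lev x = \<alpha>}"
  have "ext E W \<subseteq> coset \<alpha> ` {t. t \<subseteq> ?L \<and> finite t}"
  proof
    fix z assume "z \<in> ext E W"
    then obtain s where s: "s \<in> FA i" "\<forall>x\<in>s. E (lev x) (vsucc E \<alpha>)" "z = coset \<alpha> s" unfolding mem_ext mem_W by blast
    have f: "finite s" "s \<subseteq> T" "\<forall>x\<in>s. fib x = i" using s(1) by (auto simp: FA_def)
    then have t: "s \<inter> ?L \<in> FA i" by (auto simp: FA_def)
    have "z = coset \<alpha> (s \<inter> ?L)" unfolding s(3) using coset_eq[OF s(1) t] s(2) f by auto
    then show "z \<in> coset \<alpha> ` {t. t \<subseteq> ?L \<and> finite t}" using f(1) by blast
  qed
  from ordLeq_transitive[OF card_of_mono1[OF this] card_of_image]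
  have "|ext E W| \<le>o |?L|" using ordLeq_transitive[OF _ finite_subsets_le[OF inf]] by blast
  moreover have "|?L| \<le>o |ext E W|"
  proof -
    have F: "{x} \<in> FA i" if "x \<in> ?L" for x using that by (auto simp: FA_def)
    have "inj_on (\<lambda>x. coset \<alpha> {x}) ?L"
    proof (rule inj_onI)
      fix x y assume xy: "x \<in> ?L" "y \<in> ?L" "coset \<alpha> {x} = coset \<alpha> {y}"
      then have "\<forall>z\<in>sd {x} {y}. E (lev z) \<alpha>" using coset_eq[OF F F] by blast
      moreover have "\<not> E (lev x) \<alpha>" using xy(1) by simp
      ultimately show "x = y" by (cases "x = y") auto
    qed
    moreover have "(\<lambda>x. coset \<alpha> {x}) ` ?L \<subseteq> ext E W"
    proof
      fix z assume "z \<in> (\<lambda>x. coset \<alpha> {x}) ` ?L"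
      then obtain x where x: "x \<in> ?L" "z = coset \<alpha> {x}" by blast
      then show "z \<in> ext E W" unfolding mem_ext mem_W using F[OF x(1)] by (intro bexI[of _ "{x}"]) auto
    qed
    ultimately show ?thesis using card_of_ordLeq by blast
  qed
  ultimately show ?thesis using ordIso_iff_ordLeq card_of_ordIso by blast
qed

end

context leveled
begin

text \<open>The reduced height is \<eta>+1, so \<open>is_reduced_height\<close> wants the ideals
  with indices up to \<eta>+2, that is, a sequence of length \<eta>+3.\<close>

abbreviation (input) top_index where "top_index \<equiv> vsucc E (vsucc E (vsucc E \<eta>))"

abbreviation (input) Jseq where "Jseq \<equiv> ck (vgraph E J (ext E top_index))"

lemma J_mono: "Ord E a \<Longrightarrow> E b a \<Longrightarrow> E z (J b) \<Longrightarrow> E z (J a)"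
  unfolding mem_J_iff using Ord_trans by blast

text \<open>An element has finitely many points, so their levels are bounded by an ordinal below the
  limit.\<close>

lemma J_limit:
  assumes a: "sat E (is_limit a)" and z: "E z (J a)"
  shows "\<exists>b. E b a \<and> E z (J b)"
proof -
  have l: "Ord E a" "a \<noteq> vset E {}" "\<And>y. a \<noteq> vsucc E y" using a unfolding sat_is_limit by auto
  obtain s where s: "s \<in> FA i" "\<forall>x\<in>s. E (lev x) a" "z = vset E s" using z unfolding mem_J_iff by blast
  show ?thesis
  proof (cases "s = {}")
    case True
    have "ext E a \<noteq> {}" using l(2) vset_ext by metis
    then obtain b where "b \<in> ext E a" by blast
    then have "E b a" by simp
    then show ?thesis unfolding mem_J_iff using s(1,3) True by blast
  next
    case False
    have "finite s" using s(1) by (simp add: FA_def)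
    then obtain b where b: "E b a" "\<forall>x\<in>s. E (lev x) (vsucc E b)" using max_level[OF _ False _ l(1)] s(2) by blast
    have "E (vsucc E b) a \<or> vsucc E b = a \<or> E a (vsucc E b)"
      using Ord_linear[OF Ord_vsucc[OF Ord_mem[OF l(1) b(1)]] l(1)] .
    then have "E (vsucc E b) a" using l(3) b(1) E_asym by auto
    then show ?thesis unfolding mem_J_iff using s(1,3) b(2) by blast
  qed
qed

lemma cb_clause:
  assumes a: "E a top_index"
  shows "p \<tturnstile> ((is_empty (ck a) \<^bold>\<longrightarrow> (\<^bold>\<forall>x. x \<^bold>\<in> ck (J a) \<^bold>\<longleftrightarrow> x \<^bold>= bzero base.Alg)) \<^bold>\<and>
     (\<^bold>\<forall>\<beta>. is_succ (ck a) \<beta> \<^bold>\<longrightarrow> app Jseq \<beta> (\<lambda>I0. cb_step base.Alg I0 (ck (J a)))) \<^bold>\<and>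
     (is_limit (ck a) \<^bold>\<longrightarrow> (\<^bold>\<forall>x. x \<^bold>\<in> ck (J a) \<^bold>\<longleftrightarrow> (\<^bold>\<exists>\<beta>. \<beta> \<^bold>\<in> ck a \<^bold>\<and> app Jseq \<beta> (\<lambda>I0. x \<^bold>\<in> I0)))))"
  unfolding f_conj
proof (intro conjI)
  have Oa: "Ord E a" using Ord_mem[OF _ a] Ord_eta by simp
  show "p \<tturnstile> (is_empty (ck a) \<^bold>\<longrightarrow> (\<^bold>\<forall>x. x \<^bold>\<in> ck (J a) \<^bold>\<longleftrightarrow> x \<^bold>= bzero base.Alg))"
  proof (rule f_impI)
    fix q assume q: "q \<preceq> p" "q \<tturnstile> is_empty (ck a)"
    have "a = vset E {}" using q le_cond(1)[OF q(1)] by simp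
    then have na: "\<not> E x a" for x by simp
    have J0: "E z (J a) \<longleftrightarrow> z = vset E {}" for z
    proof
      assume "E z (J a)"
      then obtain s where "\<forall>x\<in>s. E (lev x) a" "z = vset E s" unfolding mem_J_iff by blast
      moreover from this(1) have "s = {}" using na by auto
      ultimately show "z = vset E {}" by simp
    next
      assume "z = vset E {}"
      then show "E z (J a)" unfolding mem_J_iff by (intro bexI[of _ "{}"]) simp_all
    qed
    show "q \<tturnstile> (\<^bold>\<forall>x. x \<^bold>\<in> ck (J a) \<^bold>\<longleftrightarrow> x \<^bold>= bzero base.Alg)"
    proof (intro f_allI f_iffI iffI)
      fix x r assume "r \<tturnstile> (x \<^bold>\<in> ck (J a))"
      then show "r \<tturnstile> (x \<^bold>= bzero base.Alg)"
      proof (rule check_memE)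
        fix v z assume "E z (J a)" "v \<tturnstile> (x \<^bold>= ck z)"
        then show "v \<tturnstile> (x \<^bold>= bzero base.Alg)" unfolding J0 by simp
      qed
    next
      fix x r assume "r \<tturnstile> (x \<^bold>= bzero base.Alg)"
      then have e: "r \<tturnstile> (ck (vset E {}) \<^bold>= x)" using eq_sym unfolding base.Alg_simps by blast
      have "E (vset E {}) (J a)" unfolding J0 ..
      then show "r \<tturnstile> (x \<^bold>\<in> ck (J a))" using mem_eq_left[OF check_memI e] by blast
    qed
  qed
  show "p \<tturnstile> (\<^bold>\<forall>\<beta>. is_succ (ck a) \<beta> \<^bold>\<longrightarrow> app Jseq \<beta> (\<lambda>I0. cb_step base.Alg I0 (ck (J a))))"
  proof (intro f_allI f_impI)
    fix \<beta> q assume n: "name \<beta>" and q: "q \<preceq> p" "q \<tturnstile> is_succ (ck a) \<beta>"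
    show "q \<tturnstile> app Jseq \<beta> (\<lambda>I0. cb_step base.Alg I0 (ck (J a)))"
    proof (rule succ_checkE[OF q(2) n])
      fix r b assume r: "a = vsucc E b" "r \<tturnstile> (\<beta> \<^bold>= ck b)"
      have b: "E b (vsucc E (vsucc E \<eta>))"
      proof -
        have "a = vsucc E (vsucc E \<eta>) \<or> E a (vsucc E (vsucc E \<eta>))" using a by simp
        moreover have "E b a" using r(1) by simp
        ultimately show ?thesis using Ord_trans[OF Ord_vsucc[OF Ord_vsucc[OF Ord_eta]]] by blast
      qed
      interpret at: leveled_at E T fib prec apex al i lev \<eta> b by unfold_locales (rule b)
      have c: "congr (\<lambda>I0. cb_step base.Alg I0 (ck (J a)))" by (intro cong_intros)
      have k: "congr (\<lambda>\<beta>. app Jseq \<beta> (\<lambda>I0. cb_step base.Alg I0 (ck (J a))))" by (intro cong_intros)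
      have bt: "E b top_index" using b by simp
      have "r \<tturnstile> app Jseq (ck b) (\<lambda>I0. cb_step base.Alg I0 (ck (J a)))"
        using app_check[OF c bt] at.cb_step_check unfolding r(1) by blast
      then show "r \<tturnstile> app Jseq \<beta> (\<lambda>I0. cb_step base.Alg I0 (ck (J a)))" using congrD'[OF k, OF r(2)] by blast
    qed
  qed
  show "p \<tturnstile> (is_limit (ck a) \<^bold>\<longrightarrow> (\<^bold>\<forall>x. x \<^bold>\<in> ck (J a) \<^bold>\<longleftrightarrow> (\<^bold>\<exists>\<beta>. \<beta> \<^bold>\<in> ck a \<^bold>\<and> app Jseq \<beta> (\<lambda>I0. x \<^bold>\<in> I0))))"
  proof (rule f_impI)
    fix q assume q: "q \<preceq> p" "q \<tturnstile> is_limit (ck a)"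
    have lim: "sat E (is_limit a)" using q le_cond(1)[OF q(1)] by simp
    have app: "r \<tturnstile> app Jseq (ck b) (\<lambda>I0. x \<^bold>\<in> I0) \<longleftrightarrow> r \<tturnstile> (x \<^bold>\<in> ck (J b))" if b: "E b a" for r b x
    proof -
      have c: "congr (\<lambda>I0. x \<^bold>\<in> I0)" by (intro cong_intros)
      have "E b top_index" using Ord_trans[OF _ a b] Ord_eta by simp
      then show ?thesis using app_check[OF c] by blast
    qed
    show "q \<tturnstile> (\<^bold>\<forall>x. x \<^bold>\<in> ck (J a) \<^bold>\<longleftrightarrow> (\<^bold>\<exists>\<beta>. \<beta> \<^bold>\<in> ck a \<^bold>\<and> app Jseq \<beta> (\<lambda>I0. x \<^bold>\<in> I0)))"
    proof (intro f_allI f_iffI iffI)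
      fix x r assume x: "r \<tturnstile> (x \<^bold>\<in> ck (J a))"
      show "r \<tturnstile> (\<^bold>\<exists>\<beta>. \<beta> \<^bold>\<in> ck a \<^bold>\<and> app Jseq \<beta> (\<lambda>I0. x \<^bold>\<in> I0))"
      proof (rule check_memE[OF x])
        fix v z assume v: "E z (J a)" "v \<tturnstile> (x \<^bold>= ck z)"
        obtain b where b: "E b a" "E z (J b)" using J_limit[OF lim v(1)] by blast
        have "v \<tturnstile> (x \<^bold>\<in> ck (J b))" using mem_eq_left[OF check_memI[OF b(2)] eq_sym[OF v(2)]] .
        then have vb: "v \<tturnstile> (ck b \<^bold>\<in> ck a \<^bold>\<and> app Jseq (ck b) (\<lambda>I0. x \<^bold>\<in> I0))"
          unfolding f_conj app[OF b(1)] using check_memI[OF b(1)] by blast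
        show "v \<tturnstile> (\<^bold>\<exists>\<beta>. \<beta> \<^bold>\<in> ck a \<^bold>\<and> app Jseq \<beta> (\<lambda>I0. x \<^bold>\<in> I0))"
          by (rule f_exI[where x = "ck b"], rule vb, rule name_check)
      qed
    next
      fix x r assume ex: "r \<tturnstile> (\<^bold>\<exists>\<beta>. \<beta> \<^bold>\<in> ck a \<^bold>\<and> app Jseq \<beta> (\<lambda>I0. x \<^bold>\<in> I0))"
      show "r \<tturnstile> (x \<^bold>\<in> ck (J a))"
      proof (rule f_exE[OF ex], unfold f_conj, elim conjE)
        fix v \<beta> assume v: "v \<tturnstile> (\<beta> \<^bold>\<in> ck a)" "v \<tturnstile> app Jseq \<beta> (\<lambda>I0. x \<^bold>\<in> I0)"
        show "v \<tturnstile> (x \<^bold>\<in> ck (J a))"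
        proof (rule check_memE[OF v(1)])
          fix u b assume u: "u \<preceq> v" "E b a" "u \<tturnstile> (\<beta> \<^bold>= ck b)"
          have k: "congr (\<lambda>\<beta>. app Jseq \<beta> (\<lambda>I0. x \<^bold>\<in> I0))" by (intro cong_intros)
          have "u \<tturnstile> app Jseq (ck b) (\<lambda>I0. x \<^bold>\<in> I0)" using congrD[OF k, OF u(3) forces_mono[OF v(2) u(1)]] .
          then have xb: "u \<tturnstile> (x \<^bold>\<in> ck (J b))" unfolding app[OF u(2)] .
          show "u \<tturnstile> (x \<^bold>\<in> ck (J a))"
          proof (rule check_memE[OF xb])
            fix v z assume "E z (J b)" "v \<tturnstile> (x \<^bold>= ck z)"
            then show "v \<tturnstile> (x \<^bold>\<in> ck (J a))"
              using mem_eq_left[OF check_memI[OF J_mono[OF Oa u(2)]] eq_sym] by blast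
          qed
        qed
      qed
    qed
  qed
qed

lemma cb_sequence_check: "p \<tturnstile> is_cb_sequence base.Alg Jseq (ck top_index)"
proof (cases "cond p")
  case True
  show ?thesis unfolding is_cb_sequence_def f_conj
  proof (intro conjI fun_on_graph f_allI f_impI)
    show "p \<tturnstile> is_ord (ck top_index)" using True Ord_eta by simp
    fix \<alpha> I q assume n: "name \<alpha>" "name I" and m: "q \<tturnstile> maps Jseq \<alpha> I"
    let ?Q = "\<lambda>\<alpha> I. ((is_empty \<alpha> \<^bold>\<longrightarrow> (\<^bold>\<forall>x. x \<^bold>\<in> I \<^bold>\<longleftrightarrow> x \<^bold>= bzero base.Alg)) \<^bold>\<and>
     (\<^bold>\<forall>\<beta>. is_succ \<alpha> \<beta> \<^bold>\<longrightarrow> app Jseq \<beta> (\<lambda>I0. cb_step base.Alg I0 I)) \<^bold>\<and>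
     (is_limit \<alpha> \<^bold>\<longrightarrow> (\<^bold>\<forall>x. x \<^bold>\<in> I \<^bold>\<longleftrightarrow> (\<^bold>\<exists>\<beta>. \<beta> \<^bold>\<in> \<alpha> \<^bold>\<and> app Jseq \<beta> (\<lambda>I0. x \<^bold>\<in> I0)))))"
    show "q \<tturnstile> ?Q \<alpha> I"
    proof (rule maps_graphE[OF m _ n])
      fix r a assume r: "a \<in> ext E top_index" "r \<tturnstile> (\<alpha> \<^bold>= ck a)" "r \<tturnstile> (I \<^bold>= ck (J a))"
      have k: "congr (\<lambda>\<alpha>. ?Q \<alpha> (ck (J a)))" "congr (\<lambda>I. ?Q \<alpha> I)" by (intro cong_intros)+
      have "r \<tturnstile> ?Q (ck a) (ck (J a))" using cb_clause[of a r] r(1) unfolding mem_ext by blast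
      then have "r \<tturnstile> ?Q \<alpha> (ck (J a))" by (rule congrD'[OF k(1), OF r(2)])
      then show "r \<tturnstile> ?Q \<alpha> I" by (rule congrD'[OF k(2), OF r(3)])
    qed simp
  qed
qed (rule not_cond_forces)

lemma J_top: "J (vsucc E (vsucc E \<eta>)) = base.X"
proof (rule extensionality, intro allI)
  fix z
  have "\<forall>x\<in>s. E (lev x) (vsucc E (vsucc E \<eta>))" if "s \<in> FA i" for s using that lev_le by (auto simp: FA_def)
  then show "E z (J (vsucc E (vsucc E \<eta>))) \<longleftrightarrow> E z base.X" unfolding mem_J_iff base.mem_X by blast
qed

text \<open>The unit has its only point on level \<eta>+1, so it is missing from every ideal with
  index at most \<eta>+1, while the index \<eta>+2 exhausts all levels.\<close>

lemma reduced_height_check: "p \<tturnstile> is_reduced_height base.Alg Jseq (ck (vsucc E \<eta>))"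
proof (cases "cond p")
  case True
  let ?d = "vsucc E \<eta>"
  have c: "congr (\<lambda>I. I \<^bold>= ck base.X)" by (intro cong_intros)
  have 1: "p \<tturnstile> is_ord (ck ?d)" using True Ord_eta by simp
  have s2: "p \<tturnstile> (is_succ (ck (vsucc E ?d)) (ck ?d) \<^bold>\<and> is_succ (ck top_index) (ck (vsucc E ?d)) \<^bold>\<and>
      is_cb_sequence base.Alg Jseq (ck top_index))"
    unfolding f_conj using succ_check0 cb_sequence_check by blast
  have 2: "p \<tturnstile> (\<^bold>\<exists>\<delta>' \<theta>. is_succ \<delta>' (ck ?d) \<^bold>\<and> is_succ \<theta> \<delta>' \<^bold>\<and> is_cb_sequence base.Alg Jseq \<theta>)"
    by (rule f_exI[where x = "ck (vsucc E ?d)"], rule f_exI[where x = "ck top_index"], rule s2) (rule name_check)+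
  have s: "E (vsucc E ?d) top_index" by simp
  have 3: "p \<tturnstile> app_succ Jseq (ck ?d) (\<lambda>I. I \<^bold>= ck base.X)"
    unfolding app_succ_check[OF c s] J_top by (rule eq_refl)
  have 4: "p \<tturnstile> (\<^bold>\<forall>\<gamma>. \<gamma> \<^bold>\<in> ck ?d \<^bold>\<longrightarrow> \<^bold>\<not> app_succ Jseq \<gamma> (\<lambda>I. I \<^bold>= ck base.X))"
  proof (rule f_ballI)
    show "congr (\<lambda>\<gamma>. \<^bold>\<not> app_succ Jseq \<gamma> (\<lambda>I. I \<^bold>= ck base.X))" by (intro cong_intros)
    fix g assume g: "E g ?d"
    have sg: "E (vsucc E g) top_index"
    proof -
      have "E (vsucc E g) (vsucc E ?d)" using vsucc_mono[OF _ g] Ord_eta by simp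
      then show ?thesis by simp
    qed
    show "p \<tturnstile> (\<^bold>\<not> app_succ Jseq (ck g) (\<lambda>I. I \<^bold>= ck base.X))"
      unfolding forces.simps(3) app_succ_check[OF c sg]
    proof (intro allI impI notI)
      fix q assume q: "q \<preceq> p" "q \<tturnstile> (ck (J (vsucc E g)) \<^bold>= ck base.X)"
      have "J (vsucc E g) = base.X" using check_eqD[OF q(2) le_cond(1)[OF q(1)]] .
      then have "E (vset E {apex i}) (J (vsucc E g))" using base_X[OF one_FA] by simp
      then have "E ?d (vsucc E g)" using mem_J[OF one_FA] lev_apex by simp
      then show False using vsucc_asym[OF g] by blast
    qed
  qed
  show ?thesis unfolding is_reduced_height_def f_conj base.Alg_simps using 1 2 3 4 by blast
qed (rule not_cond_forces)

text \<open>Levels are counted in the ground universe: the bijection remains one in the extension,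
  and the chain condition keeps \<open>k a\<close> a cardinal.\<close>

lemma cardinal_sequence_check:
  assumes ccc: ccc and k: "\<And>a. E a (vsucc E \<eta>) \<Longrightarrow> sat E (is_card (k a)) \<and> infinite (ext E (k a))"
    and bij: "\<And>a. E a (vsucc E \<eta>) \<Longrightarrow> \<exists>g. bij_betw g {x \<in> T. fib x = i \<and> lev x = a} (ext E (k a))"
  shows "p \<tturnstile> is_cardinal_sequence base.Alg (ck (vgraph E k (ext E (vsucc E \<eta>))))"
proof (cases "cond p")
  case True
  let ?d = "vsucc E \<eta>" and ?s = "ck (vgraph E k (ext E (vsucc E \<eta>)))"
  have "p \<tturnstile> (\<^bold>\<forall>\<alpha>. \<alpha> \<^bold>\<in> ck ?d \<^bold>\<longrightarrow> app Jseq \<alpha> (\<lambda>I. app_succ Jseq \<alpha> (\<lambda>I'. app ?s \<alpha> (\<lambda>\<kappa>.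
             \<^bold>\<exists>W. is_level base.Alg I I' W \<^bold>\<and> is_card_of \<kappa> W))))"
  proof (rule f_ballI)
    fix a assume a: "E a ?d"
    interpret at: leveled_at E T fib prec apex al i lev \<eta> a by unfold_locales (use a in simp)
    obtain g where g: "bij_betw g {x \<in> T. fib x = i \<and> lev x = a} (ext E (k a))" using bij[OF a] by blast
    have "infinite {x \<in> T. fib x = i \<and> lev x = a}" using k[OF a] bij_betw_finite[OF g] by blast
    then obtain h where "bij_betw h (ext E at.W) {x \<in> T. fib x = i \<and> lev x = a}" using at.ex_bij_W by blast
    then have "bij_betw (g \<circ> h) (ext E at.W) (ext E (k a))" using bij_betw_trans g by blast
    then have e: "p \<tturnstile> equipotent (ck at.W) (ck (k a))" by (rule equipotent_check)
    have "p \<tturnstile> is_card (ck (k a))" using card_preserved[OF ccc _ True] k[OF a] by blast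
    then have "p \<tturnstile> (is_level base.Alg (ck (J a)) (ck (J (vsucc E a))) (ck at.W) \<^bold>\<and> is_card_of (ck (k a)) (ck at.W))"
      unfolding f_conj is_card_of_def using e at.level_check by blast
    note m0 = this
    have m: "p \<tturnstile> (\<^bold>\<exists>W. is_level base.Alg (ck (J a)) (ck (J (vsucc E a))) W \<^bold>\<and> is_card_of (ck (k a)) W)"
      by (rule f_exI[where x = "ck at.W"], rule m0, rule name_check)
    have at': "E a top_index" "E (vsucc E a) top_index"
    proof -
      show "E a top_index" using a by simp
      have "E (vsucc E a) (vsucc E ?d)" using vsucc_mono[OF _ a] Ord_eta by simp
      then show "E (vsucc E a) top_index" by simp
    qed
    have c1: "congr (\<lambda>\<kappa>. \<^bold>\<exists>W. is_level base.Alg I I' W \<^bold>\<and> is_card_of \<kappa> W)" for I I' by (intro cong_intros)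
    have c2: "congr (\<lambda>I'. app ?s \<alpha> (\<lambda>\<kappa>. \<^bold>\<exists>W. is_level base.Alg I I' W \<^bold>\<and> is_card_of \<kappa> W))" for \<alpha> I by (intro cong_intros)
    have c3: "congr (\<lambda>I. app_succ Jseq \<alpha> (\<lambda>I'. app ?s \<alpha> (\<lambda>\<kappa>. \<^bold>\<exists>W. is_level base.Alg I I' W \<^bold>\<and> is_card_of \<kappa> W)))" for \<alpha>
      by (intro cong_intros)
    show "p \<tturnstile> app Jseq (ck a) (\<lambda>I. app_succ Jseq (ck a) (\<lambda>I'. app ?s (ck a) (\<lambda>\<kappa>.
             \<^bold>\<exists>W. is_level base.Alg I I' W \<^bold>\<and> is_card_of \<kappa> W)))"
      unfolding app_check[OF c3 at'(1)] app_succ_check[OF c2 at'(2)] app_check[OF c1 a] by (rule m)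
  qed (intro cong_intros)
  then have m: "p \<tturnstile> (is_reduced_height base.Alg Jseq (ck ?d) \<^bold>\<and> is_fun_on ?s (ck ?d) \<^bold>\<and>
      (\<^bold>\<forall>\<alpha>. \<alpha> \<^bold>\<in> ck ?d \<^bold>\<longrightarrow> app Jseq \<alpha> (\<lambda>I. app_succ Jseq \<alpha> (\<lambda>I'. app ?s \<alpha> (\<lambda>\<kappa>.
             \<^bold>\<exists>W. is_level base.Alg I I' W \<^bold>\<and> is_card_of \<kappa> W)))))"
    unfolding f_conj using reduced_height_check fun_on_graph by blast
  show ?thesis unfolding is_cardinal_sequence_def
    by (rule f_exI[where x = Jseq], rule f_exI[where x = "ck ?d"], rule m) (rule name_check)+
qed (rule not_cond_forces)

theorem omega_eta_lambda_check:
  assumes ccc: ccc and w: "sat E (is_omega w)" and lam: "sat E (is_card lam)" "infinite (ext E lam)"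
    and low: "\<And>a. E a \<eta> \<Longrightarrow> \<exists>g. bij_betw g {x \<in> T. fib x = i \<and> lev x = a} (ext E w)"
    and tp: "\<exists>g. bij_betw g {x \<in> T. fib x = i \<and> lev x = \<eta>} (ext E lam)"
  shows "p \<tturnstile> (\<^bold>\<exists>\<^sub>B A. is_omega_eta_lambda_BA A (ck \<eta>) (ck lam))"
proof (cases "cond p")
  case True
  define k where "k a = (if a = \<eta> then lam else w)" for a
  let ?s = "ck (vgraph E k (ext E (vsucc E \<eta>)))"
  have 1: "p \<tturnstile> is_cardinal_sequence base.Alg ?s"
  proof (rule cardinal_sequence_check[OF ccc])
    fix a assume "E a (vsucc E \<eta>)"
    then have a: "a = \<eta> \<or> a \<noteq> \<eta> \<and> E a \<eta>" by auto
    show "sat E (is_card (k a)) \<and> infinite (ext E (k a))"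
      using lam omega_is_card[OF w] infinite_omega[OF w] by (simp add: k_def)
    show "\<exists>g. bij_betw g {x \<in> T. fib x = i \<and> lev x = a} (ext E (k a))" using a low tp unfolding k_def by auto
  qed
  have m2: "p \<tturnstile> (is_succ (ck (vsucc E \<eta>)) (ck \<eta>) \<^bold>\<and> is_fun_on ?s (ck (vsucc E \<eta>)))"
    unfolding f_conj using succ_check0 fun_on_graph by blast
  have 2: "p \<tturnstile> (\<^bold>\<exists>\<eta>'. is_succ \<eta>' (ck \<eta>) \<^bold>\<and> is_fun_on ?s \<eta>')"
    by (rule f_exI[where x = "ck (vsucc E \<eta>)"], rule m2, rule name_check)
  have 3: "p \<tturnstile> (\<^bold>\<forall>\<alpha>. \<alpha> \<^bold>\<in> ck \<eta> \<^bold>\<longrightarrow> app ?s \<alpha> is_omega)"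
  proof (rule f_ballI)
    show "congr (\<lambda>\<alpha>. app ?s \<alpha> is_omega)" by (intro cong_intros)
    fix a assume a: "E a \<eta>"
    have c: "congr is_omega" by (intro cong_intros)
    have "E a (vsucc E \<eta>)" "k a = w" using a unfolding k_def by auto
    then show "p \<tturnstile> app ?s (ck a) is_omega" using app_check[OF c] omega_check[OF True] w by metis
  qed
  have 4: "p \<tturnstile> maps ?s (ck \<eta>) (ck lam)" using maps_graph[OF True] by (simp add: k_def)
  have m3: "p \<tturnstile> (is_cardinal_sequence base.Alg ?s \<^bold>\<and> is_omega_then ?s (ck \<eta>) (ck lam))"
    unfolding f_conj is_omega_then_def using 1 2 3 4 by blast
  have "p \<tturnstile> (\<^bold>\<exists>s. is_cardinal_sequence base.Alg s \<^bold>\<and> is_omega_then s (ck \<eta>) (ck lam))"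
    by (rule f_exI[where x = ?s], rule m3, rule name_check)
  then have m: "p \<tturnstile> is_omega_eta_lambda_BA base.Alg (ck \<eta>) (ck lam)"
    unfolding is_omega_eta_lambda_BA_def f_conj using superatomic_check by blast
  show ?thesis unfolding ExistsBA_def
    by (rule f_exI[where x = "ck base.X"], rule f_exI[where x = "base.opn mt"], rule f_exI[where x = "base.opn jn"],
        rule f_exI[where x = "ck base.cm"], rule f_exI[where x = "ck (vset E {})"],
        rule f_exI[where x = "ck (vset E {apex i})"])
      (use m in \<open>simp_all add: base.Alg_def\<close>)
qed (rule not_cond_forces)

end

section \<open>The forcing obtained from a strongly unbounded function\<close>

section \<open>The ground model\<close>

context zfc_universe
begin

text \<open>Adding one element does not change the size of an infinite set, so an infinite cardinal
  is not a successor ordinal. In \<omega>_1 this yields strict upper bounds of two elements.\<close>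

lemma infinite_card_limit:
  assumes k: "sat E (is_card k)" "infinite (ext E k)" and a: "E a k"
  shows "E (vsucc E a) k"
proof -
  have O: "Ord E k" and nb: "\<nexists>g. bij_betw g (ext E a) (ext E k)" using k(1) a unfolding sat_is_card by blast+
  have "vsucc E a \<noteq> k"
  proof
    assume eq: "vsucc E a = k"
    then have ek: "ext E k = ext E a \<union> {a}" using ext_vsucc[of a] by simp
    then have "infinite (ext E a)" using k(2) by simp
    then obtain h where "bij_betw h (ext E a) (ext E a \<union> {a})" using infinite_imp_bij_betw2[of "ext E a" a] by blast
    then show False using nb ek by simp
  qed
  then show ?thesis using Ord_linear[OF Ord_vsucc[OF Ord_mem[OF O a]] O] vsucc_asym[OF a] by blast
qed

text \<open>\<open>F\<close> is symmetric because \<open>G\<close> is evaluated at the unordered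
  pair. Families become functions on \<open>w1\<close>, and the internal hypothesis about sets of
  size \<omega>_1 is applied to the coded range of such a function.\<close>

lemma strongly_unbounded_function:
  assumes "sat E (strongly_unbounded G lam)"
  shows "\<exists>w1 F. sat E (is_omega_n 1 w1) \<and> (\<forall>x y. F x y = F y x) \<and>
     (\<forall>x y. E x lam \<longrightarrow> E y lam \<longrightarrow> x \<noteq> y \<longrightarrow> E (F x y) w1) \<and>
     (\<forall>d n g. E d w1 \<longrightarrow> n > 0 \<longrightarrow> (\<forall>v. E v w1 \<longrightarrow> g v \<subseteq> ext E lam \<and> finite (g v) \<and> card (g v) = n) \<longrightarrow>
        (\<forall>v v'. E v w1 \<longrightarrow> E v' w1 \<longrightarrow> v \<noteq> v' \<longrightarrow> g v \<inter> g v' = {}) \<longrightarrow>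
        (\<exists>v v'. E v w1 \<and> E v' w1 \<and> v \<noteq> v' \<and> (\<forall>i\<in>g v. \<forall>j\<in>g v'. E d (F i j))))"
proof -
  obtain w w1 two pairs where w: "sat E (is_omega w)" and w1: "sat E (is_omega_n 1 w1)" and two: "sat E (is_two two)"
    and pairs: "\<forall>u. E u pairs \<longleftrightarrow> sat E (subset_of_size u lam two)" and G: "sat E (is_fun G pairs w1)"
    and unb: "\<forall>\<delta> n A. E \<delta> w1 \<and> E n w \<and> (\<forall>a. E a A \<longrightarrow> sat E (subset_of_size a lam n)) \<and>
           sat E (pairwise_disjoint A) \<and> sat E (is_card_of w1 A) \<longrightarrow>
           (\<exists>a b. E a A \<and> E b A \<and> a \<noteq> b \<and> (\<forall>\<alpha> \<beta>. E \<alpha> a \<and> E \<beta> b \<longrightarrow>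
                 (\<exists>u v. sat E (is_upair u \<alpha> \<beta>) \<and> sat E (maps G u v) \<and> E \<delta> v)))"
    using assms unfolding strongly_unbounded_def sat_derived sat.simps by blast
  have size: "sat E (subset_of_size a lam n) \<longleftrightarrow> ext E a \<subseteq> ext E lam \<and> (\<exists>g. bij_betw g (ext E a) (ext E n))" for a n
    unfolding subset_of_size_def is_subset_def sat.simps sat_derived sat_equipotent by (simp add: subset_iff)
  have two2: "finite (ext E two)" "card (ext E two) = 2"
  proof -
    have "two = vsucc E (vsucc E (vset E {}))" using two unfolding is_two_def by simp
    then have "ext E two = {vsucc E (vset E {}), vset E {}}" by (simp add: ext_vsucc)
    moreover have "vsucc E (vset E {}) \<noteq> vset E {}"
    proof
      assume "vsucc E (vset E {}) = vset E {}"
      then have "E (vset E {}) (vset E {})" using mem_vsucc by metis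
      then show False by simp
    qed
    ultimately show "finite (ext E two)" "card (ext E two) = 2" by simp_all
  qed
  obtain g where g: "g ` ext E pairs \<subseteq> ext E w1" "G = vgraph E g (ext E pairs)" using G unfolding sat_is_fun by blast
  define F where "F x y = g (vset E {x, y})" for x y
  have sp: "ext E (vset E {x, y}) = {x, y}" for x y by (simp add: small_pair)
  have F1: "E (F x y) w1" if "E x lam" "E y lam" "x \<noteq> y" for x y
  proof -
    have "\<exists>h. bij_betw h {x, y} (ext E two)" by (rule finite_same_card_bij) (use two2 that(3) in auto)
    then have "E (vset E {x, y}) pairs" using pairs that(1,2) unfolding size sp by auto
    then have "g (vset E {x, y}) \<in> g ` ext E pairs" by (intro imageI) simp
    then have "g (vset E {x, y}) \<in> ext E w1" using g(1) by blast
    then show ?thesis unfolding F_def by simp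
  qed
  have F2: "\<exists>v v'. E v w1 \<and> E v' w1 \<and> v \<noteq> v' \<and> (\<forall>i\<in>a v. \<forall>j\<in>a v'. E d (F i j))"
    if d: "E d w1" and n: "n > 0" and a: "\<forall>v. E v w1 \<longrightarrow> a v \<subseteq> ext E lam \<and> finite (a v) \<and> card (a v) = n"
      and dis: "\<forall>v v'. E v w1 \<longrightarrow> E v' w1 \<longrightarrow> v \<noteq> v' \<longrightarrow> a v \<inter> a v' = {}" for d n a
  proof -
    let ?f = "\<lambda>v. vset E (a v)"
    define A where "A = vset E (?f ` ext E w1)"
    have eA: "ext E A = ?f ` ext E w1" unfolding A_def by (rule ext_vset) (rule small_image[OF small_ext])
    have sa: "ext E (?f v) = a v" if "E v w1" for v by (rule ext_vset) (use a that in blast)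
    have ne: "a v \<noteq> {}" if "E v w1" for v
    proof
      assume "a v = {}"
      then show False using a that n by auto
    qed
    \<comment> \<open>Disjointness alone would allow the empty set to repeat; positive size excludes
      it, so the range has size \<omega>_1.\<close>
    have inj: "inj_on ?f (ext E w1)"
    proof (rule inj_onI, rule ccontr)
      fix v v' assume v: "v \<in> ext E w1" "v' \<in> ext E w1" "?f v = ?f v'" "v \<noteq> v'"
      then have v': "E v w1" "E v' w1" by simp_all
      have "ext E (?f v) = ext E (?f v')" using v(3) by simp
      then have "a v = a v'" unfolding sa[OF v'(1)] sa[OF v'(2)] .
      moreover have "a v \<inter> a v' = {}" using dis v' v(4) by blast
      ultimately show False using ne[OF v'(1)] by blast
    qed
    have nw: "E (natV E n) w"
    proof -
      have "natV E n \<in> ext E w" unfolding sat_is_omega[OF w] by simp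
      then show ?thesis by simp
    qed
    have mem: "\<exists>v. E v w1 \<and> x = ?f v" if "E x A" for x
    proof -
      have "x \<in> ext E A" using that by simp
      then show ?thesis unfolding eA by auto
    qed
    have sz: "\<forall>x. E x A \<longrightarrow> sat E (subset_of_size x lam (natV E n))"
    proof (intro allI impI)
      fix x assume "E x A"
      then obtain v where v: "E v w1" "x = ?f v" using mem by blast
      have "\<exists>h. bij_betw h (a v) (ext E (natV E n))"
      proof (rule finite_same_card_bij)
        show "finite (a v)" using a v(1) by blast
        show "finite (ext E (natV E n))" by (simp add: ext_natV)
        show "card (a v) = card (ext E (natV E n))"
          using a v(1) unfolding ext_natV by (simp add: card_image inj_on_subset[OF inj_natV])
      qed
      then show "sat E (subset_of_size x lam (natV E n))" unfolding size v(2) sa[OF v(1)] using a v(1) by blast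
    qed
    have pd: "sat E (pairwise_disjoint A)" unfolding pairwise_disjoint_def sat_derived sat.simps
    proof (intro allI impI notI, elim conjE exE)
      fix x y z assume x: "E x A" "E y A" "x \<noteq> y" and z: "E z x" "E z y"
      obtain v v' where v: "E v w1" "x = ?f v" "E v' w1" "y = ?f v'" using mem x(1,2) by blast
      have "z \<in> ext E x" "z \<in> ext E y" using z by simp_all
      then have "z \<in> a v" "z \<in> a v'" using v sa by simp_all
      moreover have "v \<noteq> v'" using x(3) v by blast
      ultimately show False using dis v by blast
    qed
    have "bij_betw (inv_into (ext E w1) ?f) (ext E A) (ext E w1)"
      unfolding eA by (rule bij_betw_inv_into) (rule inj_on_imp_bij_betw[OF inj])
    moreover have "sat E (is_card w1)" using w1 by (auto simp: is_succ_card_def)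
    ultimately have co: "sat E (is_card_of w1 A)" unfolding is_card_of_def sat.simps sat_equipotent by blast
    have hyps: "E d w1 \<and> E (natV E n) w \<and> (\<forall>x. E x A \<longrightarrow> sat E (subset_of_size x lam (natV E n))) \<and>
        sat E (pairwise_disjoint A) \<and> sat E (is_card_of w1 A)"
      using d nw sz pd co by blast
    have "\<exists>x y. E x A \<and> E y A \<and> x \<noteq> y \<and> (\<forall>\<alpha> \<beta>. E \<alpha> x \<and> E \<beta> y \<longrightarrow>
        (\<exists>u v. sat E (is_upair u \<alpha> \<beta>) \<and> sat E (maps G u v) \<and> E d v))"
      by (rule unb[THEN spec, THEN spec, THEN spec, THEN mp, OF hyps])
    then obtain x y where xy: "E x A" "E y A" "x \<noteq> y"
      and un: "\<forall>\<alpha> \<beta>. E \<alpha> x \<and> E \<beta> y \<longrightarrow> (\<exists>u v. sat E (is_upair u \<alpha> \<beta>) \<and> sat E (maps G u v) \<and> E d v)"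
      by (elim exE conjE) (rule that)
    obtain v v' where v: "E v w1" "x = ?f v" "E v' w1" "y = ?f v'" using mem xy(1,2) by blast
    have "E d (F i j)" if "i \<in> a v" "j \<in> a v'" for i j
    proof -
      have "i \<in> ext E x" "j \<in> ext E y" using that v sa by simp_all
      then obtain u c where "sat E (is_upair u i j)" "sat E (maps G u c)" "E d c" using un unfolding mem_ext by blast
      then show ?thesis unfolding g(2) F_def by simp
    qed
    then show ?thesis using v xy(3) by blast
  qed
  have "F x y = F y x" for x y unfolding F_def by (simp add: insert_commute)
  then show ?thesis using w1 F1 F2 by (intro exI[of _ w1] exI[of _ F]) blast
qed

end

locale ground_data = zfc_universe E
  for E :: "'v \<Rightarrow> 'v \<Rightarrow> bool" +
  fixes w w1 w2 lam :: 'v and F :: "'v \<Rightarrow> 'v \<Rightarrow> 'v"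
  assumes w: "sat E (is_omega w)"
    and w1: "sat E (is_succ_card w1 w)"
    and w2: "sat E (is_succ_card w2 w1)"
    and lam: "sat E (is_card lam)" "infinite (ext E lam)"
    and F_mem: "E x lam \<Longrightarrow> E y lam \<Longrightarrow> x \<noteq> y \<Longrightarrow> E (F x y) w1"
    and F_commute: "F x y = F y x"
    and F_strong: "\<forall>d n g. E d w1 \<longrightarrow> n > 0 \<longrightarrow> (\<forall>v. E v w1 \<longrightarrow> g v \<subseteq> ext E lam \<and> finite (g v) \<and> card (g v) = n) \<longrightarrow>
        (\<forall>v v'. E v w1 \<longrightarrow> E v' w1 \<longrightarrow> v \<noteq> v' \<longrightarrow> g v \<inter> g v' = {}) \<longrightarrow>
        (\<exists>v v'. E v w1 \<and> E v' w1 \<and> v \<noteq> v' \<and> (\<forall>i\<in>g v. \<forall>j\<in>g v'. E d (F i j)))"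
begin

lemma w_w1: "E w w1" and w1_w2: "E w1 w2" and cards: "sat E (is_card w1)" "sat E (is_card w2)"
  using w1 w2 by (auto simp: is_succ_card_def)

lemma Ord_w1: "Ord E w1" and Ord_w2: "Ord E w2"
  using cards unfolding sat_is_card by blast+

lemma infinite_w: "infinite (ext E w)"
  by (rule infinite_omega[OF w])

lemma countable_w: "countable (ext E w)"
  unfolding sat_is_omega[OF w] by simp

lemma w_sub: "ext E w \<subseteq> ext E w1"
  using Ord_subset[OF Ord_w1] w_w1 by blast

lemma infinite_w1: "infinite (ext E w1)"
  using infinite_w w_sub finite_subset by blast

lemma countable_below:
  assumes "E d w1"
  shows "countable (ext E d)"
proof -
  obtain f where "inj_on f (ext E d)" "f ` ext E d \<subseteq> ext E w"
    using iffD2[OF card_of_ordLeq succ_card_le[OF w1 assms]] by blast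
  then show ?thesis using countable_image_inj_on[OF countable_subset[OF _ countable_w]] by blast
qed

text \<open>
  The tree of fibre \<open>h\<close> has \<open>\<omega>\<close> points on each level \<open>l \<in> h\<close>, \<open>lam\<close> points on level \<open>h\<close>, and one
  point above them; all fibres are treated by the same forcing.
\<close>

definition pt :: "'v \<Rightarrow> 'v \<Rightarrow> 'v \<Rightarrow> 'v" where
  "pt h l x = vpair E h (vpair E l x)"

definition kind :: "'v \<Rightarrow> 'v \<Rightarrow> 'v \<Rightarrow> bool" where
  "kind h l x \<longleftrightarrow> (E l h \<and> E x w) \<or> (l = h \<and> E x lam) \<or> (l = vsucc E h \<and> x = vset E {})"

definition Pts :: "'v set" where
  "Pts = {z. \<exists>h l x. E h w2 \<and> kind h l x \<and> z = pt h l x}"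

definition fb :: "'v \<Rightarrow> 'v" where
  "fb z = (THE h. \<exists>l x. z = pt h l x)"

text \<open>Outside \<open>Pts\<close> the level is 0 by convention. Levels are then ordinals for
  all arguments, and \<open>pr\<close> is transitive without side conditions.\<close>

definition lv :: "'v \<Rightarrow> 'v" where
  "lv z = (if z \<in> Pts then THE l. \<exists>h x. z = pt h l x else vset E {})"

definition ix :: "'v \<Rightarrow> 'v" where
  "ix z = (THE x. \<exists>h l. z = pt h l x)"

definition pr :: "'v \<Rightarrow> 'v \<Rightarrow> bool" where
  "pr x y \<longleftrightarrow> E (lv x) (lv y)"

definition ap :: "'v \<Rightarrow> 'v" where
  "ap h = pt h (vsucc E h) (vset E {})"

definition lowp :: "'v \<Rightarrow> bool" where
  "lowp z \<longleftrightarrow> z \<in> Pts \<and> E (lv z) (fb z)"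

definition topp :: "'v \<Rightarrow> bool" where
  "topp z \<longleftrightarrow> z \<in> Pts \<and> lv z = fb z"

lemma pt_inject [simp]: "pt h l x = pt h' l' x' \<longleftrightarrow> h = h' \<and> l = l' \<and> x = x'"
  by (simp add: pt_def)

lemma pt_Pts [simp]: "pt h l x \<in> Pts \<longleftrightarrow> E h w2 \<and> kind h l x"
  by (auto simp: Pts_def)

lemma fb_pt [simp]: "fb (pt h l x) = h" and ix_pt [simp]: "ix (pt h l x) = x"
  by (auto simp: fb_def ix_def)

lemma lv_pt [simp]: "E h w2 \<Longrightarrow> kind h l x \<Longrightarrow> lv (pt h l x) = l"
  by (auto simp: lv_def)

lemma Pts_cases:
  assumes "z \<in> Pts"
  obtains h l x where "E h w2" "kind h l x" "z = pt h l x" "fb z = h" "lv z = l" "ix z = x"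
proof -
  obtain h l x where "E h w2" "kind h l x" "z = pt h l x" using assms unfolding Pts_def by blast
  then show ?thesis using that by simp
qed

lemma Ord_h: "E h w2 \<Longrightarrow> Ord E h"
  using Ord_mem[OF Ord_w2] .

lemma kind_level: "kind h l x \<Longrightarrow> E l (vsucc E (vsucc E h))"
  by (auto simp: kind_def)

lemma Ord_lv: "Ord E (lv z)"
proof (cases "z \<in> Pts")
  case True
  then obtain h l x where z: "E h w2" "kind h l x" "z = pt h l x" "fb z = h" "lv z = l" "ix z = x" by (rule Pts_cases)
  show ?thesis using Ord_mem[OF Ord_vsucc[OF Ord_vsucc[OF Ord_h[OF z(1)]]] kind_level[OF z(2)]] z(5) by simp
next
  case False
  then have "lv z = vset E {}" by (simp add: lv_def)
  then show ?thesis by (simp add: Ord_def)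
qed

lemma kind_ap [simp]: "kind h (vsucc E h) (vset E {})"
  by (simp add: kind_def)

lemma small_Pts: "small E Pts"
proof (rule small_subset)
  let ?B = "\<lambda>h. {vpair E l x | l x. l \<in> ext E (vsucc E (vsucc E h)) \<and> x \<in> insert (vset E {}) (ext E w \<union> ext E lam)}"
  have B: "small E (?B h)" for h by (intro small_pairs small_ext small_insert small_Un)
  show "small E {vpair E h u | h u. h \<in> ext E w2 \<and> u \<in> ?B h}" by (rule small_pairs[OF small_ext B])
  show "Pts \<subseteq> {vpair E h u | h u. h \<in> ext E w2 \<and> u \<in> ?B h}"
  proof
    fix z assume "z \<in> Pts"
    then obtain h l x where z: "E h w2" "kind h l x" "z = pt h l x" "fb z = h" "lv z = l" "ix z = x"
      by (rule Pts_cases)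
    have "l \<in> ext E (vsucc E (vsucc E h))" using kind_level[OF z(2)] by simp
    moreover have "x \<in> insert (vset E {}) (ext E w \<union> ext E lam)" using z(2) by (auto simp: kind_def)
    ultimately have "vpair E l x \<in> ?B h" by blast
    then show "z \<in> {vpair E h u | h u. h \<in> ext E w2 \<and> u \<in> ?B h}" using z(1,3) unfolding pt_def mem_ext by blast
  qed
qed

definition Low :: "'v \<Rightarrow> 'v set" where
  "Low h = {z \<in> Pts. lowp z \<and> fb z = h}"

text \<open>The chosen map depends on the fibre only, so \<open>en\<close> is injective on the low
  points of each fibre; codes may repeat across fibres.\<close>

definition en :: "'v \<Rightarrow> 'v" where
  "en z = (SOME f. inj_on f (Low (fb z)) \<and> f ` Low (fb z) \<subseteq> ext E w1) z"

text \<open>An ordinal below \<omega>_2 has size at most \<omega>_1, and so has its product with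
  \<omega>. This is where the restriction to ordinals below \<omega>_2 enters.\<close>

lemma Low_embeds: "\<exists>f. inj_on f (Low h) \<and> f ` Low h \<subseteq> ext E w1"
proof (cases "E h w2")
  case True
  have "|ext E h \<times> ext E w| \<le>o |ext E w1|"
    using card_of_Sigma_ordLeq_infinite[OF infinite_w1 succ_card_le[OF w2 True], of "\<lambda>_. ext E w"] card_of_mono1[OF w_sub]
    by blast
  moreover have "Low h \<subseteq> (\<lambda>(l, n). pt h l n) ` (ext E h \<times> ext E w)"
  proof
    fix z assume z: "z \<in> Low h"
    then have zP: "z \<in> Pts" unfolding Low_def by blast
    obtain h' l x where p: "E h' w2" "kind h' l x" "z = pt h' l x" "fb z = h'" "lv z = l" "ix z = x"
      using zP by (rule Pts_cases)
    have "h' = h" "E l h" using z p(4,5) unfolding Low_def lowp_def by auto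
    then have "E x w" using p(2) E_asym unfolding kind_def by auto
    then show "z \<in> (\<lambda>(l, n). pt h l n) ` (ext E h \<times> ext E w)"
      using p(3) \<open>h' = h\<close> \<open>E l h\<close> by (intro image_eqI[of _ _ "(l, x)"]) auto
  qed
  from ordLeq_transitive[OF card_of_mono1[OF this] card_of_image]
  have "|Low h| \<le>o |ext E h \<times> ext E w|" .
  ultimately show ?thesis using ordLeq_transitive card_of_ordLeq by blast
next
  case False
  then have "Low h = {}" unfolding Low_def using Pts_cases by blast
  then show ?thesis by simp
qed

lemma en: "inj_on en (Low h)" "en ` Low h \<subseteq> ext E w1"
proof -
  define f where "f = (SOME f. inj_on f (Low h) \<and> f ` Low h \<subseteq> ext E w1)"
  have f: "inj_on f (Low h) \<and> f ` Low h \<subseteq> ext E w1" unfolding f_def using someI_ex[OF Low_embeds[of h]] .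
  have eq: "en z = f z" if "z \<in> Low h" for z using that unfolding Low_def en_def f_def by simp
  show "inj_on en (Low h)" using f inj_on_cong[of "Low h" en f] eq by blast
  show "en ` Low h \<subseteq> ext E w1" using f eq by auto
qed

sublocale tree: ccc_data Pts fb pr ap lowp topp en ix F "ext E w1" E
proof unfold_locales
  fix x y z i :: 'v
  show "pr x y \<Longrightarrow> pr y z \<Longrightarrow> pr x z" unfolding pr_def using Ord_trans[OF Ord_lv] by blast
  show "\<not> pr x x" unfolding pr_def by simp
  show "x \<in> Pts \<Longrightarrow> ap (fb x) \<in> Pts" by (erule Pts_cases) (simp add: ap_def)
  show "fb (ap (fb x)) = fb x" by (simp add: ap_def)
  show "x \<in> Pts \<Longrightarrow> x = ap (fb x) \<or> pr x (ap (fb x))"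
    by (erule Pts_cases) (auto simp: ap_def pr_def kind_def)
  show "x \<in> Pts \<Longrightarrow> lowp x \<or> topp x \<or> x = ap (fb x)"
    by (erule Pts_cases) (auto simp: lowp_def topp_def ap_def kind_def)
  show "lowp x \<Longrightarrow> \<not> topp x" by (auto simp: lowp_def topp_def)
  show "y = ap (fb y)" if "y \<in> Pts" "topp x" "fb x = fb y" "pr x y"
    using that(1)
  proof (rule Pts_cases)
    fix h l v assume y: "kind h l v" "y = pt h l v" "fb y = h" "lv y = l"
    have "E h l" using that(2-4) y(3,4) unfolding topp_def pr_def by simp
    then show "y = ap (fb y)" using y(1) E_asym unfolding y(3) unfolding y(2) ap_def kind_def by auto
  qed
  show "x = y" if "x \<in> Pts" "y \<in> Pts" "topp x" "topp y" "fb x = fb y" "ix x = ix y"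
    using that Pts_cases[OF that(1)] Pts_cases[OF that(2)] unfolding topp_def by metis
  show "x \<in> ext E w1 \<Longrightarrow> y \<in> ext E w1 \<Longrightarrow> z \<in> ext E w1 \<Longrightarrow> E x y \<Longrightarrow> E y z \<Longrightarrow> E x z"
    using Ord_trans[OF Ord_mem[OF Ord_w1]] by auto
  show "x \<in> ext E w1 \<Longrightarrow> y \<in> ext E w1 \<Longrightarrow> E x y \<or> x = y \<or> E y x"
    using Ord_linear[OF Ord_mem[OF Ord_w1] Ord_mem[OF Ord_w1]] by auto
  show "wf {(a, b). E a b}" using foundation unfolding wfp_def .
  show "countable {a \<in> ext E w1. E a y}" if "y \<in> ext E w1"
    by (rule countable_subset[OF _ countable_below[of y]]) (use that in auto)
  show "x \<in> ext E w1 \<Longrightarrow> y \<in> ext E w1 \<Longrightarrow> \<exists>c\<in>ext E w1. E x c \<and> E y c"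
  proof -
    assume "x \<in> ext E w1" "y \<in> ext E w1"
    then have xy: "E x w1" "E y w1" by simp_all
    note s = infinite_card_limit[OF cards(1) infinite_w1]
    consider "E x y \<or> x = y" | "E y x" using Ord_linear[OF Ord_mem[OF Ord_w1 xy(1)] Ord_mem[OF Ord_w1 xy(2)]] by blast
    then show ?thesis
    proof cases
      case 1
      then show ?thesis using s[OF xy(2)] by (intro bexI[of _ "vsucc E y"]) auto
    next
      case 2
      then show ?thesis using s[OF xy(1)] by (intro bexI[of _ "vsucc E x"]) auto
    qed
  qed
  show "ext E w1 \<noteq> {}" using infinite_w1 by auto
  show "x \<in> Pts \<Longrightarrow> lowp x \<Longrightarrow> en x \<in> ext E w1" using en(2)[of "fb x"] unfolding Low_def by blast
  show "countable {x \<in> Pts. lowp x \<and> fb x = i \<and> E (en x) y}" if "y \<in> ext E w1"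
  proof (rule countable_image_inj_on)
    show "inj_on en {x \<in> Pts. lowp x \<and> fb x = i \<and> E (en x) y}"
      by (rule inj_on_subset[OF en(1)[of i]]) (auto simp: Low_def)
    have "en ` {x \<in> Pts. lowp x \<and> fb x = i \<and> E (en x) y} \<subseteq> ext E y" by auto
    then show "countable (en ` {x \<in> Pts. lowp x \<and> fb x = i \<and> E (en x) y})"
      by (rule countable_subset[OF _ countable_below]) (use that in simp)
  qed
  show "F x y = F y x" by (rule F_commute)
next
  have top_ix: "ix ` {x \<in> Pts. topp x} \<subseteq> ext E lam"
  proof
    fix k assume "k \<in> ix ` {x \<in> Pts. topp x}"
    then obtain z where z: "z \<in> Pts" "topp z" "k = ix z" by blast
    from z(1) show "k \<in> ext E lam"
    proof (rule Pts_cases)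
      fix h l x assume p: "kind h l x" "fb z = h" "lv z = l" "ix z = x"
      have l: "l = h" using z(2) p(2,3) unfolding topp_def by simp
      have "h \<noteq> vsucc E h" using mem_vsucc E_irrefl by metis
      then have "E x lam" using p(1) unfolding l kind_def by auto
      then show "k \<in> ext E lam" using z(3) p(4) by simp
    qed
  qed
  show "F k k' \<in> ext E w1" if "k \<in> ix ` {x \<in> Pts. topp x}" "k' \<in> ix ` {x \<in> Pts. topp x}" "k \<noteq> k'" for k k'
  proof -
    have "k \<in> ext E lam" "k' \<in> ext E lam" using top_ix that(1,2) by blast+
    then show ?thesis using F_mem that(3) by simp
  qed
  show "\<exists>v\<in>ext E w1. \<exists>v'\<in>ext E w1. v \<noteq> v' \<and> (\<forall>i\<in>g v. \<forall>j\<in>g v'. E d (F i j))"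
    if d: "d \<in> ext E w1" and n: "0 < n"
      and g: "\<And>v. v \<in> ext E w1 \<Longrightarrow> g v \<subseteq> ix ` {x \<in> Pts. topp x} \<and> finite (g v) \<and> card (g v) = n"
      and dis: "\<And>v v'. v \<in> ext E w1 \<Longrightarrow> v' \<in> ext E w1 \<Longrightarrow> v \<noteq> v' \<Longrightarrow> g v \<inter> g v' = {}" for d n g
  proof -
    have "\<exists>v v'. E v w1 \<and> E v' w1 \<and> v \<noteq> v' \<and> (\<forall>i\<in>g v. \<forall>j\<in>g v'. E d (F i j))"
    proof (rule F_strong[rule_format])
      show "E d w1" "0 < n" using d n by simp_all
      show "g v \<subseteq> ext E lam \<and> finite (g v) \<and> card (g v) = n" if "E v w1" for v using g[of v] top_ix that by auto
      show "g v \<inter> g v' = {}" if "E v w1" "E v' w1" "v \<noteq> v'" for v v' using dis[of v v'] that by simp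
    qed
    then obtain v v' where v: "E v w1" "E v' w1" "v \<noteq> v'" "\<forall>i\<in>g v. \<forall>j\<in>g v'. E d (F i j)" by blast
    have "v \<in> ext E w1" "v' \<in> ext E w1" using v(1,2) by simp_all
    then show ?thesis using v(3,4) by blast
  qed
qed

sublocale algebra_forcing E Pts fb pr ap tree.al
  by unfold_locales (rule small_Pts)

lemma ccc_tree: ccc
proof (rule ccc_Pos)
  fix S assume "\<And>r. r \<in> S \<Longrightarrow> tree.is_cond r"
    and "\<And>p q. p \<in> S \<Longrightarrow> q \<in> S \<Longrightarrow> p \<noteq> q \<Longrightarrow>
      \<not> (\<exists>r. tree.is_cond r \<and> tree.refines r p \<and> tree.refines r q)"
  then show "countable S" by (rule tree.countable_conditions)
qed

lemma level_bij:
  assumes "E h w2"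
  shows "E a h \<Longrightarrow> bij_betw ix {z \<in> Pts. fb z = h \<and> lv z = a} (ext E w)"
    and "bij_betw ix {z \<in> Pts. fb z = h \<and> lv z = h} (ext E lam)"
proof -
  have eq: "{z \<in> Pts. fb z = h \<and> lv z = a} = pt h a ` {x. kind h a x}" for a
  proof (rule set_eqI)
    fix z
    show "z \<in> {z \<in> Pts. fb z = h \<and> lv z = a} \<longleftrightarrow> z \<in> pt h a ` {x. kind h a x}"
    proof
      assume z: "z \<in> {z \<in> Pts. fb z = h \<and> lv z = a}"
      then have zP: "z \<in> Pts" by blast
      from zP show "z \<in> pt h a ` {x. kind h a x}" by (rule Pts_cases) (use z in auto)
    next
      assume "z \<in> pt h a ` {x. kind h a x}"
      then show "z \<in> {z \<in> Pts. fb z = h \<and> lv z = a}" using assms by auto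
    qed
  qed
  have b: "bij_betw ix {z \<in> Pts. fb z = h \<and> lv z = a} {x. kind h a x}" for a
    unfolding eq by (rule bij_betw_byWitness[where f' = "pt h a"]) auto
  show "bij_betw ix {z \<in> Pts. fb z = h \<and> lv z = a} (ext E w)" if a: "E a h"
  proof -
    have "{x. kind h a x} = ext E w" using a E_asym vsucc_asym[OF a] unfolding kind_def by auto
    then show ?thesis using b[of a] by simp
  qed
  have "h \<noteq> vsucc E h" using mem_vsucc E_irrefl by metis
  then have "{x. kind h h x} = ext E lam" unfolding kind_def by auto
  then show "bij_betw ix {z \<in> Pts. fb z = h \<and> lv z = h} (ext E lam)" using b[of h] by simp
qed

text \<open>The one forcing is viewed from the fibre of \<open>h\<close>: \<open>leveled\<close>
  concerns the points of this fibre, while the chain condition is that of the whole forcing.\<close>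

lemma algebra_check:
  assumes h: "E h w2"
  shows "forces E Pos (\<^bold>\<exists>\<^sub>B A. is_omega_eta_lambda_BA A (ck h) (ck lam)) p"
proof -
  interpret leveled E Pts fb pr ap tree.al h lv h
  proof unfold_locales
    show "ap h \<in> Pts" "fb (ap h) = h" "lv (ap h) = vsucc E h" using h by (simp_all add: ap_def)
    show "pr x y \<longleftrightarrow> E (lv x) (lv y)" for x y by (rule pr_def)
    show "Ord E h" by (rule Ord_h[OF h])
    show "E (lv x) (vsucc E (vsucc E h))" if "x \<in> Pts" "fb x = h" for x
      using that(1) by (rule Pts_cases) (use that(2) kind_level in auto)
    show "\<exists>z\<in>Pts - S. fb z = h \<and> lv z = a" if a: "E a (vsucc E h)" and S: "finite S" for a S
    proof -
      have "infinite {z \<in> Pts. fb z = h \<and> lv z = a}"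
      proof (cases "a = h")
        case True
        then show ?thesis using bij_betw_finite[OF level_bij(2)[OF h]] lam(2) by simp
      next
        case False
        then have "E a h" using a by simp
        then show ?thesis using bij_betw_finite[OF level_bij(1)[OF h]] infinite_w by simp
      qed
      then have "{z \<in> Pts. fb z = h \<and> lv z = a} - S \<noteq> {}" using S by (metis finite.emptyI finite_Diff2)
      then show ?thesis by blast
    qed
  qed
  show ?thesis by (rule omega_eta_lambda_check[OF ccc_tree w lam]) (use level_bij[OF h] in blast)+
qed

lemma congr_omega_eta_lambda: "congr (\<lambda>\<eta>. \<^bold>\<exists>\<^sub>B A. is_omega_eta_lambda_BA A \<eta> l)"
  unfolding ExistsBA_def is_omega_eta_lambda_BA_def is_omega_then_def by (intro cong_intros)

lemma generic_algebras:
  "forcing_notion E Pos \<and> cardinal_preserving E Pos \<and>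
   holds_in_extension E Pos
     (\<^bold>\<forall>\<eta> w1 w2.
        is_ord \<eta> \<^bold>\<and> is_omega_n 1 w1 \<^bold>\<and> is_omega_n 2 w2 \<^bold>\<and>
        ord_le w1 \<eta> \<^bold>\<and> \<eta> \<^bold>\<in> w2 \<^bold>\<and> is_cof w1 \<eta> \<^bold>\<longrightarrow>
        (\<^bold>\<exists>\<^sub>B A. is_omega_eta_lambda_BA A \<eta> (check E Pos lam)))"
proof (intro conjI is_forcing_notion)
  show "cardinal_preserving E Pos"
    unfolding cardinal_preserving_def holds_in_extension_def using card_preserved[OF ccc_tree _ max_cond] by blast
  show "holds_in_extension E Pos
     (\<^bold>\<forall>\<eta> w1 w2.
        is_ord \<eta> \<^bold>\<and> is_omega_n 1 w1 \<^bold>\<and> is_omega_n 2 w2 \<^bold>\<and>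
        ord_le w1 \<eta> \<^bold>\<and> \<eta> \<^bold>\<in> w2 \<^bold>\<and> is_cof w1 \<eta> \<^bold>\<longrightarrow>
        (\<^bold>\<exists>\<^sub>B A. is_omega_eta_lambda_BA A \<eta> (check E Pos lam)))"
    unfolding holds_in_extension_def
  proof (intro f_allI f_impI, unfold f_conj, elim conjE)
    fix \<eta> t1 t2 q assume n: "name \<eta>" "name t2"
      and q: "forces E Pos (is_omega_n 2 t2) q" "forces E Pos (\<eta> \<^bold>\<in> t2) q"
    \<comment> \<open>The \<omega>_2 of the extension does not exceed that of the ground universe,
      so \<open>\<eta>\<close> is densely the check name of a ground ordinal \<open>h\<close>, and
      the fibre of \<open>h\<close> provides the algebra.\<close>
    have \<eta>: "forces E Pos (\<eta> \<^bold>\<in> ck w2) q" using omega2_bound[OF ccc_tree w w1 w2 n(2,1) q] .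
    show "forces E Pos (\<^bold>\<exists>\<^sub>B A. is_omega_eta_lambda_BA A \<eta> (ck lam)) q"
    proof (rule check_memE[OF \<eta>])
      fix r h assume r: "E h w2" "forces E Pos (\<eta> \<^bold>= ck h) r"
      show "forces E Pos (\<^bold>\<exists>\<^sub>B A. is_omega_eta_lambda_BA A \<eta> (ck lam)) r"
        by (rule congrD'[OF congr_omega_eta_lambda, OF r(2) algebra_check[OF r(1)]])
    qed
  qed
qed

end

theorem theorem6:
  fixes E :: "'v \<Rightarrow> 'v \<Rightarrow> bool" and lam :: 'v
  assumes "zfc_universe E"
    and "sat E (is_card lam)"
    and "sat E (\<^bold>\<exists>w3. is_omega_n 3 w3 \<^bold>\<and> ord_le w3 lam)"
    and "sat E (\<^bold>\<exists>F. strongly_unbounded F lam)"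
  shows "\<exists>P. forcing_notion E P \<and> cardinal_preserving E P \<and>
           holds_in_extension E P
             (\<^bold>\<forall>\<eta> w1 w2.
                is_ord \<eta> \<^bold>\<and> is_omega_n 1 w1 \<^bold>\<and> is_omega_n 2 w2 \<^bold>\<and>
                ord_le w1 \<eta> \<^bold>\<and> \<eta> \<^bold>\<in> w2 \<^bold>\<and> is_cof w1 \<eta> \<^bold>\<longrightarrow>
                (\<^bold>\<exists>\<^sub>B A. is_omega_eta_lambda_BA A \<eta> (check E P lam)))"
proof -
  interpret zfc_universe E by (rule assms(1))
  obtain w3 where w3: "sat E (is_omega_n 3 w3)" "E w3 lam \<or> w3 = lam"
    using assms(3) by (auto simp: ord_le_def)
  have 3: "(3 :: nat) = Suc (Suc (Suc 0))" by simp
  obtain w w1 w2 where w: "sat E (is_omega w)" "sat E (is_succ_card w1 w)" "sat E (is_succ_card w2 w1)"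
      "sat E (is_succ_card w3 w2)"
    using w3(1) unfolding 3 by auto
  have mem: "E w w1" "E w1 w2" "E w2 w3" and O: "Ord E w3" "Ord E lam"
    using w assms(2) by (auto simp: is_succ_card_def sat_is_card)
  have "E w w3" using Ord_trans[OF O(1)] mem by blast
  then have "E w lam" using w3(2) Ord_trans[OF O(2)] by blast
  then have inf: "infinite (ext E lam)"
    using Ord_subset[OF O(2)] infinite_omega[OF w(1)] finite_subset by blast
  obtain G where "sat E (strongly_unbounded G lam)" using assms(4) by auto
  from strongly_unbounded_function[OF this] obtain w1' F where F: "sat E (is_omega_n 1 w1')"
    "\<forall>x y. F x y = F y x" "\<forall>x y. E x lam \<longrightarrow> E y lam \<longrightarrow> x \<noteq> y \<longrightarrow> E (F x y) w1'"
    "\<forall>d n g. E d w1' \<longrightarrow> n > 0 \<longrightarrow> (\<forall>v. E v w1' \<longrightarrow> g v \<subseteq> ext E lam \<and> finite (g v) \<and> card (g v) = n) \<longrightarrow>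
        (\<forall>v v'. E v w1' \<longrightarrow> E v' w1' \<longrightarrow> v \<noteq> v' \<longrightarrow> g v \<inter> g v' = {}) \<longrightarrow>
        (\<exists>v v'. E v w1' \<and> E v' w1' \<and> v \<noteq> v' \<and> (\<forall>i\<in>g v. \<forall>j\<in>g v'. E d (F i j)))"
    by (elim exE conjE) (rule that)
  \<comment> \<open>Strong unboundedness brings its own \<omega>_1, which has to be identified with
    the one below \<open>w3\<close>.\<close>
  have "sat E (is_omega_n 1 w1)" using w(1,2) by auto
  then have eq: "w1' = w1" using is_omega_n_unique[OF F(1)] by blast
  interpret ground_data E w w1 w2 lam F
  proof unfold_locales
    show "F x y = F y x" for x y using F(2) by blast
    show "E (F x y) w1" if "E x lam" "E y lam" "x \<noteq> y" for x y using F(3) that unfolding eq by blast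
  qed (rule w assms(2) inf F(4)[unfolded eq])+
  show ?thesis using generic_algebras by blast
qed

end
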